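(* Let $f\in\mathbb{R}\{x,y\}$ be a right-reduced series which satisfies the injectivity condition, and let $F_x(y)\in\mathbb{R}\{x,y\}$ be a primitive of $f$. Then $F_x(y)$ is a morsification, and its combinatorial type is represented by the bi-ordered set $(\mathcal{R}_{\mathbb{R}}(f),<_{\mathbb{R}},<_{\int})$; that is, for a Morse rectangle $[0,\epsilon]\times I$ of $F_x(y)$ and every $x_0\in(0,\epsilon]$, the bi-ordered sets $(\mathrm{Crit}(F_{x_0}),<_s,<_t)$ and $(\mathcal{R}_{\mathbb{R}}(f),<_{\mathbb{R}},<_{\int})$ are isomorphic.
   Context: **Newton-Puiseux series.** For $\mathbb{K}=\mathbb{R}$ or $\mathbb{C}$, $\mathbb{K}\{x\}$ and $\mathbb{K}\{x,y\}$ are the rings of convergent power series, and $\mathbb{K}\{x^{1/\mathbb{N}}\}=\{g(x^{1/n}) : g\in\mathbb{K}\{t\},\ n\geq 1 \text{ an integer}\}$. A non-zero $\gamma\in\mathbb{C}\{x^{1/\mathbb{N}}\}$ is written uniquely $\gamma=s x^{\sigma}+(\text{terms of higher exponent})$ with $s\in\mathbb{C}^*$, $\sigma\in\mathbb{Q}\cap[0,\infty)$; $\chi(\gamma):=s$ is its initial coefficient and $\nu(\gamma):=\sigma$ its valuation ($\nu(0)=\infty$). The real total order $<_{\mathbb{R}}$ on $\mathbb{R}\{x^{1/\mathbb{N}}\}$ is: $\xi<_{\mathbb{R}}\xi'$ iff $\chi(\xi'-\xi)>0$ (equivalently $\xi(x_0)<\xi'(x_0)$ for all small enough $x_0>0$).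 **Roots, right-reduced series, primitives.** Let $f\in\mathbb{R}\{x,y\}$ with $f(0,0)=0$, $f(0,y)\not\equiv0$. One has a unique factorization $f=u(x,y)\prod_{i=1}^k(y-\gamma_i)$ with $u$ a unit and $\gamma_i\in\mathbb{C}\{x^{1/\mathbb{N}}\}$, $\gamma_i(0)=0$; the $\gamma_i$ are the Newton-Puiseux roots of $f$. $\mathcal{R}_{\mathbb{K}}(f)$ is the multi-set of roots (counted with multiplicity) lying in $\mathbb{K}\{x^{1/\mathbb{N}}\}$. The series $f$ is right-reduced if $f(0,0)=0$, $f(0,y)\not\equiv0$ and the real roots of $f$ are pairwise distinct (so $\mathcal{R}_{\mathbb{R}}(f)$ is a set). A primitive of $f$ is a series $F_x(y)\in\mathbb{R}\{x,y\}$ with $\partial_yF_x=f$. Number the real roots so that $\xi_1<_{\mathbb{R}}\cdots<_{\mathbb{R}}\xi_n$. **Morse functions and morsifications.** A smooth function $\varphi:I\to\mathbb{R}$ on a compact interval is Morse if all its critical points are non-degenerate and lie in the interior of $I$ and its critical values are pairwise distinct. $\mathrm{Crit}(\varphi)=\{(c,\varphi(c)) : \varphi'(c)=0\}$ carries two total orders: $(y_1,z_1)<_s(y_2,z_2)$ iff $y_1<y_2$, and $(y_1,z_1)<_t(y_2,z_2)$ iff $z_1<z_2$. A bi-ordered set is a finite set with a pair of total orders; isomorphisms are bijections preserving both orders. A Morse rectangle of a primitive $F_x(y)$ is a product $[0,\epsilon]\times I$, with $\epsilon>0$ and $I$ a compact interval neighborhood of $0$, such that $F_x(y)$ converges on $[0,\epsilon]\times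 I$, $F_0:I\to\mathbb{R}$ has $0$ as single critical point, and $F_{x_0}:I\to\mathbb{R}$ is Morse for every $x_0\in(0,\epsilon]$. $F_x(y)$ is a morsification if it admits a Morse rectangle. Its combinatorial type is the isomorphism class of the bi-ordered sets $(\mathrm{Crit}(F_{x_0}),<_s,<_t)$, $x_0\in(0,\epsilon]$ (independent of the choices). **Trees.** A tree is a topological space homeomorphic to a finite connected graph without cycles; the valency of a point $P$ is the number of connected components of $T\setminus\{P\}$; vertices are points of valency $\neq2$; edges are closures of the connected components of the complement of the set of vertices. A rooted tree has a marked point $O$ (the root) of valency $1$; $P\preceq_TQ$ iff $[O,P]\subset[O,Q]$; leaves are the $\preceq_T$-maximal points; internal vertices are the vertices that are neither leaves nor the root; $P\wedge Q$ is the greatest lower bound: $[O,P\wedge Q]=[O,P]\cap[O,Q]$. An outgoing edge at an internal vertex $P$ is an edge $[P,Q]$ not contained in $[O,P]$. A planar structure on $T$ is a choice, for each internal vertex $P$, of a total order $<_P$ on the set $\mathcal{E}^+_T(P)$ of outgoing edges at $P$. It induces a total order on the leaves: $\ell_1<\ell_2$ iff $e_1<_Pe_2$, where $P=\ell_1\wedge\ell_2$ and $e_1,e_2\in\mathcal{E}_T^+(P)$ go towards $\ell_1,\ell_2$. **Real contact tree.** $T_{\mathbb{R}}(f)$ is the contact tree of $\{\xi_1,\dots,\xi_n\}$: take one copy $I_i$ of $[0,\infty]$ for each $\xi_i$, and for $i\ne j$ glue $[0,\nu(\xi_j-\xi_i)]\subset I_i$ with $[0,\nu(\xi_j-\xi_i)]\subset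 I_j$ by identifying points with equal coordinate. The root is the common point of coordinate $0$; the leaves are identified with $\xi_1,\dots,\xi_n$ (if there are no real roots the tree is empty). The order $<_{\mathbb{R}}$ on the leaves is induced by a unique planar structure, the real planar structure of $T_{\mathbb{R}}(f)$. **Injectivity condition.** For $1\le r\le n-1$ let $S_r:=F_x(\xi_{r+1})-F_x(\xi_r)\in\mathbb{R}\{x^{1/\mathbb{N}}\}$ (where $F_x(\xi)$ denotes $F$ with $y$ replaced by $\xi$; $S_r$ is non-zero and independent of the choice of primitive), and let $s_r:=\chi(S_r)$. Let $P$ be an internal vertex of $T_{\mathbb{R}}(f)$ with outgoing edges $e_1<_P\cdots<_Pe_p$ for the real planar structure. For $1\le k\le p-1$ there is a unique index $\iota(k)$ such that $\xi_{\iota(k)}\wedge\xi_{\iota(k)+1}=P$ and $e_k$, $e_{k+1}$ are the outgoing edges at $P$ going to $\xi_{\iota(k)}$, $\xi_{\iota(k)+1}$ respectively. The discrete integration map at $P$ is ${\int}_P:\{0,1,\dots,p-1\}\to\mathbb{R}$, ${\int}_P(0)=0$, ${\int}_P(i)=s_{\iota(1)}+\cdots+s_{\iota(i)}$. The series $f$ satisfies the injectivity condition if ${\int}_P$ is injective for every internal vertex $P$ of $T_{\mathbb{R}}(f)$. **Integrated order.** If $f$ satisfies the injectivity condition, define for each internal vertex $P$ of $T_{\mathbb{R}}(f)$ a total order on the outgoing edges at $P$ by $e_k<_{\int,P}e_l$ iff ${\int}_P(k-1)<{\int}_P(l-1)$. These orders form the integrated planar structure on the abstract rooted tree $T_{\mathbb{R}}(f)$;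 the induced total order on its set of leaves $\mathcal{R}_{\mathbb{R}}(f)$ is the integrated order $<_{\int}$. *)

theory Defs
  imports "HOL-Analysis.Analysis" "HOL-Library.Multiset"
begin

section \<open>Convergent power series in two variables\<close>

text \<open>
  A formal power series in \<open>x\<close> and \<open>y\<close> is an element of \<open>K[[x]][[y]]\<close>: the outer variable
  of a \<open>real fps fps\<close> is \<open>y\<close>, so \<open>fps_nth (fps_nth f j) i\<close> is the coefficient of
  \<open>x ^ i * y ^ j\<close>, and \<open>fps_deriv\<close> is the partial derivative with respect to \<open>y\<close>.
\<close>

definition eval2 :: "real fps fps \<Rightarrow> real \<Rightarrow> real \<Rightarrow> real" where
  "eval2 f x y = (\<Sum>\<^sub>\<infinity>(i, j)\<in>UNIV. fps_nth (fps_nth f j) i * x ^ i * y ^ j)"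

text \<open>
  Convergence on a set of points means convergence on some open neighbourhood of that set;
  this is what makes the sum analytic up to the boundary of a compact set.
\<close>

definition converges_on :: "(real \<times> real) set \<Rightarrow> real fps fps \<Rightarrow> bool" where
  "converges_on K f \<longleftrightarrow> (\<exists>U. open U \<and> K \<subseteq> U \<and>
     (\<forall>(x, y)\<in>U. (\<lambda>(i, j). fps_nth (fps_nth f j) i * x ^ i * y ^ j) summable_on UNIV))"

definition convergent_series :: "real fps fps set" where
  "convergent_series = {f. converges_on {(0, 0)} f}"

definition is_primitive :: "real fps fps \<Rightarrow> real fps fps \<Rightarrow> bool" where
  "is_primitive F f \<longleftrightarrow> F \<in> convergent_series \<and> fps_deriv F = f"

lemma fps_deriv_fps_integral0_series: "fps_deriv (fps_integral0 f) = (f :: real fps fps)"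
proof (rule fps_ext)
  fix n
  have "of_nat (Suc n) * inverse (of_nat (Suc n)) = (1 :: real fps)"
    by (subst mult.commute, rule inverse_mult_eq_1)
       (simp add: fps_of_nat [symmetric] del: of_nat_Suc)
  then have "of_nat (Suc n) * (inverse (of_nat (Suc n)) * fps_nth f n) = fps_nth f n"
    by (simp only: mult.assoc [symmetric] mult_1_left)
  then show "fps_nth (fps_deriv (fps_integral0 f)) n = fps_nth f n"
    by (simp add: fps_integral_def del: of_nat_Suc)
qed

section \<open>Newton-Puiseux series\<close>

text \<open>
  A Newton-Puiseux series is given by its coefficients, indexed by rational exponents;
  \<open>puiseux n g\<close> is \<open>g(x\<^bsup>1/n\<^esup>)\<close>.
\<close>

type_synonym 'a pseries = "rat \<Rightarrow> 'a"

definition puiseux :: "nat \<Rightarrow> 'a::zero fps \<Rightarrow> 'a pseries" where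
  "puiseux n g = (\<lambda>q. if \<exists>k::nat. q = of_nat k / of_nat n
                       then fps_nth g (THE k::nat. q = of_nat k / of_nat n) else 0)"

definition valuation :: "'a::zero pseries \<Rightarrow> ereal" where
  "valuation \<gamma> = (if \<gamma> = (\<lambda>_. 0) then \<infinity> else ereal (of_rat (LEAST q. \<gamma> q \<noteq> 0)))"

definition init_coeff :: "'a::zero pseries \<Rightarrow> 'a" where
  "init_coeff \<gamma> = \<gamma> (LEAST q. \<gamma> q \<noteq> 0)"

definition less_R :: "real pseries \<Rightarrow> real pseries \<Rightarrow> bool" where
  "less_R \<xi> \<xi>' \<longleftrightarrow> init_coeff (\<xi>' - \<xi>) > 0"

section \<open>Newton-Puiseux roots\<close>

text \<open>\<open>ramify N f\<close> is \<open>f(t ^ N, y)\<close> with complex coefficients, where \<open>t = x\<^bsup>1/N\<^esup>\<close>.\<close>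

definition ramify :: "nat \<Rightarrow> real fps fps \<Rightarrow> complex fps fps" where
  "ramify N f = Abs_fps (\<lambda>j.
     fps_compose (Abs_fps (\<lambda>i. complex_of_real (fps_nth (fps_nth f j) i))) (fps_X ^ N))"

text \<open>
  The factorization \<open>f = u(x,y) \<Prod>(y - \<gamma>\<^sub>i)\<close>, written in \<open>\<complex>[[t]][[y]]\<close> for a common
  denominator \<open>N\<close> of the exponents of the \<open>\<gamma>\<^sub>i\<close>, that is, \<open>\<gamma>\<^sub>i = g\<^sub>i(x\<^bsup>1/N\<^esup>)\<close>.
\<close>

definition np_factorization :: "real fps fps \<Rightarrow> complex pseries multiset \<Rightarrow> bool" where
  "np_factorization f \<Gamma> \<longleftrightarrow>
     (\<exists>N\<ge>1. \<exists>G :: complex fps multiset. \<exists>u\<in>convergent_series. (\<exists>v\<in>convergent_series. u * v = 1) \<and>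
        (\<forall>g\<in>#G. fps_conv_radius g > 0 \<and> fps_nth g 0 = 0) \<and>
        \<Gamma> = image_mset (puiseux N) G \<and>
        ramify N f = ramify N u * (\<Prod>g\<in>#G. fps_X - fps_const g))"

definition np_roots :: "real fps fps \<Rightarrow> complex pseries multiset" where
  "np_roots f = (THE \<Gamma>. np_factorization f \<Gamma>)"

definition real_roots :: "real fps fps \<Rightarrow> real pseries multiset" where
  "real_roots f = image_mset (\<lambda>\<gamma> q. Re (\<gamma> q)) (filter_mset (\<lambda>\<gamma>. \<forall>q. \<gamma> q \<in> \<real>) (np_roots f))"

definition right_reduced :: "real fps fps \<Rightarrow> bool" where
  "right_reduced f \<longleftrightarrow> f \<in> convergent_series \<and> fps_nth (fps_nth f 0) 0 = 0 \<and>
     (\<exists>j. fps_nth (fps_nth f j) 0 \<noteq> 0) \<and> (\<forall>\<xi>. count (real_roots f) \<xi> \<le> 1)"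

abbreviation root_set :: "real fps fps \<Rightarrow> real pseries set" where
  "root_set f \<equiv> set_mset (real_roots f)"

text \<open>The increasing list of the real roots, indexed from 0.\<close>

definition root_list :: "real fps fps \<Rightarrow> real pseries list" where
  "root_list f = (THE xs. distinct xs \<and> set xs = root_set f \<and> sorted_wrt less_R xs)"

section \<open>Rooted trees and planar structures\<close>

text \<open>
  A rooted tree is a topology \<open>T\<close> with a marked point \<open>r\<close>. The segment \<open>[P, Q]\<close>, i.e. the unique
  arc between two points of a tree, is the smallest connected subset containing both.
\<close>

definition segment :: "'p topology \<Rightarrow> 'p \<Rightarrow> 'p \<Rightarrow> 'p set" where
  "segment T P Q = \<Inter>{C. connectedin T C \<and> P \<in> C \<and> Q \<in> C}"

definition valency :: "'p topology \<Rightarrow> 'p \<Rightarrow> nat" where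
  "valency T P = card (connected_components_of (subtopology T (topspace T - {P})))"

definition vertices :: "'p topology \<Rightarrow> 'p set" where
  "vertices T = {P \<in> topspace T. valency T P \<noteq> 2}"

definition edges :: "'p topology \<Rightarrow> 'p set set" where
  "edges T = (\<lambda>C. T closure_of C) ` connected_components_of (subtopology T (topspace T - vertices T))"

definition tree_le :: "'p topology \<Rightarrow> 'p \<Rightarrow> 'p \<Rightarrow> 'p \<Rightarrow> bool" where
  "tree_le T r P Q \<longleftrightarrow> segment T r P \<subseteq> segment T r Q"

definition leaves :: "'p topology \<Rightarrow> 'p \<Rightarrow> 'p set" where
  "leaves T r = {P \<in> topspace T. \<forall>Q\<in>topspace T. tree_le T r P Q \<longrightarrow> Q = P}"

definition internal_vertices :: "'p topology \<Rightarrow> 'p \<Rightarrow> 'p set" where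
  "internal_vertices T r = vertices T - leaves T r - {r}"

definition meet :: "'p topology \<Rightarrow> 'p \<Rightarrow> 'p \<Rightarrow> 'p \<Rightarrow> 'p" where
  "meet T r P Q = (THE M. M \<in> topspace T \<and> segment T r M = segment T r P \<inter> segment T r Q)"

definition out_edges :: "'p topology \<Rightarrow> 'p \<Rightarrow> 'p \<Rightarrow> 'p set set" where
  "out_edges T r P = {e \<in> edges T. (\<exists>Q\<in>vertices T. e = segment T P Q) \<and> \<not> e \<subseteq> segment T r P}"

definition edge_towards :: "'p topology \<Rightarrow> 'p \<Rightarrow> 'p \<Rightarrow> 'p \<Rightarrow> 'p set" where
  "edge_towards T r P l = (THE e. e \<in> out_edges T r P \<and> e \<subseteq> segment T P l)"

text \<open>
  The empty relation away from internal vertices makes a planar structure uniquely determined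
  as a function by its orders at the internal vertices.
\<close>

definition planar_structure :: "'p topology \<Rightarrow> 'p \<Rightarrow> ('p \<Rightarrow> 'p set rel) \<Rightarrow> bool" where
  "planar_structure T r lt \<longleftrightarrow>
     (\<forall>P\<in>internal_vertices T r. lt P \<subseteq> out_edges T r P \<times> out_edges T r P \<and>
        strict_linear_order_on (out_edges T r P) (lt P)) \<and>
     (\<forall>P. P \<notin> internal_vertices T r \<longrightarrow> lt P = {})"

definition leaf_less :: "'p topology \<Rightarrow> 'p \<Rightarrow> ('p \<Rightarrow> 'p set rel) \<Rightarrow> 'p \<Rightarrow> 'p \<Rightarrow> bool" where
  "leaf_less T r lt l l' \<longleftrightarrow>
     (let P = meet T r l l' in (edge_towards T r P l, edge_towards T r P l') \<in> lt P)"

section \<open>The real contact tree\<close>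

definition quotient_topology :: "'a topology \<Rightarrow> ('a \<Rightarrow> 'b) \<Rightarrow> 'b topology" where
  "quotient_topology X q =
     topology (\<lambda>U. U \<subseteq> q ` topspace X \<and> openin X {x \<in> topspace X. q x \<in> U})"

lemma openin_quotient_topology:
  "openin (quotient_topology X q) U \<longleftrightarrow>
     U \<subseteq> q ` topspace X \<and> openin X {x \<in> topspace X. q x \<in> U}"
proof -
  have "istopology (\<lambda>U. U \<subseteq> q ` topspace X \<and> openin X {x \<in> topspace X. q x \<in> U})"
    unfolding istopology_def
  proof (intro conjI allI impI)
    fix S U
    assume "S \<subseteq> q ` topspace X \<and> openin X {x \<in> topspace X. q x \<in> S}"
      and "U \<subseteq> q ` topspace X \<and> openin X {x \<in> topspace X. q x \<in> U}"
    then have "openin X ({x \<in> topspace X. q x \<in> S} \<inter> {x \<in> topspace X. q x \<in> U})"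
      and sub: "S \<inter> U \<subseteq> q ` topspace X" by (blast intro: openin_Int)+
    moreover have "{x \<in> topspace X. q x \<in> S \<inter> U} =
        {x \<in> topspace X. q x \<in> S} \<inter> {x \<in> topspace X. q x \<in> U}" by auto
    ultimately show "openin X {x \<in> topspace X. q x \<in> S \<inter> U}" by simp
    show "S \<inter> U \<subseteq> q ` topspace X" by (rule sub)
  next
    fix \<K> assume \<K>: "\<forall>S\<in>\<K>. S \<subseteq> q ` topspace X \<and> openin X {x \<in> topspace X. q x \<in> S}"
    have "{x \<in> topspace X. q x \<in> \<Union>\<K>} = (\<Union>S\<in>\<K>. {x \<in> topspace X. q x \<in> S})" by auto
    moreover have "openin X (\<Union>S\<in>\<K>. {x \<in> topspace X. q x \<in> S})"
      by (rule openin_Union) (use \<K> in blast)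
    ultimately show "openin X {x \<in> topspace X. q x \<in> \<Union>\<K>}" by simp
    show "\<Union>\<K> \<subseteq> q ` topspace X" using \<K> by blast
  qed
  then show ?thesis unfolding quotient_topology_def by (simp add: topology_inverse')
qed

lemma quotient_map_quotient_topology: "quotient_map X (quotient_topology X q) q"
proof -
  have "topspace (quotient_topology X q) = q ` topspace X"
  proof
    show "topspace (quotient_topology X q) \<subseteq> q ` topspace X"
      using openin_quotient_topology[of X q] by (metis openin_topspace)
    have "{x \<in> topspace X. q x \<in> q ` topspace X} = topspace X" by auto
    then have "openin (quotient_topology X q) (q ` topspace X)"
      by (simp add: openin_quotient_topology)
    then show "q ` topspace X \<subseteq> topspace (quotient_topology X q)" by (rule openin_subset)
  qed
  then show ?thesis by (simp add: quotient_map_def openin_quotient_topology)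
qed

text \<open>
  Points of the contact tree of \<open>A\<close> are the classes of pairs \<open>(\<xi>, t)\<close> with \<open>\<xi> \<in> A\<close> and
  \<open>t \<in> [0, \<infinity>]\<close>. Since \<open>valuation 0 = \<infinity>\<close>, the case \<open>\<xi> = \<xi>'\<close> needs no separate treatment.
\<close>

type_synonym contact_point = "(real pseries \<times> ereal) set"

definition contact_class :: "real pseries set \<Rightarrow> real pseries \<times> ereal \<Rightarrow> contact_point" where
  "contact_class A = (\<lambda>(\<xi>, t). {(\<xi>', t'). \<xi>' \<in> A \<and> t' = t \<and> t \<le> valuation (\<xi>' - \<xi>)})"

definition contact_tree :: "real pseries set \<Rightarrow> contact_point topology" where
  "contact_tree A =
     quotient_topology (prod_topology (discrete_topology A) (top_of_set {0..\<infinity>})) (contact_class A)"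

text \<open>The common class of all the points \<open>(\<xi>, 0)\<close>.\<close>

definition contact_root :: "real pseries set \<Rightarrow> contact_point" where
  "contact_root A = A \<times> {0}"

definition contact_leaf :: "real pseries set \<Rightarrow> real pseries \<Rightarrow> contact_point" where
  "contact_leaf A \<xi> = contact_class A (\<xi>, \<infinity>)"

abbreviation real_tree :: "real fps fps \<Rightarrow> contact_point topology" where
  "real_tree f \<equiv> contact_tree (root_set f)"

abbreviation tree_root :: "real fps fps \<Rightarrow> contact_point" where
  "tree_root f \<equiv> contact_root (root_set f)"

abbreviation tree_leaf :: "real fps fps \<Rightarrow> real pseries \<Rightarrow> contact_point" where
  "tree_leaf f \<equiv> contact_leaf (root_set f)"

definition real_planar :: "real fps fps \<Rightarrow> contact_point \<Rightarrow> contact_point set rel" where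
  "real_planar f = (THE lt. planar_structure (real_tree f) (tree_root f) lt \<and>
     (\<forall>\<xi>\<in>root_set f. \<forall>\<xi>'\<in>root_set f.
        leaf_less (real_tree f) (tree_root f) lt (tree_leaf f \<xi>) (tree_leaf f \<xi>') \<longleftrightarrow> less_R \<xi> \<xi>'))"

section \<open>Discrete integration, injectivity condition, integrated order\<close>

text \<open>
  \<open>subst_y F \<xi>\<close> is \<open>F\<^sub>x(\<xi>)\<close>: if \<open>\<xi> = g(x\<^bsup>1/n\<^esup>)\<close> with \<open>g(0) = 0\<close>, it is the series \<open>F(t ^ n, g(t))\<close>
  at \<open>t = x\<^bsup>1/n\<^esup>\<close>. The powers \<open>g ^ j\<close> with \<open>j > k\<close> do not contribute to the coefficient of \<open>t ^ k\<close>.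
\<close>

definition subst_y :: "real fps fps \<Rightarrow> real pseries \<Rightarrow> real pseries" where
  "subst_y F \<xi> = (THE S. \<exists>n\<ge>1. \<exists>g. fps_nth g 0 = 0 \<and> \<xi> = puiseux n g \<and>
     S = puiseux n (Abs_fps (\<lambda>k. \<Sum>j\<le>k.
           fps_nth (fps_compose (fps_nth F j) (fps_X ^ n) * g ^ j) k)))"

text \<open>
  Indices start from 0 throughout: \<open>increment f r\<close> is \<open>F\<^sub>x(\<xi>\<^sub>r\<^sub>+\<^sub>1) - F\<^sub>x(\<xi>\<^sub>r)\<close> for \<open>Suc r < length (root_list f)\<close>.
  It does not depend on the primitive, so the one with \<open>F\<^sub>x(0) = 0\<close> is taken.
\<close>

definition increment :: "real fps fps \<Rightarrow> nat \<Rightarrow> real pseries" where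
  "increment f r = subst_y (fps_integral0 f) (root_list f ! Suc r) -
                   subst_y (fps_integral0 f) (root_list f ! r)"

definition edge_list :: "real fps fps \<Rightarrow> contact_point \<Rightarrow> contact_point set list" where
  "edge_list f P = (THE es. distinct es \<and> set es = out_edges (real_tree f) (tree_root f) P \<and>
     sorted_wrt (\<lambda>e e'. (e, e') \<in> real_planar f P) es)"

definition gap_index :: "real fps fps \<Rightarrow> contact_point \<Rightarrow> nat \<Rightarrow> nat" where
  "gap_index f P k = (THE r. Suc r < length (root_list f) \<and>
     (let l = tree_leaf f (root_list f ! r); l' = tree_leaf f (root_list f ! Suc r) in
        meet (real_tree f) (tree_root f) l l' = P \<and>
        edge_list f P ! k = edge_towards (real_tree f) (tree_root f) P l \<and>
        edge_list f P ! Suc k = edge_towards (real_tree f) (tree_root f) P l'))"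

definition discrete_integral :: "real fps fps \<Rightarrow> contact_point \<Rightarrow> nat \<Rightarrow> real" where
  "discrete_integral f P i = (\<Sum>k<i. init_coeff (increment f (gap_index f P k)))"

definition injectivity_condition :: "real fps fps \<Rightarrow> bool" where
  "injectivity_condition f \<longleftrightarrow>
     (\<forall>P\<in>internal_vertices (real_tree f) (tree_root f).
        inj_on (discrete_integral f P) {0..<length (edge_list f P)})"

definition integrated_planar :: "real fps fps \<Rightarrow> contact_point \<Rightarrow> contact_point set rel" where
  "integrated_planar f P =
     (if P \<in> internal_vertices (real_tree f) (tree_root f)
      then {(edge_list f P ! k, edge_list f P ! l) | k l.
              k < length (edge_list f P) \<and> l < length (edge_list f P) \<and>
              discrete_integral f P k < discrete_integral f P l}
      else {})"

definition less_int :: "real fps fps \<Rightarrow> real pseries \<Rightarrow> real pseries \<Rightarrow> bool" where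
  "less_int f \<xi> \<xi>' \<longleftrightarrow>
     leaf_less (real_tree f) (tree_root f) (integrated_planar f) (tree_leaf f \<xi>) (tree_leaf f \<xi>')"

section \<open>Morse functions and morsifications\<close>

definition crit_points :: "real \<Rightarrow> real \<Rightarrow> (real \<Rightarrow> real) \<Rightarrow> real set" where
  "crit_points a b \<phi> = {c \<in> {a..b}. (\<phi> has_real_derivative 0) (at c within {a..b})}"

text \<open>
  \<open>D n\<close> is the \<open>n\<close>-th derivative of \<open>\<phi>\<close> on \<open>{a..b}\<close>, one-sided at the end points.
\<close>

definition morse_on :: "real \<Rightarrow> real \<Rightarrow> (real \<Rightarrow> real) \<Rightarrow> bool" where
  "morse_on a b \<phi> \<longleftrightarrow>
     (\<exists>D. D 0 = \<phi> \<and>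
        (\<forall>n. \<forall>y\<in>{a..b}. (D n has_real_derivative D (Suc n) y) (at y within {a..b})) \<and>
        (\<forall>c\<in>crit_points a b \<phi>. D 2 c \<noteq> 0)) \<and>
     crit_points a b \<phi> \<subseteq> {a<..<b} \<and> inj_on \<phi> (crit_points a b \<phi>)"

definition Crit :: "real \<Rightarrow> real \<Rightarrow> (real \<Rightarrow> real) \<Rightarrow> (real \<times> real) set" where
  "Crit a b \<phi> = (\<lambda>c. (c, \<phi> c)) ` crit_points a b \<phi>"

definition less_s :: "real \<times> real \<Rightarrow> real \<times> real \<Rightarrow> bool" where
  "less_s p q \<longleftrightarrow> fst p < fst q"

definition less_t :: "real \<times> real \<Rightarrow> real \<times> real \<Rightarrow> bool" where
  "less_t p q \<longleftrightarrow> snd p < snd q"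

definition biordered_set :: "'a set \<Rightarrow> ('a \<Rightarrow> 'a \<Rightarrow> bool) \<Rightarrow> ('a \<Rightarrow> 'a \<Rightarrow> bool) \<Rightarrow> bool" where
  "biordered_set A R S \<longleftrightarrow> finite A \<and>
     strict_linear_order_on A (Restr {(x, y). R x y} A) \<and>
     strict_linear_order_on A (Restr {(x, y). S x y} A)"

definition biordered_iso ::
  "'a set \<Rightarrow> ('a \<Rightarrow> 'a \<Rightarrow> bool) \<Rightarrow> ('a \<Rightarrow> 'a \<Rightarrow> bool) \<Rightarrow>
   'b set \<Rightarrow> ('b \<Rightarrow> 'b \<Rightarrow> bool) \<Rightarrow> ('b \<Rightarrow> 'b \<Rightarrow> bool) \<Rightarrow> bool" where
  "biordered_iso A R S B R' S' \<longleftrightarrow> biordered_set A R S \<and> biordered_set B R' S' \<and>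
     (\<exists>h. bij_betw h A B \<and>
        (\<forall>x\<in>A. \<forall>y\<in>A. (R x y \<longleftrightarrow> R' (h x) (h y)) \<and> (S x y \<longleftrightarrow> S' (h x) (h y))))"

text \<open>The rectangle is \<open>{0..\<epsilon>} \<times> {a..b}\<close>.\<close>

definition morse_rectangle :: "real fps fps \<Rightarrow> real \<Rightarrow> real \<Rightarrow> real \<Rightarrow> bool" where
  "morse_rectangle F \<epsilon> a b \<longleftrightarrow> \<epsilon> > 0 \<and> a < 0 \<and> 0 < b \<and>
     converges_on ({0..\<epsilon>} \<times> {a..b}) F \<and>
     crit_points a b (eval2 F 0) = {0} \<and>
     (\<forall>x\<in>{0<..\<epsilon>}. morse_on a b (eval2 F x))"

definition morsification :: "real fps fps \<Rightarrow> bool" where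
  "morsification F \<longleftrightarrow> (\<exists>\<epsilon> a b. morse_rectangle F \<epsilon> a b)"

end

(*
  Choose a common denominator N of the exponents of the Newton-Puiseux roots and put x = t^N, so
  that every root is a convergent power series in t. For small t > 0, the critical points of F_x
  near 0 are the values r(t) of the real roots r, they are simple because f is right-reduced, and
  their order is the order of the roots.

  Let two real roots r, s separate at the height m of the tree, and substitute y = r(t) + t^m w.
  The rescaled f converges, uniformly for bounded w, to q(w), where q is a nonzero constant times
  the product of the linear factors that belong to the roots through the vertex. Hence the
  rescaled differences of F_x between roots through the vertex converge to the differences of a
  primitive Q of q. The initial coefficients of the increments are the differences of Q between
  neighbouring edges. They do not vanish, since q has no zero between two neighbours. So Q restricted to
  the outgoing edges is, up to a constant, the discrete integration map. The injectivity condition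
  separates its values, and F_x(r) < F_x(s) for small x iff r precedes s in the integrated order.

  On an arbitrary Morse rectangle, non-degenerate critical points and the order of their distinct
  values persist under small changes of x, so by connectedness of the range of x the combinatorial
  type is the one near x = 0.
*)
theory Submission
  imports Defs "HOL-Computational_Algebra.Fundamental_Theorem_Algebra"
begin

text \<open>\<open>np_roots\<close> is a definite description, so existence and uniqueness of the
  Newton-Puiseux factorization both have to be proved. The algebra rests on division by y - g, whose
  remainder F(g) is unique. Existence is an induction on the order in y. Convergence is never
  estimated along the whole Newton algorithm: shift, ramification and rescaling preserve geometric
  coefficient bounds, and an analytic construction occurs only in order 1, by contraction. The unit
  has to be real and in integral powers of x; uniqueness supplies this by symmetry. On the side of
  the tree, the topological notions are first translated into the ultrametric of contact orders. The
  link between tree and analysis is a potential at each vertex: constant on every outgoing edge,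
  with the initial coefficients as its jumps between neighbours. Non-real roots are an obstacle: a
  conjugate pair may share its real leading term, and then q may vanish between two neighbouring
  edges. Only the constancy of the sign of q there survives, together with the finiteness of its
  zeros, and this is enough.\<close>

section \<open>Substitution and linear factors of formal power series\<close>

text \<open>The cut-off j \<le> k stands for the infinite sum over j: if \<open>g\<close> has no
  constant term, g^j starts in degree j. The value is F(g) only for such \<open>g\<close>.\<close>

definition fsubst :: "'a::comm_ring_1 fps fps \<Rightarrow> 'a fps \<Rightarrow> 'a fps" where
  "fsubst F g = Abs_fps (\<lambda>k. \<Sum>j\<le>k. fps_nth (fps_nth F j * g ^ j) k)"

text \<open>The quotient \<open>(F - F(g)) / (y - g)\<close>.\<close>

definition fquot :: "'a::comm_ring_1 fps fps \<Rightarrow> 'a fps \<Rightarrow> 'a fps fps" where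
  "fquot F g = Abs_fps (\<lambda>a. fsubst (fps_shift (Suc a) F) g)"

lemma fps_mult_nth_eq_0:
  fixes a b :: "'a::comm_ring_1 fps"
  assumes "\<And>i. i < k \<Longrightarrow> fps_nth a i = 0" "l < k"
  shows "fps_nth (a * b) l = 0" "fps_nth (b * a) l = 0"
proof -
  show "fps_nth (a * b) l = 0" unfolding fps_mult_nth
    by (rule sum.neutral) (use assms in auto)
  then show "fps_nth (b * a) l = 0" by (simp add: mult.commute)
qed

lemma fps_power_nth_eq_0:
  fixes g :: "'a::comm_ring_1 fps"
  assumes "fps_nth g 0 = 0" "l < j"
  shows "fps_nth (w * g ^ j) l = 0" "fps_nth (g ^ j * w) l = 0"
proof -
  have *: "\<And>i. i < j \<Longrightarrow> fps_nth (g ^ j) i = 0"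
    using startsby_zero_power_prefix[OF assms(1)] by auto
  show "fps_nth (w * g ^ j) l = 0" "fps_nth (g ^ j * w) l = 0"
    using fps_mult_nth_eq_0[of j "g ^ j" l w] * assms(2) by auto
qed

text \<open>A common cut-off \<open>M\<close> for all coefficients up to degree \<open>M\<close> is
  what allows double sums to be interchanged below.\<close>

lemma fsubst_nth_pad:
  assumes "fps_nth g 0 = 0" "k \<le> M"
  shows "fps_nth (fsubst F g) k = (\<Sum>j\<le>M. fps_nth (fps_nth F j * g ^ j) k)"
  unfolding fsubst_def fps_nth_Abs_fps
  by (rule sum.mono_neutral_left) (use assms in \<open>auto intro: fps_power_nth_eq_0\<close>)

lemma fsubst_mult_nth:
  assumes "fps_nth g 0 = 0" "k \<le> M"
  shows "fps_nth (w * fsubst F g) k = (\<Sum>j\<le>M. fps_nth (w * (fps_nth F j * g ^ j)) k)"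
proof -
  have "fps_nth (w * fsubst F g) k =
      (\<Sum>i=0..k. fps_nth w i * (\<Sum>j\<le>M. fps_nth (fps_nth F j * g ^ j) (k - i)))"
    unfolding fps_mult_nth[of w]
    by (rule sum.cong) (use assms in \<open>simp_all add: fsubst_nth_pad[where M = M]\<close>)
  also have "\<dots> = (\<Sum>j\<le>M. \<Sum>i=0..k. fps_nth w i * fps_nth (fps_nth F j * g ^ j) (k - i))"
    by (subst sum.swap) (simp add: sum_distrib_left)
  finally show ?thesis by (simp add: fps_mult_nth[of w])
qed

text \<open>Horner's rule. Applied to the tails \<open>fps_shift n F\<close>, it is the coefficient
  of y^n in the division identity \<open>fsubst_division\<close>.\<close>

lemma fsubst_rec:
  assumes "fps_nth g 0 = 0"
  shows "fsubst F g = fps_nth F 0 + g * fsubst (fps_shift 1 F) g"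
proof (rule fps_ext)
  fix k
  have "fps_nth (fsubst F g) k = (\<Sum>j\<le>Suc k. fps_nth (fps_nth F j * g ^ j) k)"
    by (rule fsubst_nth_pad[OF assms]) simp
  also have "\<dots> = fps_nth (fps_nth F 0) k + (\<Sum>j\<le>k. fps_nth (g * (fps_nth (fps_shift 1 F) j * g ^ j)) k)"
    by (subst sum.atMost_Suc_shift) (simp add: mult_ac)
  also have "(\<Sum>j\<le>k. fps_nth (g * (fps_nth (fps_shift 1 F) j * g ^ j)) k)
      = fps_nth (g * fsubst (fps_shift 1 F) g) k"
    by (rule fsubst_mult_nth[OF assms, symmetric]) simp
  finally show "fps_nth (fsubst F g) k = fps_nth (fps_nth F 0 + g * fsubst (fps_shift 1 F) g) k" by simp
qed

lemma linear_mult_nth: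
  fixes g :: "'a::comm_ring_1 fps"
  shows "fps_nth ((fps_X - fps_const g) * h) n = (if n = 0 then 0 else fps_nth h (n - 1)) - g * fps_nth h n"
  by (simp add: ring_distribs left_diff_distrib)

lemma fsubst_division:
  assumes "fps_nth g 0 = 0"
  shows "F = fps_const (fsubst F g) + (fps_X - fps_const g) * fquot F g"
proof (rule fps_ext)
  fix n
  have *: "fsubst (fps_shift n F) g = fps_nth F n + g * fsubst (fps_shift (Suc n) F) g"
    using fsubst_rec[OF assms, of "fps_shift n F"] by (simp add: fps_shift_fps_shift[symmetric])
  show "fps_nth F n = fps_nth (fps_const (fsubst F g) + (fps_X - fps_const g) * fquot F g) n"
    unfolding fps_add_nth linear_mult_nth
    using * by (cases n) (auto simp: fquot_def)
qed

text \<open>Comparing coefficients of y gives h_n = g h_(n+1), so h_0 is divisible by every power of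
  t and vanishes, and r = - g h_0.\<close>

lemma linear_dvd_const:
  fixes g :: "'a::comm_ring_1 fps"
  assumes "fps_nth g 0 = 0" "fps_const r = (fps_X - fps_const g) * h"
  shows "r = 0"
proof -
  have h: "fps_nth h n = g * fps_nth h (Suc n)" for n
    using arg_cong[OF assms(2), of "\<lambda>z. fps_nth z (Suc n)"] unfolding linear_mult_nth by simp
  have hn: "fps_nth h 0 = g ^ n * fps_nth h n" for n
  proof (induction n)
    case (Suc n)
    then show ?case by (simp add: h[of n] mult_ac)
  qed simp
  have "fps_nth h 0 = 0"
  proof (rule fps_ext)
    fix k show "fps_nth (fps_nth h 0) k = fps_nth 0 k"
      by (subst hn[of "Suc k"]) (simp add: fps_power_nth_eq_0[OF assms(1), of k "Suc k"] del: power_Suc)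
  qed
  then show ?thesis
    using arg_cong[OF assms(2), of "\<lambda>z. fps_nth z 0"] unfolding linear_mult_nth by simp
qed

text \<open>Division by y - g leaves only one remainder. This characterization of F(g) gives
  multiplicativity and compatibility with ring homomorphisms without touching the truncated
  sums.\<close>

lemma fsubst_unique:
  assumes "fps_nth g 0 = 0" "F = fps_const r + (fps_X - fps_const g) * h"
  shows "fsubst F g = r"
proof -
  have "fps_const (fsubst F g - r) = (fps_X - fps_const g) * (h - fquot F g)"
  proof -
    have "fps_const (fsubst F g) + (fps_X - fps_const g) * fquot F g = fps_const r + (fps_X - fps_const g) * h"
      using fsubst_division[OF assms(1), of F] assms(2) by simp
    moreover have "a + b = c + d \<Longrightarrow> a - c = d - b" for a b c d :: "'a fps fps"
      by (simp add: algebra_simps)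
    ultimately show ?thesis
      unfolding fps_const_sub[symmetric] right_diff_distrib by blast
  qed
  from linear_dvd_const[OF assms(1) this] show ?thesis by simp
qed

section \<open>Substitution is a ring homomorphism\<close>

context
  fixes g :: "'a::comm_ring_1 fps"
  assumes g: "fps_nth g 0 = 0"
begin

lemma fsubst_mult: "fsubst (F * G) g = fsubst F g * fsubst G g"
proof (rule fsubst_unique[OF g])
  let ?L = "fps_X - fps_const g"
  have "F * G = (fps_const (fsubst F g) + ?L * fquot F g) * (fps_const (fsubst G g) + ?L * fquot G g)"
    by (rule arg_cong2[of _ _ _ _ "(*)"]; rule fsubst_division[OF g])
  also have "\<dots> = fps_const (fsubst F g * fsubst G g) +
      ?L * (fquot F g * (fps_const (fsubst G g) + ?L * fquot G g) + fps_const (fsubst F g) * fquot G g)"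
    unfolding fps_const_mult[symmetric] by (simp only: ring_distribs mult_ac add_ac)
  finally show "F * G = fps_const (fsubst F g * fsubst G g) +
      ?L * (fquot F g * (fps_const (fsubst G g) + ?L * fquot G g) + fps_const (fsubst F g) * fquot G g)" .
qed

lemma fsubst_add: "fsubst (F + G) g = fsubst F g + fsubst G g"
  unfolding fsubst_def by (rule fps_ext) (simp add: ring_distribs sum.distrib)

lemma fsubst_diff: "fsubst (F - G) g = fsubst F g - fsubst G g"
  unfolding fsubst_def by (rule fps_ext) (simp add: left_diff_distrib sum_subtractf)

lemma fsubst_const [simp]: "fsubst (fps_const r) g = r"
  by (rule fsubst_unique[OF g, of _ _ 0]) simp

lemma fsubst_0 [simp]: "fsubst 0 g = 0" and fsubst_1 [simp]: "fsubst 1 g = 1"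
  using fsubst_const[of 0] fsubst_const[of 1] by auto

lemma fsubst_X [simp]: "fsubst fps_X g = g"
  by (rule fsubst_unique[OF g, of _ _ 1]) simp

lemma fsubst_linear [simp]: "fsubst (fps_X - fps_const g') g = g - g'"
  by (simp add: fsubst_diff)

lemma fsubst_prod_mset: "fsubst (\<Prod>a\<in>#A. P a) g = (\<Prod>a\<in>#A. fsubst (P a) g)"
  by (induction A) (simp_all add: fsubst_mult)

lemma fsubst_nth_0: "fps_nth (fsubst F g) 0 = fps_nth (fps_nth F 0) 0"
  by (simp add: fsubst_def)

end

lemma linear_neq_0: "fps_X - fps_const g \<noteq> (0 :: 'a::comm_ring_1 fps fps)"
proof
  assume "fps_X - fps_const g = (0 :: 'a fps fps)"
  then have "fps_nth (fps_X - fps_const g) 1 = 0" by simp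
  then show False by simp
qed

text \<open>Substituting a root of the left product into the right one shows that it is a root there, too.\<close>

lemma linear_factorization_unique:
  fixes u u' :: "'a::idom fps fps"
  assumes "u * (\<Prod>g\<in>#G. fps_X - fps_const g) = u' * (\<Prod>g\<in>#G'. fps_X - fps_const g)"
    and "\<forall>g\<in>#G. fps_nth g 0 = 0" "\<forall>g\<in>#G'. fps_nth g 0 = 0"
    and "fps_nth (fps_nth u 0) 0 \<noteq> 0" "fps_nth (fps_nth u' 0) 0 \<noteq> 0"
  shows "G = G' \<and> u = u'"
  using assms
proof (induction G arbitrary: G')
  case empty
  show ?case
  proof (cases "G' = {#}")
    case False
    then obtain g where g: "g \<in># G'" by auto
    then have g0: "fps_nth g 0 = 0" using empty by auto
    have "fsubst u g = fsubst (u' * (\<Prod>g\<in>#G'. fps_X - fps_const g)) g" using empty(1) by simp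
    also have "\<dots> = 0" using g0 g by (auto simp: fsubst_mult fsubst_prod_mset prod_mset_zero_iff)
    finally have "fps_nth (fsubst u g) 0 = 0" by simp
    then show ?thesis using empty(4) g0 by (simp add: fsubst_nth_0)
  qed (use empty in auto)
next
  case (add g G)
  then have g0: "fps_nth g 0 = 0" by auto
  have "0 = fsubst (u * (\<Prod>g\<in>#add_mset g G. fps_X - fps_const g)) g"
    using g0 by (simp add: fsubst_mult)
  also have "\<dots> = fsubst u' g * (\<Prod>a\<in>#G'. g - a)"
    unfolding add.prems(1) using g0 by (simp add: fsubst_mult fsubst_prod_mset)
  finally have "fsubst u' g = 0 \<or> (\<Prod>a\<in>#G'. g - a) = 0" by simp
  \<comment> \<open>The constant coefficient of u'(g) is that of u', so the zero must come from the
    product.\<close>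
  moreover have "fsubst u' g \<noteq> 0"
    using fsubst_nth_0[OF g0, of u'] add.prems(5) by auto
  ultimately have "g \<in># G'" by (auto simp: prod_mset_zero_iff)
  then obtain G'' where G': "G' = add_mset g G''" by (metis insert_DiffM)
  have "(fps_X - fps_const g) * (u * (\<Prod>g\<in>#G. fps_X - fps_const g)) =
      (fps_X - fps_const g) * (u' * (\<Prod>g\<in>#G''. fps_X - fps_const g))"
    using add.prems(1) unfolding G' by (simp add: mult_ac)
  then have "u * (\<Prod>g\<in>#G. fps_X - fps_const g) = u' * (\<Prod>g\<in>#G''. fps_X - fps_const g)"
    using linear_neq_0[of g] by simp
  with add.IH[of G''] add.prems G' show ?case by auto
qed

section \<open>Coefficientwise ring homomorphisms and ramification\<close>

definition fps_hom :: "('a::comm_ring_1 fps \<Rightarrow> 'b::comm_ring_1 fps) \<Rightarrow> bool" where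
  "fps_hom \<phi> \<longleftrightarrow> \<phi> 1 = 1 \<and> (\<forall>a b. \<phi> (a + b) = \<phi> a + \<phi> b) \<and> (\<forall>a b. \<phi> (a * b) = \<phi> a * \<phi> b)"

definition map_coeff :: "('a::comm_ring_1 fps \<Rightarrow> 'b::comm_ring_1 fps) \<Rightarrow> 'a fps fps \<Rightarrow> 'b fps fps" where
  "map_coeff \<phi> F = Abs_fps (\<lambda>j. \<phi> (fps_nth F j))"

lemma map_coeff_nth [simp]: "fps_nth (map_coeff \<phi> F) j = \<phi> (fps_nth F j)"
  by (simp add: map_coeff_def)

context
  fixes \<phi> :: "'a::comm_ring_1 fps \<Rightarrow> 'b::comm_ring_1 fps"
  assumes hom: "fps_hom \<phi>"
begin

lemma hom_simps: "\<phi> 1 = 1" "\<phi> (a + b) = \<phi> a + \<phi> b" "\<phi> (a * b) = \<phi> a * \<phi> b"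
  using hom by (auto simp: fps_hom_def)

lemma hom_0: "\<phi> 0 = 0" using hom_simps(2)[of 0 0] by simp

lemma hom_uminus: "\<phi> (- a) = - \<phi> a"
  using hom_simps(2)[of a "- a"] by (simp add: hom_0 eq_neg_iff_add_eq_0 add.commute)

lemma hom_diff: "\<phi> (a - b) = \<phi> a - \<phi> b"
  using hom_simps(2)[of a "- b"] by (simp add: hom_uminus)

lemma hom_sum: "\<phi> (sum f A) = (\<Sum>a\<in>A. \<phi> (f a))"
  by (induction A rule: infinite_finite_induct) (auto simp: hom_0 hom_simps)

lemma hom_power: "\<phi> (a ^ n) = \<phi> a ^ n"
  by (induction n) (auto simp: hom_simps)

lemma fps_hom_map_coeff: "fps_hom (map_coeff \<phi>)"
  unfolding fps_hom_def
proof (intro conjI allI)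
  show "map_coeff \<phi> 1 = 1" by (rule fps_ext) (auto simp: hom_simps hom_0)
  show "map_coeff \<phi> (a + b) = map_coeff \<phi> a + map_coeff \<phi> b" for a b
    by (rule fps_ext) (simp add: hom_simps)
  show "map_coeff \<phi> (a * b) = map_coeff \<phi> a * map_coeff \<phi> b" for a b
    by (rule fps_ext) (simp add: fps_mult_nth hom_sum hom_simps)
qed

lemma map_coeff_const: "map_coeff \<phi> (fps_const a) = fps_const (\<phi> a)"
  by (rule fps_ext) (simp add: hom_0)

lemma map_coeff_X: "map_coeff \<phi> fps_X = fps_X"
  by (rule fps_ext) (auto simp: hom_0 hom_simps fps_X_def)

end

lemma map_coeff_linear:
  assumes "fps_hom \<phi>"
  shows "map_coeff \<phi> (fps_X - fps_const g) = fps_X - fps_const (\<phi> g)"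
  by (simp add: hom_diff[OF fps_hom_map_coeff] assms map_coeff_X map_coeff_const)

lemma map_coeff_prod:
  assumes "fps_hom \<phi>"
  shows "map_coeff \<phi> (\<Prod>g\<in>#G. fps_X - fps_const g) = (\<Prod>g\<in>#image_mset \<phi> G. fps_X - fps_const g)"
  by (induction G)
     (simp_all add: hom_simps[OF fps_hom_map_coeff] assms map_coeff_linear del: fps_const_sub)

text \<open>Applying \<phi> to the division of F by y - g yields a division by y - \<phi>(g), and
  its remainder is unique.\<close>

lemma fsubst_hom:
  assumes "fps_hom \<phi>" "fps_nth g 0 = 0" "fps_nth (\<phi> g) 0 = 0"
  shows "fsubst (map_coeff \<phi> F) (\<phi> g) = \<phi> (fsubst F g)"
proof (rule fsubst_unique[OF assms(3)])
  note h = fps_hom_map_coeff[OF assms(1)]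
  have "map_coeff \<phi> F = map_coeff \<phi> (fps_const (fsubst F g) + (fps_X - fps_const g) * fquot F g)"
    using fsubst_division[OF assms(2), of F] by simp
  then show "map_coeff \<phi> F = fps_const (\<phi> (fsubst F g)) + (fps_X - fps_const (\<phi> g)) * map_coeff \<phi> (fquot F g)"
    by (simp add: hom_simps[OF h] map_coeff_const map_coeff_linear assms(1) del: fps_const_sub)
qed

definition coeff_hom :: "('a::comm_ring_1 \<Rightarrow> 'b::comm_ring_1) \<Rightarrow> 'a fps \<Rightarrow> 'b fps" where
  "coeff_hom h a = Abs_fps (\<lambda>i. h (fps_nth a i))"

lemma coeff_hom_nth [simp]: "fps_nth (coeff_hom h a) i = h (fps_nth a i)"
  by (simp add: coeff_hom_def)

lemma fps_hom_coeff_hom: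
  assumes "h 1 = 1" "\<And>a b. h (a + b) = h a + h b" "\<And>a b. h (a * b) = h a * h b"
  shows "fps_hom (coeff_hom h)"
proof -
  have h0: "h 0 = 0" using assms(2)[of 0 0] by simp
  have hs: "h (sum f A) = (\<Sum>a\<in>A. h (f a))" for f and A :: "nat set"
    by (induction A rule: infinite_finite_induct) (auto simp: h0 assms)
  show ?thesis unfolding fps_hom_def
  proof (intro conjI allI)
    show "coeff_hom h 1 = 1" by (rule fps_ext) (auto simp: h0 assms)
    show "coeff_hom h (a + b) = coeff_hom h a + coeff_hom h b" for a b
      by (rule fps_ext) (simp add: assms)
    show "coeff_hom h (a * b) = coeff_hom h a * coeff_hom h b" for a b
      by (rule fps_ext) (simp add: fps_mult_nth hs assms)
  qed
qed

text \<open>The substitution t -> t^N, given on coefficients: coefficient bounds and divisibility of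
  exponents are then immediate, while \<open>ram_eq_compose\<close> supplies the ring laws.\<close>

definition ram :: "nat \<Rightarrow> 'a::comm_ring_1 fps \<Rightarrow> 'a fps" where
  "ram N a = Abs_fps (\<lambda>i. if N dvd i then fps_nth a (i div N) else 0)"

lemma ram_nth: "fps_nth (ram N a) i = (if N dvd i then fps_nth a (i div N) else 0)"
  by (simp add: ram_def)

lemma ram_eq_compose: "N > 0 \<Longrightarrow> ram N a = fps_compose a (fps_X ^ N)"
proof (rule fps_ext)
  fix i assume N: "N > 0"
  have "fps_nth (fps_compose a (fps_X ^ N)) i = (\<Sum>k=0..i. if i = N * k then fps_nth a k else 0)"
    unfolding fps_compose_nth
    by (rule sum.cong) (simp_all flip: power_mult)
  also have "\<dots> = (\<Sum>k=0..i. if k = i div N \<and> N dvd i then fps_nth a k else 0)"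
    by (rule sum.cong) (use N in auto)
  also have "\<dots> = fps_nth (ram N a) i" by (auto simp: ram_nth)
  finally show "fps_nth (ram N a) i = fps_nth (fps_compose a (fps_X ^ N)) i" by simp
qed

lemma ram_nth_0 [simp]: "fps_nth (ram N a) 0 = fps_nth a 0"
  by (simp add: ram_nth)

lemma fps_hom_ram: "N > 0 \<Longrightarrow> fps_hom (ram N :: 'a::idom fps \<Rightarrow> 'a fps)"
  unfolding fps_hom_def
  by (auto simp: ram_eq_compose fps_compose_add_distrib fps_compose_mult_distrib)

lemma ram_ram: "N > 0 \<Longrightarrow> M > 0 \<Longrightarrow> ram M (ram N a) = ram (M * N) a"
  by (rule fps_ext) (auto simp: ram_nth div_mult2_eq dvd_div_iff_mult mult.commute elim: dvd_mult_left dvd_mult_right)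

lemma map_coeff_comp: "map_coeff \<phi> (map_coeff \<psi> F) = map_coeff (\<phi> \<circ> \<psi>) F"
  by (rule fps_ext) simp

lemma ramify_eq:
  "N > 0 \<Longrightarrow> ramify N f = map_coeff (ram N \<circ> coeff_hom complex_of_real) f"
  by (rule fps_ext) (simp add: ramify_def ram_eq_compose coeff_hom_def)

section \<open>Convergence of formal roots\<close>

lemma sum_half_powers: "(\<Sum>i\<le>n. (1/2) ^ Suc i :: real) \<le> 1"
proof -
  have "(\<Sum>i\<le>n. (1/2) ^ Suc i :: real) = 1 - (1/2) ^ Suc n"
    by (induction n) auto
  then show ?thesis by (simp only:) simp
qed

lemma Suc_le_two_power: "real (Suc i) \<le> 2 ^ i"
  by (induction i) auto

text \<open>Convergence in a form that survives algebraic operations with explicit constants;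
  \<open>geom_bounded_iff_radius\<close> shows it to be a positive radius of convergence.\<close>

definition geom_bounded :: "'a::real_normed_field fps \<Rightarrow> bool" where
  "geom_bounded g \<longleftrightarrow> (\<exists>C R. \<forall>i. norm (fps_nth g i) \<le> C * R ^ i)"

definition geom_bounded2 :: "'a::real_normed_field fps fps \<Rightarrow> bool" where
  "geom_bounded2 F \<longleftrightarrow> (\<exists>C R. \<forall>i j. norm (fps_nth (fps_nth F j) i) \<le> C * R ^ (i + j))"

lemma geom_boundedE:
  assumes "geom_bounded g"
  obtains C R where "C \<ge> 1" "R \<ge> 1" "\<And>i. norm (fps_nth g i) \<le> C * R ^ i"
proof -
  obtain C R where b: "\<And>i. norm (fps_nth g i) \<le> C * R ^ i"
    using assms by (auto simp: geom_bounded_def)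
  have "norm (fps_nth g i) \<le> max 1 \<bar>C\<bar> * max 1 \<bar>R\<bar> ^ i" for i
  proof -
    have "norm (fps_nth g i) \<le> \<bar>C\<bar> * \<bar>R\<bar> ^ i"
      using b[of i] by (metis abs_ge_self abs_mult order_trans power_abs)
    also have "\<dots> \<le> max 1 \<bar>C\<bar> * max 1 \<bar>R\<bar> ^ i" by (intro mult_mono power_mono) auto
    finally show ?thesis .
  qed
  then show thesis using that[of "max 1 \<bar>C\<bar>" "max 1 \<bar>R\<bar>"] by auto
qed

lemma geom_bounded2E:
  assumes "geom_bounded2 F"
  obtains C R where "C \<ge> 1" "R \<ge> 1" "\<And>i j. norm (fps_nth (fps_nth F j) i) \<le> C * R ^ (i + j)"
proof -
  obtain C R where b: "\<And>i j. norm (fps_nth (fps_nth F j) i) \<le> C * R ^ (i + j)"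
    using assms by (auto simp: geom_bounded2_def)
  have "norm (fps_nth (fps_nth F j) i) \<le> max 1 \<bar>C\<bar> * max 1 \<bar>R\<bar> ^ (i + j)" for i j
  proof -
    have "norm (fps_nth (fps_nth F j) i) \<le> \<bar>C\<bar> * \<bar>R\<bar> ^ (i + j)"
      using b[of j i] by (metis abs_ge_self abs_mult order_trans power_abs)
    also have "\<dots> \<le> max 1 \<bar>C\<bar> * max 1 \<bar>R\<bar> ^ (i + j)" by (intro mult_mono power_mono) auto
    finally show ?thesis .
  qed
  then show thesis using that[of "max 1 \<bar>C\<bar>" "max 1 \<bar>R\<bar>"] by auto
qed

text \<open>Without a constant term only degrees i \<ge> 1 matter, and there the factor C is
  absorbed by C^i.\<close>

lemma geom_bounded_0E:
  assumes "geom_bounded g" "fps_nth g 0 = 0"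
  obtains A where "A \<ge> 1" "\<And>i. norm (fps_nth g i) \<le> A ^ i"
proof -
  obtain C R where CR: "C \<ge> 1" "R \<ge> 1" "\<And>i. norm (fps_nth g i) \<le> C * R ^ i"
    using geom_boundedE[OF assms(1)] by metis
  have "norm (fps_nth g i) \<le> (C * R) ^ i" for i
  proof (cases i)
    case 0 then show ?thesis using assms(2) by simp
  next
    case (Suc n)
    have "norm (fps_nth g i) \<le> C * R ^ i" by (rule CR)
    also have "\<dots> \<le> C ^ i * R ^ i"
      using CR(1,2) Suc by (intro mult_right_mono) (auto simp: self_le_power)
    finally show ?thesis by (simp add: power_mult_distrib)
  qed
  moreover have "C * R \<ge> 1" using CR(1,2) by (metis mult_mono' mult_1 zero_le_one)
  ultimately show thesis using that by blast
qed

lemma geom_boundedI_seq: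
  "(\<And>i. norm (fps_nth g i) \<le> C * R ^ i) \<Longrightarrow> geom_bounded g"
  by (auto simp: geom_bounded_def)

text \<open>The i + 1 terms of the Cauchy product cost a factor 2^i.\<close>

lemma geom_bounded_mult_bound:
  fixes a b :: "'a::real_normed_field fps"
  assumes "\<And>i. norm (fps_nth a i) \<le> C * R ^ i" "\<And>i. norm (fps_nth b i) \<le> D * S ^ i"
    and "R \<ge> 1" "S \<ge> 1" "C \<ge> 0" "D \<ge> 0"
  shows "norm (fps_nth (a * b) i) \<le> C * D * (2 * R * S) ^ i"
proof -
  have "norm (fps_nth (a * b) i) \<le> (\<Sum>k=0..i. norm (fps_nth a k) * norm (fps_nth b (i - k)))"
    unfolding fps_mult_nth by (rule order_trans[OF norm_sum]) (simp add: norm_mult)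
  also have "\<dots> \<le> (\<Sum>k=0..i. (C * R ^ i) * (D * S ^ i))"
  proof (intro sum_mono mult_mono)
    fix k assume k: "k \<in> {0..i}"
    show "norm (fps_nth a k) \<le> C * R ^ i"
      by (rule order_trans[OF assms(1)]) (use k assms in \<open>auto intro!: mult_left_mono power_increasing\<close>)
    show "norm (fps_nth b (i - k)) \<le> D * S ^ i"
      by (rule order_trans[OF assms(2)]) (use k assms in \<open>auto intro!: mult_left_mono power_increasing\<close>)
  qed (use assms in auto)
  also have "\<dots> = real (Suc i) * (C * D * (R * S) ^ i)" by (simp add: power_mult_distrib)
  also have "\<dots> \<le> 2 ^ i * (C * D * (R * S) ^ i)"
    using assms by (intro mult_right_mono Suc_le_two_power) auto
  finally show ?thesis by (simp add: power_mult_distrib mult_ac)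
qed

text \<open>The bound is independent of the exponent \<open>j\<close>, so the powers of
  \<open>g\<close> can be summed in \<open>fsubst_bound\<close>. It reproduces itself: the
  convolution with \<open>g\<close> starts in degree 1, and A^(l+1) (2A)^(n-l) is (2A)^(n+1) times
  2^-(l+1), whose sum over l is at most 1.\<close>

lemma geom_bounded_power_bound:
  fixes g :: "'a::real_normed_field fps"
  assumes g: "fps_nth g 0 = 0" and A: "A \<ge> 1" "\<And>i. norm (fps_nth g i) \<le> A ^ i"
  shows "norm (fps_nth (g ^ j) i) \<le> (2 * A) ^ i"
proof (induction j arbitrary: i)
  case 0
  show ?case using A(1) by (cases i) auto
next
  case (Suc j)
  show ?case
  proof (cases i)
    case 0
    then show ?thesis using g by simp
  next
    case (Suc n)
    have "norm (fps_nth (g ^ Suc j) i) \<le> (\<Sum>l=0..i. norm (fps_nth g l) * norm (fps_nth (g ^ j) (i - l)))"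
      unfolding power_Suc fps_mult_nth by (rule order_trans[OF norm_sum]) (simp add: norm_mult)
    also have "\<dots> = (\<Sum>l=0..n. norm (fps_nth g (Suc l)) * norm (fps_nth (g ^ j) (n - l)))"
      unfolding Suc by (subst sum.atLeast0_atMost_Suc_shift) (simp add: g)
    also have "\<dots> \<le> (\<Sum>l=0..n. A ^ Suc l * (2 * A) ^ (n - l))"
      by (intro sum_mono mult_mono A Suc.IH) (use A(1) in auto)
    also have "\<dots> = (\<Sum>l\<le>n. (2 * A) ^ i * (1/2) ^ Suc l)"
      unfolding atLeast0AtMost
    proof (rule sum.cong)
      fix l assume "l \<in> {..n}"
      then have "Suc l + (n - l) = i" using Suc by auto
      then have "(2 * A) ^ i * (1/2) ^ Suc l = (2 * A) ^ Suc l * (2 * A) ^ (n - l) * (1/2) ^ Suc l"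
        by (metis power_add)
      also have "\<dots> = (2 * A * (1/2)) ^ Suc l * (2 * A) ^ (n - l)"
        by (simp only: power_mult_distrib mult_ac)
      finally show "A ^ Suc l * (2 * A) ^ (n - l) = (2 * A) ^ i * (1/2) ^ Suc l" by simp
    qed simp
    also have "\<dots> = (2 * A) ^ i * (\<Sum>l\<le>n. (1/2) ^ Suc l)"
      by (rule sum_distrib_left[symmetric])
    also have "\<dots> \<le> (2 * A) ^ i * 1"
      using A(1) by (intro mult_left_mono sum_half_powers) auto
    finally show ?thesis by simp
  qed
qed

text \<open>The base is made up of R from R^j \<le> R^i, of 4RA from the product with the j-th power
  of \<open>g\<close>, and of 2 for the number i + 1 of summands.\<close>

lemma fsubst_bound:
  fixes F :: "'a::real_normed_field fps fps"
  assumes g: "fps_nth g 0 = 0" and A: "A \<ge> 1" "\<And>i. norm (fps_nth g i) \<le> A ^ i"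
    and F: "\<And>i j. norm (fps_nth (fps_nth F j) i) \<le> C * R ^ (i + j)" and CR: "C \<ge> 0" "R \<ge> 1"
  shows "norm (fps_nth (fsubst F g) i) \<le> C * (8 * R * R * A) ^ i"
proof -
  have *: "norm (fps_nth (fps_nth F j * g ^ j) i) \<le> C * (4 * R * R * A) ^ i" if "j \<le> i" for j
  proof -
    have "norm (fps_nth (fps_nth F j * g ^ j) i) \<le> C * R ^ j * 1 * (2 * R * (2 * A)) ^ i"
    proof (rule geom_bounded_mult_bound)
      show "norm (fps_nth (fps_nth F j) k) \<le> C * R ^ j * R ^ k" for k
        using F[of j k] by (simp add: power_add mult_ac)
      show "norm (fps_nth (g ^ j) k) \<le> 1 * (2 * A) ^ k" for k
        using geom_bounded_power_bound[OF g A] by simp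
    qed (use A CR in auto)
    also have "\<dots> \<le> C * R ^ i * 1 * (2 * R * (2 * A)) ^ i"
      using that A CR by (intro mult_right_mono mult_left_mono power_increasing) auto
    finally show ?thesis by (simp add: power_mult_distrib mult_ac)
  qed
  have "norm (fps_nth (fsubst F g) i) \<le> (\<Sum>j\<le>i. C * (4 * R * R * A) ^ i)"
    unfolding fsubst_def fps_nth_Abs_fps
    by (rule order_trans[OF norm_sum]) (rule sum_mono, use * in auto)
  also have "\<dots> = real (Suc i) * (C * (4 * R * R * A) ^ i)" by simp
  also have "\<dots> \<le> 2 ^ i * (C * (4 * R * R * A) ^ i)"
    using A CR by (intro mult_right_mono Suc_le_two_power) auto
  also have "\<dots> = C * (2 * (4 * R * R * A)) ^ i"
    by (simp only: power_mult_distrib[of 2 "4 * R * R * A" i] mult.left_commute)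
  finally show ?thesis by (simp add: mult.assoc)
qed

lemma geom_bounded_fsubst:
  assumes "geom_bounded2 F" "geom_bounded g" "fps_nth g 0 = 0"
  shows "geom_bounded (fsubst F g)"
proof -
  obtain A where A: "A \<ge> 1" "\<And>i. norm (fps_nth g i) \<le> A ^ i"
    using geom_bounded_0E[OF assms(2,3)] by metis
  obtain C R where F: "C \<ge> 1" "R \<ge> 1" "\<And>i j. norm (fps_nth (fps_nth F j) i) \<le> C * R ^ (i + j)"
    using geom_bounded2E[OF assms(1)] by metis
  show ?thesis
    by (rule geom_boundedI_seq, rule fsubst_bound[OF assms(3) A F(3)]) (use F in auto)
qed

text \<open>The coefficient of y^a is a substitution into a tail of \<open>F\<close>, and the shift
  to this tail costs only R^(a+1).\<close>

lemma geom_bounded2_fquot: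
  assumes "geom_bounded2 F" "geom_bounded g" "fps_nth g 0 = 0"
  shows "geom_bounded2 (fquot F g)"
proof -
  obtain A where A: "A \<ge> 1" "\<And>i. norm (fps_nth g i) \<le> A ^ i"
    using geom_bounded_0E[OF assms(2,3)] by metis
  obtain C R where F: "C \<ge> 1" "R \<ge> 1" "\<And>i j. norm (fps_nth (fps_nth F j) i) \<le> C * R ^ (i + j)"
    using geom_bounded2E[OF assms(1)] by metis
  have RA: "R \<le> 8 * R * R * A" "1 \<le> 8 * R * R * A"
  proof -
    have "1 \<le> R * A" using F A by (metis mult_mono' mult_1 zero_le_one)
    then have "1 * R \<le> (8 * R * A) * R" using F by (intro mult_right_mono) auto
    then show "R \<le> 8 * R * R * A" by (simp add: mult_ac)
    then show "1 \<le> 8 * R * R * A" using F by linarith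
  qed
  have "norm (fps_nth (fps_nth (fquot F g) a) i) \<le> (C * R) * (8 * R * R * A) ^ (i + a)" for a i
  proof -
    have "norm (fps_nth (fps_nth (fquot F g) a) i) \<le> (C * R ^ Suc a) * (8 * R * R * A) ^ i"
      unfolding fquot_def fps_nth_Abs_fps
    proof (rule fsubst_bound[OF assms(3) A])
      show "norm (fps_nth (fps_nth (fps_shift (Suc a) F) j) k) \<le> C * R ^ Suc a * R ^ (k + j)" for j k
        using F(3)[of "j + Suc a" k] by (simp add: power_add mult_ac)
    qed (use F in auto)
    also have "\<dots> = (C * R) * (R ^ a * (8 * R * R * A) ^ i)" by (simp add: mult_ac)
    also have "\<dots> \<le> (C * R) * ((8 * R * R * A) ^ a * (8 * R * R * A) ^ i)"
      using F A RA by (intro mult_left_mono mult_right_mono power_mono) auto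
    finally show ?thesis by (simp add: power_add mult_ac)
  qed
  then show ?thesis unfolding geom_bounded2_def by blast
qed

lemma geom_bounded2_map_ram:
  assumes "geom_bounded2 F" "N > 0"
  shows "geom_bounded2 (map_coeff (ram N) F)"
proof -
  obtain C R where F: "C \<ge> 1" "R \<ge> 1" "\<And>i j. norm (fps_nth (fps_nth F j) i) \<le> C * R ^ (i + j)"
    using geom_bounded2E[OF assms(1)] by metis
  have "norm (fps_nth (fps_nth (map_coeff (ram N) F) j) i) \<le> C * R ^ (i + j)" for i j
  proof (cases "N dvd i")
    case True
    have "norm (fps_nth (fps_nth (map_coeff (ram N) F) j) i) \<le> C * R ^ (i div N + j)"
      using True F(3) by (simp add: ram_nth)
    also have "\<dots> \<le> C * R ^ (i + j)"
      using F by (intro mult_left_mono power_increasing) auto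
    finally show ?thesis .
  qed (use F in \<open>auto simp: ram_nth\<close>)
  then show ?thesis unfolding geom_bounded2_def by blast
qed

section \<open>Convergent solution of an equation of order 1\<close>

definition pnorm :: "nat \<Rightarrow> real \<Rightarrow> 'a::real_normed_field fps \<Rightarrow> real" where
  "pnorm n \<rho> g = (\<Sum>k\<le>n. norm (fps_nth g k) * \<rho> ^ k)"

lemma pnorm_mult:
  assumes "\<rho> \<ge> 0"
  shows "pnorm n \<rho> (a * b) \<le> pnorm n \<rho> a * pnorm n \<rho> b"
proof -
  let ?f = "\<lambda>i j. (norm (fps_nth a i) * \<rho> ^ i) * (norm (fps_nth b j) * \<rho> ^ j)"
  have "pnorm n \<rho> (a * b) \<le> (\<Sum>k\<le>n. \<Sum>i\<le>k. ?f i (k - i))"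
    unfolding pnorm_def
  proof (rule sum_mono)
    fix k assume "k \<in> {..n}"
    have "norm (fps_nth (a * b) k) * \<rho> ^ k \<le>
        (\<Sum>i\<le>k. norm (fps_nth a i) * norm (fps_nth b (k - i))) * \<rho> ^ k"
      unfolding fps_mult_nth atLeast0AtMost
      using assms by (intro mult_right_mono order_trans[OF norm_sum]) (auto simp: norm_mult)
    also have "\<dots> = (\<Sum>i\<le>k. ?f i (k - i))"
      unfolding sum_distrib_right
    proof (rule sum.cong)
      fix i assume "i \<in> {..k}"
      then have "\<rho> ^ k = \<rho> ^ i * \<rho> ^ (k - i)" by (simp flip: power_add)
      then show "norm (fps_nth a i) * norm (fps_nth b (k - i)) * \<rho> ^ k = ?f i (k - i)" by simp
    qed simp
    finally show "norm (fps_nth (a * b) k) * \<rho> ^ k \<le> (\<Sum>i\<le>k. ?f i (k - i))" .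
  qed
  also have "\<dots> = (\<Sum>(i, j)\<in>{(i, j). i + j \<le> n}. ?f i j)"
    by (rule sum.triangle_reindex_eq[symmetric])
  also have "\<dots> \<le> (\<Sum>(i, j)\<in>{..n} \<times> {..n}. ?f i j)"
    by (rule sum_mono2) (use assms in auto)
  also have "\<dots> = pnorm n \<rho> a * pnorm n \<rho> b"
    unfolding pnorm_def sum_product by (rule sum.cartesian_product[symmetric])
  finally show ?thesis .
qed

lemma pnorm_nonneg: "\<rho> \<ge> 0 \<Longrightarrow> pnorm n \<rho> a \<ge> 0"
  unfolding pnorm_def by (rule sum_nonneg) auto

lemma pnorm_power:
  assumes "\<rho> \<ge> 0" "pnorm n \<rho> a \<le> s"
  shows "pnorm n \<rho> (w * a ^ j) \<le> pnorm n \<rho> w * s ^ j"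
proof (induction j)
  case (Suc j)
  have "pnorm n \<rho> ((w * a ^ j) * a) \<le> pnorm n \<rho> (w * a ^ j) * pnorm n \<rho> a"
    by (rule pnorm_mult[OF assms(1)])
  also have "\<dots> \<le> pnorm n \<rho> w * s ^ j * s"
    using assms Suc order_trans[OF pnorm_nonneg[OF assms(1)] assms(2)]
    by (intro mult_mono) (auto intro!: mult_nonneg_nonneg pnorm_nonneg)
  finally show ?case by (simp add: mult_ac)
qed simp

text \<open>Truncation at degree n keeps all sums finite. Bounds that do not depend on n will take
  the place of completeness in a Banach algebra of series.\<close>

lemma pnorm_fsubst:
  assumes "\<rho> \<ge> 0" "pnorm n \<rho> g \<le> s" "fps_nth g 0 = 0"
  shows "pnorm n \<rho> (fsubst F g) \<le> (\<Sum>j\<le>n. pnorm n \<rho> (fps_nth F j) * s ^ j)"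
proof -
  have "pnorm n \<rho> (fsubst F g) \<le> (\<Sum>k\<le>n. \<Sum>j\<le>n. norm (fps_nth (fps_nth F j * g ^ j) k) * \<rho> ^ k)"
    unfolding pnorm_def
  proof (rule sum_mono)
    fix k assume "k \<in> {..n}"
    then show "norm (fps_nth (fsubst F g) k) * \<rho> ^ k \<le>
        (\<Sum>j\<le>n. norm (fps_nth (fps_nth F j * g ^ j) k) * \<rho> ^ k)"
      unfolding sum_distrib_right[symmetric]
      using assms(1) by (simp add: fsubst_nth_pad[OF assms(3), of k n] mult_right_mono norm_sum)
  qed
  also have "\<dots> = (\<Sum>j\<le>n. pnorm n \<rho> (fps_nth F j * g ^ j))"
    unfolding pnorm_def by (rule sum.swap)
  also have "\<dots> \<le> (\<Sum>j\<le>n. pnorm n \<rho> (fps_nth F j) * s ^ j)"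
    by (intro sum_mono pnorm_power assms)
  finally show ?thesis .
qed

text \<open>A(h') - A(h) = (h' - h) e, where e(0) is the y-derivative of A at the origin, hence 0.
  So A gains one degree of agreement: it is a contraction for the t-adic metric.\<close>

lemma fsubst_agree:
  fixes A :: "'a::comm_ring_1 fps fps"
  assumes "fps_nth (fps_nth A 1) 0 = 0" "fps_nth h 0 = 0" "fps_nth h' 0 = 0"
    and "\<And>l. l < k \<Longrightarrow> fps_nth h l = fps_nth h' l" "l \<le> k"
  shows "fps_nth (fsubst A h) l = fps_nth (fsubst A h') l"
proof -
  let ?e = "fsubst (fquot A h) h'"
  have "fsubst A h' = fsubst (fps_const (fsubst A h) + (fps_X - fps_const h) * fquot A h) h'"
    using fsubst_division[OF assms(2), of A] by simp
  also have "\<dots> = fsubst A h + (h' - h) * ?e"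
    by (simp add: fsubst_add fsubst_mult assms)
  finally have eq: "fsubst A h' = fsubst A h + (h' - h) * ?e" .
  have e0: "fps_nth ?e 0 = 0"
    using assms by (simp add: fsubst_nth_0 fquot_def)
  have "fps_nth ((h' - h) * ?e) l = (\<Sum>i=0..l. fps_nth (h' - h) i * fps_nth ?e (l - i))"
    by (rule fps_mult_nth)
  also have "\<dots> = 0"
  proof (rule sum.neutral, intro ballI)
    fix i assume "i \<in> {0..l}"
    then show "fps_nth (h' - h) i * fps_nth ?e (l - i) = 0"
      using assms(4)[of i] assms(5) e0 by (cases "i < k") auto
  qed
  finally show ?thesis using eq by simp
qed

text \<open>The coefficient of degree k is stationary from the iterate k + 1 on, so the diagonal of
  the iterates is their t-adic limit.\<close>

lemma contraction_fixpoint: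
  fixes A :: "'a::comm_ring_1 fps fps"
  assumes A: "fps_nth (fps_nth A 0) 0 = 0" "fps_nth (fps_nth A 1) 0 = 0"
  defines "it \<equiv> \<lambda>n. ((\<lambda>h. fsubst A h) ^^ n) 0"
  defines "h \<equiv> Abs_fps (\<lambda>k. fps_nth (it (Suc k)) k)"
  shows "fsubst A h = h" "fps_nth h 0 = 0"
proof -
  have it0: "fps_nth (it n) 0 = 0" for n
    by (induction n) (auto simp: it_def fsubst_nth_0 A)
  have itS: "it (Suc n) = fsubst A (it n)" for n by (simp add: it_def)
  have step: "fps_nth (it n) l = fps_nth (it (Suc n)) l" if "l < n" for n l
    using that
  proof (induction n arbitrary: l)
    case (Suc n)
    have eq: "it (Suc (Suc n)) = fsubst A (it (Suc n))" "it (Suc n) = fsubst A (it n)" by (rule itS)+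
    have "fps_nth (fsubst A (it n)) l = fps_nth (fsubst A (it (Suc n))) l"
      by (rule fsubst_agree[OF A(2) it0 it0, of n]) (use Suc in \<open>auto simp: itS[symmetric]\<close>)
    then show ?case unfolding eq(1) by (simp only: eq(2)[symmetric])
  qed simp
  have agree: "fps_nth (it n) l = fps_nth h l" if "l < n" for n l
    using that
  proof (induction n)
    case (Suc n)
    then show ?case using step[of l n] by (cases "l = n") (auto simp: h_def)
  qed simp
  show h0: "fps_nth h 0 = 0" using it0 by (simp add: h_def)
  show "fsubst A h = h"
  proof (rule fps_ext)
    fix k
    have "fps_nth (fsubst A h) k = fps_nth (fsubst A (it k)) k"
      by (rule fsubst_agree[OF A(2) h0 it0, of k]) (auto simp: agree)
    then show "fps_nth (fsubst A h) k = fps_nth h k"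
      using agree[of k "Suc k"] by (simp add: itS)
  qed
qed

text \<open>Analytic implicit function theorem. With c the y-derivative of H at the origin, the
  roots of H are the fixed points of A = y - H/c. The formal fixed point converges because all
  iterates stay in one ball \<open>pnorm n \<rho> g \<le> s\<close>, with \<rho> and s independent
  of n, so its k-th coefficient is at most s / \<rho>^k.\<close>

lemma order1_root:
  fixes H :: "'a::real_normed_field fps fps"
  assumes "geom_bounded2 H" "fps_nth (fps_nth H 0) 0 = 0" "fps_nth (fps_nth H 1) 0 \<noteq> 0"
  shows "\<exists>h. geom_bounded h \<and> fps_nth h 0 = 0 \<and> fsubst H h = 0"
proof -
  define c where "c = fps_nth (fps_nth H 1) 0"
  define A where "A = fps_X - fps_const (fps_const (1 / c)) * H"
  have c: "c \<noteq> 0" using assms(3) by (simp add: c_def)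
  have A0: "fps_nth (fps_nth A 0) 0 = 0" "fps_nth (fps_nth A 1) 0 = 0"
    using assms c by (auto simp: A_def c_def)
  obtain C' R where CR: "C' \<ge> 1" "R \<ge> 1" "\<And>i j. norm (fps_nth (fps_nth H j) i) \<le> C' * R ^ (i + j)"
    using geom_bounded2E[OF assms(1)] by metis
  define C where "C = 1 + C' / norm c"
  have C: "C \<ge> 1" using CR c by (auto simp: C_def)
  have bA: "norm (fps_nth (fps_nth A j) i) \<le> C * R ^ (i + j)" for i j
  proof -
    have "norm (fps_nth (fps_nth A j) i) \<le> norm (fps_nth (fps_nth fps_X j) i :: 'a) + norm (1 / c * fps_nth (fps_nth H j) i)"
      by (simp add: A_def norm_triangle_ineq4 del: times_divide_eq_left)
    also have "\<dots> \<le> 1 * 1 + (1 / norm c) * (C' * R ^ (i + j))"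
      by (rule add_mono) (auto simp: fps_X_def norm_divide norm_mult divide_right_mono CR(3))
    also have "\<dots> \<le> 1 * R ^ (i + j) + (1 / norm c) * (C' * R ^ (i + j))"
      using CR by (intro add_mono mult_left_mono) auto
    finally show ?thesis by (simp add: C_def algebra_simps)
  qed
  \<comment> \<open>With R \<rho> = z^2 and R s = z, every part of A(g) is of size O(z^2): the terms
    of y-degree below 2 carry a factor t, the others at least y^2. The total is at most 32 C z^2,
    and z is chosen to make this equal to s = z / R.\<close>
  define z where "z = 1 / (32 * C * R)"
  have z: "0 < z" "z \<le> 1/2" "z * (32 * C * R) = 1" "z \<le> 1"
  proof -
    have "32 * C * R \<ge> 32" using C CR by (metis mult.assoc mult_1_right mult_left_mono mult_mono' zero_le_one zero_le_numeral)
    then show "0 < z" "z \<le> 1/2" "z * (32 * C * R) = 1" "z \<le> 1" by (auto simp: z_def field_simps)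
  qed
  define \<rho> where "\<rho> = z\<^sup>2 / R"
  define s where "s = z / R"
  have \<rho>: "\<rho> > 0" using z CR by (auto simp: \<rho>_def)
  have R\<rho>: "R * \<rho> = z\<^sup>2" "R * s = z" using CR by (auto simp: \<rho>_def s_def)
  have z2: "z\<^sup>2 \<le> 1/2" "z\<^sup>2 \<le> 1" "0 \<le> z\<^sup>2"
  proof -
    have "z\<^sup>2 \<le> z" using z by (simp add: power2_eq_square mult_left_le)
    then show "z\<^sup>2 \<le> 1/2" "z\<^sup>2 \<le> 1" "0 \<le> z\<^sup>2" using z by auto
  qed
  have pA: "pnorm n \<rho> (fps_nth A j) \<le> 4 * (C * R ^ j) * (if j < 2 then z\<^sup>2 else 1)" for n j
  proof -
    have "norm (fps_nth (fps_nth A j) i) * \<rho> ^ i \<le> 4 * (C * R ^ j) * (if j < 2 then z\<^sup>2 else 1) * (1/2) ^ Suc i" for i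
    proof -
      have 1: "norm (fps_nth (fps_nth A j) i) * \<rho> ^ i \<le> C * R ^ j * (z\<^sup>2) ^ i"
      proof -
        have "norm (fps_nth (fps_nth A j) i) * \<rho> ^ i \<le> C * R ^ (i + j) * \<rho> ^ i"
          using bA[where i = i and j = j] \<rho> by (intro mult_right_mono) auto
        also have "\<dots> = C * R ^ j * (R * \<rho>) ^ i" by (simp add: power_add power_mult_distrib)
        finally show ?thesis by (simp add: R\<rho>)
      qed
      have 2: "(z\<^sup>2) ^ i \<le> (1/2) ^ i" by (rule power_mono) (use z2 in auto)
      show ?thesis
      proof (cases "j < 2")
        case True
        show ?thesis
        proof (cases i)
          case 0
          have "fps_nth (fps_nth A j) 0 = 0" using A0 True by (auto simp: less_2_cases_iff)
          then show ?thesis using 0 C CR z2 True by auto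
        next
          case (Suc m)
          have "(z\<^sup>2) ^ i \<le> z\<^sup>2 * (1/2) ^ m"
            unfolding Suc power_Suc by (intro mult_left_mono power_mono) (use z2 in auto)
          also have "\<dots> = z\<^sup>2 * (4 * (1/2) ^ Suc i)" using Suc by simp
          finally have "C * R ^ j * (z\<^sup>2) ^ i \<le> C * R ^ j * (z\<^sup>2 * (4 * (1/2) ^ Suc i))"
            using C CR by (intro mult_left_mono) auto
          then show ?thesis using 1 True by (simp add: mult_ac)
        qed
      next
        case False
        have "C * R ^ j * (z\<^sup>2) ^ i \<le> C * R ^ j * (4 * (1/2) ^ Suc i)"
          using C CR 2 by (intro mult_left_mono order_trans[OF 2]) auto
        then show ?thesis using 1 False by (simp add: mult_ac)
      qed
    qed
    then have "pnorm n \<rho> (fps_nth A j) \<le> (\<Sum>i\<le>n. 4 * (C * R ^ j) * (if j < 2 then z\<^sup>2 else 1) * (1/2) ^ Suc i)"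
      unfolding pnorm_def by (intro sum_mono)
    also have "\<dots> = 4 * (C * R ^ j) * (if j < 2 then z\<^sup>2 else 1) * (\<Sum>i\<le>n. (1/2) ^ Suc i)"
      by (rule sum_distrib_left[symmetric])
    also have "\<dots> \<le> 4 * (C * R ^ j) * (if j < 2 then z\<^sup>2 else 1) * 1"
      using C CR z2 by (intro mult_left_mono sum_half_powers) auto
    finally show ?thesis by simp
  qed
  have keep: "pnorm n \<rho> (fsubst A g) \<le> s" if "pnorm n \<rho> g \<le> s" "fps_nth g 0 = 0" for n g
  proof -
    have "pnorm n \<rho> (fsubst A g) \<le> (\<Sum>j\<le>n. pnorm n \<rho> (fps_nth A j) * s ^ j)"
      using \<rho> that by (intro pnorm_fsubst) auto
    also have "\<dots> \<le> (\<Sum>j\<le>n. 32 * C * z\<^sup>2 * (1/2) ^ Suc j)"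
    proof (rule sum_mono)
      fix j
      have "(if j < 2 then z\<^sup>2 else 1) * z ^ j \<le> 8 * z\<^sup>2 * (1/2) ^ Suc j"
      proof (cases "j < 2")
        case True
        then have "j = 0 \<or> j = 1" by auto
        then show ?thesis
        proof
          assume "j = 1"
          have "z * z\<^sup>2 \<le> 1 * z\<^sup>2" using z by (intro mult_right_mono) auto
          also have "\<dots> \<le> 2 * z\<^sup>2" using z2 by simp
          finally show ?thesis using \<open>j = 1\<close> by (simp add: mult_ac)
        qed (use z2 in auto)
      next
        case False
        then obtain m where j: "j = m + 2" by (metis add.commute le_Suc_ex linorder_not_less)
        have "z ^ j = z\<^sup>2 * z ^ m" by (simp add: j power_add power2_eq_square mult_ac)
        also have "\<dots> \<le> z\<^sup>2 * (1/2) ^ m" by (intro mult_left_mono power_mono) (use z in auto)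
        finally show ?thesis using False by (simp add: j)
      qed
      then have "4 * C * ((if j < 2 then z\<^sup>2 else 1) * z ^ j) \<le> 4 * C * (8 * z\<^sup>2 * (1/2) ^ Suc j)"
        using C by (intro mult_left_mono) auto
      moreover have "pnorm n \<rho> (fps_nth A j) * s ^ j \<le> 4 * (C * R ^ j) * (if j < 2 then z\<^sup>2 else 1) * s ^ j"
        using pA[of n j] z CR by (intro mult_right_mono) (auto simp: s_def)
      moreover have "32 * C * z\<^sup>2 * (1/2) ^ Suc j = 4 * C * (8 * z\<^sup>2 * (1/2) ^ Suc j)" by simp
      moreover have "4 * (C * R ^ j) * (if j < 2 then z\<^sup>2 else 1) * s ^ j = 4 * C * ((if j < 2 then z\<^sup>2 else 1) * z ^ j)"
        by (simp flip: R\<rho>(2) add: power_mult_distrib mult_ac)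
      ultimately show "pnorm n \<rho> (fps_nth A j) * s ^ j \<le> 32 * C * z\<^sup>2 * (1/2) ^ Suc j" by linarith
    qed
    also have "\<dots> = 32 * C * z\<^sup>2 * (\<Sum>j\<le>n. (1/2) ^ Suc j)" by (rule sum_distrib_left[symmetric])
    also have "\<dots> \<le> 32 * C * z\<^sup>2 * 1" using C by (intro mult_left_mono sum_half_powers) auto
    also have "\<dots> = s" using z(3) CR by (simp add: s_def power2_eq_square field_simps)
    finally show ?thesis .
  qed
  define it where "it = (\<lambda>n. ((\<lambda>h. fsubst A h) ^^ n) 0)"
  define h where "h = Abs_fps (\<lambda>k. fps_nth (it (Suc k)) k)"
  have fp: "fsubst A h = h" "fps_nth h 0 = 0"
    using contraction_fixpoint[OF A0] unfolding h_def it_def by auto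
  have it: "pnorm n \<rho> (it m) \<le> s \<and> fps_nth (it m) 0 = 0" for n m
  proof (induction m)
    case 0
    show ?case using z CR by (simp add: it_def pnorm_def s_def)
  next
    case (Suc m)
    then show ?case using keep[of n "it m"] by (simp add: it_def fsubst_nth_0 A0)
  qed
  have "geom_bounded h"
  proof (rule geom_boundedI_seq)
    fix k
    have "norm (fps_nth h k) * \<rho> ^ k \<le> pnorm k \<rho> (it (Suc k))"
      unfolding pnorm_def h_def fps_nth_Abs_fps
      by (rule member_le_sum[of k "{..k}" "\<lambda>i. norm (fps_nth (it (Suc k)) i) * \<rho> ^ i"]) (use \<rho> in auto)
    also have "\<dots> \<le> s" using it by blast
    finally show "norm (fps_nth h k) \<le> s * (1 / \<rho>) ^ k"
      using \<rho> by (simp add: power_divide field_simps)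
  qed
  moreover have "fsubst H h = 0"
  proof -
    have "h - fps_const (1 / c) * fsubst H h = h"
      using fp by (simp add: A_def fsubst_diff fsubst_mult)
    then have "fps_const (1 / c) * fsubst H h = 0" by simp
    then show ?thesis using c by simp
  qed
  ultimately show ?thesis using fp(2) by blast
qed

section \<open>The Newton-Puiseux factorization\<close>

lemma geom_bounded_add:
  assumes "geom_bounded g" "geom_bounded h"
  shows "geom_bounded (g + h)"
proof -
  obtain C R where g: "C \<ge> 1" "R \<ge> 1" "\<And>i. norm (fps_nth g i) \<le> C * R ^ i"
    using geom_boundedE[OF assms(1)] by metis
  obtain D S where h: "D \<ge> 1" "S \<ge> 1" "\<And>i. norm (fps_nth h i) \<le> D * S ^ i"
    using geom_boundedE[OF assms(2)] by metis
  show ?thesis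
  proof (rule geom_boundedI_seq)
    fix i
    have "norm (fps_nth (g + h) i) \<le> C * R ^ i + D * S ^ i"
      unfolding fps_add_nth by (rule norm_triangle_le[OF add_mono[OF g(3) h(3)]])
    also have "\<dots> \<le> C * (R * S) ^ i + D * (R * S) ^ i"
    proof (intro add_mono mult_left_mono power_mono)
      show "R \<le> R * S" "S \<le> R * S"
        using g h mult_left_mono[of 1 S R] mult_right_mono[of 1 R S] by auto
    qed (use g h in auto)
    finally show "norm (fps_nth (g + h) i) \<le> (C + D) * (R * S) ^ i" by (simp add: algebra_simps)
  qed
qed

lemma geom_bounded_mult:
  assumes "geom_bounded g" "geom_bounded h"
  shows "geom_bounded (g * h)"
proof -
  obtain C R where g: "C \<ge> 1" "R \<ge> 1" "\<And>i. norm (fps_nth g i) \<le> C * R ^ i"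
    using geom_boundedE[OF assms(1)] by metis
  obtain D S where h: "D \<ge> 1" "S \<ge> 1" "\<And>i. norm (fps_nth h i) \<le> D * S ^ i"
    using geom_boundedE[OF assms(2)] by metis
  show ?thesis
    by (rule geom_boundedI_seq, rule geom_bounded_mult_bound[OF g(3) h(3)]) (use g h in auto)
qed

lemma geom_bounded_X_power: "geom_bounded (fps_X ^ p)"
  by (rule geom_boundedI_seq[of _ 1 1]) (auto simp: fps_X_power_nth)

lemma geom_bounded_const: "geom_bounded (fps_const c)"
  by (rule geom_boundedI_seq[of _ "norm c" 1]) (auto simp: fps_nth_fps_const)

lemma geom_bounded_0: "geom_bounded 0"
  by (rule geom_boundedI_seq[of _ 0 1]) auto

lemma geom_bounded_ram:
  assumes "geom_bounded g" "N > 0"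
  shows "geom_bounded (ram N g)"
proof -
  obtain C R where g: "C \<ge> 1" "R \<ge> 1" "\<And>i. norm (fps_nth g i) \<le> C * R ^ i"
    using geom_boundedE[OF assms(1)] by metis
  show ?thesis
  proof (rule geom_boundedI_seq)
    fix i
    show "norm (fps_nth (ram N g) i) \<le> C * R ^ i"
    proof (cases "N dvd i")
      case True
      have "norm (fps_nth (ram N g) i) \<le> C * R ^ (i div N)" using True g by (simp add: ram_nth)
      also have "\<dots> \<le> C * R ^ i" using g by (intro mult_left_mono power_increasing) auto
      finally show ?thesis .
    qed (use g in \<open>auto simp: ram_nth\<close>)
  qed
qed

section \<open>Taylor shift and rescaling in y\<close>

definition hasse :: "nat \<Rightarrow> 'a::comm_ring_1 fps fps \<Rightarrow> 'a fps fps" where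
  "hasse n F = Abs_fps (\<lambda>j. of_nat ((j + n) choose n) * fps_nth F (j + n))"

text \<open>F(\<psi> + y) by Taylor's formula; \<open>hasse n F\<close> is the divided derivative
  (1/n!) d^n F / dy^n.\<close>

definition fshift :: "'a::comm_ring_1 fps \<Rightarrow> 'a fps fps \<Rightarrow> 'a fps fps" where
  "fshift \<psi> F = Abs_fps (\<lambda>n. fsubst (hasse n F) \<psi>)"

text \<open>The substitution y -> t^p y.\<close>

definition fscale :: "nat \<Rightarrow> 'a::comm_ring_1 fps fps \<Rightarrow> 'a fps fps" where
  "fscale p F = Abs_fps (\<lambda>n. fps_X ^ (p * n) * fps_nth F n)"

text \<open>Binomial theorem. In degree k the terms with h^n \<psi>^m vanish once n or m exceeds k,
  so the square n, m \<le> k may be replaced by the triangle n + m \<le> 2k, which is then summed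
  along its diagonals j = n + m.\<close>

lemma fsubst_fshift:
  fixes F :: "'a::comm_ring_1 fps fps"
  assumes \<psi>: "fps_nth \<psi> 0 = 0" and h: "fps_nth h 0 = 0"
  shows "fsubst (fshift \<psi> F) h = fsubst F (\<psi> + h)"
proof (rule fps_ext)
  fix k
  define T where "T n m = fps_nth (fps_nth F (n + m) * (of_nat ((n + m) choose n) * h ^ n * \<psi> ^ m)) k" for n m
  have T0: "T n m = 0" if "n > k \<or> m > k" for n m
  proof (cases "n > k")
    case True
    have "T n m = fps_nth ((fps_nth F (n + m) * of_nat ((n + m) choose n) * \<psi> ^ m) * h ^ n) k"
      by (simp add: T_def mult_ac)
    then show ?thesis using True fps_power_nth_eq_0(1)[OF h] by simp
  next
    case False
    then have "m > k" using that by auto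
    have "T n m = fps_nth ((fps_nth F (n + m) * of_nat ((n + m) choose n) * h ^ n) * \<psi> ^ m) k"
      by (simp add: T_def mult_ac)
    then show ?thesis using \<open>m > k\<close> fps_power_nth_eq_0(1)[OF \<psi>] by simp
  qed
  have "fps_nth (fsubst (fshift \<psi> F) h) k = (\<Sum>n\<le>k. fps_nth (h ^ n * fsubst (hasse n F) \<psi>) k)"
    unfolding fsubst_nth_pad[OF h order_refl] by (simp add: fshift_def mult_ac)
  also have "\<dots> = (\<Sum>n\<le>k. \<Sum>m\<le>k. T n m)"
    unfolding fsubst_mult_nth[OF \<psi> order_refl]
    by (simp add: hasse_def T_def mult_ac add_ac)
  also have "\<dots> = (\<Sum>(n, m)\<in>{..k} \<times> {..k}. T n m)" by (rule sum.cartesian_product)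
  also have "\<dots> = (\<Sum>(n, m)\<in>{(n, m). n + m \<le> 2 * k}. T n m)"
  proof (rule sum.mono_neutral_left)
    show "finite {(n, m). n + m \<le> 2 * k}"
      by (rule finite_subset[of _ "{..2*k} \<times> {..2*k}"]) auto
  qed (auto intro: T0)
  also have "\<dots> = (\<Sum>j\<le>2 * k. \<Sum>n\<le>j. T n (j - n))" by (rule sum.triangle_reindex_eq)
  also have "\<dots> = (\<Sum>j\<le>2 * k. fps_nth (fps_nth F j * (\<psi> + h) ^ j) k)"
  proof (rule sum.cong)
    fix j
    have "(\<Sum>n\<le>j. T n (j - n)) = (\<Sum>n\<le>j. fps_nth (fps_nth F j * (of_nat (j choose n) * h ^ n * \<psi> ^ (j - n))) k)"
      by (rule sum.cong) (auto simp: T_def)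
    also have "\<dots> = fps_nth (fps_nth F j * (h + \<psi>) ^ j) k"
      by (simp add: binomial_ring sum_distrib_left fps_sum_nth)
    finally show "(\<Sum>n\<le>j. T n (j - n)) = fps_nth (fps_nth F j * (\<psi> + h) ^ j) k" by (simp add: add.commute)
  qed simp
  also have "\<dots> = fps_nth (fsubst F (\<psi> + h)) k"
    by (rule fsubst_nth_pad[symmetric]) (use assms in auto)
  finally show "fps_nth (fsubst (fshift \<psi> F) h) k = fps_nth (fsubst F (\<psi> + h)) k" .
qed

lemma fsubst_fscale: "fsubst (fscale p F) g = fsubst F (fps_X ^ p * g)"
  unfolding fsubst_def fscale_def
  by (simp add: power_mult_distrib mult.assoc flip: power_mult) (simp add: mult.commute mult.left_commute)

lemma fps_hom_of_nat: "fps_hom \<phi> \<Longrightarrow> \<phi> (of_nat n) = of_nat n"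
proof (induction n)
  case (Suc n)
  then show ?case using hom_simps(1,2)[OF Suc.prems] by simp
qed (simp add: hom_0)

lemma ram_X: "N > 0 \<Longrightarrow> ram N fps_X = fps_X ^ N"
  by (simp add: ram_eq_compose fps_X_fps_compose_startby0)

lemma map_ram_fshift:
  fixes F :: "'a::idom fps fps"
  assumes "M > 0" "fps_nth \<psi> 0 = 0"
  shows "map_coeff (ram M) (fshift \<psi> F) = fshift (ram M \<psi>) (map_coeff (ram M) F)"
proof (rule fps_ext)
  fix n
  note h = fps_hom_ram[OF assms(1)]
  have "map_coeff (ram M) (hasse n F) = hasse n (map_coeff (ram M) F)"
    by (rule fps_ext) (simp add: hasse_def hom_simps[OF h] fps_hom_of_nat[OF h])
  then show "fps_nth (map_coeff (ram M) (fshift \<psi> F)) n = fps_nth (fshift (ram M \<psi>) (map_coeff (ram M) F)) n"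
    using fsubst_hom[OF h assms(2), of "hasse n F"] assms(2) by (simp add: fshift_def)
qed

lemma map_ram_fscale:
  fixes F :: "'a::idom fps fps"
  assumes "M > 0"
  shows "map_coeff (ram M) (fscale p F) = fscale (M * p) (map_coeff (ram M) F)"
proof (rule fps_ext)
  fix n
  note h = fps_hom_ram[OF assms, where 'a = 'a]
  have "ram M (fps_X ^ (p * n)) = (fps_X ^ (M * p * n) :: 'a fps)"
    unfolding hom_power[OF h] ram_X[OF assms] by (simp only: power_mult[symmetric] mult.assoc)
  then show "fps_nth (map_coeff (ram M) (fscale p F)) n = fps_nth (fscale (M * p) (map_coeff (ram M) F)) n"
    by (simp add: fscale_def hom_simps[OF h])
qed

lemma hasse_bound:
  fixes F :: "'a::real_normed_field fps fps"
  assumes "\<And>i j. norm (fps_nth (fps_nth F j) i) \<le> C * R ^ (i + j)" "C \<ge> 0" "R \<ge> 1"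
  shows "norm (fps_nth (fps_nth (hasse n F) j) i) \<le> (C * (2 * R) ^ n) * (2 * R) ^ (i + j)"
proof -
  have "fps_nth (of_nat c * a) i = of_nat c * fps_nth a i" for c and a :: "'a fps"
    by (metis fps_mult_left_const_nth fps_of_nat)
  then have "norm (fps_nth (fps_nth (hasse n F) j) i) = real ((j + n) choose n) * norm (fps_nth (fps_nth F (j + n)) i)"
    by (simp add: hasse_def norm_mult)
  also have "\<dots> \<le> 2 ^ (j + n) * (C * R ^ (i + (j + n)))"
  proof (intro mult_mono assms)
    have "((j + n) choose n) \<le> (2::nat) ^ (j + n)" by (rule binomial_le_pow2)
    then show "real ((j + n) choose n) \<le> 2 ^ (j + n)" by (metis of_nat_le_iff of_nat_numeral of_nat_power)
  qed auto
  also have "\<dots> \<le> 2 ^ (i + (j + n)) * (C * R ^ (i + (j + n)))"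
    using assms by (intro mult_right_mono power_increasing) auto
  also have "\<dots> = (C * (2 * R) ^ n) * (2 * R) ^ (i + j)"
    by (simp add: power_add power_mult_distrib mult_ac)
  finally show ?thesis .
qed

lemma geom_bounded2_hasse:
  fixes F :: "'a::real_normed_field fps fps"
  assumes "geom_bounded2 F"
  shows "geom_bounded2 (hasse n F)"
proof -
  obtain C R where F: "C \<ge> 1" "R \<ge> 1" "\<And>i j. norm (fps_nth (fps_nth F j) i) \<le> C * R ^ (i + j)"
    using geom_bounded2E[OF assms(1)] by metis
  show ?thesis unfolding geom_bounded2_def
    using hasse_bound[OF F(3), of n] F by (meson order_trans zero_le_one)
qed

lemma geom_bounded2_fshift:
  fixes F :: "'a::real_normed_field fps fps"
  assumes "geom_bounded2 F" "geom_bounded \<psi>" "fps_nth \<psi> 0 = 0"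
  shows "geom_bounded2 (fshift \<psi> F)"
proof -
  obtain C R where F: "C \<ge> 1" "R \<ge> 1" "\<And>i j. norm (fps_nth (fps_nth F j) i) \<le> C * R ^ (i + j)"
    using geom_bounded2E[OF assms(1)] by metis
  obtain A where A: "A \<ge> 1" "\<And>i. norm (fps_nth \<psi> i) \<le> A ^ i"
    using geom_bounded_0E[OF assms(2,3)] by metis
  define K where "K = 8 * (2 * R) * (2 * R) * A"
  have K: "2 * R \<le> K" "1 \<le> K"
  proof -
    have "1 \<le> R * A" using F A by (metis mult_mono' mult_1 zero_le_one)
    then have "1 * (2 * R) \<le> (16 * (R * A)) * (2 * R)" using F by (intro mult_right_mono) auto
    then show "2 * R \<le> K" by (simp add: K_def mult_ac)
    then show "1 \<le> K" using F by linarith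
  qed
  have "norm (fps_nth (fps_nth (fshift \<psi> F) n) i) \<le> C * K ^ (i + n)" for n i
  proof -
    have "norm (fps_nth (fps_nth (fshift \<psi> F) n) i) \<le> (C * (2 * R) ^ n) * K ^ i"
      unfolding fshift_def fps_nth_Abs_fps K_def
      by (rule fsubst_bound[OF assms(3) A hasse_bound[OF F(3)]]) (use F in auto)
    also have "\<dots> \<le> (C * K ^ n) * K ^ i"
      using F K by (intro mult_right_mono mult_left_mono power_mono) auto
    finally show ?thesis by (simp add: power_add mult_ac)
  qed
  then show ?thesis unfolding geom_bounded2_def by blast
qed

text \<open>A root is asked for only after some ramification t -> t^M. In this form the property can
  be pulled back along the three moves of the Newton algorithm: shift, ramification and
  rescaling.\<close>

definition np_root_ex :: "complex fps fps \<Rightarrow> bool" where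
  "np_root_ex F \<longleftrightarrow> (\<exists>M>0. \<exists>g. geom_bounded g \<and> fps_nth g 0 = 0 \<and> fsubst (map_coeff (ram M) F) g = 0)"

lemma np_root_ex_fshift:
  assumes "np_root_ex (fshift \<psi> F)" "geom_bounded \<psi>" "fps_nth \<psi> 0 = 0"
  shows "np_root_ex F"
proof -
  obtain M g where g: "M > 0" "geom_bounded g" "fps_nth g 0 = 0" "fsubst (map_coeff (ram M) (fshift \<psi> F)) g = 0"
    using assms(1) by (auto simp: np_root_ex_def)
  have "fsubst (map_coeff (ram M) F) (ram M \<psi> + g) = 0"
    using g assms(3) by (simp add: map_ram_fshift fsubst_fshift)
  then show ?thesis unfolding np_root_ex_def
    using g assms by (intro exI[of _ M] conjI exI[of _ "ram M \<psi> + g"] geom_bounded_add geom_bounded_ram) auto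
qed

lemma np_root_ex_ram:
  assumes "np_root_ex (map_coeff (ram N) F)" "N > 0"
  shows "np_root_ex F"
proof -
  obtain M g where g: "M > 0" "geom_bounded g" "fps_nth g 0 = 0" "fsubst (map_coeff (ram M) (map_coeff (ram N) F)) g = 0"
    using assms(1) by (auto simp: np_root_ex_def)
  have "ram M \<circ> ram N = (ram (M * N) :: complex fps \<Rightarrow> _)" using ram_ram g(1) assms(2) by (auto simp: fun_eq_iff)
  then show ?thesis unfolding np_root_ex_def
    using g assms(2) by (intro exI[of _ "M * N"] conjI exI[of _ g]) (auto simp: map_coeff_comp)
qed

lemma np_root_ex_fscale:
  assumes "np_root_ex H" "fps_const (fps_X ^ e) * H = fscale p F" 
  shows "np_root_ex F"
proof -
  obtain M g where g: "M > 0" "geom_bounded g" "fps_nth g 0 = 0" "fsubst (map_coeff (ram M) H) g = 0"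
    using assms(1) by (auto simp: np_root_ex_def)
  note h = fps_hom_ram[OF g(1), where 'a = complex]
  have "fsubst (map_coeff (ram M) (fps_const (fps_X ^ e) * H)) g = 0"
    using g by (simp add: hom_simps[OF fps_hom_map_coeff[OF h]] map_coeff_const[OF h] fsubst_mult)
  then have "fsubst (map_coeff (ram M) F) (fps_X ^ (M * p) * g) = 0"
    using g(1) unfolding assms(2) by (simp add: map_ram_fscale fsubst_fscale)
  moreover have "geom_bounded (fps_X ^ (M * p) * g)"
    by (intro geom_bounded_mult geom_bounded_X_power g)
  moreover have "fps_nth (fps_X ^ (M * p) * g) 0 = 0" using g by simp
  ultimately show ?thesis unfolding np_root_ex_def using g(1) by blast
qed

lemma map_ram_1 [simp]: "map_coeff (ram 1) F = F" "map_coeff (ram (Suc 0)) F = F"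
  by (auto intro!: fps_ext simp: ram_nth)

text \<open>
  One step of the Newton polygon algorithm: after a Tschirnhaus shift along a root of the
  \<open>(k - 1)\<close>-st derivative, the polynomial of an edge is not a \<open>k\<close>-th power.
\<close>

lemma np_root_exists:
  assumes "geom_bounded2 F" "\<And>j. j < k \<Longrightarrow> fps_nth (fps_nth F j) 0 = 0" "fps_nth (fps_nth F k) 0 \<noteq> 0" "k > 0"
  shows "np_root_ex F"
  using assms
proof (induction k arbitrary: F rule: less_induct)
  case (less k F)
  show ?case
  proof (cases "k = 1")
    case True
    then obtain h where "geom_bounded h" "fps_nth h 0 = 0" "fsubst F h = 0"
      using order1_root[of F] less.prems by auto
    then show ?thesis unfolding np_root_ex_def by (intro exI[of _ 1] conjI exI[of _ h]) auto
  next
    case False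
    with less.prems have k2: "k \<ge> 2" by auto
    have hn: "fps_nth (of_nat c * a) i = of_nat c * fps_nth a i" for c i and a :: "complex fps"
      by (metis fps_mult_left_const_nth fps_of_nat)
    \<comment> \<open>The divided derivative of order k - 1 has order 1 in y, so the case of order 1
      provides \<phi>. After the shift by \<phi> the coefficient of y^(k-1) vanishes, as in
      completing a k-th power.\<close>
    obtain \<phi> where \<phi>: "geom_bounded \<phi>" "fps_nth \<phi> 0 = 0" "fsubst (hasse (k - 1) F) \<phi> = 0"
    proof -
      have "fps_nth (fps_nth (hasse (k - 1) F) 0) 0 = 0"
        using less.prems(2)[of "k - 1"] k2 by (simp add: hasse_def hn)
      moreover have "fps_nth (fps_nth (hasse (k - 1) F) 1) 0 \<noteq> 0"
        using less.prems(3) k2 by (simp add: hasse_def hn binomial_eq_0_iff)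
      ultimately show thesis
        using order1_root[OF geom_bounded2_hasse[OF less.prems(1)]] that by blast
    qed
    define C0 where "C0 = fshift \<phi> F"
    define c where "c j = fps_nth C0 j" for j
    have c: "c j = fsubst (hasse j F) \<phi>" for j by (simp add: c_def C0_def fshift_def)
    have c0: "fps_nth (c j) 0 = fps_nth (fps_nth F j) 0" for j
      by (simp add: c fsubst_nth_0[OF \<phi>(2)] hasse_def)
    have ck1: "c (k - 1) = 0" using \<phi> by (simp add: c)
    have C0b: "geom_bounded2 C0" unfolding C0_def by (rule geom_bounded2_fshift[OF less.prems(1) \<phi>(1,2)])
    have "np_root_ex C0"
    proof (cases "\<forall>j<k. c j = 0")
      case True
      then have "fsubst C0 0 = 0"
        using fsubst_rec[of 0 C0] k2 by (simp add: c_def)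
      then show ?thesis unfolding np_root_ex_def
        by (intro exI[of _ 1] conjI exI[of _ 0]) (auto intro: geom_bounded_0)
    next
      case False
      define J where "J = {j. j < k \<and> c j \<noteq> 0}"
      have J: "finite J" "J \<noteq> {}" using False by (auto simp: J_def)
      \<comment> \<open>\<open>j0\<close> lies on the edge of the Newton polygon that ends at y^k:
        it minimizes ord(c_j) / (k - j), and this minimum is p / q. After t -> t^q the weight p of y
        is an integer.\<close>
      obtain j0 where j0: "j0 \<in> J" "\<And>j. j \<in> J \<Longrightarrow> real (subdegree (c j0)) / real (k - j0) \<le> real (subdegree (c j)) / real (k - j)"
      proof -
        let ?s = "\<lambda>j. real (subdegree (c j)) / real (k - j)"
        show thesis using that[of "arg_min_on ?s J"] arg_min_if_finite(1)[OF J, of ?s] arg_min_least[OF J, of _ ?s] by simp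
      qed
      define q where "q = k - j0"
      define p where "p = subdegree (c j0)"
      have j0k: "j0 < k" "c j0 \<noteq> 0" using j0 by (auto simp: J_def)
      have q: "q > 0" using j0k by (auto simp: q_def)
      have p: "p > 0"
      proof -
        have "fps_nth (c j0) 0 = 0" using c0 less.prems(2)[OF j0k(1)] by simp
        then show ?thesis using j0k by (auto simp: p_def subdegree_eq_0_iff intro!: gr0I)
      qed
      define C where "C = map_coeff (ram q) C0"
      have Cnth: "fps_nth (fps_nth C j) i = (if q dvd i then fps_nth (c j) (i div q) else 0)" for i j
        by (simp add: C_def c_def ram_nth)
      have Cz: "fps_nth (fps_nth C j) i = 0" if "j \<le> k" "i < p * (k - j)" for i j
      proof -
        have jk: "j < k" using that by (cases "j = k") auto
        show ?thesis
        proof (cases "q dvd i \<and> c j \<noteq> 0")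
          case True
          then obtain i' where i: "i = q * i'" by auto
          have "j \<in> J" using jk True by (auto simp: J_def)
          then have "real p / real q \<le> real (subdegree (c j)) / real (k - j)"
            using j0(2) by (simp add: p_def q_def)
          then have le: "p * (k - j) \<le> subdegree (c j) * q"
          proof -
            assume le: "real p / real q \<le> real (subdegree (c j)) / real (k - j)"
            have pos: "real q > 0" "real (k - j) > 0" using q jk by auto
            have "real p \<le> real (subdegree (c j)) * real q / real (k - j)"
              using le unfolding pos_divide_le_eq[OF pos(1)] by simp
            then have "real p * real (k - j) \<le> real (subdegree (c j)) * real q"
              unfolding pos_le_divide_eq[OF pos(2)] .
            then show ?thesis by (metis of_nat_le_iff of_nat_mult)
          qed
          have "i' * q < p * (k - j)" using that(2) unfolding i mult.commute[of q i'] .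
          also note le
          finally have lt: "i' < subdegree (c j)" by (rule mult_less_cancel2[THEN iffD1, THEN conjunct2])
          have "i div q = i'" using i q by simp
          then show ?thesis using nth_less_subdegree_zero[OF lt] by (simp add: Cnth)
        qed (auto simp: Cnth)
      qed
      \<comment> \<open>The coefficients of C on the edge, i.e. those of the part of weight p k when
        t has weight 1 and y has weight p.\<close>
      define b where "b j = fps_nth (fps_nth C j) (p * (k - j))" for j
      have bk: "b k \<noteq> 0" using less.prems(3) by (simp add: b_def Cnth c0)
      have bk1: "b (k - 1) = 0" using ck1 by (simp add: b_def Cnth)
      have bj0: "b j0 \<noteq> 0"
        using j0k q by (simp add: b_def Cnth flip: q_def) (simp add: p_def)
      define Q where "Q = (\<Sum>j\<le>k. monom (b j) j)"
      have "coeff Q k = b k" by (simp add: Q_def coeff_sum)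
      then have "degree Q \<ge> k" using bk le_degree by metis
      then have "\<not> constant (poly Q)" using k2 by (simp add: constant_degree)
      then obtain z where z: "poly Q z = 0" using fundamental_theorem_of_algebra by blast
      \<comment> \<open>The Taylor coefficients of the edge polynomial \<open>Q\<close> at its root
        \<open>z\<close>.\<close>
      define e where "e n = (\<Sum>m\<le>k - n. of_nat ((m + n) choose n) * b (m + n) * z ^ m)" for n
      have e0: "e 0 = 0" using z by (simp add: e_def Q_def poly_sum poly_monom)
      have ek: "e k \<noteq> 0" using bk by (simp add: e_def)
      \<comment> \<open>Otherwise Q = b_k (w - z)^k. The coefficient of w^(k-1) vanishes by the
        shift, so z = 0, and then no lower term could survive, contrary to
        \<open>bj0\<close>.\<close>
      have ex: "\<exists>n<k. e n \<noteq> 0"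
      proof (rule ccontr)
        assume "\<not> (\<exists>n<k. e n \<noteq> 0)"
        then have all0: "e n = 0" if "n < k" for n using that by auto
        have "{..k - (k - 1)} = {0, 1}" using k2 by auto
        then have "e (k - 1) = of_nat (k choose (k - 1)) * b k * z"
          using bk1 k2 by (simp add: e_def)
        then have "z = 0" using all0[of "k - 1"] bk k2 by (auto simp: binomial_eq_0_iff)
        then have "e j0 = b j0" by (simp add: e_def power_0_left if_distrib[of "\<lambda>x. _ * x"] cong: if_cong)
        then show False using all0[OF j0k(1)] bj0 by simp
      qed
      \<comment> \<open>The multiplicity of \<open>z\<close> in \<open>Q\<close>; 0 < m < k makes
        the induction hypothesis applicable.\<close>
      define m where "m = (LEAST n. e n \<noteq> 0)"
      have em: "e m \<noteq> 0" unfolding m_def by (rule LeastI[of _ k]) (rule ek)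
      have eless: "e n = 0" if "n < m" for n using not_less_Least that unfolding m_def by blast
      have mk: "m < k" using ex Least_le[of "\<lambda>n. e n \<noteq> 0"] by (fastforce simp: m_def)
      have m0: "m > 0" using em e0 by (cases m) auto
      define \<psi> where "\<psi> = fps_const z * fps_X ^ p"
      have \<psi>: "geom_bounded \<psi>" "fps_nth \<psi> 0 = 0"
        using p unfolding \<psi>_def by (auto intro!: geom_bounded_mult geom_bounded_const geom_bounded_X_power)
      define S where "S = fshift \<psi> C"
      have Sb: "geom_bounded2 S"
        unfolding S_def C_def by (intro geom_bounded2_fshift geom_bounded2_map_ram C0b q \<psi>)
      \<comment> \<open>After the shift by z t^p, each coefficient of y^n with n \<le> k still
        starts in degree p (k - n) or later, and its term of that degree is
        \<open>e n\<close>.\<close>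
      have Snth: "fps_nth (fps_nth S n) i = (if i = p * (k - n) then e n else 0)" if "n \<le> k" "i \<le> p * (k - n)" for n i
      proof -
        define M where "M = p * k"
        have M: "i \<le> M" "k \<le> M" using that p by (auto simp: M_def intro: order_trans)
        have \<psi>p: "\<psi> ^ l = fps_const (z ^ l) * fps_X ^ (p * l)" for l
          by (simp add: \<psi>_def power_mult_distrib fps_const_power power_mult)
        have "fps_nth (fps_nth S n) i = (\<Sum>l\<le>M. fps_nth (fps_nth (hasse n C) l * \<psi> ^ l) i)"
          unfolding S_def fshift_def fps_nth_Abs_fps by (rule fsubst_nth_pad[OF \<psi>(2) M(1)])
        also have "\<dots> = (\<Sum>l\<le>M. if l \<le> k - n \<and> i = p * (k - n) then of_nat ((l + n) choose n) * b (l + n) * z ^ l else 0)"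
        proof (rule sum.cong)
          fix l
          have eq: "fps_nth (fps_nth (hasse n C) l * \<psi> ^ l) i =
              (if i < p * l then 0 else of_nat ((l + n) choose n) * fps_nth (fps_nth C (l + n)) (i - p * l) * z ^ l)"
            unfolding \<psi>p mult.assoc[symmetric] fps_X_power_mult_right_nth
            by (auto simp: hasse_def hn)
          show "fps_nth (fps_nth (hasse n C) l * \<psi> ^ l) i =
              (if l \<le> k - n \<and> i = p * (k - n) then of_nat ((l + n) choose n) * b (l + n) * z ^ l else 0)"
          proof (cases "l \<le> k - n")
            case True
            have kl: "k - (l + n) = (k - n) - l" by simp
            show ?thesis
            proof (cases "i < p * l")
              case True
              then have "i < p * (k - n)" using \<open>l \<le> k - n\<close> by (meson less_le_trans mult_le_mono2)
              then show ?thesis unfolding eq using True by auto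
            next
              case False
              have 1: "p * (k - (l + n)) = p * (k - n) - p * l" unfolding kl by (rule diff_mult_distrib2)
              show ?thesis
              proof (cases "i = p * (k - n)")
                case True
                then show ?thesis unfolding eq using False \<open>l \<le> k - n\<close> by (simp add: b_def 1)
              next
                case neq: False
                then have "i - p * l < p * (k - (l + n))" using that False unfolding 1 by linarith
                then have "fps_nth (fps_nth C (l + n)) (i - p * l) = 0"
                  by (intro Cz) (use True that in auto)
                then show ?thesis unfolding eq using neq by auto
              qed
            qed
          next
            case False
            then have "p * (k - n) < p * l" using p by simp
            then have "i < p * l" using that by linarith
            then show ?thesis unfolding eq using False by auto
          qed
        qed simp
        also have "\<dots> = (if i = p * (k - n) then e n else 0)"
        proof (cases "i = p * (k - n)")
          case True
          have sub: "{..M} \<inter> {l. l \<le> k - n} = {..k - n}" using M by auto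
          show ?thesis using True by (simp add: e_def sum.If_cases sub)
        qed simp
        finally show ?thesis .
      qed
      \<comment> \<open>S(t, t^p y) / t^(pk). The division is possible by \<open>Snth\<close> for n
        \<le> k; for larger n the exponent p (n - k) is positive. H(0, y) has order m, since its
        coefficients up to degree k are the \<open>e n\<close>.\<close>
      define H where "H = Abs_fps (\<lambda>n. if n \<le> k then fps_shift (p * (k - n)) (fps_nth S n)
                                         else fps_X ^ (p * (n - k)) * fps_nth S n)"
      have Hb: "geom_bounded2 H"
      proof -
        obtain D R where S: "D \<ge> 1" "R \<ge> 1" "\<And>i j. norm (fps_nth (fps_nth S j) i) \<le> D * R ^ (i + j)"
          using geom_bounded2E[OF Sb] by metis
        have "norm (fps_nth (fps_nth H n) i) \<le> (D * R ^ (p * k)) * R ^ (i + n)" for n i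
        proof -
          consider "n \<le> k" | "n > k" "i < p * (n - k)" | "n > k" "i \<ge> p * (n - k)" by linarith
          then show ?thesis
          proof cases
            case 1
            then have "norm (fps_nth (fps_nth H n) i) \<le> D * R ^ (i + p * (k - n) + n)"
              using S(3)[of n "i + p * (k - n)"] by (simp add: H_def)
            also have "\<dots> \<le> D * R ^ (p * k + (i + n))"
              using S by (intro mult_left_mono power_increasing) auto
            finally show ?thesis by (simp add: power_add mult_ac)
          next
            case 2
            then show ?thesis using S by (simp add: H_def fps_X_power_mult_nth)
          next
            case 3
            then have "norm (fps_nth (fps_nth H n) i) \<le> D * R ^ (i - p * (n - k) + n)"
              using S(3)[of n "i - p * (n - k)"] by (simp add: H_def fps_X_power_mult_nth)
            also have "\<dots> \<le> D * R ^ (p * k + (i + n))"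
              using S by (intro mult_left_mono power_increasing) auto
            finally show ?thesis by (simp add: power_add mult_ac)
          qed
        qed
        then show ?thesis unfolding geom_bounded2_def by blast
      qed
      have H0: "fps_nth (fps_nth H n) 0 = e n" if "n \<le> k" for n
        using Snth[OF that order_refl] that by (simp add: H_def)
      have HS: "fps_const (fps_X ^ (p * k)) * H = fscale p S"
      proof (rule fps_ext)
        fix n
        have "fps_X ^ (p * k) * fps_nth H n = fps_X ^ (p * n) * fps_nth S n"
        proof (cases "n \<le> k")
          case True
          have e1: "fps_nth S n = fps_X ^ (p * (k - n)) * fps_shift (p * (k - n)) (fps_nth S n)"
            by (rule fps_ext) (use Snth[OF True] in \<open>auto simp: fps_X_power_mult_nth\<close>)
          have "p * k = p * n + p * (k - n)" using True by (simp flip: distrib_left)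
          then have e2: "fps_X ^ (p * k) = (fps_X ^ (p * n) * fps_X ^ (p * (k - n)) :: complex fps)"
            by (simp only: power_add)
          have "fps_X ^ (p * k) * fps_nth H n = fps_X ^ (p * k) * fps_shift (p * (k - n)) (fps_nth S n)"
            using True by (simp add: H_def)
          also have "\<dots> = fps_X ^ (p * n) * fps_nth S n"
            by (simp only: e2 mult.assoc e1[symmetric])
          finally show ?thesis .
        next
          case False
          then have "p * n = p * k + p * (n - k)" by (simp flip: distrib_left)
          then have "fps_X ^ (p * n) = (fps_X ^ (p * k) * fps_X ^ (p * (n - k)) :: complex fps)"
            by (simp only: power_add)
          then show ?thesis using False by (simp add: H_def mult.assoc)
        qed
        then show "fps_nth (fps_const (fps_X ^ (p * k)) * H) n = fps_nth (fscale p S) n"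
          by (simp add: fscale_def)
      qed
      have "np_root_ex H"
        by (rule less.IH[OF mk Hb _ _ m0]) (use H0 mk em eless in auto)
      then have "np_root_ex S" by (rule np_root_ex_fscale[OF _ HS])
      then have "np_root_ex C" unfolding S_def by (rule np_root_ex_fshift[OF _ \<psi>])
      then show ?thesis unfolding C_def by (rule np_root_ex_ram[OF _ q])
    qed
    then show ?thesis unfolding C0_def by (rule np_root_ex_fshift[OF _ \<phi>(1,2)])
  qed
qed

text \<open>Induction on the order k of F(0, y): one root, found after a ramification, splits off by
  division and lowers the order by 1; in order 0 the series itself is the unit. Roots found earlier
  have to follow the later ramifications.\<close>

lemma np_factorization_complex:
  fixes F :: "complex fps fps"
  assumes "geom_bounded2 F" "\<And>j. j < k \<Longrightarrow> fps_nth (fps_nth F j) 0 = 0" "fps_nth (fps_nth F k) 0 \<noteq> 0"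
  shows "\<exists>N>0. \<exists>G u. geom_bounded2 u \<and> fps_nth (fps_nth u 0) 0 \<noteq> 0 \<and>
    (\<forall>g\<in>#G. geom_bounded g \<and> fps_nth g 0 = 0) \<and>
    map_coeff (ram N) F = u * (\<Prod>g\<in>#G. fps_X - fps_const g)"
  using assms
proof (induction k arbitrary: F)
  case 0
  then show ?case by (intro exI[of _ 1] conjI exI[of _ "{#}"] exI[of _ F]) auto
next
  case (Suc k F)
  obtain M g where g: "M > 0" "geom_bounded g" "fps_nth g 0 = 0" "fsubst (map_coeff (ram M) F) g = 0"
    using np_root_exists[of F "Suc k"] Suc.prems unfolding np_root_ex_def by blast
  let ?F = "map_coeff (ram M) F"
  define h where "h = fquot ?F g"
  have Fh: "?F = (fps_X - fps_const g) * h"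
    using fsubst_division[OF g(3), of ?F] g(4) by (simp add: h_def)
  have hb: "geom_bounded2 h"
    unfolding h_def by (intro geom_bounded2_fquot geom_bounded2_map_ram Suc.prems g)
  have h0: "fps_nth (fps_nth h j) 0 = fps_nth (fps_nth F (Suc j)) 0" for j
  proof -
    have "fps_nth (fps_nth ?F (Suc j)) 0 = fps_nth (fps_nth ((fps_X - fps_const g) * h) (Suc j)) 0"
      using Fh by simp
    then show ?thesis unfolding linear_mult_nth using g(3) by simp
  qed
  obtain N G u where u: "N > 0" "geom_bounded2 u" "fps_nth (fps_nth u 0) 0 \<noteq> 0"
    "\<forall>g\<in>#G. geom_bounded g \<and> fps_nth g 0 = 0" "map_coeff (ram N) h = u * (\<Prod>g\<in>#G. fps_X - fps_const g)"
    using Suc.IH[OF hb] Suc.prems h0 by fastforce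
  note hom = fps_hom_ram[OF u(1), where 'a = complex]
  have "ram N \<circ> ram M = (ram (N * M) :: complex fps \<Rightarrow> _)" using ram_ram g(1) u(1) by (auto simp: fun_eq_iff)
  then have "map_coeff (ram (N * M)) F = map_coeff (ram N) ((fps_X - fps_const g) * h)"
    using Fh by (metis map_coeff_comp)
  also have "\<dots> = u * (\<Prod>g\<in>#add_mset (ram N g) G. fps_X - fps_const g)"
    by (simp add: hom_simps[OF fps_hom_map_coeff[OF hom]] map_coeff_linear[OF hom] u mult_ac del: fps_const_sub)
  finally show ?case
    using u g by (intro exI[of _ "N * M"] conjI exI[of _ "add_mset (ram N g) G"] exI[of _ u]) (auto intro: geom_bounded_ram)
qed

section \<open>Descent of the unit to real coefficients and integral powers\<close>

lemma fps_hom_coeff_cnj: "fps_hom (coeff_hom cnj)"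
  by (rule fps_hom_coeff_hom) auto

text \<open>The substitution t -> \<zeta> t; for \<zeta>^N = 1 it is a deck transformation of x =
  t^N.\<close>

definition dilate :: "'a::comm_ring_1 \<Rightarrow> 'a fps \<Rightarrow> 'a fps" where
  "dilate \<zeta> a = Abs_fps (\<lambda>i. \<zeta> ^ i * fps_nth a i)"

lemma fps_hom_dilate: "fps_hom (dilate \<zeta>)"
  unfolding fps_hom_def
proof (intro conjI allI)
  show "dilate \<zeta> 1 = 1" by (rule fps_ext) (simp add: dilate_def)
  show "dilate \<zeta> (a + b) = dilate \<zeta> a + dilate \<zeta> b" for a b
    by (rule fps_ext) (simp add: dilate_def ring_distribs)
  show "dilate \<zeta> (a * b) = dilate \<zeta> a * dilate \<zeta> b" for a b
  proof (rule fps_ext)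
    fix n
    have "(\<Sum>i=0..n. \<zeta> ^ n * (fps_nth a i * fps_nth b (n - i))) =
        (\<Sum>i=0..n. \<zeta> ^ i * fps_nth a i * (\<zeta> ^ (n - i) * fps_nth b (n - i)))"
    proof (rule sum.cong)
      fix i assume "i \<in> {0..n}"
      then have "\<zeta> ^ n = \<zeta> ^ i * \<zeta> ^ (n - i)" by (simp flip: power_add)
      then show "\<zeta> ^ n * (fps_nth a i * fps_nth b (n - i)) = \<zeta> ^ i * fps_nth a i * (\<zeta> ^ (n - i) * fps_nth b (n - i))"
        by (simp add: mult_ac)
    qed simp
    then show "fps_nth (dilate \<zeta> (a * b)) n = fps_nth (dilate \<zeta> a * dilate \<zeta> b) n"
      by (simp add: dilate_def fps_mult_nth sum_distrib_left)
  qed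
qed

lemma ramify_eq_ram:
  assumes "N > 0"
  shows "ramify N f = map_coeff (ram N) (map_coeff (coeff_hom complex_of_real) f)"
  using ramify_eq[OF assms] by (simp add: map_coeff_comp)

lemma ramify_nth:
  "N > 0 \<Longrightarrow> fps_nth (fps_nth (ramify N f) j) i =
     (if N dvd i then complex_of_real (fps_nth (fps_nth f j) (i div N)) else 0)"
  by (simp add: ramify_eq_ram ram_nth)

text \<open>
  Conjugation and \<open>t \<mapsto> \<zeta> t\<close> fix \<open>f(t ^ N, y)\<close>, so they permute the linear factors and fix the unit.
\<close>

lemma np_factorization_real:
  fixes f :: "real fps fps"
  assumes "geom_bounded2 f" "\<And>j. j < k \<Longrightarrow> fps_nth (fps_nth f j) 0 = 0" "fps_nth (fps_nth f k) 0 \<noteq> 0"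
  shows "\<exists>N>0. \<exists>G u. geom_bounded2 u \<and> fps_nth (fps_nth u 0) 0 \<noteq> 0 \<and>
    (\<forall>g\<in>#G. geom_bounded g \<and> fps_nth g 0 = 0) \<and>
    ramify N f = ramify N u * (\<Prod>g\<in>#G. fps_X - fps_const g)"
proof -
  define fc where "fc = map_coeff (coeff_hom complex_of_real) f"
  have "geom_bounded2 fc" using assms(1) by (simp add: fc_def geom_bounded2_def)
  then obtain N G w where w: "N > 0" "geom_bounded2 w" "fps_nth (fps_nth w 0) 0 \<noteq> 0"
    "\<forall>g\<in>#G. geom_bounded g \<and> fps_nth g 0 = 0" "map_coeff (ram N) fc = w * (\<Prod>g\<in>#G. fps_X - fps_const g)"
    using np_factorization_complex[of fc k] assms by (auto simp: fc_def)
  \<comment> \<open>Such an automorphism maps the factorization to another one of the same series;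
    by uniqueness the unit is unchanged.\<close>
  have inv: "map_coeff \<phi> w = w"
    if "fps_hom \<phi>" "map_coeff \<phi> (map_coeff (ram N) fc) = map_coeff (ram N) fc"
      "\<And>g. fps_nth g 0 = 0 \<Longrightarrow> fps_nth (\<phi> g) 0 = 0" "\<And>g. fps_nth g 0 \<noteq> 0 \<Longrightarrow> fps_nth (\<phi> g) 0 \<noteq> 0" for \<phi>
  proof -
    have "map_coeff \<phi> w * (\<Prod>g\<in>#image_mset \<phi> G. fps_X - fps_const g) = map_coeff \<phi> (map_coeff (ram N) fc)"
      unfolding w(5) hom_simps(3)[OF fps_hom_map_coeff[OF that(1)]] map_coeff_prod[OF that(1)] ..
    also have "\<dots> = w * (\<Prod>g\<in>#G. fps_X - fps_const g)" using that(2) w(5) by simp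
    finally show ?thesis
      using linear_factorization_unique[of "map_coeff \<phi> w" "image_mset \<phi> G" w G] w that by auto
  qed
  have "map_coeff (coeff_hom cnj) w = w"
    by (rule inv[OF fps_hom_coeff_cnj]) (auto intro!: fps_ext simp: ram_nth fc_def)
  then have "cnj (fps_nth (fps_nth w j) i) = fps_nth (fps_nth w j) i" for i j
    by (metis coeff_hom_nth map_coeff_nth)
  then have real: "complex_of_real (Re (fps_nth (fps_nth w j) i)) = fps_nth (fps_nth w j) i" for i j
    by (metis Reals_cnj_iff of_real_Re)
  \<comment> \<open>A primitive N-th root of unity. Invariance under t -> \<zeta> t kills every
    exponent of t that \<open>N\<close> does not divide.\<close>
  define \<zeta> where "\<zeta> = exp (2 * of_real pi * \<i> * of_nat 1 / of_nat N)"
  have \<zeta>: "\<zeta> ^ i = 1 \<longleftrightarrow> N dvd i" for i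
  proof -
    have "\<zeta> ^ i = exp (2 * of_real pi * \<i> * of_nat i / of_nat N)"
      unfolding \<zeta>_def by (simp flip: exp_of_nat_mult add: mult_ac)
    then show ?thesis using complex_root_unity_eq_1[of N i] w(1) by simp
  qed
  have "map_coeff (dilate \<zeta>) w = w"
  proof (rule inv[OF fps_hom_dilate])
    show "map_coeff (dilate \<zeta>) (map_coeff (ram N) fc) = map_coeff (ram N) fc"
      by (intro fps_ext) (auto simp: dilate_def ram_nth \<zeta>)
  qed (auto simp: dilate_def)
  then have "\<zeta> ^ i * fps_nth (fps_nth w j) i = fps_nth (fps_nth w j) i" for i j
    by (metis (no_types, lifting) dilate_def fps_nth_Abs_fps map_coeff_nth)
  then have zero: "fps_nth (fps_nth w j) i = 0" if "\<not> N dvd i" for i j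
    using \<zeta>[of i] that by (metis mult_cancel_right2)
  define u where "u = Abs_fps (\<lambda>j. Abs_fps (\<lambda>i. Re (fps_nth (fps_nth w j) (N * i))))"
  have wu: "w = ramify N u"
    by (intro fps_ext) (auto simp: ramify_nth[OF w(1)] u_def real zero)
  have "geom_bounded2 u"
  proof -
    obtain C R where F: "C \<ge> 1" "R \<ge> 1" "\<And>i j. norm (fps_nth (fps_nth w j) i) \<le> C * R ^ (i + j)"
      using geom_bounded2E[OF w(2)] by metis
    have "norm (fps_nth (fps_nth u j) i) \<le> C * (R ^ N) ^ (i + j)" for i j
    proof -
      have "norm (fps_nth (fps_nth u j) i) \<le> norm (fps_nth (fps_nth w j) (N * i))"
        by (simp add: u_def abs_Re_le_cmod)
      also have "\<dots> \<le> C * R ^ (N * i + j)" by (rule F)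
      also have "\<dots> \<le> C * R ^ (N * (i + j))"
        using F w(1) by (intro mult_left_mono power_increasing) (auto simp: distrib_left)
      finally show ?thesis by (simp add: power_mult)
    qed
    then show ?thesis unfolding geom_bounded2_def by blast
  qed
  moreover have "fps_nth (fps_nth u 0) 0 \<noteq> 0"
    using w(3) unfolding wu by (simp add: ramify_nth[OF w(1)])
  moreover have "ramify N f = ramify N u * (\<Prod>g\<in>#G. fps_X - fps_const g)"
    unfolding wu[symmetric] ramify_eq_ram[OF w(1), of f] fc_def[symmetric] by (rule w(5))
  ultimately show ?thesis using w by blast
qed

text \<open>The coefficients of v are bounded by strong induction on i + j through u v = 1, solved
  for the term that contains the constant coefficient c of \<open>u\<close>.\<close>

lemma geom_bounded2_inverse:
  fixes u :: "real fps fps"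
  assumes "geom_bounded2 u" "fps_nth (fps_nth u 0) 0 \<noteq> 0"
  shows "\<exists>v. u * v = 1 \<and> geom_bounded2 v"
proof -
  have u0: "fps_nth u 0 * inverse (fps_nth u 0) = 1"
    using inverse_mult_eq_1[of "fps_nth u 0"] assms(2) by (simp add: mult.commute)
  define v where "v = fps_right_inverse u (inverse (fps_nth u 0))"
  have uv: "u * v = 1" unfolding v_def by (rule fps_right_inverse[OF u0])
  obtain C R where u: "C \<ge> 1" "R \<ge> 1" "\<And>i j. norm (fps_nth (fps_nth u j) i) \<le> C * R ^ (i + j)"
    using geom_bounded2E[OF assms(1)] by metis
  define c where "c = fps_nth (fps_nth u 0) 0"
  define D where "D = 1 / \<bar>c\<bar>"
  have D: "D > 0" using assms(2) by (simp add: D_def c_def)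
  \<comment> \<open>With R = K \<delta> / 2 the terms other than that of c carry (\<delta>/2)^(a+b)
    \<le> \<delta> 2^-(a+b), because a + b \<ge> 1. Their sum is at most C D K^(i+j) times 4
    \<delta>, and \<delta> satisfies 4 C D \<delta> \<le> 1, so the bound D K^(i+j) reproduces
    itself.\<close>
  define \<delta> where "\<delta> = 1 / (4 * C * D + 1)"
  have CD: "C * D > 0" using u D by simp
  have \<delta>: "0 < \<delta>" "\<delta> \<le> 1" "C * D * (4 * \<delta>) \<le> 1"
    using CD by (auto simp: \<delta>_def field_simps)
  define K where "K = 2 * R / \<delta>"
  have K: "K > 0" "R = K * (\<delta> / 2)" using u \<delta> by (auto simp: K_def)
  define s where "s = (\<lambda>(a::nat, b::nat). \<delta> * (1/2::real) ^ (a + b))"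
  have sb: "(\<Sum>(a, b)\<in>{..i}\<times>{..j}. \<delta> * (1/2::real) ^ (a + b)) \<le> 4 * \<delta>" for i j
  proof -
    have 1: "(\<Sum>a\<le>i. (1/2::real) ^ a) \<le> 2" for i
    proof -
      have "(\<Sum>a\<le>i. (1/2::real) ^ a) = 2 * (\<Sum>a\<le>i. (1/2) ^ Suc a)" by (simp add: sum_distrib_left)
      then show ?thesis using sum_half_powers[of i] by linarith
    qed
    have "(\<Sum>(a, b)\<in>{..i}\<times>{..j}. \<delta> * (1/2::real) ^ (a + b)) = \<delta> * ((\<Sum>a\<le>i. (1/2) ^ a) * (\<Sum>b\<le>j. (1/2) ^ b))"
    proof -
      have "(\<Sum>(a, b)\<in>{..i}\<times>{..j}. \<delta> * (1/2::real) ^ (a + b)) = (\<Sum>a\<le>i. \<Sum>b\<le>j. \<delta> * ((1/2) ^ a * (1/2) ^ b))"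
        unfolding sum.cartesian_product power_add ..
      then show ?thesis unfolding sum_product by (simp only: sum_distrib_left)
    qed
    also have "\<dots> \<le> \<delta> * (2 * 2)"
      using \<delta> by (intro mult_left_mono mult_mono 1) (auto intro: sum_nonneg)
    finally show ?thesis by simp
  qed
  have "norm (fps_nth (fps_nth v j) i) \<le> D * K ^ (i + j)" for i j
  proof (induction "i + j" arbitrary: i j rule: less_induct)
    case less
    define P where "P = (\<lambda>(b, a). fps_nth (fps_nth u b) a * fps_nth (fps_nth v (j - b)) (i - a))"
    have "fps_nth (fps_nth (u * v) j) i = (\<Sum>x\<in>{..j}\<times>{..i}. P x)"
      by (simp add: fps_mult_nth fps_sum_nth P_def sum.cartesian_product atLeast0AtMost)
    also have "\<dots> = P (0, 0) + (\<Sum>x\<in>{..j}\<times>{..i} - {(0,0)}. P x)"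
      by (rule sum.remove) auto
    finally have eq: "c * fps_nth (fps_nth v j) i = fps_nth (fps_nth (1::real fps fps) j) i - (\<Sum>x\<in>{..j}\<times>{..i} - {(0,0)}. P x)"
      by (simp add: uv P_def c_def)
    show ?case
    proof (cases "i = 0 \<and> j = 0")
      case True
      then have "\<bar>c\<bar> * \<bar>fps_nth (fps_nth v 0) 0\<bar> = 1" using eq by (simp flip: abs_mult)
      then show ?thesis using True assms(2) by (simp add: D_def c_def field_simps)
    next
      case False
      have "\<bar>c\<bar> * norm (fps_nth (fps_nth v j) i) = norm (\<Sum>x\<in>{..j}\<times>{..i} - {(0,0)}. P x)"
        using eq False by (auto simp: abs_mult[symmetric])
      also have "\<dots> \<le> (\<Sum>x\<in>{..j}\<times>{..i} - {(0,0)}. C * D * K ^ (i + j) * (case x of (a, b) \<Rightarrow> \<delta> * (1/2) ^ (a + b)))"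
      proof (rule sum_norm_le)
        fix x assume x: "x \<in> {..j}\<times>{..i} - {(0,0)}"
        obtain b a where ab: "x = (b, a)" by (cases x)
        with x have le: "b \<le> j" "a \<le> i" "a + b > 0" by auto
        have "norm (P x) \<le> (C * R ^ (a + b)) * (D * K ^ (i - a + (j - b)))"
        proof -
          have "norm (fps_nth (fps_nth v (j - b)) (i - a)) \<le> D * K ^ (i - a + (j - b))"
            by (rule less) (use le in auto)
          then have "norm (fps_nth (fps_nth u b) a) * norm (fps_nth (fps_nth v (j - b)) (i - a)) \<le>
              (C * R ^ (a + b)) * (D * K ^ (i - a + (j - b)))"
            using u by (intro mult_mono) auto
          then show ?thesis by (simp add: P_def ab norm_mult abs_mult)
        qed
        also have "\<dots> = C * D * (\<delta> / 2) ^ (a + b) * (K ^ (a + b) * K ^ (i - a + (j - b)))"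
          by (subst K(2)) (simp only: power_mult_distrib mult_ac)
        also have "K ^ (a + b) * K ^ (i - a + (j - b)) = K ^ (i + j)"
          using le by (simp flip: power_add)
        also have "C * D * (\<delta> / 2) ^ (a + b) * K ^ (i + j) \<le> C * D * (\<delta> * (1/2) ^ (a + b)) * K ^ (i + j)"
        proof (intro mult_right_mono mult_left_mono)
          have "\<delta> ^ (a + b) \<le> \<delta> ^ 1" using \<delta> le by (intro power_decreasing) auto
          then show "(\<delta> / 2) ^ (a + b) \<le> \<delta> * (1/2) ^ (a + b)" by (simp add: power_divide divide_right_mono)
        qed (use CD K in auto)
        finally show "norm (P x) \<le> C * D * K ^ (i + j) * (case x of (a, b) \<Rightarrow> \<delta> * (1/2) ^ (a + b))"
          by (simp add: ab mult_ac add_ac)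
      qed
      also have "\<dots> \<le> (\<Sum>x\<in>{..j}\<times>{..i}. C * D * K ^ (i + j) * (case x of (a, b) \<Rightarrow> \<delta> * (1/2) ^ (a + b)))"
        by (rule sum_mono2) (use CD K \<delta> in \<open>auto split: prod.splits\<close>)
      also have "\<dots> = C * D * K ^ (i + j) * (\<Sum>(a, b)\<in>{..j}\<times>{..i}. \<delta> * (1/2) ^ (a + b))"
        by (rule sum_distrib_left[symmetric])
      also have "\<dots> \<le> C * D * K ^ (i + j) * (4 * \<delta>)"
        using CD K by (intro mult_left_mono sb) auto
      also have "\<dots> = (C * D * (4 * \<delta>)) * K ^ (i + j)" by (simp add: mult_ac)
      also have "\<dots> \<le> 1 * K ^ (i + j)" using \<delta> K by (intro mult_right_mono) auto
      finally show ?thesis using assms(2) by (simp add: D_def c_def field_simps)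
    qed
  qed
  then show ?thesis using uv unfolding geom_bounded2_def by blast
qed

section \<open>Evaluation of convergent series\<close>

text \<open>Abel's lemma: comparison with the geometric series of ratio |t| / X.\<close>

lemma eval_fps_bounded:
  fixes a :: "'a::{banach,real_normed_field} fps"
  assumes "\<And>i. norm (fps_nth a i) * X ^ i \<le> C" "X > 0"
  shows "fps_conv_radius a \<ge> ereal X"
    and "norm t < X \<Longrightarrow> norm (eval_fps a t) \<le> C * (X / (X - norm t))"
proof -
  have bound: "norm (fps_nth a i * t ^ i) \<le> C * (norm t / X) ^ i" for t :: 'a and i
  proof -
    have "norm (fps_nth a i * t ^ i) = (norm (fps_nth a i) * X ^ i) * (norm t / X) ^ i"
      using assms(2) by (simp add: norm_mult norm_power power_divide)
    also have "\<dots> \<le> C * (norm t / X) ^ i"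
      using assms by (intro mult_right_mono) auto
    finally show ?thesis .
  qed
  have geo: "summable (\<lambda>i. C * (norm t / X) ^ i)" if "norm t < X" for t :: 'a
    using that assms(2) by (intro summable_mult summable_geometric) auto
  have sum: "summable (\<lambda>i. norm (fps_nth a i * t ^ i))" if "norm t < X" for t
    by (rule summable_comparison_test[OF _ geo[OF that]]) (use bound in auto)
  show "fps_conv_radius a \<ge> ereal X"
    unfolding fps_conv_radius_def
  proof (rule conv_radius_geI_ex)
    fix r assume r: "0 < r" "ereal r < ereal X"
    then show "\<exists>z. norm z = r \<and> summable (\<lambda>n. fps_nth a n * z ^ n)"
      by (intro exI[of _ "of_real r"] conjI summable_norm_cancel[OF sum]) auto
  qed
  assume t: "norm t < X"
  have "norm (eval_fps a t) \<le> (\<Sum>i. norm (fps_nth a i * t ^ i))"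
    unfolding eval_fps_def by (rule summable_norm[OF sum[OF t]])
  also have "\<dots> \<le> (\<Sum>i. C * (norm t / X) ^ i)"
    by (rule suminf_le[OF bound sum[OF t] geo[OF t]])
  also have "\<dots> = C * (1 / (1 - norm t / X))"
    using t assms(2) by (subst suminf_mult) (auto simp: suminf_geometric summable_geometric)
  also have "\<dots> = C * (X / (X - norm t))" using t assms(2) by (simp add: field_simps)
  finally show "norm (eval_fps a t) \<le> C * (X / (X - norm t))" .
qed

text \<open>Freezing t makes the double series an iterated one, to which the one-variable theory of
  \<open>eval_fps\<close> applies; \<open>eval2_eq_ev\<close> returns to the unordered double
  sum.\<close>

definition section_at :: "'a::{banach,real_normed_field} fps fps \<Rightarrow> 'a \<Rightarrow> 'a fps" where
  "section_at F t = Abs_fps (\<lambda>j. eval_fps (fps_nth F j) t)"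

definition ev :: "'a::{banach,real_normed_field} fps fps \<Rightarrow> 'a \<Rightarrow> 'a \<Rightarrow> 'a" where
  "ev F t y = eval_fps (section_at F t) y"

lemma section_at_nth [simp]: "fps_nth (section_at F t) j = eval_fps (fps_nth F j) t"
  by (simp add: section_at_def)

lemma eval_fps_sum:
  fixes a :: "'b \<Rightarrow> 'a::{banach,real_normed_field} fps"
  assumes "\<And>i. i \<in> A \<Longrightarrow> ereal (norm t) < fps_conv_radius (a i)"
  shows "ereal (norm t) < fps_conv_radius (\<Sum>i\<in>A. a i) \<and> eval_fps (\<Sum>i\<in>A. a i) t = (\<Sum>i\<in>A. eval_fps (a i) t)"
  using assms
proof (induction A rule: infinite_finite_induct)
  case (insert x A)
  then have "ereal (norm t) < min (fps_conv_radius (a x)) (fps_conv_radius (sum a A))" by auto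
  also have "\<dots> \<le> fps_conv_radius (a x + sum a A)" by (rule fps_conv_radius_add)
  finally show ?case using insert by (simp add: eval_fps_add)
qed auto

lemma conv_mult:
  fixes a b :: "'a::{banach,real_normed_field} fps"
  assumes "ereal r < fps_conv_radius a" "ereal r < fps_conv_radius b"
  shows "ereal r < fps_conv_radius (a * b)"
  using less_le_trans[OF _ fps_conv_radius_mult[of a b]] assms by simp

lemma section_at_mult:
  assumes "\<And>j. ereal (norm t) < fps_conv_radius (fps_nth F j)" "\<And>j. ereal (norm t) < fps_conv_radius (fps_nth G j)"
  shows "section_at (F * G) t = section_at F t * section_at G t"
    "ereal (norm t) < fps_conv_radius (fps_nth (F * G) j)"
proof -
  have *: "ereal (norm t) < fps_conv_radius (fps_nth F i * fps_nth G k)" for i k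
    by (intro conv_mult assms)
  show "section_at (F * G) t = section_at F t * section_at G t"
    by (rule fps_ext) (simp add: fps_mult_nth eval_fps_sum * eval_fps_mult assms)
  show "ereal (norm t) < fps_conv_radius (fps_nth (F * G) j)"
    by (simp add: fps_mult_nth eval_fps_sum *)
qed

lemma section_at_linear:
  assumes "ereal (norm t) < fps_conv_radius g"
  shows "section_at (fps_X - fps_const g) t = fps_X - fps_const (eval_fps g t)"
    "ereal (norm t) < fps_conv_radius (fps_nth (fps_X - fps_const g) j)"
proof -
  have X: "fps_nth (fps_X :: 'a fps fps) j = (if j = 1 then 1 else 0)" for j by (simp add: fps_X_def)
  have c: "ereal (norm t) < fps_conv_radius (fps_nth fps_X j :: 'a fps)" "ereal (norm t) < fps_conv_radius (fps_nth (fps_const g) j)" for j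
    using assms by (auto simp: X fps_nth_fps_const)
  show "section_at (fps_X - fps_const g) t = fps_X - fps_const (eval_fps g t)"
  proof (rule fps_ext)
    fix j
    show "fps_nth (section_at (fps_X - fps_const g) t) j = fps_nth (fps_X - fps_const (eval_fps g t)) j"
      using c[of j] by (simp add: eval_fps_diff X fps_nth_fps_const)
  qed
  show "ereal (norm t) < fps_conv_radius (fps_nth (fps_X - fps_const g) j)"
    using less_le_trans[OF _ fps_conv_radius_diff[of "fps_nth fps_X j" "fps_nth (fps_const g) j"]] c[of j]
    by auto
qed

lemma ev_const: "ev (fps_const r) t y = eval_fps r t"
proof -
  have "section_at (fps_const r) t = fps_const (eval_fps r t)"
    by (rule fps_ext) (simp add: fps_nth_fps_const)
  then show ?thesis by (simp add: ev_def)
qed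

text \<open>Convergence of the partial products is part of the induction, since multiplicativity of
  evaluation requires it of both factors.\<close>

lemma ev_linear_prod:
  assumes "\<And>j. ereal (norm t) < fps_conv_radius (fps_nth u j)" "ereal (norm y) < fps_conv_radius (section_at u t)"
    and "\<And>g. g \<in># G \<Longrightarrow> ereal (norm t) < fps_conv_radius g"
  shows "ev (u * (\<Prod>g\<in>#G. fps_X - fps_const g)) t y = ev u t y * (\<Prod>g\<in>#G. y - eval_fps g t)"
proof -
  let ?P = "\<lambda>G. \<Prod>g\<in>#G. fps_X - fps_const g"
  have "(\<forall>j. ereal (norm t) < fps_conv_radius (fps_nth (u * ?P G) j)) \<and>
      ereal (norm y) < fps_conv_radius (section_at (u * ?P G) t) \<and>
      ev (u * ?P G) t y = ev u t y * (\<Prod>g\<in>#G. y - eval_fps g t)"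
    using assms(3)
  proof (induction G)
    case empty
    then show ?case using assms by simp
  next
    case (add g G)
    then have g: "ereal (norm t) < fps_conv_radius g" by simp
    have IH: "\<And>j. ereal (norm t) < fps_conv_radius (fps_nth (u * ?P G) j)"
      "ereal (norm y) < fps_conv_radius (section_at (u * ?P G) t)"
      "ev (u * ?P G) t y = ev u t y * (\<Prod>g\<in>#G. y - eval_fps g t)"
      using add by auto
    have eq: "u * ?P (add_mset g G) = (fps_X - fps_const g) * (u * ?P G)" by (simp add: mult_ac)
    have r: "ereal (norm y) < fps_conv_radius (fps_X - fps_const (eval_fps g t))"
      using less_le_trans[OF _ fps_conv_radius_diff[of fps_X "fps_const (eval_fps g t)"]] by simp
    have s: "section_at (u * ?P (add_mset g G)) t = (fps_X - fps_const (eval_fps g t)) * section_at (u * ?P G) t"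
      unfolding eq by (subst section_at_mult(1)) (use IH section_at_linear[OF g] in auto)
    have "ereal (norm y) < fps_conv_radius (section_at (u * ?P (add_mset g G)) t)"
      unfolding s by (rule conv_mult[OF r IH(2)])
    moreover have "ev (u * ?P (add_mset g G)) t y = ev u t y * (\<Prod>g\<in>#add_mset g G. y - eval_fps g t)"
      using IH(3) unfolding ev_def s by (subst eval_fps_mult) (use r IH(2) in \<open>auto simp: eval_fps_diff mult_ac\<close>)
    moreover have "ereal (norm t) < fps_conv_radius (fps_nth (u * ?P (add_mset g G)) j)" for j
      unfolding eq by (rule section_at_mult(2)[OF section_at_linear(2)[OF g] IH(1)])
    ultimately show ?case by blast
  qed
  then show ?thesis by blast
qed

text \<open>The bound \<open>geom_bounded2\<close> with the two radii kept apart: the series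
  converges absolutely on the open bidisc |x| < X, |y| < Y.\<close>

definition bidisc_bounded :: "real \<Rightarrow> real \<Rightarrow> 'a::{banach,real_normed_field} fps fps \<Rightarrow> bool" where
  "bidisc_bounded X Y F \<longleftrightarrow> X > 0 \<and> Y > 0 \<and> (\<exists>C. \<forall>i j. norm (fps_nth (fps_nth F j) i) * X ^ i * Y ^ j \<le> C)"

lemma bidisc_bounded_mono:
  assumes "bidisc_bounded X Y F" "0 < X'" "X' \<le> X" "0 < Y'" "Y' \<le> Y"
  shows "bidisc_bounded X' Y' F"
proof -
  obtain C where C: "\<And>i j. norm (fps_nth (fps_nth F j) i) * X ^ i * Y ^ j \<le> C"
    using assms by (auto simp: bidisc_bounded_def)
  have "norm (fps_nth (fps_nth F j) i) * X' ^ i * Y' ^ j \<le> C" for i j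
    by (rule order_trans[OF _ C[of j i]]) (use assms in \<open>auto intro!: mult_mono power_mono\<close>)
  then show ?thesis using assms by (auto simp: bidisc_bounded_def)
qed

lemma geom_bounded2_imp_bidisc_bounded:
  assumes "geom_bounded2 F"
  shows "\<exists>X>0. bidisc_bounded X X F"
proof -
  obtain C R where F: "C \<ge> 1" "R \<ge> 1" "\<And>i j. norm (fps_nth (fps_nth F j) i) \<le> C * R ^ (i + j)"
    using geom_bounded2E[OF assms(1)] by metis
  have "norm (fps_nth (fps_nth F j) i) * (1 / R) ^ i * (1 / R) ^ j \<le> C" for i j
    using F(3)[of j i] F(2) by (simp add: power_divide field_simps power_add)
  then have "bidisc_bounded (1 / R) (1 / R) F" using F by (auto simp: bidisc_bounded_def)
  then show ?thesis using F by (intro exI[of _ "1 / R"]) auto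
qed

lemma bidisc_bounded_imp_geom_bounded2:
  assumes "bidisc_bounded X Y F"
  shows "geom_bounded2 F"
proof -
  obtain C where C: "\<And>i j. norm (fps_nth (fps_nth F j) i) * X ^ i * Y ^ j \<le> C" and XY: "X > 0" "Y > 0"
    using assms by (auto simp: bidisc_bounded_def)
  define R where "R = max (1 / X) (1 / Y)"
  have "C \<ge> 0" using order_trans[OF _ C[of 0 0]] by simp
  have R: "R \<ge> 0" "1 / X \<le> R" "1 / Y \<le> R" using XY by (auto simp: R_def le_max_iff_disj)
  have "norm (fps_nth (fps_nth F j) i) \<le> C * R ^ (i + j)" for i j
  proof -
    have "norm (fps_nth (fps_nth F j) i) = (norm (fps_nth (fps_nth F j) i) * X ^ i * Y ^ j) * ((1 / X) ^ i * (1 / Y) ^ j)"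
      using XY by (simp add: power_divide)
    also have "\<dots> \<le> C * (R ^ i * R ^ j)"
      using XY \<open>C \<ge> 0\<close> R by (intro mult_mono C power_mono) auto
    finally show ?thesis by (simp add: power_add)
  qed
  then show ?thesis by (auto simp: geom_bounded2_def)
qed

text \<open>The third part is uniform in t and feeds the Weierstrass test in
  \<open>ev_continuous\<close>.\<close>

lemma section_at_bounded:
  fixes F :: "'a::{banach,real_normed_field} fps fps"
  assumes "bidisc_bounded X Y F"
  shows "ereal X \<le> fps_conv_radius (fps_nth F j)"
    and "norm t < X \<Longrightarrow> ereal Y \<le> fps_conv_radius (section_at F t)"
    and "r < X \<Longrightarrow> \<exists>C. \<forall>t j. norm t \<le> r \<longrightarrow> norm (eval_fps (fps_nth F j) t) * Y ^ j \<le> C"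
proof -
  obtain C where C: "\<And>i j. norm (fps_nth (fps_nth F j) i) * X ^ i * Y ^ j \<le> C" and XY: "X > 0" "Y > 0"
    using assms by (auto simp: bidisc_bounded_def)
  have C0: "C \<ge> 0" using order_trans[OF _ C[of 0 0]] by simp
  have b: "norm (fps_nth (fps_nth F j) i) * X ^ i \<le> C / Y ^ j" for i j
    using C[of j i] XY by (simp add: field_simps)
  show "ereal X \<le> fps_conv_radius (fps_nth F j)" by (rule eval_fps_bounded(1)[OF b XY(1)])
  have e: "norm (eval_fps (fps_nth F j) t) * Y ^ j \<le> C * (X / (X - norm t))" if "norm t < X" for t :: 'a and j
  proof -
    have "norm (eval_fps (fps_nth F j) t) * Y ^ j \<le> C / Y ^ j * (X / (X - norm t)) * Y ^ j"
      by (rule mult_right_mono[OF eval_fps_bounded(2)[OF b XY(1) that]]) (use XY in auto)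
    then show ?thesis using XY by simp
  qed
  show "ereal Y \<le> fps_conv_radius (section_at F t)" if "norm t < X"
    by (rule eval_fps_bounded(1)[OF _ XY(2)]) (use e[OF that] in simp)
  show "\<exists>C. \<forall>t j. norm t \<le> r \<longrightarrow> norm (eval_fps (fps_nth F j) t) * Y ^ j \<le> C" if "r < X"
  proof (intro exI allI impI)
    fix t :: 'a and j assume t: "norm t \<le> r"
    have "norm (eval_fps (fps_nth F j) t) * Y ^ j \<le> C * (X / (X - norm t))"
      by (rule e) (use t that in auto)
    also have "\<dots> \<le> C * (X / (X - r))"
      using t that XY C0 by (intro mult_left_mono divide_left_mono mult_pos_pos) auto
    finally show "norm (eval_fps (fps_nth F j) t) * Y ^ j \<le> C * (X / (X - r))" .
  qed
qed

context
  fixes F :: "'a::{banach,real_normed_field} fps fps" and X Y :: real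
  assumes F: "bidisc_bounded X Y F"
begin

lemma conv_coeff: "norm t < X \<Longrightarrow> ereal (norm t) < fps_conv_radius (fps_nth F j)"
  by (rule less_le_trans[OF _ section_at_bounded(1)[OF F]]) simp

lemma conv_section: "norm t < X \<Longrightarrow> norm y < Y \<Longrightarrow> ereal (norm y) < fps_conv_radius (section_at F t)"
  by (rule less_le_trans[OF _ section_at_bounded(2)[OF F]]) simp_all

lemma section_at_deriv:
  assumes "norm t < X"
  shows "section_at (fps_deriv F) t = fps_deriv (section_at F t)"
proof (rule fps_ext)
  fix n
  have "eval_fps (fps_const (of_nat (n + 1)) * fps_nth F (n + 1)) t = of_nat (n + 1) * eval_fps (fps_nth F (n + 1)) t"
    using conv_coeff[OF assms, of "n + 1"] by (subst eval_fps_mult) auto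
  then show "fps_nth (section_at (fps_deriv F) t) n = fps_nth (fps_deriv (section_at F t)) n"
    unfolding section_at_nth fps_deriv_nth by (simp only: fps_of_nat)
qed

lemma ev_has_derivative:
  assumes "norm t < X" "norm y < Y"
  shows "((\<lambda>y. ev F t y) has_field_derivative ev (fps_deriv F) t y) (at y within A)"
  unfolding ev_def section_at_deriv[OF assms(1)]
  using has_field_derivative_eval_fps[OF conv_section[OF assms]] .

text \<open>Weierstrass test on a smaller closed bidisc, where the j-th summand is at most C (s /
  Y)^j uniformly in t.\<close>

lemma ev_continuous: "continuous_on (ball 0 X \<times> ball 0 Y) (\<lambda>(t, y). ev F t y)"
proof (rule continuous_at_imp_continuous_on, safe)
  fix t y :: 'a assume ty: "t \<in> ball 0 X" "y \<in> ball 0 Y"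
  obtain r s where rs: "norm t < r" "r < X" "norm y < s" "s < Y"
    using ty dense[of "norm t" X] dense[of "norm y" Y] by auto
  obtain C where C: "\<And>t j. norm t \<le> r \<Longrightarrow> norm (eval_fps (fps_nth F j) t) * Y ^ j \<le> C"
    using section_at_bounded(3)[OF F rs(2)] by blast
  have Y: "Y > 0" using F by (simp add: bidisc_bounded_def)
  let ?K = "cball 0 r \<times> cball 0 s :: ('a \<times> 'a) set"
  have "uniform_limit ?K (\<lambda>n x. \<Sum>j<n. eval_fps (fps_nth F j) (fst x) * snd x ^ j)
      (\<lambda>x. \<Sum>j. eval_fps (fps_nth F j) (fst x) * snd x ^ j) sequentially"
  proof (rule Weierstrass_m_test)
    show "summable (\<lambda>j. C * (s / Y) ^ j)"
      using rs Y order_le_less_trans[OF norm_ge_zero rs(3)] by (intro summable_mult summable_geometric) auto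
    fix j and x :: "'a \<times> 'a" assume x: "x \<in> ?K"
    have "C \<ge> 0" using order_trans[OF _ C[of "fst x" 0]] x by auto
    have "norm (eval_fps (fps_nth F j) (fst x) * snd x ^ j) =
        (norm (eval_fps (fps_nth F j) (fst x)) * Y ^ j) * (norm (snd x) / Y) ^ j"
      using Y by (simp add: norm_mult norm_power power_divide)
    also have "\<dots> \<le> C * (s / Y) ^ j"
      using x Y \<open>C \<ge> 0\<close> by (intro mult_mono C power_mono divide_right_mono) auto
    finally show "norm (eval_fps (fps_nth F j) (fst x) * snd x ^ j) \<le> C * (s / Y) ^ j" .
  qed
  moreover have "continuous_on ?K (\<lambda>x. \<Sum>j<n. eval_fps (fps_nth F j) (fst x) * snd x ^ j)" for n
  proof -
    have "fst ` ?K \<subseteq> eball 0 (fps_conv_radius (fps_nth F j))" for j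
    proof safe
      fix x :: 'a and y :: 'a assume "x \<in> cball 0 r"
      then have "norm x < X" using rs by auto
      then show "fst (x, y) \<in> eball 0 (fps_conv_radius (fps_nth F j))" using conv_coeff by simp
    qed
    then show ?thesis by (intro continuous_intros)
  qed
  ultimately have "continuous_on ?K (\<lambda>x. \<Sum>j. eval_fps (fps_nth F j) (fst x) * snd x ^ j)"
    using uniform_limit_theorem[OF always_eventually] by (metis (no_types, lifting) trivial_limit_sequentially)
  then have "continuous_on ?K (\<lambda>(t, y). ev F t y)"
    by (simp add: ev_def eval_fps_def case_prod_beta)
  then have "continuous_on (ball 0 r \<times> ball 0 s) (\<lambda>(t, y). ev F t y)"
    by (rule continuous_on_subset) auto
  then show "isCont (\<lambda>(t, y). ev F t y) (t, y)"
    using rs by (subst (asm) continuous_on_eq_continuous_at) (auto intro: open_Times)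
qed

text \<open>The factor j + 1 of the derivative is absorbed by (Y' / Y)^(j+1), at the price of a
  smaller radius in y.\<close>

lemma bidisc_bounded_deriv:
  assumes "0 < Y'" "Y' < Y"
  shows "bidisc_bounded X Y' (fps_deriv F)"
proof -
  obtain C where C: "\<And>i j. norm (fps_nth (fps_nth F j) i) * X ^ i * Y ^ j \<le> C" and XY: "X > 0" "Y > 0"
    using F by (auto simp: bidisc_bounded_def)
  have C0: "C \<ge> 0" using order_trans[OF _ C[of 0 0]] by simp
  define \<theta> where "\<theta> = Y' / Y"
  have \<theta>: "0 < \<theta>" "\<theta> < 1" using assms XY by (auto simp: \<theta>_def)
  have "(\<lambda>n. real n * \<theta> ^ n) \<longlonglongrightarrow> 0" using \<theta> by (intro powser_times_n_limit_0) auto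
  then have "Bseq (\<lambda>n. real n * \<theta> ^ n)" by (intro convergent_imp_Bseq convergentI)
  then obtain B where B: "B > 0" "\<And>n. norm (real n * \<theta> ^ n) \<le> B" by (auto simp: Bseq_def)
  have "norm (fps_nth (fps_nth (fps_deriv F) j) i) * X ^ i * Y' ^ j \<le> C * B / Y'" for i j
  proof -
    have "fps_nth (of_nat c * a) i = of_nat c * fps_nth a i" for c and a :: "'a fps"
      by (metis fps_mult_left_const_nth fps_of_nat)
    then have "norm (fps_nth (fps_nth (fps_deriv F) j) i) = real (j + 1) * norm (fps_nth (fps_nth F (j + 1)) i)"
      by (simp add: norm_mult del: of_nat_Suc)
    then have "norm (fps_nth (fps_nth (fps_deriv F) j) i) * X ^ i * Y' ^ j =
        (norm (fps_nth (fps_nth F (j + 1)) i) * X ^ i * Y ^ (j + 1)) * (real (j + 1) * \<theta> ^ (j + 1)) / Y'"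
      using assms XY by (simp add: \<theta>_def power_divide del: of_nat_Suc)
    also have "\<dots> \<le> C * B / Y'"
      using assms C0 XY B \<theta> by (intro divide_right_mono mult_mono C order_trans[OF _ B(2)[of "j + 1"]]) auto
    finally show ?thesis .
  qed
  then show ?thesis using assms XY by (auto simp: bidisc_bounded_def)
qed

end

lemma ev_mult_bounded:
  assumes "bidisc_bounded X Y F" "bidisc_bounded X Y G" "norm t < X" "norm y < Y"
  shows "ev (F * G) t y = ev F t y * ev G t y"
  unfolding ev_def
  by (subst section_at_mult(1)) (use assms in \<open>auto intro!: eval_fps_mult conv_coeff conv_section\<close>)

lemma summable_bidisc:
  fixes f :: "real fps fps"
  assumes "bidisc_bounded X Y f" "\<bar>x\<bar> < X" "\<bar>y\<bar> < Y"
  shows "(\<lambda>(i, j). fps_nth (fps_nth f j) i * x ^ i * y ^ j) summable_on UNIV"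
proof -
  obtain C where C: "\<And>i j. norm (fps_nth (fps_nth f j) i) * X ^ i * Y ^ j \<le> C" and XY: "X > 0" "Y > 0"
    using assms by (auto simp: bidisc_bounded_def)
  have C0: "C \<ge> 0" using order_trans[OF _ C[of 0 0]] by simp
  have geo: "(\<lambda>i. (\<bar>x\<bar> / X) ^ i) summable_on UNIV" "(\<lambda>j. (\<bar>y\<bar> / Y) ^ j) summable_on UNIV"
    using assms XY by (auto intro!: norm_summable_imp_summable_on summable_geometric simp: norm_power)
  have "(\<lambda>(i::nat, j::nat). C * ((\<bar>x\<bar> / X) ^ i * (\<bar>y\<bar> / Y) ^ j)) summable_on (UNIV \<times> UNIV)"
  proof (rule summable_on_SigmaI)
    fix i :: nat
    show "((\<lambda>j. case (i, j) of (i, j) \<Rightarrow> C * ((\<bar>x\<bar> / X) ^ i * (\<bar>y\<bar> / Y) ^ j)) has_sum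
        C * ((\<bar>x\<bar> / X) ^ i * infsum (\<lambda>j. (\<bar>y\<bar> / Y) ^ j) UNIV)) UNIV"
      by (simp, intro has_sum_cmult_right has_sum_infsum geo)
  next
    show "(\<lambda>i. C * ((\<bar>x\<bar> / X) ^ i * infsum (\<lambda>j. (\<bar>y\<bar> / Y) ^ j) UNIV)) summable_on UNIV"
      by (intro summable_on_cmult_right summable_on_cmult_left geo)
  qed (use C0 XY in auto)
  then have S: "(\<lambda>(i::nat, j::nat). C * ((\<bar>x\<bar> / X) ^ i * (\<bar>y\<bar> / Y) ^ j)) summable_on UNIV" by simp
  have "norm (fps_nth (fps_nth f j) i * x ^ i * y ^ j) \<le> C * ((\<bar>x\<bar> / X) ^ i * (\<bar>y\<bar> / Y) ^ j)" for i j
  proof -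
    have "norm (fps_nth (fps_nth f j) i * x ^ i * y ^ j) =
        (norm (fps_nth (fps_nth f j) i) * X ^ i * Y ^ j) * ((\<bar>x\<bar> / X) ^ i * (\<bar>y\<bar> / Y) ^ j)"
      using XY by (simp add: abs_mult power_abs power_divide)
    also have "\<dots> \<le> C * ((\<bar>x\<bar> / X) ^ i * (\<bar>y\<bar> / Y) ^ j)"
      using XY by (intro mult_right_mono C) auto
    finally show ?thesis .
  qed
  then show ?thesis
    by (intro Infinite_Sum.abs_summable_summable[OF Infinite_Sum.abs_summable_on_comparison_test'[OF S]]) auto
qed

text \<open>Fubini for an absolutely summable family; the order of summation is exchanged because
  \<open>ev\<close> sums over the exponents of x first.\<close>

lemma eval2_eq_ev:
  fixes f :: "real fps fps"
  assumes "bidisc_bounded X Y f" "\<bar>x\<bar> < X" "\<bar>y\<bar> < Y"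
  shows "eval2 f x y = ev f x y"
proof -
  let ?a = "\<lambda>i j. fps_nth (fps_nth f j) i * x ^ i * y ^ j"
  have S: "(\<lambda>(i, j). ?a i j) summable_on UNIV \<times> UNIV"
    using summable_bidisc[OF assms] by simp
  have "eval2 f x y = infsum (\<lambda>(i, j). ?a i j) (UNIV \<times> UNIV)" by (simp add: eval2_def)
  also have "\<dots> = infsum (\<lambda>i. infsum (\<lambda>j. ?a i j) UNIV) UNIV"
    using infsum_Sigma_banach[OF S] by simp
  also have "\<dots> = infsum (\<lambda>j. infsum (\<lambda>i. ?a i j) UNIV) UNIV"
    by (rule infsum_swap_banach[OF S])
  also have "\<dots> = infsum (\<lambda>j. eval_fps (fps_nth f j) x * y ^ j) UNIV"
  proof (rule infsum_cong)
    fix j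
    have r: "ereal (norm x) < fps_conv_radius (fps_nth f j)" using conv_coeff[OF assms(1), of x] assms by simp
    have "((\<lambda>i. fps_nth (fps_nth f j) i * x ^ i) has_sum eval_fps (fps_nth f j) x) UNIV"
      by (rule norm_summable_imp_has_sum[OF norm_summable_fps[OF r] sums_eval_fps[OF r]])
    from has_sum_cmult_left[OF this, of "y ^ j"]
    show "infsum (\<lambda>i. ?a i j) UNIV = eval_fps (fps_nth f j) x * y ^ j" by (rule infsumI)
  qed
  also have "\<dots> = ev f x y"
  proof (rule infsumI)
    have r: "ereal (norm y) < fps_conv_radius (section_at f x)" using conv_section[OF assms(1), of x y] assms by simp
    have "((\<lambda>j. fps_nth (section_at f x) j * y ^ j) has_sum eval_fps (section_at f x) y) UNIV"
      by (rule norm_summable_imp_has_sum[OF norm_summable_fps[OF r] sums_eval_fps[OF r]])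
    then show "((\<lambda>j. eval_fps (fps_nth f j) x * y ^ j) has_sum ev f x y) UNIV" by (simp add: ev_def)
  qed
  finally show ?thesis .
qed

text \<open>Summability of a real family is absolute, so every term at the point (X, Y) is bounded
  by the total, and bounded terms at one corner are all that a bidisc requires.\<close>

lemma summable_imp_bidisc_bounded:
  fixes f :: "real fps fps"
  assumes "(\<lambda>(i, j). fps_nth (fps_nth f j) i * X ^ i * Y ^ j) summable_on UNIV" "X > 0" "Y \<noteq> 0"
  shows "bidisc_bounded X \<bar>Y\<bar> f"
proof -
  let ?b = "\<lambda>(i, j). norm (fps_nth (fps_nth f j) i * X ^ i * Y ^ j)"
  have S: "?b summable_on UNIV"
    using iffD1[OF summable_on_iff_abs_summable_on_real assms(1)] by (simp add: case_prod_unfold)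
  have "norm (fps_nth (fps_nth f j) i) * X ^ i * \<bar>Y\<bar> ^ j \<le> infsum ?b UNIV" for i j
    using finite_sum_le_infsum[OF S, of "{(i, j)}"] assms(2)
    by (auto simp: abs_mult power_abs)
  then show ?thesis using assms by (auto simp: bidisc_bounded_def)
qed

text \<open>One point (\<delta>, \<delta>) of the neighbourhood with \<delta> > 0 already bounds all
  coefficients.\<close>

lemma convergent_series_iff: "f \<in> convergent_series \<longleftrightarrow> geom_bounded2 f"
proof
  assume "f \<in> convergent_series"
  then obtain U where U: "open U" "(0, 0) \<in> U"
    "\<forall>(x, y)\<in>U. (\<lambda>(i, j). fps_nth (fps_nth f j) i * x ^ i * y ^ j) summable_on UNIV"
    by (auto simp: convergent_series_def converges_on_def)
  have "((\<lambda>\<delta>::real. (\<delta>, \<delta>)) \<longlongrightarrow> (0, 0)) (at_right 0)" by (intro tendsto_intros)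
  then have "eventually (\<lambda>\<delta>::real. (\<delta>, \<delta>) \<in> U) (at_right 0)" using U by (simp add: tendsto_def)
  then have "eventually (\<lambda>\<delta>::real. (\<delta>, \<delta>) \<in> U \<and> \<delta> > 0) (at_right 0)"
    using eventually_at_right_less by (rule eventually_conj)
  then obtain \<delta> :: real where "(\<delta>, \<delta>) \<in> U" "\<delta> > 0"
    using eventually_happens'[OF trivial_limit_at_right_real] by blast
  then show "geom_bounded2 f"
    using summable_imp_bidisc_bounded[of f \<delta> \<delta>] U by (auto intro: bidisc_bounded_imp_geom_bounded2)
next
  assume "geom_bounded2 f"
  then obtain X where X: "X > 0" "bidisc_bounded X X f"
    using geom_bounded2_imp_bidisc_bounded[of f] by metis
  have "(\<lambda>(i, j). fps_nth (fps_nth f j) i * x ^ i * y ^ j) summable_on UNIV" if "x \<in> ball 0 X" "y \<in> ball 0 X" for x y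
    using summable_bidisc[OF X(2), of x y] that by simp
  then show "f \<in> convergent_series"
    unfolding convergent_series_def converges_on_def using X
    by (auto intro!: exI[of _ "ball 0 X \<times> ball 0 X"] open_Times)
qed

lemma geom_bounded_iff_radius:
  fixes g :: "'a::{banach,real_normed_field} fps"
  shows "geom_bounded g \<longleftrightarrow> fps_conv_radius g > 0"
proof
  assume "geom_bounded g"
  then obtain C R where g: "C \<ge> 1" "R \<ge> 1" "\<And>i. norm (fps_nth g i) \<le> C * R ^ i"
    using geom_boundedE[of g] by metis
  have "norm (fps_nth g i) * (1 / R) ^ i \<le> C" for i
    using g by (simp add: power_divide field_simps)
  then have "ereal (1 / R) \<le> fps_conv_radius g" by (rule eval_fps_bounded(1)) (use g in auto)
  moreover have "0 < ereal (1 / R)" using g by simp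
  ultimately show "fps_conv_radius g > 0" by (rule less_le_trans[rotated])
next
  assume "fps_conv_radius g > 0"
  then obtain r where r: "0 < ereal r" "ereal r < fps_conv_radius g" using ereal_dense2 by blast
  then have "summable (\<lambda>n. norm (fps_nth g n * of_real r ^ n))"
    by (intro norm_summable_fps) auto
  then have "Bseq (\<lambda>n. norm (fps_nth g n * of_real r ^ n))"
    by (intro convergent_imp_Bseq convergentI[OF summable_LIMSEQ_zero])
  then obtain B where B: "\<And>n. norm (norm (fps_nth g n * of_real r ^ n)) \<le> B" by (auto simp: Bseq_def)
  show "geom_bounded g"
  proof (rule geom_boundedI_seq)
    fix n
    show "norm (fps_nth g n) \<le> B * (1 / r) ^ n"
      using B[of n] r by (simp add: norm_mult norm_power power_divide field_simps)
  qed
qed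

section \<open>The topology of the contact tree\<close>

text \<open>The complement of a member of such a cover is the union of the other members, so each
  member is open, closed and connected.\<close>

lemma connected_components_of_eqI:
  assumes "\<And>C. C \<in> \<U> \<Longrightarrow> connectedin X C \<and> openin X C \<and> C \<noteq> {}" "\<Union>\<U> = topspace X"
    and "\<And>C D. C \<in> \<U> \<Longrightarrow> D \<in> \<U> \<Longrightarrow> C \<inter> D \<noteq> {} \<Longrightarrow> C = D"
  shows "connected_components_of X = \<U>"
proof -
  have comp: "connected_component_of_set X x = C" if "C \<in> \<U>" "x \<in> C" for C x
  proof
    show "C \<subseteq> connected_component_of_set X x"
      using assms(1)[OF that(1)] that(2) by (intro connected_component_of_maximal) auto
    have "topspace X - C = \<Union>(\<U> - {C})" using assms(2,3) that by auto
    moreover have "openin X (\<Union>(\<U> - {C}))" by (rule openin_Union) (use assms(1) in auto)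
    ultimately have cl: "closedin X C"
      using assms(1)[OF that(1)] by (simp add: closedin_def openin_subset)
    have "connected_component_of_set X x \<subseteq> C \<or> disjnt (connected_component_of_set X x) C"
      by (rule connectedin_clopen_cases[OF connectedin_connected_component_of cl]) (use assms(1)[OF that(1)] in blast)
    moreover have "x \<in> connected_component_of_set X x"
      using that assms(2) by (auto simp: connected_component_of_refl)
    ultimately show "connected_component_of_set X x \<subseteq> C" using that(2) by (auto simp: disjnt_def)
  qed
  show ?thesis
  proof
    show "connected_components_of X \<subseteq> \<U>"
    proof
      fix D assume "D \<in> connected_components_of X"
      then obtain x where x: "x \<in> topspace X" "D = connected_component_of_set X x"
        unfolding connected_components_of_def by auto
      then obtain C where "C \<in> \<U>" "x \<in> C" using assms(2) by auto
      then show "D \<in> \<U>" using comp x by simp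
    qed
    show "\<U> \<subseteq> connected_components_of X"
    proof
      fix C assume C: "C \<in> \<U>"
      then obtain x where "x \<in> C" using assms(1) by blast
      then show "C \<in> connected_components_of X"
        unfolding connected_components_of_def using comp[OF C] C assms(2)
        by (intro image_eqI[of _ _ x]) auto
    qed
  qed
qed

lemma openin_prod_discrete:
  "openin (prod_topology (discrete_topology A) X) W \<longleftrightarrow>
     W \<subseteq> A \<times> topspace X \<and> (\<forall>a\<in>A. openin X {t. (a, t) \<in> W})"
proof
  assume W: "openin (prod_topology (discrete_topology A) X) W"
  have "openin X {t. (a, t) \<in> W}" if "a \<in> A" for a
  proof -
    have "continuous_map X (prod_topology (discrete_topology A) X) (\<lambda>t. (a, t))"
      using that by (intro continuous_map_pairedI) auto
    from openin_continuous_map_preimage[OF this W]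
    have "openin X {t \<in> topspace X. (a, t) \<in> W}" .
    moreover have "{t \<in> topspace X. (a, t) \<in> W} = {t. (a, t) \<in> W}" using openin_subset[OF W] by auto
    ultimately show ?thesis by simp
  qed
  then show "W \<subseteq> A \<times> topspace X \<and> (\<forall>a\<in>A. openin X {t. (a, t) \<in> W})"
    using openin_subset[OF W] by simp
next
  assume W: "W \<subseteq> A \<times> topspace X \<and> (\<forall>a\<in>A. openin X {t. (a, t) \<in> W})"
  then have "W = (\<Union>a\<in>A. {a} \<times> {t. (a, t) \<in> W})" by auto
  moreover have "openin (prod_topology (discrete_topology A) X) (\<Union>a\<in>A. {a} \<times> {t. (a, t) \<in> W})"
    using W by (intro openin_Union) (auto simp: openin_prod_Times_iff)
  ultimately show "openin (prod_topology (discrete_topology A) X) W" by simp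
qed

text \<open>\<open>exp (- d \<xi> \<eta>)\<close> is an ultrametric on the set of branches.\<close>

locale contact_set =
  fixes A :: "real pseries set" and d :: "real pseries \<Rightarrow> real pseries \<Rightarrow> ereal"
  defines d_def: "d \<equiv> \<lambda>\<xi> \<eta>. valuation (\<eta> - \<xi>)"
  assumes fin: "finite A" and ne: "A \<noteq> {}"
    and d_sym: "\<And>\<xi> \<eta>. \<xi> \<in> A \<Longrightarrow> \<eta> \<in> A \<Longrightarrow> d \<xi> \<eta> = d \<eta> \<xi>"
    and d_pos: "\<And>\<xi> \<eta>. \<xi> \<in> A \<Longrightarrow> \<eta> \<in> A \<Longrightarrow> 0 < d \<xi> \<eta>"
    and d_inf: "\<And>\<xi> \<eta>. \<xi> \<in> A \<Longrightarrow> \<eta> \<in> A \<Longrightarrow> d \<xi> \<eta> = \<infinity> \<longleftrightarrow> \<xi> = \<eta>"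
    and d_ultra: "\<And>\<xi> \<eta> \<zeta>. \<xi> \<in> A \<Longrightarrow> \<eta> \<in> A \<Longrightarrow> \<zeta> \<in> A \<Longrightarrow> min (d \<xi> \<eta>) (d \<eta> \<zeta>) \<le> d \<xi> \<zeta>"
begin

abbreviation "T \<equiv> contact_tree A"
abbreviation "base \<equiv> contact_root A"
abbreviation "leaf \<equiv> contact_leaf A"

definition pt :: "real pseries \<Rightarrow> ereal \<Rightarrow> contact_point" where
  "pt \<xi> t = contact_class A (\<xi>, t)"

lemma d_le: "r \<le> d \<xi> \<eta> \<Longrightarrow> r \<le> d \<eta> \<zeta> \<Longrightarrow> \<xi> \<in> A \<Longrightarrow> \<eta> \<in> A \<Longrightarrow> \<zeta> \<in> A \<Longrightarrow> r \<le> d \<xi> \<zeta>"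
  using d_ultra[of \<xi> \<eta> \<zeta>] by (meson min.boundedI order_trans)

lemma d_less: "r < d \<xi> \<eta> \<Longrightarrow> r < d \<eta> \<zeta> \<Longrightarrow> \<xi> \<in> A \<Longrightarrow> \<eta> \<in> A \<Longrightarrow> \<zeta> \<in> A \<Longrightarrow> r < d \<xi> \<zeta>"
  using d_ultra[of \<xi> \<eta> \<zeta>] by (meson min_less_iff_conj less_le_trans)

lemma d_self: "\<xi> \<in> A \<Longrightarrow> d \<xi> \<xi> = \<infinity>"
  using d_inf by blast

text \<open>Isosceles property of an ultrametric: the smallest of three contact orders occurs
  twice.\<close>

lemma d_transfer:
  assumes "\<xi> \<in> A" "\<eta> \<in> A" "\<zeta> \<in> A" "d \<xi> \<eta> < d \<xi> \<zeta>"
  shows "d \<zeta> \<eta> = d \<xi> \<eta>"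
proof (rule antisym)
  show "d \<xi> \<eta> \<le> d \<zeta> \<eta>"
    using d_le[of "d \<xi> \<eta>" \<zeta> \<xi> \<eta>] assms d_sym by auto
  show "d \<zeta> \<eta> \<le> d \<xi> \<eta>"
  proof (rule ccontr)
    assume "\<not> d \<zeta> \<eta> \<le> d \<xi> \<eta>"
    then have "d \<xi> \<eta> < d \<xi> \<eta>" using d_less[of "d \<xi> \<eta>" \<xi> \<zeta> \<eta>] assms by (meson not_le)
    then show False by simp
  qed
qed

lemma pt_mem: "(\<eta>, s) \<in> pt \<xi> t \<longleftrightarrow> \<eta> \<in> A \<and> s = t \<and> t \<le> d \<xi> \<eta>"
  by (auto simp: pt_def contact_class_def d_def)

lemma pt_eq_iff:
  assumes "\<xi> \<in> A" "\<eta> \<in> A"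
  shows "pt \<xi> s = pt \<eta> t \<longleftrightarrow> s = t \<and> s \<le> d \<xi> \<eta>"
proof
  assume "pt \<xi> s = pt \<eta> t"
  moreover have "(\<eta>, t) \<in> pt \<eta> t" using assms by (simp add: pt_mem d_self)
  ultimately show "s = t \<and> s \<le> d \<xi> \<eta>" using pt_mem by blast
next
  assume st: "s = t \<and> s \<le> d \<xi> \<eta>"
  have "(\<zeta>, u) \<in> pt \<xi> s \<longleftrightarrow> (\<zeta>, u) \<in> pt \<eta> t" for \<zeta> u
    unfolding pt_mem using st assms d_le d_sym by metis
  then show "pt \<xi> s = pt \<eta> t" by (metis subsetI subset_antisym surj_pair)
qed

lemma pt_eqI: "\<xi> \<in> A \<Longrightarrow> \<eta> \<in> A \<Longrightarrow> s \<le> d \<xi> \<eta> \<Longrightarrow> pt \<xi> s = pt \<eta> s"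
  by (simp add: pt_eq_iff)

lemma top_T: "topspace T = {pt \<xi> t |\<xi> t. \<xi> \<in> A \<and> 0 \<le> t}"
proof -
  have "topspace T = contact_class A ` (A \<times> {0..\<infinity>})"
    using quotient_imp_surjective_map[OF quotient_map_quotient_topology]
    by (metis contact_tree_def topspace_prod_topology topspace_discrete_topology topspace_euclidean_subtopology)
  then show ?thesis unfolding pt_def by auto blast
qed

lemma pt_in_T: "\<xi> \<in> A \<Longrightarrow> 0 \<le> t \<Longrightarrow> pt \<xi> t \<in> topspace T"
  unfolding top_T by blast

text \<open>The tree is a quotient of finitely many copies of [0, \<infinity>], so openness is
  tested branch by branch, and the topology of the tree reduces to that of the interval.\<close>

lemma open_T:
  "openin T U \<longleftrightarrow> U \<subseteq> topspace T \<and> (\<forall>\<xi>\<in>A. openin (top_of_set {0..\<infinity>}) {t \<in> {0..\<infinity>}. pt \<xi> t \<in> U})"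
proof -
  have "openin T U \<longleftrightarrow> U \<subseteq> contact_class A ` (A \<times> {0..\<infinity>}) \<and>
     openin (prod_topology (discrete_topology A) (top_of_set {0..\<infinity>})) {x \<in> A \<times> {0..\<infinity>}. contact_class A x \<in> U}"
    unfolding contact_tree_def openin_quotient_topology by simp
  also have "\<dots> \<longleftrightarrow> U \<subseteq> topspace T \<and> (\<forall>\<xi>\<in>A. openin (top_of_set {0..\<infinity>}) {t \<in> {0..\<infinity>}. pt \<xi> t \<in> U})"
  proof (rule conj_cong)
    show "U \<subseteq> contact_class A ` (A \<times> {0..\<infinity>}) \<longleftrightarrow> U \<subseteq> topspace T"
    proof -
      have "contact_class A ` (A \<times> {0..\<infinity>}) = topspace T" unfolding top_T pt_def by auto blast
      then show ?thesis by simp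
    qed
    show "openin (prod_topology (discrete_topology A) (top_of_set {0..\<infinity>})) {x \<in> A \<times> {0..\<infinity>}. contact_class A x \<in> U} \<longleftrightarrow>
      (\<forall>\<xi>\<in>A. openin (top_of_set {0..\<infinity>}) {t \<in> {0..\<infinity>}. pt \<xi> t \<in> U})"
      unfolding openin_prod_discrete by (auto simp: pt_def cong: conj_cong)
  qed
  finally show ?thesis .
qed

lemma branch_continuous:
  assumes "\<xi> \<in> A"
  shows "continuous_map (top_of_set {0..\<infinity>}) T (pt \<xi>)"
  unfolding continuous_map_def using open_T pt_in_T assms by auto

lemma branch_connected:
  assumes "\<xi> \<in> A" "connected S" "S \<subseteq> {0..}"
  shows "connectedin T (pt \<xi> ` S)"
  by (rule connectedin_continuous_map_image[OF branch_continuous[OF assms(1)]])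
     (use assms in \<open>auto simp: connectedin_subtopology\<close>)

lemma open_halfline: "openin (top_of_set {0..\<infinity>}) {t \<in> {0..\<infinity>}. r < (t::ereal)}"
  "openin (top_of_set {0..\<infinity>}) {t \<in> {0..\<infinity>}. (t::ereal) < r}"
  "openin (top_of_set {0..\<infinity>}) {t \<in> {0..\<infinity>}. r < (t::ereal) \<and> t < s}"
proof -
  have eq: "{t \<in> {0..\<infinity>}. r < t} = {0..\<infinity>} \<inter> {r<..}" "{t \<in> {0..\<infinity>}. t < r} = {0..\<infinity>} \<inter> {..<r}"
    "{t \<in> {0..\<infinity>}. r < t \<and> t < s} = {0..\<infinity>} \<inter> {r<..<s}" by auto
  show "openin (top_of_set {0..\<infinity>}) {t \<in> {0..\<infinity>}. r < (t::ereal)}"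
    "openin (top_of_set {0..\<infinity>}) {t \<in> {0..\<infinity>}. (t::ereal) < r}"
    "openin (top_of_set {0..\<infinity>}) {t \<in> {0..\<infinity>}. r < (t::ereal) \<and> t < s}"
    unfolding eq by (intro openin_open_Int; simp)+
qed

lemma open_all: "openin (top_of_set {0..\<infinity>}) {t. 0 \<le> (t::ereal)}"
proof -
  have "{t. 0 \<le> (t::ereal)} = {0..\<infinity>}" by auto
  then show ?thesis by simp
qed

text \<open>Three open pieces around the point \<open>pt \<xi> r\<close>: \<open>cone_open\<close>
  is everything strictly above it, \<open>cone\<close> the single component above it towards \<xi>,
  \<open>below\<close> everything that is not at or above it.\<close>

definition cone_open :: "real pseries \<Rightarrow> ereal \<Rightarrow> contact_point set" where
  "cone_open \<xi> r = {pt \<eta> t |\<eta> t. \<eta> \<in> A \<and> r \<le> d \<xi> \<eta> \<and> r < t \<and> 0 \<le> t}"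

definition cone :: "real pseries \<Rightarrow> ereal \<Rightarrow> contact_point set" where
  "cone \<xi> r = {pt \<eta> t |\<eta> t. \<eta> \<in> A \<and> r < d \<xi> \<eta> \<and> r < t \<and> 0 \<le> t}"

definition below :: "real pseries \<Rightarrow> ereal \<Rightarrow> contact_point set" where
  "below \<xi> r = {pt \<eta> t |\<eta> t. \<eta> \<in> A \<and> \<not> (r \<le> d \<xi> \<eta> \<and> r \<le> t) \<and> 0 \<le> t}"

lemma pt_in_cone_open:
  assumes "\<xi> \<in> A" "\<eta> \<in> A" "0 \<le> t"
  shows "pt \<eta> t \<in> cone_open \<xi> r \<longleftrightarrow> r \<le> d \<xi> \<eta> \<and> r < t"
proof
  assume "pt \<eta> t \<in> cone_open \<xi> r"
  then obtain \<zeta> where z: "\<zeta> \<in> A" "r \<le> d \<xi> \<zeta>" "r < t" "t \<le> d \<eta> \<zeta>"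
    using assms by (auto simp: cone_open_def pt_eq_iff)
  then show "r \<le> d \<xi> \<eta> \<and> r < t"
    using d_le[of r \<xi> \<zeta> \<eta>] d_sym[of \<eta> \<zeta>] assms by (auto intro: order_trans less_imp_le)
qed (use assms in \<open>auto simp: cone_open_def\<close>)

lemma pt_in_cone:
  assumes "\<xi> \<in> A" "\<eta> \<in> A" "0 \<le> t"
  shows "pt \<eta> t \<in> cone \<xi> r \<longleftrightarrow> r < d \<xi> \<eta> \<and> r < t"
proof
  assume "pt \<eta> t \<in> cone \<xi> r"
  then obtain \<zeta> where z: "\<zeta> \<in> A" "r < d \<xi> \<zeta>" "r < t" "t \<le> d \<eta> \<zeta>"
    using assms by (auto simp: cone_def pt_eq_iff)
  then show "r < d \<xi> \<eta> \<and> r < t"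
    using d_less[of r \<xi> \<zeta> \<eta>] d_sym[of \<eta> \<zeta>] assms by (auto intro: less_le_trans)
qed (use assms in \<open>auto simp: cone_def\<close>)

lemma pt_in_below:
  assumes "\<xi> \<in> A" "\<eta> \<in> A" "0 \<le> t"
  shows "pt \<eta> t \<in> below \<xi> r \<longleftrightarrow> \<not> (r \<le> d \<xi> \<eta> \<and> r \<le> t)"
proof
  assume "pt \<eta> t \<in> below \<xi> r"
  then obtain \<zeta> where z: "\<zeta> \<in> A" "\<not> (r \<le> d \<xi> \<zeta> \<and> r \<le> t)" "t \<le> d \<eta> \<zeta>"
    using assms by (auto simp: below_def pt_eq_iff)
  show "\<not> (r \<le> d \<xi> \<eta> \<and> r \<le> t)"
  proof
    assume "r \<le> d \<xi> \<eta> \<and> r \<le> t"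
    then have "r \<le> d \<xi> \<zeta>" using d_le[of r \<xi> \<eta> \<zeta>] z assms by (auto intro: order_trans)
    then show False using z \<open>r \<le> d \<xi> \<eta> \<and> r \<le> t\<close> by auto
  qed
qed (use assms in \<open>auto simp: below_def\<close>)

lemma open_cones:
  assumes "\<xi> \<in> A"
  shows "openin T (cone_open \<xi> r)" "openin T (cone \<xi> r)" "openin T (below \<xi> r)"
proof -
  have "cone_open \<xi> r \<subseteq> topspace T" "cone \<xi> r \<subseteq> topspace T" "below \<xi> r \<subseteq> topspace T"
    by (auto simp: cone_open_def cone_def below_def pt_in_T)
  moreover have "openin (top_of_set {0..\<infinity>}) {t \<in> {0..\<infinity>}. pt \<eta> t \<in> cone_open \<xi> r}" if "\<eta> \<in> A" for \<eta>
    using open_halfline(1)[of r] assms that by (cases "r \<le> d \<xi> \<eta>") (simp_all add: pt_in_cone_open cong: conj_cong)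
  moreover have "openin (top_of_set {0..\<infinity>}) {t \<in> {0..\<infinity>}. pt \<eta> t \<in> cone \<xi> r}" if "\<eta> \<in> A" for \<eta>
    using open_halfline(1)[of r] assms that by (cases "r < d \<xi> \<eta>") (simp_all add: pt_in_cone cong: conj_cong)
  moreover have "openin (top_of_set {0..\<infinity>}) {t \<in> {0..\<infinity>}. pt \<eta> t \<in> below \<xi> r}" if "\<eta> \<in> A" for \<eta>
    using open_halfline(2)[of r] open_all assms that
    by (cases "r \<le> d \<xi> \<eta>") (simp_all add: pt_in_below not_le cong: conj_cong)
  ultimately show "openin T (cone_open \<xi> r)" "openin T (cone \<xi> r)" "openin T (below \<xi> r)"
    unfolding open_T by blast+
qed

text \<open>A connected set that misses an inner point \<open>pt \<xi> r\<close> would be split by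
  the disjoint open sets \<open>cone_open \<xi> r\<close> and \<open>below \<xi> r\<close>, which
  contain the upper and the lower end.\<close>

lemma segment_branch:
  assumes "\<xi> \<in> A" "0 \<le> s" "s \<le> t"
  shows "segment T (pt \<xi> s) (pt \<xi> t) = pt \<xi> ` {s..t}"
proof
  show "segment T (pt \<xi> s) (pt \<xi> t) \<subseteq> pt \<xi> ` {s..t}"
    unfolding segment_def
    by (rule Inter_lower) (use assms in \<open>auto intro!: branch_connected\<close>)
  show "pt \<xi> ` {s..t} \<subseteq> segment T (pt \<xi> s) (pt \<xi> t)"
    unfolding segment_def
  proof safe
    fix r C assume r: "r \<in> {s..t}" and C: "connectedin T C" "pt \<xi> s \<in> C" "pt \<xi> t \<in> C"
    show "pt \<xi> r \<in> C"
    proof (rule ccontr)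
      assume no: "pt \<xi> r \<notin> C"
      then have st: "s < r" "r < t" using r C by (cases "s = r"; cases "r = t"; auto)+
      have "C \<subseteq> cone_open \<xi> r \<union> below \<xi> r"
      proof
        fix x assume x: "x \<in> C"
        then have "x \<in> topspace T" using connectedin_subset_topspace[OF C(1)] by auto
        then obtain \<eta> u where u: "x = pt \<eta> u" "\<eta> \<in> A" "0 \<le> u" by (auto simp: top_T)
        have "\<not> (u = r \<and> r \<le> d \<xi> \<eta>)" using no x u pt_eq_iff[OF assms(1) u(2), of r u] by auto
        then show "x \<in> cone_open \<xi> r \<union> below \<xi> r"
          unfolding u(1) Un_iff using pt_in_cone_open[OF assms(1) u(2,3), of r] pt_in_below[OF assms(1) u(2,3), of r] by auto
      qed
      moreover have "cone_open \<xi> r \<inter> below \<xi> r \<inter> C = {}"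
      proof -
        have False if "x \<in> cone_open \<xi> r" "x \<in> below \<xi> r" for x
        proof -
          note prem = that
          obtain \<eta> u where u: "x = pt \<eta> u" "\<eta> \<in> A" "0 \<le> u" using prem by (auto simp: cone_open_def)
          then show False using that pt_in_cone_open[OF assms(1) u(2,3)] pt_in_below[OF assms(1) u(2,3)] by auto
        qed
        then show ?thesis by blast
      qed
      moreover have "pt \<xi> t \<in> cone_open \<xi> r" "pt \<xi> s \<in> below \<xi> r"
        using st assms by (auto simp: pt_in_cone_open pt_in_below d_self)
      ultimately show False
        using connectedinD[OF C(1) open_cones(1)[OF assms(1)] open_cones(3)[OF assms(1)]] C by blast
    qed
  qed
qed

lemma root_eq: "\<xi> \<in> A \<Longrightarrow> base = pt \<xi> 0"
  using d_pos by (auto simp: contact_root_def pt_mem less_imp_le)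

lemma leaf_eq: "leaf \<xi> = pt \<xi> \<infinity>"
  by (simp add: contact_leaf_def pt_def)

lemma segment_root: "\<xi> \<in> A \<Longrightarrow> 0 \<le> t \<Longrightarrow> segment T base (pt \<xi> t) = pt \<xi> ` {0..t}"
  using root_eq segment_branch[of \<xi> 0 t] by simp

lemma pt_in_image:
  assumes "\<xi> \<in> A" "\<eta> \<in> A"
  shows "pt \<eta> t \<in> pt \<xi> ` S \<longleftrightarrow> t \<in> S \<and> t \<le> d \<xi> \<eta>"
  using assms pt_eq_iff[OF assms(2,1)] d_sym by (auto simp: image_iff)

text \<open>Two branches that separate above r meet at the height of their contact order, and each
  union of such a branch with that of \<xi> contains the leaf of \<xi>.\<close>

lemma cone_connected:
  assumes "\<xi> \<in> A" "0 \<le> r" "r < \<infinity>"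
  shows "connectedin T (cone \<xi> r)"
proof -
  define S where "S \<eta> = pt \<xi> ` {r<..} \<union> pt \<eta> ` {r<..}" for \<eta>
  have "connectedin T (S \<eta>)" if \<eta>: "\<eta> \<in> A" "r < d \<xi> \<eta>" for \<eta>
    unfolding S_def
  proof (rule connectedin_Un)
    show "connectedin T (pt \<xi> ` {r<..})" "connectedin T (pt \<eta> ` {r<..})"
      using assms \<eta> by (auto intro!: branch_connected)
    have "pt \<xi> (d \<xi> \<eta>) \<in> pt \<xi> ` {r<..}" "pt \<xi> (d \<xi> \<eta>) = pt \<eta> (d \<xi> \<eta>)"
      using \<eta> assms by (auto simp: pt_eq_iff)
    then show "pt \<xi> ` {r<..} \<inter> pt \<eta> ` {r<..} \<noteq> {}" using \<eta> by auto
  qed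
  then have "connectedin T (\<Union>(S ` {\<eta> \<in> A. r < d \<xi> \<eta>}))"
  proof (intro connectedin_Union)
    have "pt \<xi> \<infinity> \<in> S \<eta>" for \<eta> using assms by (auto simp: S_def)
    then show "\<Inter> (S ` {\<eta> \<in> A. r < d \<xi> \<eta>}) \<noteq> {}" by blast
  qed auto
  moreover have "\<Union>(S ` {\<eta> \<in> A. r < d \<xi> \<eta>}) = cone \<xi> r"
    using assms d_self[OF assms(1)] unfolding S_def cone_def by (fastforce intro: less_imp_le order_le_less_trans)
  ultimately show ?thesis by simp
qed

lemma below_connected:
  assumes "\<xi> \<in> A" "0 < r"
  shows "connectedin T (below \<xi> r)"
proof -
  define S where "S \<eta> = pt \<eta> ` (if r \<le> d \<xi> \<eta> then {0..<r} else {0..})" for \<eta>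
  have "connectedin T (S \<eta>)" if "\<eta> \<in> A" for \<eta>
    unfolding S_def by (rule branch_connected[OF that]) auto
  then have "connectedin T (\<Union>(S ` A))"
  proof (intro connectedin_Union)
    have "base \<in> S \<eta>" if "\<eta> \<in> A" for \<eta> using assms that by (auto simp: S_def root_eq[OF that])
    then show "\<Inter> (S ` A) \<noteq> {}" by blast
  qed auto
  moreover have "\<Union>(S ` A) = below \<xi> r"
  proof (intro equalityI subsetI)
    fix x assume "x \<in> \<Union>(S ` A)"
    then obtain \<eta> where \<eta>: "\<eta> \<in> A" "x \<in> S \<eta>" by auto
    then obtain t where t: "x = pt \<eta> t" "0 \<le> t" "\<not> (r \<le> d \<xi> \<eta> \<and> r \<le> t)"
      by (auto simp: S_def split: if_splits)
    then show "x \<in> below \<xi> r" using \<eta> by (auto simp: below_def)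
  next
    fix x assume "x \<in> below \<xi> r"
    then obtain \<eta> t where t: "\<eta> \<in> A" "x = pt \<eta> t" "0 \<le> t" "\<not> (r \<le> d \<xi> \<eta> \<and> r \<le> t)"
      by (auto simp: below_def)
    then have "x \<in> S \<eta>" by (auto simp: S_def)
    then show "x \<in> \<Union>(S ` A)" using t by auto
  qed
  ultimately show ?thesis by simp
qed

section \<open>Vertices, edges, leaves and meets through contact orders\<close>

definition heights :: "real pseries \<Rightarrow> ereal set" where
  "heights \<xi> = insert 0 (d \<xi> ` A)"

lemma heights_finite: "finite (heights \<xi>)" using fin by (simp add: heights_def)

lemma heights_nonneg: "\<xi> \<in> A \<Longrightarrow> h \<in> heights \<xi> \<Longrightarrow> 0 \<le> h"
  using d_pos by (auto simp: heights_def less_imp_le)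

lemma heights_inf: "\<xi> \<in> A \<Longrightarrow> \<infinity> \<in> heights \<xi>"
  by (metis d_self heights_def image_eqI insertI2)

lemma heights_d: "\<eta> \<in> A \<Longrightarrow> d \<xi> \<eta> \<in> heights \<xi>"
  by (simp add: heights_def)

lemma heights_transfer:
  assumes "\<xi> \<in> A" "\<eta> \<in> A" "h \<in> heights \<xi>" "h \<le> d \<xi> \<eta>"
  shows "h \<in> heights \<eta>"
proof (cases "h = 0")
  case False
  then obtain \<zeta> where z: "\<zeta> \<in> A" "h = d \<xi> \<zeta>" using assms(3) by (auto simp: heights_def)
  show ?thesis
  proof (cases "h = d \<xi> \<eta>")
    case True
    then show ?thesis using d_sym[OF assms(1,2)] heights_d[OF assms(1)] by simp
  next
    case False
    then have "d \<eta> \<zeta> = d \<xi> \<zeta>" using assms z by (intro d_transfer) auto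
    then show ?thesis using z heights_d[OF z(1), of \<eta>] by simp
  qed
qed (simp add: heights_def)

lemma cones_eq_iff:
  assumes "\<xi> \<in> A" "\<eta> \<in> A" "0 \<le> h" "h < \<infinity>"
  shows "cone \<xi> h = cone \<eta> h \<longleftrightarrow> h < d \<xi> \<eta>"
proof
  assume "cone \<xi> h = cone \<eta> h"
  moreover have "pt \<eta> \<infinity> \<in> cone \<eta> h" using assms by (simp add: pt_in_cone d_self)
  ultimately show "h < d \<xi> \<eta>" using assms pt_in_cone[of \<xi> \<eta> \<infinity> h] by simp
next
  assume h: "h < d \<xi> \<eta>"
  have "h < d \<xi> \<zeta> \<longleftrightarrow> h < d \<eta> \<zeta>" if "\<zeta> \<in> A" for \<zeta>
    using h that assms d_less[of h \<xi> \<eta> \<zeta>] d_less[of h \<eta> \<xi> \<zeta>] d_sym[of \<xi> \<eta>] by auto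
  then show "cone \<xi> h = cone \<eta> h" unfolding cone_def by metis
qed

text \<open>No component lies below the root and no cone above a leaf; these two exceptions give
  root and leaves valency 1.\<close>

lemma components_punctured:
  assumes "\<xi> \<in> A" "0 \<le> h"
  shows "connected_components_of (subtopology T (topspace T - {pt \<xi> h})) =
    (if h = 0 then {} else {below \<xi> h}) \<union> (if h = \<infinity> then {} else (\<lambda>\<eta>. cone \<eta> h) ` {\<eta> \<in> A. h \<le> d \<xi> \<eta>})"
    (is "_ = ?U")
proof (rule connected_components_of_eqI)
  let ?V = "topspace T - {pt \<xi> h}"
  have b: "below \<xi> h \<subseteq> ?V"
    using pt_in_below[OF assms(1,1,2), of h] d_self[OF assms(1)] by (auto simp: below_def pt_in_T)
  have c: "cone \<eta> h \<subseteq> ?V" if "\<eta> \<in> A" for \<eta>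
    using pt_in_cone[OF that assms, of h] by (auto simp: cone_def pt_in_T)
  show "connectedin (subtopology T ?V) C \<and> openin (subtopology T ?V) C \<and> C \<noteq> {}" if "C \<in> ?U" for C
  proof -
    note prem = that
    have "connectedin T C \<and> openin T C \<and> C \<subseteq> ?V \<and> C \<noteq> {}"
    proof (cases "h \<noteq> 0 \<and> C = below \<xi> h")
      case True
      then have "base \<in> C" using pt_in_below[of \<xi> \<xi> 0 h] assms by (simp add: root_eq[OF assms(1)])
      then show ?thesis using True assms b open_cones below_connected[of \<xi> h] by auto
    next
      case False
      then obtain \<eta> where \<eta>: "\<eta> \<in> A" "h \<le> d \<xi> \<eta>" "C = cone \<eta> h" "h \<noteq> \<infinity>" using prem by (auto split: if_splits)
      then have "pt \<eta> \<infinity> \<in> C" using pt_in_cone[of \<eta> \<eta> \<infinity> h] by (simp add: d_self)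
      then show ?thesis using \<eta> assms c open_cones cone_connected[of \<eta> h] by auto
    qed
    then show ?thesis by (auto simp: connectedin_subtopology openin_subtopology)
  qed
  show "\<Union>?U = topspace (subtopology T ?V)"
  proof
    show "\<Union>?U \<subseteq> topspace (subtopology T ?V)" using b c by (auto split: if_splits)
    show "topspace (subtopology T ?V) \<subseteq> \<Union>?U"
    proof
      fix x assume "x \<in> topspace (subtopology T ?V)"
      then have x: "x \<in> topspace T" "x \<noteq> pt \<xi> h" by auto
      then obtain \<eta> t where t: "x = pt \<eta> t" "\<eta> \<in> A" "0 \<le> t" by (auto simp: top_T)
      show "x \<in> \<Union>?U"
      proof (cases "h \<le> d \<xi> \<eta> \<and> h \<le> t")
        case True
        then have "h < t" using x t pt_eq_iff[OF assms(1) t(2), of h t] by auto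
        then have "x \<in> cone \<eta> h" using t pt_in_cone[of \<eta> \<eta> t h] True by (auto simp: d_self)
        then show ?thesis using True t \<open>h < t\<close> by auto
      next
        case False
        then have "x \<in> below \<xi> h" using t pt_in_below[OF assms(1) t(2,3), of h] by auto
        moreover have "h \<noteq> 0" using False t d_pos[OF assms(1) t(2)] by (auto simp: less_imp_le)
        ultimately show ?thesis by auto
      qed
    qed
  qed
  show "C = D" if CD: "C \<in> ?U" "D \<in> ?U" "C \<inter> D \<noteq> {}" for C D
  proof -
    have bc: False if "\<eta> \<in> A" "h \<le> d \<xi> \<eta>" "x \<in> below \<xi> h" "x \<in> cone \<eta> h" for \<eta> x
    proof -
      note prem = that
      obtain \<zeta> t where t: "x = pt \<zeta> t" "\<zeta> \<in> A" "0 \<le> t" using prem(3) by (auto simp: below_def)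
      then have "\<not> (h \<le> d \<xi> \<zeta> \<and> h \<le> t)" "h < d \<eta> \<zeta> \<and> h < t"
        using that assms pt_in_cone[of \<eta> \<zeta> t h] pt_in_below[of \<xi> \<zeta> t h] by auto
      then show False using d_le[of h \<xi> \<eta> \<zeta>] that assms t by (auto simp: less_imp_le)
    qed
    have cc: "cone \<eta> h = cone \<eta>' h" if "\<eta> \<in> A" "\<eta>' \<in> A" "x \<in> cone \<eta> h" "x \<in> cone \<eta>' h" "h \<noteq> \<infinity>" for \<eta> \<eta>' x
    proof -
      note prem = that
      obtain \<zeta> t where t: "x = pt \<zeta> t" "\<zeta> \<in> A" "0 \<le> t" using prem(3) by (auto simp: cone_def)
      then have "h < d \<eta> \<zeta>" "h < d \<eta>' \<zeta>" using that pt_in_cone by auto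
      then have "h < d \<eta> \<eta>'" using d_less[of h \<eta> \<zeta> \<eta>'] d_sym that t by auto
      then show ?thesis using cones_eq_iff that assms by auto
    qed
    show ?thesis using CD bc cc by (fastforce split: if_splits)
  qed
qed

text \<open>At an inner height h the valency is 1 plus the number of cones, and the cones of the
  branches through the point all agree unless one of them leaves \<xi> exactly at h. The value
  \<infinity> of \<open>d \<xi> \<xi>\<close> puts the leaf among
  \<open>heights \<xi>\<close>.\<close>

lemma vertices_eq: "vertices T = {pt \<xi> h |\<xi> h. \<xi> \<in> A \<and> h \<in> heights \<xi>}"
proof -
  have "valency T (pt \<xi> h) = 2 \<longleftrightarrow> h \<notin> heights \<xi>" if \<xi>: "\<xi> \<in> A" and h: "0 \<le> h" for \<xi> h
  proof -
    let ?B = "{\<eta> \<in> A. h \<le> d \<xi> \<eta>}"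
    have \<xi>B: "\<xi> \<in> ?B" using \<xi> by (simp add: d_self)
    consider "h = 0" | "h = \<infinity>" | "0 < h" "h < \<infinity>" using h by (cases h) (auto simp: less_le)
    then show ?thesis
    proof cases
      case 1
      have "cone \<eta> 0 = cone \<xi> 0" if "\<eta> \<in> A" for \<eta> using cones_eq_iff[of \<eta> \<xi> 0] d_pos \<xi> that by auto
      then have "(\<lambda>\<eta>. cone \<eta> h) ` ?B = (\<lambda>\<eta>. cone \<xi> 0) ` ?B" using 1 by (intro image_cong) blast+
      then have "(\<lambda>\<eta>. cone \<eta> h) ` ?B = {cone \<xi> 0}" using \<xi>B by blast
      then have "valency T (pt \<xi> h) = 1" unfolding valency_def components_punctured[OF \<xi> h] using 1 by simp
      then show ?thesis using 1 by (simp add: heights_def)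
    next
      case 2
      then have "valency T (pt \<xi> h) = 1" unfolding valency_def components_punctured[OF \<xi> h] by simp
      then show ?thesis using 2 heights_inf[OF \<xi>] by simp
    next
      case 3
      have nb: "below \<xi> h \<notin> (\<lambda>\<eta>. cone \<eta> h) ` ?B"
      proof
        assume "below \<xi> h \<in> (\<lambda>\<eta>. cone \<eta> h) ` ?B"
        then obtain \<eta> where "\<eta> \<in> A" "below \<xi> h = cone \<eta> h" by auto
        moreover have "pt \<eta> 0 \<in> below \<xi> h" if "\<eta> \<in> A" using that \<xi> 3 pt_in_below[of \<xi> \<eta> 0 h] by auto
        ultimately show False using pt_in_cone[of \<eta> \<eta> 0 h] 3 by auto
      qed
      have "valency T (pt \<xi> h) = Suc (card ((\<lambda>\<eta>. cone \<eta> h) ` ?B))"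
        unfolding valency_def components_punctured[OF \<xi> h] using 3 nb fin by (simp add: card_insert_if)
      also have "\<dots> = 2 \<longleftrightarrow> card ((\<lambda>\<eta>. cone \<eta> h) ` ?B) = 1" by auto
      also have "\<dots> \<longleftrightarrow> (\<forall>\<eta>\<in>?B. cone \<eta> h = cone \<xi> h)"
      proof
        assume "card ((\<lambda>\<eta>. cone \<eta> h) ` ?B) = 1"
        then obtain C where "(\<lambda>\<eta>. cone \<eta> h) ` ?B = {C}" using card_1_singletonE by blast
        then show "\<forall>\<eta>\<in>?B. cone \<eta> h = cone \<xi> h" using \<xi>B by blast
      next
        assume "\<forall>\<eta>\<in>?B. cone \<eta> h = cone \<xi> h"
        then have "(\<lambda>\<eta>. cone \<eta> h) ` ?B = {cone \<xi> h}" using \<xi>B by blast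
        then show "card ((\<lambda>\<eta>. cone \<eta> h) ` ?B) = 1" by simp
      qed
      also have "\<dots> \<longleftrightarrow> h \<notin> heights \<xi>"
      proof -
        have "cone \<eta> h = cone \<xi> h \<longleftrightarrow> h < d \<xi> \<eta>" if "\<eta> \<in> ?B" for \<eta>
          using cones_eq_iff[of \<eta> \<xi> h] that 3 \<xi> d_sym[of \<eta> \<xi>] by simp
        then have "(\<forall>\<eta>\<in>?B. cone \<eta> h = cone \<xi> h) \<longleftrightarrow> (\<forall>\<eta>\<in>?B. h < d \<xi> \<eta>)" by blast
        also have "\<dots> \<longleftrightarrow> (\<forall>\<eta>\<in>A. h \<noteq> d \<xi> \<eta>)" by (auto simp: less_le)
        also have "\<dots> \<longleftrightarrow> h \<notin> heights \<xi>" using 3(1) by (auto simp: heights_def)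
        finally show ?thesis .
      qed
      finally show ?thesis .
    qed
  qed
  then have "P \<in> vertices T \<longleftrightarrow> (\<exists>\<xi> h. P = pt \<xi> h \<and> \<xi> \<in> A \<and> 0 \<le> h \<and> h \<in> heights \<xi>)" for P
    unfolding vertices_def top_T by auto
  moreover have "(\<xi> \<in> A \<and> 0 \<le> h \<and> h \<in> heights \<xi>) \<longleftrightarrow> (\<xi> \<in> A \<and> h \<in> heights \<xi>)" for \<xi> h
    using heights_nonneg[of \<xi> h] by auto
  ultimately show ?thesis by auto
qed

lemma pt_vertex_iff:
  assumes "\<xi> \<in> A" "0 \<le> h"
  shows "pt \<xi> h \<in> vertices T \<longleftrightarrow> h \<in> heights \<xi>"
proof
  assume "pt \<xi> h \<in> vertices T"
  then obtain \<eta> where "\<eta> \<in> A" "h \<in> heights \<eta>" "h \<le> d \<xi> \<eta>"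
    unfolding vertices_eq using assms by (auto simp: pt_eq_iff)
  then show "h \<in> heights \<xi>" using heights_transfer[of \<eta> \<xi> h] d_sym assms by auto
qed (use assms vertices_eq in blast)

text \<open>The heights of the two ends of an edge on the branch \<xi>.\<close>

definition gap :: "real pseries \<Rightarrow> ereal \<Rightarrow> ereal \<Rightarrow> bool" where
  "gap \<xi> s t \<longleftrightarrow> s \<in> heights \<xi> \<and> t \<in> heights \<xi> \<and> s < t \<and> (\<forall>h\<in>heights \<xi>. \<not> (s < h \<and> h < t))"

lemma gap_transfer:
  assumes "\<xi> \<in> A" "\<eta> \<in> A" "gap \<xi> s t" "s < d \<xi> \<eta>"
  shows "gap \<eta> s t" "t \<le> d \<xi> \<eta>"
proof -
  show t: "t \<le> d \<xi> \<eta>" using assms(3,4) heights_d[OF assms(2), of \<xi>] by (auto simp: gap_def not_less)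
  show "gap \<eta> s t" unfolding gap_def
  proof (intro conjI ballI)
    show "s \<in> heights \<eta>" "t \<in> heights \<eta>" "s < t"
      using assms t heights_transfer[OF assms(1,2)] by (auto simp: gap_def)
    fix h assume "h \<in> heights \<eta>"
    show "\<not> (s < h \<and> h < t)"
    proof
      assume h: "s < h \<and> h < t"
      then have "h \<in> heights \<xi>" using heights_transfer[OF assms(2,1) \<open>h \<in> heights \<eta>\<close>] t d_sym assms by auto
      then show False using assms(3) h by (auto simp: gap_def)
    qed
  qed
qed

lemma gap_unique:
  assumes "gap \<xi> s t" "gap \<xi> s' t'" "s < r" "r < t" "s' < r" "r < t'"
  shows "s = s' \<and> t = t'"
  using assms unfolding gap_def by (metis less_trans linorder_neqE)

lemma components_edges:
  "connected_components_of (subtopology T (topspace T - vertices T)) =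
     {pt \<xi> ` {s<..<t} |\<xi> s t. \<xi> \<in> A \<and> gap \<xi> s t}" (is "_ = ?U")
proof (rule connected_components_of_eqI)
  let ?V = "topspace T - vertices T"
  have sub: "pt \<xi> ` {s<..<t} \<subseteq> ?V" if "\<xi> \<in> A" "gap \<xi> s t" for \<xi> s t
  proof
    fix x assume "x \<in> pt \<xi> ` {s<..<t}"
    then obtain r where r: "x = pt \<xi> r" "s < r" "r < t" by auto
    then have "0 \<le> r" using heights_nonneg[OF that(1)] that(2) by (meson gap_def less_imp_le order_trans)
    moreover have "r \<notin> heights \<xi>" using r that by (auto simp: gap_def)
    ultimately show "x \<in> ?V" using r that pt_vertex_iff pt_in_T by auto
  qed
  show "connectedin (subtopology T ?V) C \<and> openin (subtopology T ?V) C \<and> C \<noteq> {}" if "C \<in> ?U" for C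
  proof -
    note prem = that
    obtain \<xi> s t where C: "\<xi> \<in> A" "gap \<xi> s t" "C = pt \<xi> ` {s<..<t}" using prem by auto
    have s0: "0 \<le> s" using heights_nonneg C by (auto simp: gap_def)
    have "connectedin T C" unfolding C(3) using s0 by (intro branch_connected C) auto
    moreover have "openin T C"
      unfolding open_T
    proof (intro conjI ballI)
      show "C \<subseteq> topspace T" using sub[OF C(1,2)] C(3) by auto
      fix \<eta> assume \<eta>: "\<eta> \<in> A"
      have "{r \<in> {0..\<infinity>}. pt \<eta> r \<in> C} = (if s < d \<xi> \<eta> then {r \<in> {0..\<infinity>}. s < r \<and> r < t} else {})"
        using gap_transfer(2)[OF C(1) \<eta> C(2)] unfolding C(3) by (auto simp: pt_in_image[OF C(1) \<eta>])
      then show "openin (top_of_set {0..\<infinity>}) {r \<in> {0..\<infinity>}. pt \<eta> r \<in> C}"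
        using open_halfline(3)[of s t] by simp
    qed
    moreover have "C \<noteq> {}" using C dense[of s t] by (auto simp: gap_def)
    ultimately show ?thesis using sub[OF C(1,2)] C(3) by (auto simp: connectedin_subtopology openin_subtopology)
  qed
  show "\<Union>?U = topspace (subtopology T ?V)"
  proof
    show "\<Union>?U \<subseteq> topspace (subtopology T ?V)"
    proof (rule Union_least)
      fix C assume "C \<in> ?U"
      then obtain \<xi> s t where C: "\<xi> \<in> A" "gap \<xi> s t" "C = pt \<xi> ` {s<..<t}" by auto
      show "C \<subseteq> topspace (subtopology T ?V)" using sub[OF C(1,2)] unfolding C(3) by auto
    qed
    show "topspace (subtopology T ?V) \<subseteq> \<Union>?U"
    proof
      fix x assume "x \<in> topspace (subtopology T ?V)"
      then obtain \<xi> r where r: "x = pt \<xi> r" "\<xi> \<in> A" "0 \<le> r" "r \<notin> heights \<xi>"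
        using pt_vertex_iff by (auto simp: top_T)
      \<comment> \<open>The nearest vertices below and above the given point on its branch.\<close>
      define s where "s = Max {h \<in> heights \<xi>. h < r}"
      define t where "t = Min {h \<in> heights \<xi>. r < h}"
      have z: "0 \<in> heights \<xi>" by (simp add: heights_def)
      have "r \<noteq> 0" "r \<noteq> \<infinity>" using r z heights_inf[OF r(2)] by auto
      then have "0 < r" "r < \<infinity>" using r(3) by auto
      then have n: "{h \<in> heights \<xi>. h < r} \<noteq> {}" "{h \<in> heights \<xi>. r < h} \<noteq> {}"
        using z heights_inf[OF r(2)] by blast+
      have st: "s \<in> {h \<in> heights \<xi>. h < r}" "t \<in> {h \<in> heights \<xi>. r < h}"
        unfolding s_def t_def using n heights_finite[of \<xi>] by (intro Max_in Min_in; simp)+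
      have 1: "h \<le> s" if "h \<in> heights \<xi>" "h < r" for h
        unfolding s_def using that heights_finite by (intro Max_ge) auto
      have 2: "t \<le> h" if "h \<in> heights \<xi>" "r < h" for h
        unfolding t_def using that heights_finite by (intro Min_le) auto
      have "gap \<xi> s t"
        unfolding gap_def
      proof (intro conjI ballI)
        show "s < t" using st by (blast intro: less_trans)
        fix h assume h: "h \<in> heights \<xi>"
        then have "h < r \<or> r < h" using r(4) by (metis linorder_neqE)
        then show "\<not> (s < h \<and> h < t)" using 1[OF h] 2[OF h] by (meson leD)
      qed (use st in blast)+
      moreover have "s < r" "r < t" using st by blast+
      ultimately have "pt \<xi> ` {s<..<t} \<in> ?U" "x \<in> pt \<xi> ` {s<..<t}" using r by auto
      then show "x \<in> \<Union>?U" by blast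
    qed
  qed
  show "C = D" if CD: "C \<in> ?U" "D \<in> ?U" "C \<inter> D \<noteq> {}" for C D
  proof -
    note prem = that
    obtain \<xi> s t where C: "\<xi> \<in> A" "gap \<xi> s t" "C = pt \<xi> ` {s<..<t}" using prem by auto
    obtain \<eta> s' t' where D: "\<eta> \<in> A" "gap \<eta> s' t'" "D = pt \<eta> ` {s'<..<t'}" using prem by auto
    obtain r where r: "s < r" "r < t" "s' < r" "r < t'" "r \<le> d \<xi> \<eta>"
    proof -
      obtain x where x: "x \<in> C" "x \<in> D" using CD(3) by blast
      obtain r where r: "x = pt \<eta> r" "s' < r" "r < t'" using x(2) unfolding D(3) by auto
      have "pt \<eta> r \<in> pt \<xi> ` {s<..<t}" using x(1) unfolding C(3) r(1) .
      then show thesis using that[of r] r pt_in_image[OF C(1) D(1), of r] by simp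
    qed
    have g: "gap \<eta> s t" "t \<le> d \<xi> \<eta>" using gap_transfer[OF C(1) D(1) C(2)] r by auto
    then have "s = s'" "t = t'" using gap_unique[OF g(1) D(2)] r by auto
    moreover have "pt \<xi> ` {s<..<t} = pt \<eta> ` {s<..<t}"
      using g(2) pt_eqI[OF C(1) D(1)] by (intro image_cong) auto
    ultimately show ?thesis using C D by simp
  qed
qed

lemma closure_edge:
  assumes "\<xi> \<in> A" "gap \<xi> s t"
  shows "T closure_of (pt \<xi> ` {s<..<t}) = pt \<xi> ` {s..t}"
proof
  have s0: "0 \<le> s" "s < t" using heights_nonneg assms by (auto simp: gap_def)
  show "T closure_of (pt \<xi> ` {s<..<t}) \<subseteq> pt \<xi> ` {s..t}"
  proof (rule closure_of_minimal)
    have "openin T (topspace T - pt \<xi> ` {s..t})"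
      unfolding open_T
    proof (intro conjI ballI)
      fix \<eta> assume \<eta>: "\<eta> \<in> A"
      have "{r \<in> {0..\<infinity>}. pt \<eta> r \<in> topspace T - pt \<xi> ` {s..t}} =
          {r \<in> {0..\<infinity>}. r < s} \<union> {r \<in> {0..\<infinity>}. min t (d \<xi> \<eta>) < r}"
        using \<eta> by (auto simp: pt_in_image[OF assms(1) \<eta>] pt_in_T min_less_iff_disj)
      then show "openin (top_of_set {0..\<infinity>}) {r \<in> {0..\<infinity>}. pt \<eta> r \<in> topspace T - pt \<xi> ` {s..t}}"
        using openin_Un[OF open_halfline(2)[of s] open_halfline(1)[of "min t (d \<xi> \<eta>)"]] by simp
    qed auto
    moreover have "pt \<xi> ` {s..t} \<subseteq> topspace T"
    proof (rule image_subsetI)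
      fix r assume "r \<in> {s..t}"
      then have "0 \<le> r" using s0 by auto
      then show "pt \<xi> r \<in> topspace T" by (rule pt_in_T[OF assms(1)])
    qed
    ultimately show "closedin T (pt \<xi> ` {s..t})" by (simp add: closedin_def)
    show "pt \<xi> ` {s<..<t} \<subseteq> pt \<xi> ` {s..t}" by (intro image_mono) auto
  qed
  have "{s..t} \<subseteq> top_of_set {0..\<infinity>} closure_of {s<..<t}"
  proof -
    have "{0..\<infinity>} \<inter> {s<..<t} = {s<..<t}" using s0 by auto
    then have "top_of_set {0..\<infinity>} closure_of {s<..<t} = {0..\<infinity>} \<inter> closure {s<..<t}"
      by (simp add: closure_of_subtopology)
    then show ?thesis using s0 by auto
  qed
  then have "pt \<xi> ` {s..t} \<subseteq> pt \<xi> ` (top_of_set {0..\<infinity>} closure_of {s<..<t})" by blast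
  also have "\<dots> \<subseteq> T closure_of (pt \<xi> ` {s<..<t})"
    by (rule continuous_map_image_closure_subset[OF branch_continuous[OF assms(1)]])
  finally show "pt \<xi> ` {s..t} \<subseteq> T closure_of (pt \<xi> ` {s<..<t})" .
qed

lemma edges_eq: "edges T = {pt \<xi> ` {s..t} |\<xi> s t. \<xi> \<in> A \<and> gap \<xi> s t}"
proof (intro equalityI subsetI)
  fix e assume "e \<in> edges T"
  then obtain \<xi> s t where st: "\<xi> \<in> A" "gap \<xi> s t" "e = T closure_of (pt \<xi> ` {s<..<t})"
    unfolding edges_def components_edges by auto
  then have "e = pt \<xi> ` {s..t}" using closure_edge by simp
  then show "e \<in> {pt \<xi> ` {s..t} |\<xi> s t. \<xi> \<in> A \<and> gap \<xi> s t}" using st by auto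
next
  fix e assume "e \<in> {pt \<xi> ` {s..t} |\<xi> s t. \<xi> \<in> A \<and> gap \<xi> s t}"
  then obtain \<xi> s t where st: "\<xi> \<in> A" "gap \<xi> s t" "e = pt \<xi> ` {s..t}" by auto
  then have "e = T closure_of (pt \<xi> ` {s<..<t})" using closure_edge by simp
  then show "e \<in> edges T" unfolding edges_def components_edges using st(1,2) by (intro image_eqI) auto
qed

lemma leaves_eq: "leaves T base = leaf ` A"
proof -
  have le: "tree_le T base (pt \<xi> s) (pt \<eta> t) \<longleftrightarrow> pt \<xi> ` {0..s} \<subseteq> pt \<eta> ` {0..t}"
    if "\<xi> \<in> A" "\<eta> \<in> A" "0 \<le> s" "0 \<le> t" for \<xi> \<eta> s t
    unfolding tree_le_def using segment_root that by simp
  show ?thesis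
  proof
    show "leaves T base \<subseteq> leaf ` A"
    proof
      fix P assume P: "P \<in> leaves T base"
      then obtain \<xi> s where s: "P = pt \<xi> s" "\<xi> \<in> A" "0 \<le> s" by (auto simp: leaves_def top_T)
      then have "tree_le T base P (pt \<xi> \<infinity>)" by (auto simp: le)
      then have "pt \<xi> \<infinity> = P" using P s pt_in_T[of \<xi> \<infinity>] by (auto simp: leaves_def)
      then show "P \<in> leaf ` A" using s by (auto simp: leaf_eq)
    qed
    show "leaf ` A \<subseteq> leaves T base"
    proof safe
      fix \<xi> assume \<xi>: "\<xi> \<in> A"
      have "Q = pt \<xi> \<infinity>" if "Q \<in> topspace T" "tree_le T base (pt \<xi> \<infinity>) Q" for Q
      proof -
        note prem = that
        obtain \<eta> t where t: "Q = pt \<eta> t" "\<eta> \<in> A" "0 \<le> t" using prem by (auto simp: top_T)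
        then have "pt \<xi> ` {0..\<infinity>} \<subseteq> pt \<eta> ` {0..t}" using that \<xi> by (simp add: le)
        then have "pt \<xi> \<infinity> \<in> pt \<eta> ` {0..t}" by auto
        then have "t = \<infinity>" "d \<eta> \<xi> = \<infinity>" using pt_in_image[OF t(2) \<xi>] by auto
        then show ?thesis using t d_inf \<xi> by auto
      qed
      then show "leaf \<xi> \<in> leaves T base" using \<xi> pt_in_T[of \<xi> \<infinity>] by (auto simp: leaves_def leaf_eq)
    qed
  qed
qed

lemma internal_vertices_eq:
  "internal_vertices T base = {pt \<xi> (d \<xi> \<eta>) |\<xi> \<eta>. \<xi> \<in> A \<and> \<eta> \<in> A \<and> \<xi> \<noteq> \<eta>}"
proof
  show "internal_vertices T base \<subseteq> {pt \<xi> (d \<xi> \<eta>) |\<xi> \<eta>. \<xi> \<in> A \<and> \<eta> \<in> A \<and> \<xi> \<noteq> \<eta>}"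
  proof
    fix P assume "P \<in> internal_vertices T base"
    then have P: "P \<in> vertices T" "P \<notin> leaf ` A" "P \<noteq> base" by (auto simp: internal_vertices_def leaves_eq)
    then obtain \<xi> h where h: "P = pt \<xi> h" "\<xi> \<in> A" "h \<in> heights \<xi>" by (auto simp: vertices_eq)
    then have "h \<noteq> 0" using P root_eq[OF h(2)] by auto
    then obtain \<eta> where "\<eta> \<in> A" "h = d \<xi> \<eta>" using h by (auto simp: heights_def)
    moreover have "h \<noteq> \<infinity>" using P h leaf_eq by auto
    ultimately show "P \<in> {pt \<xi> (d \<xi> \<eta>) |\<xi> \<eta>. \<xi> \<in> A \<and> \<eta> \<in> A \<and> \<xi> \<noteq> \<eta>}" using h d_inf by auto
  qed
  show "{pt \<xi> (d \<xi> \<eta>) |\<xi> \<eta>. \<xi> \<in> A \<and> \<eta> \<in> A \<and> \<xi> \<noteq> \<eta>} \<subseteq> internal_vertices T base"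
  proof safe
    fix \<xi> \<eta> assume x: "\<xi> \<in> A" "\<eta> \<in> A" "\<xi> \<noteq> \<eta>"
    have "pt \<xi> (d \<xi> \<eta>) \<in> vertices T" using x heights_d vertices_eq by blast
    moreover have "pt \<xi> (d \<xi> \<eta>) \<noteq> base" using x d_pos[OF x(1,2)] by (auto simp: root_eq[OF x(1)] pt_eq_iff)
    moreover have "pt \<xi> (d \<xi> \<eta>) \<notin> leaf ` A" using x d_inf by (auto simp: leaf_eq pt_eq_iff)
    ultimately show "pt \<xi> (d \<xi> \<eta>) \<in> internal_vertices T base" by (simp add: internal_vertices_def leaves_eq)
  qed
qed

lemma meet_eq:
  assumes "\<xi> \<in> A" "\<eta> \<in> A"
  shows "meet T base (leaf \<xi>) (leaf \<eta>) = pt \<xi> (d \<xi> \<eta>)"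
  unfolding meet_def
proof (rule the_equality)
  have d0: "0 \<le> d \<xi> \<eta>" using d_pos assms by (simp add: less_imp_le)
  have "pt \<xi> ` {0..d \<xi> \<eta>} = pt \<xi> ` {0..\<infinity>} \<inter> pt \<eta> ` {0..\<infinity>}"
  proof (intro equalityI subsetI)
    fix x assume "x \<in> pt \<xi> ` {0..d \<xi> \<eta>}"
    then obtain r where "x = pt \<xi> r" "0 \<le> r" "r \<le> d \<xi> \<eta>" by auto
    then show "x \<in> pt \<xi> ` {0..\<infinity>} \<inter> pt \<eta> ` {0..\<infinity>}"
      using pt_in_image[OF assms(2,1), of r "{0..\<infinity>}"] d_sym assms by auto
  next
    fix x assume x: "x \<in> pt \<xi> ` {0..\<infinity>} \<inter> pt \<eta> ` {0..\<infinity>}"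
    then obtain r where "x = pt \<xi> r" "0 \<le> r" by auto
    moreover have "pt \<xi> r \<in> pt \<eta> ` {0..\<infinity>}" using x \<open>x = pt \<xi> r\<close> by blast
    ultimately show "x \<in> pt \<xi> ` {0..d \<xi> \<eta>}"
      using pt_in_image[OF assms(2,1), of r "{0..\<infinity>}"] d_sym assms by auto
  qed
  then have s: "segment T base (leaf \<xi>) \<inter> segment T base (leaf \<eta>) = pt \<xi> ` {0..d \<xi> \<eta>}"
    using segment_root assms by (simp add: leaf_eq)
  show "pt \<xi> (d \<xi> \<eta>) \<in> topspace T \<and>
    segment T base (pt \<xi> (d \<xi> \<eta>)) = segment T base (leaf \<xi>) \<inter> segment T base (leaf \<eta>)"
    unfolding s using assms d0 segment_root pt_in_T by simp
  fix M assume M: "M \<in> topspace T \<and> segment T base M = segment T base (leaf \<xi>) \<inter> segment T base (leaf \<eta>)"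
  then obtain \<zeta> m where m: "M = pt \<zeta> m" "\<zeta> \<in> A" "0 \<le> m" by (auto simp: top_T)
  then have eq: "pt \<zeta> ` {0..m} = pt \<xi> ` {0..d \<xi> \<eta>}" using M s segment_root by simp
  have "pt \<zeta> m \<in> pt \<zeta> ` {0..m}" using m by auto
  then have "pt \<zeta> m \<in> pt \<xi> ` {0..d \<xi> \<eta>}" unfolding eq .
  then have 1: "m \<le> d \<xi> \<eta>" "m \<le> d \<xi> \<zeta>" using pt_in_image[OF assms(1) m(2)] by auto
  have "pt \<xi> (d \<xi> \<eta>) \<in> pt \<zeta> ` {0..m}" unfolding eq using d0 by auto
  then have 2: "d \<xi> \<eta> \<le> m" using pt_in_image[OF m(2) assms(1)] by auto
  then have "m = d \<xi> \<eta>" using 1 by auto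
  then show "M = pt \<xi> (d \<xi> \<eta>)" using m(1) 1(2) pt_eqI[OF assms(1) m(2)] by simp
qed

section \<open>Outgoing edges at a vertex\<close>

definition next_height :: "real pseries \<Rightarrow> ereal \<Rightarrow> ereal" where
  "next_height \<xi> h = Min {h' \<in> heights \<xi>. h < h'}"

definition edge :: "ereal \<Rightarrow> real pseries \<Rightarrow> contact_point set" where
  "edge h \<xi> = pt \<xi> ` {h..next_height \<xi> h}"

lemma gap_iff_next:
  assumes "\<xi> \<in> A" "h \<in> heights \<xi>" "h < \<infinity>"
  shows "gap \<xi> h t \<longleftrightarrow> t = next_height \<xi> h"
proof -
  let ?S = "{h' \<in> heights \<xi>. h < h'}"
  have S: "finite ?S" "?S \<noteq> {}" using heights_finite heights_inf[OF assms(1)] assms(3) by auto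
  have m: "next_height \<xi> h \<in> ?S" unfolding next_height_def by (rule Min_in[OF S])
  have l: "next_height \<xi> h \<le> h'" if "h' \<in> ?S" for h' unfolding next_height_def by (rule Min_le[OF S(1) that])
  have "gap \<xi> h (next_height \<xi> h)" unfolding gap_def using assms m l by (metis (no_types, lifting) leD mem_Collect_eq)
  moreover have "t = next_height \<xi> h" if "gap \<xi> h t"
  proof (rule antisym)
    show "t \<le> next_height \<xi> h" using that m by (auto simp: gap_def not_less)
    show "next_height \<xi> h \<le> t" using that l by (auto simp: gap_def)
  qed
  ultimately show ?thesis by blast
qed

context
  fixes \<xi> h
  assumes \<xi>: "\<xi> \<in> A" and h: "h \<in> heights \<xi>" "h < \<infinity>"
begin

lemma ball_gap: "\<eta> \<in> A \<Longrightarrow> h \<le> d \<xi> \<eta> \<Longrightarrow> gap \<eta> h (next_height \<eta> h)"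
  using gap_iff_next[of \<eta> h] heights_transfer[OF \<xi> _ h(1)] h by blast

text \<open>Branches that agree slightly beyond the vertex agree at least up to the next vertex.
  Hence the outgoing edges at height h correspond to the classes of the relation h < d on the
  branches through the vertex.\<close>

lemma edge_eq_iff:
  assumes "\<eta> \<in> A" "\<zeta> \<in> A" "h \<le> d \<xi> \<eta>" "h \<le> d \<xi> \<zeta>"
  shows "edge h \<eta> = edge h \<zeta> \<longleftrightarrow> h < d \<eta> \<zeta>"
proof
  assume e: "edge h \<eta> = edge h \<zeta>"
  have g: "h < next_height \<eta> h" using ball_gap[OF assms(1,3)] by (simp add: gap_def)
  then have "pt \<eta> (next_height \<eta> h) \<in> edge h \<eta>" by (auto simp: edge_def)
  then have "pt \<eta> (next_height \<eta> h) \<in> pt \<zeta> ` {h..next_height \<zeta> h}" unfolding e by (simp add: edge_def)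
  then show "h < d \<eta> \<zeta>" using g pt_in_image[OF assms(2,1)] d_sym[OF assms(2,1)] by auto
next
  assume hd: "h < d \<eta> \<zeta>"
  have g: "gap \<zeta> h (next_height \<eta> h)" "next_height \<eta> h \<le> d \<eta> \<zeta>"
    using gap_transfer[OF assms(1,2) ball_gap[OF assms(1,3)] hd] .
  then have "next_height \<zeta> h = next_height \<eta> h"
    using gap_iff_next[OF assms(2), of h] h by (auto simp: gap_def)
  then show "edge h \<eta> = edge h \<zeta>"
    unfolding edge_def using g(2) pt_eqI[OF assms(1,2)] by (intro image_cong) auto
qed

lemma out_edges_eq: "out_edges T base (pt \<xi> h) = edge h ` {\<eta> \<in> A. h \<le> d \<xi> \<eta>}"
proof
  have h0: "0 \<le> h" using heights_nonneg[OF \<xi> h(1)] .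
  show "out_edges T base (pt \<xi> h) \<subseteq> edge h ` {\<eta> \<in> A. h \<le> d \<xi> \<eta>}"
  proof
    fix e assume "e \<in> out_edges T base (pt \<xi> h)"
    then obtain Q where e: "e \<in> edges T" "e = segment T (pt \<xi> h) Q" "\<not> e \<subseteq> segment T base (pt \<xi> h)"
      by (auto simp: out_edges_def)
    then obtain \<eta> s t where st: "\<eta> \<in> A" "gap \<eta> s t" "e = pt \<eta> ` {s..t}" by (auto simp: edges_eq)
    have "pt \<xi> h \<in> e" unfolding e(2) by (auto simp: segment_def)
    then have hst: "s \<le> h" "h \<le> t" "h \<le> d \<eta> \<xi>" unfolding st(3) using pt_in_image[OF st(1) \<xi>] by auto
    then have hd: "h \<le> d \<xi> \<eta>" using d_sym \<xi> st by simp
    then have "h \<in> heights \<eta>" using heights_transfer[OF \<xi> st(1) h(1)] by simp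
    then have "h = s \<or> h = t" using hst st(2) by (auto simp: gap_def less_le)
    \<comment> \<open>An edge that ends at the vertex lies in the segment from the root to it, so it
      is not outgoing.\<close>
    moreover have "h \<noteq> t"
    proof
      assume "h = t"
      moreover have "0 \<le> s" using heights_nonneg[OF st(1)] st(2) by (auto simp: gap_def)
      moreover have "segment T base (pt \<xi> h) = pt \<eta> ` {0..h}"
        using segment_root[OF st(1) h0] pt_eqI[OF \<xi> st(1) hd] by simp
      ultimately show False using e(3) st(3) by auto
    qed
    ultimately have "h = s" by simp
    then have "t = next_height \<eta> h" using gap_iff_next[OF st(1) \<open>h \<in> heights \<eta>\<close> h(2)] st(2) by simp
    then show "e \<in> edge h ` {\<eta> \<in> A. h \<le> d \<xi> \<eta>}" using st hd \<open>h = s\<close> by (auto simp: edge_def)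
  qed
  show "edge h ` {\<eta> \<in> A. h \<le> d \<xi> \<eta>} \<subseteq> out_edges T base (pt \<xi> h)"
  proof safe
    fix \<eta> assume \<eta>: "\<eta> \<in> A" "h \<le> d \<xi> \<eta>"
    let ?t = "next_height \<eta> h"
    have g: "gap \<eta> h ?t" by (rule ball_gap[OF \<eta>])
    then have ht: "h < ?t" by (simp add: gap_def)
    have eq: "pt \<xi> h = pt \<eta> h" by (rule pt_eqI[OF \<xi> \<eta>])
    have "edge h \<eta> \<in> edges T" unfolding edges_eq edge_def using g \<eta> by blast
    moreover have "edge h \<eta> = segment T (pt \<xi> h) (pt \<eta> ?t)"
      unfolding eq edge_def using segment_branch[OF \<eta>(1) h0, of ?t] ht by simp
    moreover have "pt \<eta> ?t \<in> vertices T" using g \<eta> vertices_eq unfolding gap_def by blast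
    moreover have "\<not> edge h \<eta> \<subseteq> segment T base (pt \<xi> h)"
    proof
      assume "edge h \<eta> \<subseteq> segment T base (pt \<xi> h)"
      moreover have "pt \<eta> ?t \<in> edge h \<eta>" using ht by (auto simp: edge_def)
      ultimately have "pt \<eta> ?t \<in> pt \<eta> ` {0..h}" unfolding eq using segment_root[OF \<eta>(1) h0] by auto
      then show False using ht pt_in_image[OF \<eta>(1,1)] by auto
    qed
    ultimately show "edge h \<eta> \<in> out_edges T base (pt \<xi> h)" unfolding out_edges_def by blast
  qed
qed

lemma edge_towards_eq:
  assumes "\<eta> \<in> A" "h \<le> d \<xi> \<eta>"
  shows "edge_towards T base (pt \<xi> h) (leaf \<eta>) = edge h \<eta>"
  unfolding edge_towards_def
proof (rule the_equality)
  have h0: "0 \<le> h" using heights_nonneg[OF \<xi> h(1)] .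
  have eq: "pt \<xi> h = pt \<eta> h" by (rule pt_eqI[OF \<xi> assms])
  have s: "segment T (pt \<xi> h) (leaf \<eta>) = pt \<eta> ` {h..\<infinity>}"
    unfolding eq leaf_eq using segment_branch[OF assms(1) h0, of \<infinity>] by simp
  show "edge h \<eta> \<in> out_edges T base (pt \<xi> h) \<and> edge h \<eta> \<subseteq> segment T (pt \<xi> h) (leaf \<eta>)"
    unfolding s out_edges_eq using assms by (auto simp: edge_def)
  fix e assume e: "e \<in> out_edges T base (pt \<xi> h) \<and> e \<subseteq> segment T (pt \<xi> h) (leaf \<eta>)"
  then obtain \<zeta> where z: "\<zeta> \<in> A" "h \<le> d \<xi> \<zeta>" "e = edge h \<zeta>" unfolding out_edges_eq by auto
  have g: "h < next_height \<zeta> h" using ball_gap[OF z(1,2)] by (simp add: gap_def)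
  then have "pt \<zeta> (next_height \<zeta> h) \<in> e" using z by (auto simp: edge_def)
  then have "pt \<zeta> (next_height \<zeta> h) \<in> pt \<eta> ` {h..\<infinity>}" using e s by auto
  then have "h < d \<eta> \<zeta>" using g pt_in_image[OF assms(1) z(1)] by auto
  then show "e = edge h \<eta>" using z edge_eq_iff[OF z(1) assms(1) z(2) assms(2)] d_sym[OF assms(1) z(1)] by simp
qed

end

end

section \<open>Planar structures and discrete integration\<close>

lemma sorted_wrt_unique:
  assumes "sorted_wrt P xs" "sorted_wrt P ys" "set xs = set ys"
    and "\<And>x y. x \<in> set xs \<Longrightarrow> y \<in> set xs \<Longrightarrow> P x y \<Longrightarrow> \<not> P y x"
  shows "xs = ys"
  using assms
proof (induction xs arbitrary: ys)
  case (Cons x xs)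
  have "ys \<noteq> []" using Cons.prems(3) by auto
  then obtain y ys' where ys: "ys = y # ys'" by (meson neq_Nil_conv)
  have xy: "x = y"
  proof (rule ccontr)
    assume "x \<noteq> y"
    have eq: "insert x (set xs) = insert y (set ys')" using Cons.prems(3) by (simp add: ys)
    have xy: "x \<in> set ys'" "y \<in> set xs" using equalityD1[OF eq] equalityD2[OF eq] \<open>x \<noteq> y\<close> by blast+
    then have "P y x" "P x y" using Cons.prems(1,2) ys by simp_all
    then show False using Cons.prems(4)[of x y] xy by (meson list.set_intros)
  qed
  have "\<not> P x x" using Cons.prems(4)[of x x] by (meson list.set_intros(1))
  moreover have "\<forall>z\<in>set xs. P x z" "\<forall>z\<in>set ys'. P y z" using Cons.prems(1,2) ys by simp_all
  ultimately have "x \<notin> set xs" "x \<notin> set ys'" using xy by blast+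
  moreover have eq: "insert x (set xs) = insert x (set ys')" using Cons.prems(3) by (simp add: ys xy)
  ultimately have "set xs = set ys'" by (metis insert_ident)
  moreover have "sorted_wrt P xs" "sorted_wrt P ys'" using Cons.prems(1,2) ys by simp_all
  moreover have "\<not> P v u" if "u \<in> set xs" "v \<in> set xs" "P u v" for u v
    by (rule Cons.prems(4)) (use that in simp_all)
  ultimately have "xs = ys'" using Cons.IH[of ys'] by blast
  then show ?case using ys xy by simp
qed simp

lemma sorted_wrt_exists:
  assumes "finite E" "\<And>x y z. x \<in> E \<Longrightarrow> y \<in> E \<Longrightarrow> z \<in> E \<Longrightarrow> P x y \<Longrightarrow> P y z \<Longrightarrow> P x z"
    and "\<And>x y. x \<in> E \<Longrightarrow> y \<in> E \<Longrightarrow> x \<noteq> y \<Longrightarrow> P x y \<or> P y x" "\<And>x. x \<in> E \<Longrightarrow> \<not> P x x"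
  shows "\<exists>xs. distinct xs \<and> set xs = E \<and> sorted_wrt P xs"
  using assms
proof (induction E rule: finite_induct)
  case (insert x E)
  have "\<exists>xs. distinct xs \<and> set xs = E \<and> sorted_wrt P xs"
  proof (rule insert.IH)
    show "\<And>x y z. x \<in> E \<Longrightarrow> y \<in> E \<Longrightarrow> z \<in> E \<Longrightarrow> P x y \<Longrightarrow> P y z \<Longrightarrow> P x z"
      by (rule insert.prems(1)) auto
    show "\<And>x y. x \<in> E \<Longrightarrow> y \<in> E \<Longrightarrow> x \<noteq> y \<Longrightarrow> P x y \<or> P y x"
      by (rule insert.prems(2)) auto
    show "\<And>x. x \<in> E \<Longrightarrow> \<not> P x x" by (rule insert.prems(3)) auto
  qed
  then obtain xs where xs: "distinct xs" "set xs = E" "sorted_wrt P xs" by blast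
  let ?ys = "filter (\<lambda>y. P y x) xs @ x # filter (\<lambda>y. P x y) xs"
  have asym: "\<not> (P y x \<and> P x y)" if "y \<in> E" for y
    using insert.prems(1)[of x y x] insert.prems(3)[of x] that by blast
  have "distinct ?ys" using xs insert.hyps insert.prems(3) asym by auto
  moreover have "set ?ys = insert x E"
    using xs insert.prems(2)[of x] insert.hyps by auto
  moreover have "sorted_wrt P ?ys"
  proof -
    have "P y z" if "y \<in> E" "z \<in> E" "P y x" "P x z" for y z using insert.prems(1)[of y x z] that by auto
    then show ?thesis using xs by (auto simp: sorted_wrt_append sorted_wrt_filter)
  qed
  ultimately show ?case by blast
qed simp

text \<open>Used for both lists that are introduced by a definite description,
  \<open>root_list\<close> and \<open>edge_list\<close>.\<close>

lemma sorted_wrt_The: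
  assumes "finite E" "\<And>x y z. x \<in> E \<Longrightarrow> y \<in> E \<Longrightarrow> z \<in> E \<Longrightarrow> P x y \<Longrightarrow> P y z \<Longrightarrow> P x z"
    and "\<And>x y. x \<in> E \<Longrightarrow> y \<in> E \<Longrightarrow> x \<noteq> y \<Longrightarrow> P x y \<or> P y x" "\<And>x. x \<in> E \<Longrightarrow> \<not> P x x"
  defines "l \<equiv> THE xs. distinct xs \<and> set xs = E \<and> sorted_wrt P xs"
  shows "distinct l \<and> set l = E \<and> sorted_wrt P l"
proof -
  obtain xs where xs: "distinct xs \<and> set xs = E \<and> sorted_wrt P xs"
  proof -
    have "\<exists>xs. distinct xs \<and> set xs = E \<and> sorted_wrt P xs"
      by (rule sorted_wrt_exists[OF assms(1)]) (fact assms)+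
    then show thesis using that by blast
  qed
  show ?thesis unfolding l_def
  proof (rule theI[of _ xs])
    fix ys assume "distinct ys \<and> set ys = E \<and> sorted_wrt P ys"
    then have ys: "sorted_wrt P ys" "set ys = E" by simp_all
    have asym: "\<not> P v u" if "u \<in> set ys" "v \<in> set ys" "P u v" for u v
      using assms(2)[of u v u] assms(4)[of u] that unfolding ys(2) by blast
    show "ys = xs"
      by (rule sorted_wrt_unique[of P]) (use ys xs asym in \<open>simp_all only: simp_thms\<close>)
  qed (rule xs)
qed

lemma sorted_wrt_nth_iff:
  assumes "sorted_wrt P xs" "i < length xs" "j < length xs"
    and "\<And>x y. x \<in> set xs \<Longrightarrow> y \<in> set xs \<Longrightarrow> P x y \<Longrightarrow> \<not> P y x"
  shows "P (xs ! i) (xs ! j) \<longleftrightarrow> i < j"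
proof
  assume p: "P (xs ! i) (xs ! j)"
  show "i < j"
  proof (rule ccontr)
    assume "\<not> i < j"
    then have "j < i \<or> i = j" by auto
    then have "P (xs ! j) (xs ! i)" using p sorted_wrt_nth_less[OF assms(1), of j i] assms(2) by blast
    then show False using p assms(4)[of "xs ! i" "xs ! j"] assms(2,3) nth_mem by blast
  qed
qed (use sorted_wrt_nth_less[OF assms(1)] assms(3) in blast)

text \<open>\<open>convex\<close> expresses that the balls of the ultrametric are intervals for
  \<open>less_R\<close>. Without it the order of the leaves would not come from any planar
  structure.\<close>

locale root_tree = contact_set A d for A d +
  fixes f :: "real fps fps"
  assumes A_eq: "A = root_set f"
    and less_trans': "\<And>a b c. a \<in> A \<Longrightarrow> b \<in> A \<Longrightarrow> c \<in> A \<Longrightarrow> less_R a b \<Longrightarrow> less_R b c \<Longrightarrow> less_R a c"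
    and less_total': "\<And>a b. a \<in> A \<Longrightarrow> b \<in> A \<Longrightarrow> a \<noteq> b \<Longrightarrow> less_R a b \<or> less_R b a"
    and less_irrefl': "\<And>a. a \<in> A \<Longrightarrow> \<not> less_R a a"
    and convex: "\<And>a b c. a \<in> A \<Longrightarrow> b \<in> A \<Longrightarrow> c \<in> A \<Longrightarrow> less_R a b \<Longrightarrow> less_R b c \<Longrightarrow> d a c \<le> d a b \<and> d a c \<le> d b c"
begin

lemma less_asym': "a \<in> A \<Longrightarrow> b \<in> A \<Longrightarrow> less_R a b \<Longrightarrow> \<not> less_R b a"
  using less_trans'[of a b a] less_irrefl' by auto

abbreviation "rs \<equiv> root_list f"

lemma rs: "distinct rs" "set rs = A" "sorted_wrt less_R rs"
  using sorted_wrt_The[of A less_R, OF fin less_trans' less_total' less_irrefl']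
  unfolding root_list_def A_eq by auto

lemma rs_nth_less: "i < length rs \<Longrightarrow> j < length rs \<Longrightarrow> less_R (rs ! i) (rs ! j) \<longleftrightarrow> i < j"
  using sorted_wrt_nth_iff[OF rs(3)] less_asym' rs(2) by auto

lemma rs_in: "i < length rs \<Longrightarrow> rs ! i \<in> A"
  using rs(2) by (auto simp: in_set_conv_nth)

text \<open>A point \<open>b\<close> between \<open>a\<close> and \<open>a'\<close> would by
  convexity have at least as much contact with them as they have with each other.\<close>

lemma less_block:
  assumes "a \<in> A" "a' \<in> A" "b \<in> A" "d a b < d a a'"
  shows "less_R a b \<longleftrightarrow> less_R a' b" "less_R b a \<longleftrightarrow> less_R b a'"
proof -
  have ne: "a \<noteq> b" "a' \<noteq> b" using assms d_self by auto
  have "d a' b = d a b" using d_transfer[of a b a'] assms by auto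
  then have b': "d a' b < d a' a" using assms d_sym by simp
  have "less_R a b \<Longrightarrow> less_R a' b"
    using convex[of a b a'] assms ne less_total'[of a' b] by fastforce
  moreover have "less_R a' b \<Longrightarrow> less_R a b"
    using convex[of a' b a] assms ne b' less_total'[of a b] by fastforce
  ultimately show 1: "less_R a b \<longleftrightarrow> less_R a' b" by blast
  show "less_R b a \<longleftrightarrow> less_R b a'"
    using 1 less_total'[of a b] less_total'[of a' b] less_asym'[of a b] less_asym'[of a' b] assms ne by metis
qed

text \<open>The candidate for \<open>real_planar f\<close>: edges are compared through leaves that
  lie beyond them. Requiring the meet to be \<open>P\<close> makes the relation empty off the
  internal vertices, as \<open>planar_structure\<close> demands.\<close>

definition rp :: "contact_point \<Rightarrow> contact_point set rel" where
  "rp P = {(edge_towards T base P (leaf a), edge_towards T base P (leaf b)) |a b.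
            a \<in> A \<and> b \<in> A \<and> a \<noteq> b \<and> pt a (d a b) = P \<and> less_R a b}"

section \<open>The order of the edges at one vertex\<close>

context
  fixes \<xi> \<eta> assumes \<xi>\<eta>: "\<xi> \<in> A" "\<eta> \<in> A" "\<xi> \<noteq> \<eta>"
begin

definition "P = pt \<xi> (d \<xi> \<eta>)"
definition "h = d \<xi> \<eta>"
definition "B = {a \<in> A. h \<le> d \<xi> a}"

lemma meet_height: "h \<in> heights \<xi>" "h < \<infinity>" "0 < h"
  using \<xi>\<eta> heights_d[of \<eta> \<xi>] d_inf[of \<xi> \<eta>] d_pos by (auto simp: h_def)

lemma ball_subset: "a \<in> B \<Longrightarrow> a \<in> A" by (simp add: B_def)

lemma ball_dist: "a \<in> B \<Longrightarrow> b \<in> B \<Longrightarrow> h \<le> d a b"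
  using d_le[of h a \<xi> b] d_sym \<xi>\<eta> by (auto simp: B_def)

lemma B_iff: "a \<in> A \<Longrightarrow> b \<in> A \<Longrightarrow> pt a (d a b) = P \<longleftrightarrow> a \<in> B \<and> b \<in> B \<and> d a b = h"
proof -
  assume ab: "a \<in> A" "b \<in> A"
  show ?thesis
  proof
    assume "pt a (d a b) = P"
    then have 1: "d a b = h" "h \<le> d \<xi> a" unfolding P_def using pt_eq_iff[of a \<xi>] d_sym[of a \<xi>] ab \<xi>\<eta> by (auto simp: h_def)
    then have "h \<le> d \<xi> b" using d_le[of h \<xi> a b] ab \<xi>\<eta> by auto
    then show "a \<in> B \<and> b \<in> B \<and> d a b = h" using 1 ab by (auto simp: B_def)
  next
    assume "a \<in> B \<and> b \<in> B \<and> d a b = h"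
    then show "pt a (d a b) = P" unfolding P_def h_def[symmetric]
      using pt_eqI[of \<xi> a h] \<xi>\<eta> ab by (auto simp: B_def)
  qed
qed

lemma edge_towards_meet: "a \<in> B \<Longrightarrow> edge_towards T base P (leaf a) = edge h a"
  using edge_towards_eq[OF \<xi>\<eta>(1) meet_height(1,2)] by (auto simp: B_def P_def h_def)

lemma out_edges_meet: "out_edges T base P = edge h ` B"
  using out_edges_eq[OF \<xi>\<eta>(1) meet_height(1,2)] by (simp add: B_def P_def h_def)

lemma edge_eq: "a \<in> B \<Longrightarrow> b \<in> B \<Longrightarrow> edge h a = edge h b \<longleftrightarrow> h < d a b"
  using edge_eq_iff[OF \<xi>\<eta>(1) meet_height(1,2)] by (auto simp: B_def)

lemma rp_eq: "rp P = {(edge h a, edge h b) |a b. a \<in> B \<and> b \<in> B \<and> d a b = h \<and> less_R a b}"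
proof -
  have "(a \<in> A \<and> b \<in> A \<and> a \<noteq> b \<and> pt a (d a b) = P \<and> less_R a b) \<longleftrightarrow>
      (a \<in> B \<and> b \<in> B \<and> d a b = h \<and> less_R a b)" for a b
    using B_iff[of a b] ball_subset less_irrefl'[of a] by blast
  then show ?thesis unfolding rp_def using edge_towards_meet by (intro Collect_cong) metis
qed

text \<open>The comparison of two edges does not depend on the leaves chosen beyond them: replacing
  a leaf by one on the same edge changes neither the contact order (\<open>d_transfer\<close>) nor
  the side (\<open>less_block\<close>).\<close>

lemma rp_iff:
  assumes "a \<in> B" "b \<in> B"
  shows "(edge h a, edge h b) \<in> rp P \<longleftrightarrow> d a b = h \<and> less_R a b"
proof
  assume "(edge h a, edge h b) \<in> rp P"
  then obtain a' b' where ab: "edge h a = edge h a'" "edge h b = edge h b'" "a' \<in> B" "b' \<in> B" "d a' b' = h" "less_R a' b'"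
    unfolding rp_eq by blast
  note AA = ball_subset[OF assms(1)] ball_subset[OF assms(2)] ball_subset[OF ab(3)] ball_subset[OF ab(4)]
  have aa: "h < d a' a" and bb: "h < d b' b" using ab edge_eq assms d_sym AA by auto
  have 1: "d a b' = h" using d_transfer[of a' b' a] ab aa AA by auto
  then have 11: "d b' a = h" using d_sym AA by simp
  have 2: "d b a = h" using d_transfer[of b' a b] bb AA 11 by auto
  have "less_R a b'" using less_block(1)[of a' a b'] ab aa AA by auto
  then have "less_R a b" using less_block(2)[of b' b a] 11 bb AA by auto
  then show "d a b = h \<and> less_R a b" using 2 d_sym AA by auto
qed (use assms rp_eq in blast)

lemma rp_strict_linear: "strict_linear_order_on (out_edges T base P) (rp P)"
  unfolding strict_linear_order_on_def
proof (intro conjI)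
  have sub: "rp P \<subseteq> edge h ` B \<times> edge h ` B" unfolding rp_eq by auto
  show "trans (rp P)"
  proof (rule transI)
    fix x y z assume xyz: "(x, y) \<in> rp P" "(y, z) \<in> rp P"
    then obtain a b c where abc: "x = edge h a" "y = edge h b" "z = edge h c" "a \<in> B" "b \<in> B" "c \<in> B"
      using sub by blast
    then have "d a b = h" "less_R a b" "d b c = h" "less_R b c" using xyz rp_iff by auto
    then have "less_R a c" "d a c \<le> h" using less_trans'[of a b c] convex[of a b c] abc ball_subset by auto
    moreover have "h \<le> d a c" using ball_dist abc by auto
    ultimately show "(x, z) \<in> rp P" using rp_iff abc by auto
  qed
  show "irrefl (rp P)"
  proof (rule irreflI)
    fix x show "(x, x) \<notin> rp P"
    proof
      assume x: "(x, x) \<in> rp P"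
      then obtain a where "x = edge h a" "a \<in> B" using sub by blast
      then show False using x rp_iff less_irrefl' ball_subset by auto
    qed
  qed
  show "total_on (out_edges T base P) (rp P)"
    unfolding out_edges_meet
  proof (rule total_onI)
    fix x y assume "x \<in> edge h ` B" "y \<in> edge h ` B" "x \<noteq> y"
    then obtain a b where ab: "x = edge h a" "y = edge h b" "a \<in> B" "b \<in> B" "edge h a \<noteq> edge h b" by auto
    then have "d a b = h" using edge_eq ball_dist by (metis antisym not_le)
    moreover have "a \<noteq> b" using ab by auto
    ultimately show "(x, y) \<in> rp P \<or> (y, x) \<in> rp P"
      using ab rp_iff[of a b] rp_iff[of b a] less_total'[of a b] d_sym[of a b] ball_subset by auto
  qed
qed

end

lemma internal_iff: "P' \<in> internal_vertices T base \<longleftrightarrow> (\<exists>\<xi>\<in>A. \<exists>\<eta>\<in>A. \<xi> \<noteq> \<eta> \<and> P' = pt \<xi> (d \<xi> \<eta>))"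
  unfolding internal_vertices_eq by blast

lemma leaf_less_eq:
  assumes "a \<in> A" "b \<in> A" "a \<noteq> b"
  shows "leaf_less T base lt (leaf a) (leaf b) \<longleftrightarrow>
    (edge_towards T base (pt a (d a b)) (leaf a), edge_towards T base (pt a (d a b)) (leaf b)) \<in> lt (pt a (d a b))"
  using assms by (simp add: leaf_less_def meet_eq Let_def)

lemma in_ball_self: "a \<in> A \<Longrightarrow> b \<in> A \<Longrightarrow> a \<noteq> b \<Longrightarrow> a \<in> B a b \<and> b \<in> B a b"
  by (auto simp: B_def h_def d_self)

lemma rp_outside: "P' \<notin> internal_vertices T base \<Longrightarrow> rp P' = {}"
  unfolding rp_def internal_iff by blast

lemma rp_planar: "planar_structure T base rp"
  unfolding planar_structure_def
proof (intro conjI ballI allI impI)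
  fix P' assume "P' \<in> internal_vertices T base"
  then obtain \<xi> \<eta> where x: "\<xi> \<in> A" "\<eta> \<in> A" "\<xi> \<noteq> \<eta>" "P' = P \<xi> \<eta>"
    unfolding internal_iff by (auto simp: P_def)
  show "rp P' \<subseteq> out_edges T base P' \<times> out_edges T base P'"
    unfolding x(4) out_edges_meet[OF x(1-3)] rp_eq[OF x(1-3)] by auto
  show "strict_linear_order_on (out_edges T base P') (rp P')"
    unfolding x(4) by (rule rp_strict_linear[OF x(1-3)])
qed (rule rp_outside)

lemma rp_leaf_less:
  assumes "a \<in> A" "b \<in> A"
  shows "leaf_less T base rp (leaf a) (leaf b) \<longleftrightarrow> less_R a b"
proof (cases "a = b")
  case True
  then have "meet T base (leaf a) (leaf b) = leaf a" using meet_eq[OF assms] d_self[OF assms(1)] leaf_eq[of a] by simp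
  moreover have "leaf a \<notin> internal_vertices T base" using assms by (auto simp: internal_vertices_def leaves_eq)
  ultimately show ?thesis using True assms rp_outside less_irrefl' by (simp add: leaf_less_def)
next
  case False
  note x = assms False
  have "leaf_less T base rp (leaf a) (leaf b) \<longleftrightarrow> (edge (h a b) a, edge (h a b) b) \<in> rp (P a b)"
    using leaf_less_eq[OF x, of rp] edge_towards_meet[OF x] in_ball_self[OF x] by (simp add: P_def[OF x])
  then show ?thesis using rp_iff[OF x] in_ball_self[OF x] by (simp add: h_def[OF x])
qed

text \<open>Any two distinct outgoing edges at an internal vertex lead to two leaves that meet
  there, so the order of the leaves determines the order of the edges.\<close>

lemma planar_unique:
  assumes "planar_structure T base lt"
    and "\<And>a b. a \<in> A \<Longrightarrow> b \<in> A \<Longrightarrow> leaf_less T base lt (leaf a) (leaf b) \<longleftrightarrow> less_R a b"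
  shows "lt = rp"
proof
  fix P'
  show "lt P' = rp P'"
  proof (cases "P' \<in> internal_vertices T base")
    case False
    then show ?thesis using assms(1) rp_outside by (auto simp: planar_structure_def)
  next
    case True
    then obtain \<xi> \<eta> where x: "\<xi> \<in> A" "\<eta> \<in> A" "\<xi> \<noteq> \<eta>" "P' = P \<xi> \<eta>"
      unfolding internal_iff by (auto simp: P_def)
    note x3 = x(1-3)
    have lt: "lt P' \<subseteq> out_edges T base P' \<times> out_edges T base P'" "irrefl (lt P')"
      using assms(1) True by (auto simp: planar_structure_def strict_linear_order_on_def)
    have key: "(edge (h \<xi> \<eta>) a, edge (h \<xi> \<eta>) b) \<in> lt P' \<longleftrightarrow> (edge (h \<xi> \<eta>) a, edge (h \<xi> \<eta>) b) \<in> rp P'"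
      if ab: "a \<in> B \<xi> \<eta>" "b \<in> B \<xi> \<eta>" for a b
    proof (cases "d a b = h \<xi> \<eta>")
      case True
      note A2 = ball_subset[OF x3 ab(1)] ball_subset[OF x3 ab(2)]
      have ne: "a \<noteq> b" using True meet_height[OF x3] A2 d_self by auto
      have P': "pt a (d a b) = P'" using B_iff[OF x3 A2] ab True x(4) by simp
      have "leaf_less T base lt (leaf a) (leaf b) \<longleftrightarrow> (edge (h \<xi> \<eta>) a, edge (h \<xi> \<eta>) b) \<in> lt P'"
        using leaf_less_eq[OF A2 ne, of lt] edge_towards_meet[OF x3] ab P' x(4) by simp
      then show ?thesis using assms(2)[OF A2] rp_iff[OF x3 ab] True x(4) by simp
    next
      case False
      then have "h \<xi> \<eta> < d a b" using ball_dist[OF x3 ab] by simp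
      then have "edge (h \<xi> \<eta>) a = edge (h \<xi> \<eta>) b" using edge_eq[OF x3 ab] by simp
      then have "(edge (h \<xi> \<eta>) a, edge (h \<xi> \<eta>) b) \<notin> lt P'" using lt(2) by (simp add: irrefl_def)
      then show ?thesis using rp_iff[OF x3 ab] False x(4) by simp
    qed
    have sub: "rp P' \<subseteq> out_edges T base P' \<times> out_edges T base P'"
      unfolding x(4) out_edges_meet[OF x3] rp_eq[OF x3] by auto
    have oe': "out_edges T base P' = edge (h \<xi> \<eta>) ` B \<xi> \<eta>" unfolding x(4) by (rule out_edges_meet[OF x3])
    show ?thesis
    proof (intro equalityI subrelI)
      fix e e' assume e: "(e, e') \<in> lt P'"
      then have "e \<in> out_edges T base P'" "e' \<in> out_edges T base P'" using lt(1) by auto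
      then have "e \<in> edge (h \<xi> \<eta>) ` B \<xi> \<eta>" "e' \<in> edge (h \<xi> \<eta>) ` B \<xi> \<eta>" unfolding oe' by simp_all
      then obtain a b where "a \<in> B \<xi> \<eta>" "b \<in> B \<xi> \<eta>" "e = edge (h \<xi> \<eta>) a" "e' = edge (h \<xi> \<eta>) b"
        by auto
      then show "(e, e') \<in> rp P'" using key e by simp
    next
      fix e e' assume e: "(e, e') \<in> rp P'"
      then have "e \<in> out_edges T base P'" "e' \<in> out_edges T base P'" using sub by auto
      then have "e \<in> edge (h \<xi> \<eta>) ` B \<xi> \<eta>" "e' \<in> edge (h \<xi> \<eta>) ` B \<xi> \<eta>" unfolding oe' by simp_all
      then obtain a b where "a \<in> B \<xi> \<eta>" "b \<in> B \<xi> \<eta>" "e = edge (h \<xi> \<eta>) a" "e' = edge (h \<xi> \<eta>) b"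
        by auto
      then show "(e, e') \<in> lt P'" using key e by simp
    qed
  qed
qed

lemma real_planar_eq: "real_planar f = rp"
  unfolding real_planar_def A_eq[symmetric]
proof (rule the_equality)
  show "planar_structure T base rp \<and>
    (\<forall>\<xi>\<in>A. \<forall>\<xi>'\<in>A. leaf_less T base rp (leaf \<xi>) (leaf \<xi>') = less_R \<xi> \<xi>')"
    using rp_planar rp_leaf_less by blast
qed (use planar_unique in blast)

section \<open>Edge positions and discrete integration at one vertex\<close>

context
  fixes \<xi> \<eta> assumes \<xi>\<eta>: "\<xi> \<in> A" "\<eta> \<in> A" "\<xi> \<noteq> \<eta>"
begin

abbreviation "PP \<equiv> P \<xi> \<eta>"
abbreviation "hh \<equiv> h \<xi> \<eta>"
abbreviation "BB \<equiv> B \<xi> \<eta>"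
abbreviation "es \<equiv> edge_list f (P \<xi> \<eta>)"

lemmas loc = ball_subset[OF \<xi>\<eta>] ball_dist[OF \<xi>\<eta>] B_iff[OF \<xi>\<eta>] edge_towards_meet[OF \<xi>\<eta>] out_edges_meet[OF \<xi>\<eta>] edge_eq[OF \<xi>\<eta>] rp_iff[OF \<xi>\<eta>]

lemma es: "distinct es" "set es = edge hh ` BB" "sorted_wrt (\<lambda>e e'. (e, e') \<in> rp PP) es"
proof -
  have lin: "trans (rp PP)" "irrefl (rp PP)" "total_on (out_edges T base PP) (rp PP)"
    using rp_strict_linear[OF \<xi>\<eta>] by (auto simp: strict_linear_order_on_def)
  have "finite (out_edges T base PP)" unfolding out_edges_meet[OF \<xi>\<eta>] using fin by (simp add: B_def[OF \<xi>\<eta>])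
  then have "distinct es \<and> set es = out_edges T base PP \<and> sorted_wrt (\<lambda>e e'. (e, e') \<in> rp PP) es"
    unfolding edge_list_def real_planar_eq A_eq[symmetric]
  proof (rule sorted_wrt_The)
    show "\<And>x y z. (x, y) \<in> rp PP \<Longrightarrow> (y, z) \<in> rp PP \<Longrightarrow> (x, z) \<in> rp PP" using lin(1) by (rule transD)
    show "\<And>x y. x \<in> out_edges T base PP \<Longrightarrow> y \<in> out_edges T base PP \<Longrightarrow> x \<noteq> y \<Longrightarrow> (x, y) \<in> rp PP \<or> (y, x) \<in> rp PP"
      using lin(3) by (auto simp: total_on_def)
    show "\<And>x. (x, x) \<notin> rp PP" using lin(2) by (auto simp: irrefl_def)
  qed
  then show "distinct es" "set es = edge hh ` BB" "sorted_wrt (\<lambda>e e'. (e, e') \<in> rp PP) es"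
    using loc(5) by auto
qed

lemma rp_asym: "(x, y) \<in> rp PP \<Longrightarrow> (y, x) \<notin> rp PP"
  using rp_strict_linear[OF \<xi>\<eta>] unfolding strict_linear_order_on_def by (metis irrefl_def transD)

lemma es_less: "i < length es \<Longrightarrow> j < length es \<Longrightarrow> (es ! i, es ! j) \<in> rp PP \<longleftrightarrow> i < j"
  using sorted_wrt_nth_iff[OF es(3)] rp_asym by auto

definition pos :: "real pseries \<Rightarrow> nat" where
  "pos a = (THE i. i < length es \<and> es ! i = edge hh a)"

lemma pos: "a \<in> BB \<Longrightarrow> pos a < length es \<and> es ! pos a = edge hh a"
  unfolding pos_def
proof (rule theI')
  assume "a \<in> BB"
  then have "edge hh a \<in> set es" using es(2) by simp
  then show "\<exists>!i. i < length es \<and> es ! i = edge hh a"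
    by (rule distinct_Ex1[OF es(1)])
qed

lemma pos_eqI: "i < length es \<Longrightarrow> es ! i = edge hh a \<Longrightarrow> a \<in> BB \<Longrightarrow> pos a = i"
  using pos[of a] es(1) by (metis nth_eq_iff_index_eq)

lemma pos_less:
  assumes "a \<in> BB" "b \<in> BB"
  shows "pos a < pos b \<longleftrightarrow> d a b = hh \<and> less_R a b"
  using es_less[of "pos a" "pos b"] pos[OF assms(1)] pos[OF assms(2)] loc(7)[OF assms] by simp

lemma pos_mono:
  assumes "a \<in> BB" "b \<in> BB" "less_R a b"
  shows "pos a \<le> pos b"
proof (rule ccontr)
  assume "\<not> pos a \<le> pos b"
  then have "less_R b a" using pos_less[OF assms(2,1)] by simp
  then show False using assms less_asym' loc(1) by blast
qed

lemma pos_eq: "a \<in> BB \<Longrightarrow> b \<in> BB \<Longrightarrow> pos a = pos b \<longleftrightarrow> hh < d a b"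
  using loc(6)[of a b] pos[of a] pos[of b] es(1) by (metis nth_eq_iff_index_eq)

lemma pos_surj: "i < length es \<Longrightarrow> \<exists>a\<in>BB. pos a = i"
  using es(2) pos_eqI[of i] by (metis imageE nth_mem)

lemma gap_ex1:
  assumes "Suc k < length es"
  shows "\<exists>!r. Suc r < length rs \<and> pt (rs ! r) (d (rs ! r) (rs ! Suc r)) = PP \<and>
     es ! k = edge_towards T base PP (leaf (rs ! r)) \<and> es ! Suc k = edge_towards T base PP (leaf (rs ! Suc r))"
proof -
  have iff: "(Suc r < length rs \<and> pt (rs ! r) (d (rs ! r) (rs ! Suc r)) = PP \<and>
     es ! k = edge_towards T base PP (leaf (rs ! r)) \<and> es ! Suc k = edge_towards T base PP (leaf (rs ! Suc r))) \<longleftrightarrow>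
     Suc r < length rs \<and> rs ! r \<in> BB \<and> rs ! Suc r \<in> BB \<and> pos (rs ! r) = k \<and> pos (rs ! Suc r) = Suc k" for r
  proof -
    have "rs ! r \<in> A" "rs ! Suc r \<in> A" if "Suc r < length rs" using rs_in that by auto
    moreover have "d a b = hh" if "a \<in> BB" "b \<in> BB" "pos a = k" "pos b = Suc k" for a b
      using pos_less[OF that(1,2)] that by simp
    moreover have "pos a = i \<longleftrightarrow> es ! i = edge_towards T base PP (leaf a)" if "a \<in> BB" "i < length es" for a i
      using pos[OF that(1)] pos_eqI[OF that(2) _ that(1)] loc(4)[OF that(1)] by auto
    ultimately show ?thesis using loc(3) assms by (metis Suc_lessD)
  qed
  \<comment> \<open>Its maximum is the required index, the last root beyond the k-th edge. Some root
    \<open>b\<close> beyond edge k + 1 lies to its right, so by convexity the next root is still in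
    the ball, and monotonicity of \<open>pos\<close> leaves k + 1 as its position.\<close>
  define R where "R = {r. r < length rs \<and> rs ! r \<in> BB \<and> pos (rs ! r) = k}"
  have "R \<noteq> {}"
  proof -
    obtain a where a: "a \<in> BB" "pos a = k" using pos_surj[of k] assms by auto
    then have "a \<in> set rs" using rs loc(1) by simp
    then show ?thesis unfolding R_def using a by (auto simp: in_set_conv_nth)
  qed
  moreover have "finite R" by (simp add: R_def)
  ultimately have r: "Max R \<in> R" "\<And>r. r \<in> R \<Longrightarrow> r \<le> Max R" by auto
  define r where "r = Max R"
  have r1: "r < length rs" "rs ! r \<in> BB" "pos (rs ! r) = k" using r(1) by (auto simp: R_def r_def)
  obtain b where b: "b \<in> BB" "pos b = Suc k" using pos_surj[OF assms] by auto
  then have "b \<in> set rs" using rs loc(1) by simp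
  then obtain j where j: "j < length rs" "rs ! j = b" by (auto simp: in_set_conv_nth)
  have "d (rs ! r) b = hh" "less_R (rs ! r) b" using pos_less[OF r1(2) b(1)] r1 b by auto
  then have rj: "r < j" using rs_nth_less[OF r1(1) j(1)] j by simp
  have S: "Suc r < length rs" using rj j by simp
  have inB: "rs ! Suc r \<in> BB"
  proof (cases "Suc r = j")
    case False
    then have "less_R (rs ! r) (rs ! Suc r)" "less_R (rs ! Suc r) b"
      using rs_nth_less S r1 j rj by auto
    then have "d (rs ! r) b \<le> d (rs ! r) (rs ! Suc r)"
      using convex[of "rs ! r" "rs ! Suc r" b] rs_in S r1 b loc(1) by auto
    then have "hh \<le> d (rs ! r) (rs ! Suc r)" using \<open>d (rs ! r) b = hh\<close> by simp
    then have "hh \<le> d \<xi> (rs ! Suc r)" using d_le[of hh \<xi> "rs ! r" "rs ! Suc r"] r1(2) \<xi>\<eta> rs_in[OF S] rs_in[OF r1(1)]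
      by (simp add: B_def[OF \<xi>\<eta>])
    then show ?thesis using rs_in[OF S] by (simp add: B_def[OF \<xi>\<eta>])
  qed (use b j in simp)
  have "pos (rs ! Suc r) \<noteq> k"
  proof
    assume "pos (rs ! Suc r) = k"
    then have "Suc r \<in> R" using S inB by (simp add: R_def)
    from r(2)[OF this] show False by (simp add: r_def)
  qed
  moreover have "k \<le> pos (rs ! Suc r)" using pos_mono[OF r1(2) inB] rs_nth_less[OF r1(1) S] r1 by simp
  moreover have "pos (rs ! Suc r) \<le> Suc k"
  proof (cases "Suc r = j")
    case False
    then show ?thesis using pos_mono[OF inB b(1)] rs_nth_less[OF S j(1)] rj b j by simp
  qed (use b j in simp)
  ultimately have "pos (rs ! Suc r) = Suc k" by simp
  then have "Suc r < length rs \<and> rs ! r \<in> BB \<and> rs ! Suc r \<in> BB \<and> pos (rs ! r) = k \<and> pos (rs ! Suc r) = Suc k"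
    using S r1 inB by simp
  moreover have False if "Suc u < length rs" "rs ! u \<in> BB" "rs ! Suc u \<in> BB" "pos (rs ! u) = k" "pos (rs ! Suc u) = Suc k"
    "Suc v < length rs" "rs ! v \<in> BB" "rs ! Suc v \<in> BB" "pos (rs ! v) = k" "pos (rs ! Suc v) = Suc k" "u < v" for u v
  proof (cases "Suc u = v")
    case False
    then have "pos (rs ! Suc u) \<le> pos (rs ! v)" using pos_mono[of "rs ! Suc u" "rs ! v"] rs_nth_less that by simp
    then show False using that by simp
  qed (use that in auto)
  ultimately show ?thesis unfolding iff by (metis linorder_neqE_nat)
qed

lemma gap_index:
  assumes "Suc k < length es"
  defines "r \<equiv> gap_index f PP k"
  shows "Suc r < length rs" "rs ! r \<in> BB" "rs ! Suc r \<in> BB" "d (rs ! r) (rs ! Suc r) = hh"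
    "pos (rs ! r) = k" "pos (rs ! Suc r) = Suc k"
proof -
  have "Suc r < length rs \<and> pt (rs ! r) (d (rs ! r) (rs ! Suc r)) = PP \<and>
     es ! k = edge_towards T base PP (leaf (rs ! r)) \<and> es ! Suc k = edge_towards T base PP (leaf (rs ! Suc r))"
  proof -
    let ?Q = "\<lambda>r. Suc r < length rs \<and> pt (rs ! r) (d (rs ! r) (rs ! Suc r)) = PP \<and>
     es ! k = edge_towards T base PP (leaf (rs ! r)) \<and> es ! Suc k = edge_towards T base PP (leaf (rs ! Suc r))"
    have "r = (THE r. ?Q r)"
      unfolding r_def gap_index_def A_eq[symmetric] Let_def
      by (rule arg_cong[of _ _ The], rule ext) (use rs_in in \<open>auto simp: meet_eq\<close>)
    then show ?thesis using theI'[OF gap_ex1[OF assms(1)]] by simp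
  qed
  then have 1: "Suc r < length rs" "pt (rs ! r) (d (rs ! r) (rs ! Suc r)) = PP"
     "es ! k = edge_towards T base PP (leaf (rs ! r))" "es ! Suc k = edge_towards T base PP (leaf (rs ! Suc r))" by auto
  then have 2: "rs ! r \<in> BB" "rs ! Suc r \<in> BB" "d (rs ! r) (rs ! Suc r) = hh"
    using loc(3)[of "rs ! r" "rs ! Suc r"] rs_in by auto
  show "Suc r < length rs" "rs ! r \<in> BB" "rs ! Suc r \<in> BB" "d (rs ! r) (rs ! Suc r) = hh"
    using 1 2 by auto
  show "pos (rs ! r) = k" "pos (rs ! Suc r) = Suc k"
    using 1 2 loc(4) assms(1) by (auto intro!: pos_eqI)
qed

text \<open>\<Psi> is a potential for the discrete integration at the vertex: constant on each edge,
  with the initial coefficients as jumps. Constancy on edges lets the end of one jump serve as the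
  start of the next, although they may belong to different roots.\<close>

lemma discrete_integral_telescope:
  assumes "\<And>a b. a \<in> BB \<Longrightarrow> b \<in> BB \<Longrightarrow> hh < d a b \<Longrightarrow> \<Psi> a = \<Psi> b"
    and "\<And>r. Suc r < length rs \<Longrightarrow> rs ! r \<in> BB \<Longrightarrow> rs ! Suc r \<in> BB \<Longrightarrow> d (rs ! r) (rs ! Suc r) = hh \<Longrightarrow>
       init_coeff (increment f r) = \<Psi> (rs ! Suc r) - \<Psi> (rs ! r)"
    and "a \<in> BB" "pos a = 0" "b \<in> BB" "pos b = i"
  shows "discrete_integral f PP i = \<Psi> b - \<Psi> a"
  using assms(5,6)
proof (induction i arbitrary: b)
  case 0
  then have "hh < d a b" using pos_eq[of a b] assms(3,4) by simp
  then show ?case using assms(1)[of a b] 0 assms(3) by (simp add: discrete_integral_def)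
next
  case (Suc i)
  have S: "Suc i < length es" using pos[OF Suc.prems(1)] Suc.prems(2) by simp
  note g = gap_index[OF S]
  let ?r = "gap_index f PP i"
  have "discrete_integral f PP (Suc i) = discrete_integral f PP i + init_coeff (increment f ?r)"
    by (simp add: discrete_integral_def)
  also have "\<dots> = (\<Psi> (rs ! ?r) - \<Psi> a) + (\<Psi> (rs ! Suc ?r) - \<Psi> (rs ! ?r))"
    using Suc.IH[OF g(2,5)] assms(2)[OF g(1-4)] by simp
  also have "\<Psi> (rs ! Suc ?r) = \<Psi> b"
    using assms(1)[OF g(3) Suc.prems(1)] pos_eq[OF g(3) Suc.prems(1)] g(6) Suc.prems(2) by simp
  finally show ?case by simp
qed

end

text \<open>The discrete integral and \<Psi> differ by a constant on the edges at the vertex, so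
  injectivity and the integrated order are both statements about \<Psi>.\<close>

lemma less_int_iff:
  assumes inj: "injectivity_condition f" and ab: "a \<in> A" "b \<in> A" "a \<noteq> b"
    and "\<And>c e. c \<in> B a b \<Longrightarrow> e \<in> B a b \<Longrightarrow> h a b < d c e \<Longrightarrow> \<Psi> c = \<Psi> e"
    and "\<And>r. Suc r < length rs \<Longrightarrow> rs ! r \<in> B a b \<Longrightarrow> rs ! Suc r \<in> B a b \<Longrightarrow> d (rs ! r) (rs ! Suc r) = h a b \<Longrightarrow>
       init_coeff (increment f r) = \<Psi> (rs ! Suc r) - \<Psi> (rs ! r)"
  shows "\<Psi> a \<noteq> \<Psi> b" "less_int f a b \<longleftrightarrow> \<Psi> a < \<Psi> b"
proof -
  let ?es = "edge_list f (P a b)" and ?D = "discrete_integral f (P a b)"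
  have aB: "a \<in> B a b" "b \<in> B a b" using in_ball_self[OF ab] by auto
  note p = pos[OF ab aB(1)] pos[OF ab aB(2)]
  have "0 < length ?es" using p(1) by linarith
  then obtain c where c: "c \<in> B a b" "pos a b c = 0" using pos_surj[OF ab] by blast
  have D: "?D (pos a b e) = \<Psi> e - \<Psi> c" if "e \<in> B a b" for e
    using discrete_integral_telescope[OF ab assms(5,6) c that refl] by blast
  have int: "P a b \<in> internal_vertices T base" unfolding internal_iff P_def[OF ab] using ab by blast
  then have "inj_on ?D {0..<length ?es}"
    using inj unfolding injectivity_condition_def A_eq[symmetric] by blast
  moreover have "pos a b a \<noteq> pos a b b" using pos_eq[OF ab aB] by (simp add: h_def[OF ab])
  ultimately have "?D (pos a b a) \<noteq> ?D (pos a b b)" using p by (auto simp: inj_on_def)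
  then show "\<Psi> a \<noteq> \<Psi> b" using D aB by auto
  have "less_int f a b \<longleftrightarrow> (edge (h a b) a, edge (h a b) b) \<in> integrated_planar f (P a b)"
    unfolding less_int_def A_eq[symmetric] leaf_less_eq[OF ab] P_def[OF ab, symmetric]
    using edge_towards_meet[OF ab] aB by simp
  also have "\<dots> \<longleftrightarrow> ?D (pos a b a) < ?D (pos a b b)"
  proof
    assume "(edge (h a b) a, edge (h a b) b) \<in> integrated_planar f (P a b)"
    then obtain k l where kl: "k < length ?es" "l < length ?es" "?D k < ?D l" "edge (h a b) a = ?es ! k" "edge (h a b) b = ?es ! l"
      using int unfolding integrated_planar_def A_eq[symmetric] by auto
    then have "pos a b a = k" "pos a b b = l" using pos_eqI[OF ab] aB by auto
    then show "?D (pos a b a) < ?D (pos a b b)" using kl by simp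
  next
    assume "?D (pos a b a) < ?D (pos a b b)"
    then show "(edge (h a b) a, edge (h a b) b) \<in> integrated_planar f (P a b)"
      using int p unfolding integrated_planar_def A_eq[symmetric] by auto
  qed
  also have "\<dots> \<longleftrightarrow> \<Psi> a < \<Psi> b" using D aB by simp
  finally show "less_int f a b \<longleftrightarrow> \<Psi> a < \<Psi> b" .
qed

text \<open>A leaf meets itself in itself. This is no internal vertex, so the relation there is
  empty.\<close>

lemma less_int_irrefl: "a \<in> A \<Longrightarrow> \<not> less_int f a a"
proof -
  assume a: "a \<in> A"
  then have "meet T base (leaf a) (leaf a) = leaf a" using meet_eq[of a a] d_self[of a] leaf_eq[of a] by simp
  moreover have "leaf a \<notin> internal_vertices T base" using a by (auto simp: internal_vertices_def leaves_eq)
  ultimately show ?thesis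
    unfolding less_int_def A_eq[symmetric] by (simp add: leaf_less_def integrated_planar_def flip: A_eq)
qed

end

section \<open>Series in fractional powers\<close>

lemma puiseux_nth:
  assumes "N > 0"
  shows "puiseux N g (of_nat k / of_nat N) = fps_nth g k"
proof -
  have eq: "(of_nat k / of_nat N :: rat) = of_nat l / of_nat N \<longleftrightarrow> l = k" for l
    using assms by auto
  show ?thesis unfolding puiseux_def using assms by (auto simp: eq)
qed

lemma puiseux_outside: "\<nexists>k. q = of_nat k / of_nat N \<Longrightarrow> puiseux N g q = 0"
  by (simp add: puiseux_def)

lemma puiseux_eqI:
  assumes "N > 0" "\<And>k. \<gamma> (of_nat k / of_nat N) = fps_nth g k" "\<And>q. \<nexists>k. q = of_nat k / of_nat N \<Longrightarrow> \<gamma> q = 0"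
  shows "\<gamma> = puiseux N g"
proof
  fix q show "\<gamma> q = puiseux N g q"
    using assms puiseux_nth[OF assms(1), of g] puiseux_outside[of q N g] by (cases "\<exists>k. q = of_nat k / of_nat N") auto
qed

lemma puiseux_inj: "N > 0 \<Longrightarrow> puiseux N g = puiseux N h \<longleftrightarrow> g = h"
  by (metis fps_ext puiseux_nth)

lemma puiseux_ram:
  fixes g :: "'a::comm_ring_1 fps"
  assumes "N > 0" "M > 0"
  shows "puiseux (M * N) (ram M g) = puiseux N g"
proof (rule puiseux_eqI[symmetric])
  show "puiseux N g (of_nat k / of_nat (M * N)) = fps_nth (ram M g) k" for k
  proof (cases "M dvd k")
    case True
    then obtain l where k: "k = M * l" by auto
    have "(of_nat k / of_nat (M * N) :: rat) = of_nat l / of_nat N" using assms by (simp add: k)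
    then show ?thesis using assms puiseux_nth[OF assms(1), of g l] by (simp add: ram_nth k)
  next
    case False
    have "\<nexists>l. (of_nat k / of_nat (M * N) :: rat) = of_nat l / of_nat N"
    proof
      assume "\<exists>l. (of_nat k / of_nat (M * N) :: rat) = of_nat l / of_nat N"
      then obtain l where "(of_nat k / of_nat (M * N) :: rat) = of_nat l / of_nat N" by auto
      then have "(of_nat k :: rat) = of_nat (M * l)" using assms by (simp add: field_simps)
      then have "k = M * l" by (simp only: of_nat_eq_iff)
      then show False using False by simp
    qed
    then show ?thesis using False puiseux_outside[of _ N g] by (simp add: ram_nth)
  qed
  fix q :: rat assume q: "\<nexists>k. q = of_nat k / of_nat (M * N)"
  have "\<nexists>k. q = of_nat k / of_nat N"
  proof
    assume "\<exists>k. q = of_nat k / of_nat N"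
    then obtain k where "q = of_nat k / of_nat N" by auto
    then have "q = of_nat (M * k) / of_nat (M * N)" using assms by simp
    then show False using q by blast
  qed
  then show "puiseux N g q = 0" by (rule puiseux_outside)
qed (use assms in auto)

lemma puiseux_diff:
  fixes g h :: "'a::group_add fps"
  assumes "N > 0"
  shows "puiseux N g - puiseux N h = puiseux N (g - h)"
  by (rule puiseux_eqI) (use assms in \<open>auto simp: puiseux_nth puiseux_outside\<close>)

lemma puiseux_0: "N > 0 \<Longrightarrow> puiseux N (0::'a::zero fps) = (\<lambda>_. 0)"
  by (rule puiseux_eqI[symmetric]) auto

lemma puiseux_least:
  fixes g :: "'a::zero fps"
  assumes "N > 0" "g \<noteq> 0"
  shows "(LEAST q. puiseux N g q \<noteq> 0) = of_nat (subdegree g) / of_nat N"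
proof (rule Least_equality)
  show "puiseux N g (of_nat (subdegree g) / of_nat N) \<noteq> 0"
    using assms by (simp add: puiseux_nth)
  fix q assume q: "puiseux N g q \<noteq> 0"
  then obtain k where k: "q = of_nat k / of_nat N" using puiseux_outside by blast
  then have "fps_nth g k \<noteq> 0" using q assms by (simp add: puiseux_nth)
  then have "subdegree g \<le> k" by (rule subdegree_leI)
  then show "of_nat (subdegree g) / of_nat N \<le> q" unfolding k by (simp add: divide_right_mono)
qed

lemma valuation_puiseux:
  fixes g :: "'a::zero fps"
  assumes "N > 0"
  shows "valuation (puiseux N g) = (if g = 0 then \<infinity> else ereal (real (subdegree g) / real N))"
proof (cases "g = 0")
  case False
  then have "puiseux N g \<noteq> (\<lambda>_. 0)" unfolding puiseux_0[OF assms, symmetric] puiseux_inj[OF assms] .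
  then show ?thesis using False by (simp add: valuation_def puiseux_least[OF assms False] of_rat_divide)
qed (simp add: valuation_def puiseux_0[OF assms])

lemma init_coeff_puiseux:
  fixes g :: "'a::zero fps"
  assumes "N > 0"
  shows "init_coeff (puiseux N g) = fps_nth g (subdegree g)"
proof (cases "g = 0")
  case False
  then show ?thesis by (simp add: init_coeff_def puiseux_least[OF assms False] puiseux_nth[OF assms])
qed (simp add: init_coeff_def puiseux_0[OF assms])

text \<open>The definite description has a unique solution: two representations of the series become
  equal over the product of their denominators, and substitution commutes with
  \<open>ram\<close>.\<close>

lemma subst_y_eq:
  assumes "N > 0" "fps_nth g 0 = 0"
  shows "subst_y F (puiseux N g) = puiseux N (fsubst (map_coeff (ram N) F) g)"
proof -
  have eq: "Abs_fps (\<lambda>k. \<Sum>j\<le>k. fps_nth (fps_compose (fps_nth F j) (fps_X ^ n) * g ^ j) k) = fsubst (map_coeff (ram n) F) g"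
    if "n \<ge> 1" for n and g :: "real fps"
    using that by (simp add: fsubst_def ram_eq_compose)
  have lift: "puiseux n (fsubst (map_coeff (ram n) F) g) = puiseux (m * n) (fsubst (map_coeff (ram (m * n)) F) (ram m g))"
    if "n > 0" "m > 0" "fps_nth g 0 = 0" for n m and g :: "real fps"
  proof -
    have "ram m \<circ> ram n = (ram (m * n) :: real fps \<Rightarrow> _)" using ram_ram that by (auto simp: fun_eq_iff)
    then have "fsubst (map_coeff (ram (m * n)) F) (ram m g) = ram m (fsubst (map_coeff (ram n) F) g)"
      using fsubst_hom[OF fps_hom_ram[OF that(2)] that(3), of "map_coeff (ram n) F"] that(3) by (simp add: map_coeff_comp)
    then show ?thesis by (simp add: puiseux_ram[OF that(1,2)])
  qed
  show ?thesis unfolding subst_y_def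
  proof (rule the_equality)
    show "\<exists>n\<ge>1. \<exists>ga. fps_nth ga 0 = 0 \<and> puiseux N g = puiseux n ga \<and>
        puiseux N (fsubst (map_coeff (ram N) F) g) =
        puiseux n (Abs_fps (\<lambda>k. \<Sum>j\<le>k. fps_nth (fps_compose (fps_nth F j) (fps_X ^ n) * ga ^ j) k))"
      using assms eq[of N g] by (intro exI[of _ N] conjI exI[of _ g]) auto
    fix S assume "\<exists>n\<ge>1. \<exists>ga. fps_nth ga 0 = 0 \<and> puiseux N g = puiseux n ga \<and>
        S = puiseux n (Abs_fps (\<lambda>k. \<Sum>j\<le>k. fps_nth (fps_compose (fps_nth F j) (fps_X ^ n) * ga ^ j) k))"
    then obtain n g' where n: "n \<ge> 1" "fps_nth g' 0 = 0" "puiseux N g = puiseux n g'"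
      "S = puiseux n (fsubst (map_coeff (ram n) F) g')" using eq by auto
    have "puiseux (n * N) (ram n g) = puiseux (n * N) (ram N g')"
      using puiseux_ram[of N n g] puiseux_ram[of n N g'] n assms by (simp add: mult.commute)
    then have "ram n g = ram N g'" using puiseux_inj n assms by (metis mult_pos_pos less_le_trans zero_less_one)
    then show "S = puiseux N (fsubst (map_coeff (ram N) F) g)"
      using lift[of n N g'] lift[of N n g] n assms by (simp add: mult.commute)
  qed
qed

lemma map_ram_ramify:
  assumes "N > 0" "M > 0"
  shows "map_coeff (ram M) (ramify N f) = ramify (M * N) f"
proof -
  have "ram M \<circ> ram N = (ram (M * N) :: complex fps \<Rightarrow> _)" using ram_ram assms by (auto simp: fun_eq_iff)
  then show ?thesis using assms by (simp add: ramify_eq_ram map_coeff_comp flip: comp_assoc)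
qed

lemma ramify_factorization_lift:
  assumes "N > 0" "M > 0" "ramify N f = ramify N u * (\<Prod>g\<in>#G. fps_X - fps_const g)"
  shows "ramify (M * N) f = ramify (M * N) u * (\<Prod>g\<in>#image_mset (ram M) G. fps_X - fps_const g)"
proof -
  note h = fps_hom_ram[OF assms(2), where 'a = complex]
  have "ramify (M * N) f = map_coeff (ram M) (ramify N u * (\<Prod>g\<in>#G. fps_X - fps_const g))"
    unfolding map_ram_ramify[OF assms(1,2), symmetric] assms(3) ..
  then show ?thesis
    unfolding hom_simps(3)[OF fps_hom_map_coeff[OF h]] map_coeff_prod[OF h] map_ram_ramify[OF assms(1,2)] .
qed

text \<open>Two factorizations with denominators N and M are compared over M N, where
  \<open>linear_factorization_unique\<close> applies.\<close>

lemma np_roots_eq: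
  assumes "N > 0" "geom_bounded2 u" "fps_nth (fps_nth u 0) 0 \<noteq> 0"
    "\<forall>g\<in>#G. geom_bounded g \<and> fps_nth g 0 = 0"
    "ramify N f = ramify N u * (\<Prod>g\<in>#G. fps_X - fps_const g)"
  shows "np_roots f = image_mset (puiseux N) G"
  unfolding np_roots_def
proof (rule the_equality)
  obtain v where "u * v = 1" "geom_bounded2 v" using geom_bounded2_inverse[OF assms(2,3)] by blast
  then show "np_factorization f (image_mset (puiseux N) G)"
    unfolding np_factorization_def convergent_series_iff
    using assms by (intro exI[of _ N] conjI exI[of _ G] bexI[of _ u] bexI[of _ v]) (auto simp: convergent_series_iff geom_bounded_iff_radius)
  fix \<Gamma> assume "np_factorization f \<Gamma>"
  then obtain M G' u' v' where M: "M \<ge> 1" "u' * v' = 1" "\<forall>g\<in>#G'. fps_conv_radius g > 0 \<and> fps_nth g 0 = 0"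
    "\<Gamma> = image_mset (puiseux M) G'" "ramify M f = ramify M u' * (\<Prod>g\<in>#G'. fps_X - fps_const g)"
    unfolding np_factorization_def by blast
  have "fps_nth (fps_nth (u' * v') 0) 0 = 1" using M(2) by simp
  then have u'0: "fps_nth (fps_nth u' 0) 0 \<noteq> 0" by auto
  have M0: "M > 0" using M by simp
  have "ramify (M * N) u * (\<Prod>g\<in>#image_mset (ram M) G. fps_X - fps_const g) =
      ramify (M * N) u' * (\<Prod>g\<in>#image_mset (ram N) G'. fps_X - fps_const g)"
    using ramify_factorization_lift[OF assms(1) M0 assms(5)] ramify_factorization_lift[OF M0 assms(1) M(5)]
    by (simp add: mult.commute[of N M])
  then have "image_mset (ram M) G = image_mset (ram N) G'"
    by (rule linear_factorization_unique[THEN conjunct1])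
       (use assms M u'0 M0 in \<open>auto simp: ramify_nth\<close>)
  then have "image_mset (puiseux (M * N)) (image_mset (ram M) G) = image_mset (puiseux (N * M)) (image_mset (ram N) G')"
    by (simp add: mult.commute)
  then show "\<Gamma> = image_mset (puiseux N) G"
    unfolding M(4) image_mset.compositionality comp_def
    by (simp add: puiseux_ram[OF assms(1) M0] puiseux_ram[OF M0 assms(1)])
qed

section \<open>Real roots among the complex factors\<close>

lemma count_image_ge: "count M x \<le> count (image_mset \<phi> M) (\<phi> x)"
proof (induction M)
  case (add y M)
  then show ?case by auto
qed simp

abbreviation "cfps \<equiv> coeff_hom complex_of_real"

lemma real_roots_data:
  assumes "N > 0" "geom_bounded2 u" "fps_nth (fps_nth u 0) 0 \<noteq> 0"
    "\<forall>g\<in>#G. geom_bounded g \<and> fps_nth g 0 = 0"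
    "ramify N f = ramify N u * (\<Prod>g\<in>#G. fps_X - fps_const g)"
  shows "root_set f = puiseux N ` {r. cfps r \<in># G}"
    "right_reduced f \<Longrightarrow> count G (cfps r) \<le> 1"
proof -
  let ?re = "\<lambda>\<gamma> q. Re (\<gamma> (q::rat))"
  have re: "?re (puiseux N (cfps r)) = puiseux N r" for r
    by (rule puiseux_eqI) (use assms(1) in \<open>auto simp: puiseux_nth puiseux_outside\<close>)
  have real: "(\<forall>q. puiseux N (cfps r) q \<in> \<real>)" for r
  proof
    fix q show "puiseux N (cfps r) q \<in> \<real>"
      using puiseux_nth[OF assms(1), of "cfps r"] puiseux_outside[of q N "cfps r"]
      by (cases "\<exists>k. q = of_nat k / of_nat N") auto
  qed
  have conv: "g = cfps (Abs_fps (\<lambda>i. Re (fps_nth g i)))" if "\<forall>q. puiseux N g q \<in> \<real>" for g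
  proof (rule fps_ext)
    fix i
    have "fps_nth g i \<in> \<real>" using that puiseux_nth[OF assms(1), of g i] by metis
    then show "fps_nth g i = fps_nth (cfps (Abs_fps (\<lambda>i. Re (fps_nth g i)))) i" by simp
  qed
  have rr: "real_roots f = image_mset ?re (filter_mset (\<lambda>\<gamma>. \<forall>q. \<gamma> q \<in> \<real>) (image_mset (puiseux N) G))"
    unfolding real_roots_def np_roots_eq[OF assms] ..
  show "root_set f = puiseux N ` {r. cfps r \<in># G}"
  proof (intro equalityI subsetI)
    fix \<xi> assume "\<xi> \<in> root_set f"
    then obtain g where g: "g \<in># G" "\<forall>q. puiseux N g q \<in> \<real>" "\<xi> = ?re (puiseux N g)" unfolding rr by auto
    define r where "r = Abs_fps (\<lambda>i. Re (fps_nth g i))"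
    have "g = cfps r" using conv[OF g(2)] by (simp add: r_def)
    then show "\<xi> \<in> puiseux N ` {r. cfps r \<in># G}" using g re by auto
  next
    fix \<xi> assume "\<xi> \<in> puiseux N ` {r. cfps r \<in># G}"
    then obtain r where "cfps r \<in># G" "\<xi> = puiseux N r" by auto
    then show "\<xi> \<in> root_set f" unfolding rr using re[of r] real[of r] by (auto intro!: image_eqI[of _ _ "puiseux N (cfps r)"])
  qed
  assume "right_reduced f"
  \<comment> \<open>Passing to images can only increase multiplicities, so a real factor is counted
    in \<open>G\<close> at most as often as in \<open>real_roots f\<close>.\<close>
  then have "count (real_roots f) (?re (puiseux N (cfps r))) \<le> 1" unfolding right_reduced_def by blast
  moreover have "count G (cfps r) \<le> count (image_mset (puiseux N) G) (puiseux N (cfps r))" by (rule count_image_ge)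
  moreover have "count (image_mset (puiseux N) G) (puiseux N (cfps r)) =
      count (filter_mset (\<lambda>\<gamma>. \<forall>q. \<gamma> q \<in> \<real>) (image_mset (puiseux N) G)) (puiseux N (cfps r))"
    using real[of r] by simp
  moreover have "\<dots> \<le> count (real_roots f) (?re (puiseux N (cfps r)))" unfolding rr by (rule count_image_ge)
  ultimately show "count G (cfps r) \<le> 1" by linarith
qed

text \<open>Positive leading terms cannot cancel. For differences of roots this gives both the
  transitivity of \<open>less_R\<close> and the convexity required by
  \<open>root_tree\<close>.\<close>

lemma pos_lead_add:
  fixes a b :: "real fps"
  assumes "fps_nth a (subdegree a) > 0" "fps_nth b (subdegree b) > 0"
  shows "fps_nth (a + b) (subdegree (a + b)) > 0 \<and> subdegree (a + b) = min (subdegree a) (subdegree b)"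
proof -
  let ?m = "min (subdegree a) (subdegree b)"
  have nn: "fps_nth a ?m \<ge> 0" "fps_nth b ?m \<ge> 0" "fps_nth a ?m > 0 \<or> fps_nth b ?m > 0"
  proof -
    have 1: "fps_nth a ?m = (if subdegree a \<le> subdegree b then fps_nth a (subdegree a) else 0)"
      "fps_nth b ?m = (if subdegree b \<le> subdegree a then fps_nth b (subdegree b) else 0)"
      using nth_less_subdegree_zero[of "subdegree b" a] nth_less_subdegree_zero[of "subdegree a" b]
      by (cases "subdegree a" "subdegree b" rule: linorder_cases; simp add: min_def)+
    show "fps_nth a ?m \<ge> 0" "fps_nth b ?m \<ge> 0" "fps_nth a ?m > 0 \<or> fps_nth b ?m > 0"
      unfolding 1 using assms by auto
  qed
  then have p: "fps_nth (a + b) ?m > 0" by auto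
  have "subdegree (a + b) = ?m"
  proof (rule subdegreeI)
    fix i assume "i < ?m"
    then show "fps_nth (a + b) i = 0"
      using nth_less_subdegree_zero[of i a] nth_less_subdegree_zero[of i b] by simp
  qed (use p in linarith)
  then show ?thesis using p by simp
qed

lemma root_tree_puiseux:
  assumes N: "N > 0" and R: "finite R" "R \<noteq> {}" "\<And>r. r \<in> R \<Longrightarrow> fps_nth r 0 = 0"
    and rs: "root_set f = puiseux N ` R"
  shows "root_tree (root_set f) f"
proof -
  have d: "valuation (puiseux N s - puiseux N r) = (if s = r then \<infinity> else ereal (real (subdegree (s - r)) / real N))" for r s :: "real fps"
    by (simp add: puiseux_diff[OF N] valuation_puiseux[OF N])
  have l: "less_R (puiseux N r) (puiseux N s) \<longleftrightarrow> fps_nth (s - r) (subdegree (s - r)) > 0" for r s :: "real fps"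
    by (simp only: less_R_def puiseux_diff[OF N] init_coeff_puiseux[OF N])
  have sd: "subdegree (s - r) = subdegree (r - s)" for r s :: "real fps"
    by (metis minus_diff_eq subdegree_uminus)
  show ?thesis
  proof (unfold_locales, unfold rs)
    show "finite (puiseux N ` R)" "puiseux N ` R \<noteq> {}" using R by auto
    fix \<xi> \<eta> assume "\<xi> \<in> puiseux N ` R" "\<eta> \<in> puiseux N ` R"
    then obtain r s where r: "\<xi> = puiseux N r" "\<eta> = puiseux N s" "r \<in> R" "s \<in> R" by auto
    show "valuation (\<eta> - \<xi>) = valuation (\<xi> - \<eta>)" unfolding r d using sd by auto
    show "0 < valuation (\<eta> - \<xi>)"
    proof (cases "s = r")
      case False
      have "fps_nth (s - r) 0 = 0" using R(3) r by simp
      then have "subdegree (s - r) > 0" using False by (auto simp: subdegree_eq_0_iff intro!: gr0I)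
      then show ?thesis unfolding r d using False N by simp
    qed (simp add: r d)
    show "valuation (\<eta> - \<xi>) = \<infinity> \<longleftrightarrow> \<xi> = \<eta>" unfolding r d puiseux_inj[OF N] by auto
    show "\<not> less_R \<xi> \<xi>" unfolding r l by simp
    show "less_R \<xi> \<eta> \<or> less_R \<eta> \<xi>" if "\<xi> \<noteq> \<eta>"
    proof -
      have "s - r \<noteq> 0" using that r by auto
      then have "fps_nth (s - r) (subdegree (s - r)) \<noteq> 0" by (rule nth_subdegree_nonzero)
      then show ?thesis unfolding r l sd[of r s] by auto
    qed
    fix \<zeta> assume "\<zeta> \<in> puiseux N ` R"
    then obtain q where q: "\<zeta> = puiseux N q" "q \<in> R" by auto
    show "min (valuation (\<eta> - \<xi>)) (valuation (\<zeta> - \<eta>)) \<le> valuation (\<zeta> - \<xi>)"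
    proof (cases "q = r \<or> s = r \<or> q = s")
      case False
      have "s - r + (q - s) = q - r" by simp
      then have "min (subdegree (s - r)) (subdegree (q - s)) \<le> subdegree (q - r)"
        using subdegree_add_ge'[of "s - r" "q - s"] False by auto
      then have "real (min (subdegree (s - r)) (subdegree (q - s))) / real N \<le> real (subdegree (q - r)) / real N"
        by (intro divide_right_mono) auto
      then show ?thesis unfolding r q d using False by (auto simp: min_def split: if_splits)
    qed (auto simp: r q d)
    assume "less_R \<xi> \<eta>" "less_R \<eta> \<zeta>"
    then have p: "fps_nth (s - r) (subdegree (s - r)) > 0" "fps_nth (q - s) (subdegree (q - s)) > 0"
      unfolding r q l by auto
    have sum: "s - r + (q - s) = q - r" by simp
    have 1: "fps_nth (q - r) (subdegree (q - r)) > 0" "subdegree (q - r) = min (subdegree (s - r)) (subdegree (q - s))"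
      using pos_lead_add[OF p] unfolding sum by blast+
    show "less_R \<xi> \<zeta>" unfolding r q l by (rule 1(1))
    have "q \<noteq> r" "s \<noteq> r" "q \<noteq> s" using 1 p by auto
    then show "valuation (\<zeta> - \<xi>) \<le> valuation (\<eta> - \<xi>) \<and> valuation (\<zeta> - \<xi>) \<le> valuation (\<zeta> - \<eta>)"
      unfolding r q d using 1(2) by (auto intro!: divide_right_mono)
  qed simp_all
qed

section \<open>Asymptotics along the real roots\<close>

lemma eval_ram:
  fixes a :: "'a::{banach,real_normed_field} fps"
  assumes "N > 0"
  shows "eval_fps (ram N a) t = eval_fps a (t ^ N)"
proof -
  have "(\<lambda>k. fps_nth (ram N a) (N * k) * t ^ (N * k)) sums c \<longleftrightarrow> (\<lambda>i. fps_nth (ram N a) i * t ^ i) sums c" for c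
  proof (rule sums_mono_reindex)
    show "strict_mono (\<lambda>k. N * k)" using assms by (auto intro!: strict_monoI)
    fix n assume "n \<notin> range (\<lambda>k. N * k)"
    then show "fps_nth (ram N a) n * t ^ n = 0" by (auto simp: ram_nth)
  qed
  then have "(\<lambda>k. fps_nth a k * (t ^ N) ^ k) sums c \<longleftrightarrow> (\<lambda>i. fps_nth (ram N a) i * t ^ i) sums c" for c
    using assms by (simp add: ram_nth power_mult)
  then have "(sums) (\<lambda>k. fps_nth a k * (t ^ N) ^ k) = (sums) (\<lambda>i. fps_nth (ram N a) i * t ^ i)" by (rule ext)
  then show ?thesis unfolding eval_fps_def suminf_def by (simp only:)
qed

lemma ev_map_ram: "N > 0 \<Longrightarrow> ev (map_coeff (ram N) F) t y = ev F (t ^ N) y"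
  by (simp add: ev_def section_at_def eval_ram)

lemma eval_cfps:
  assumes "ereal (norm x) < fps_conv_radius a"
  shows "eval_fps (cfps a) (of_real x) = of_real (eval_fps a x)"
proof -
  have "(\<lambda>n. of_real (fps_nth a n * x ^ n) :: complex) sums of_real (eval_fps a x)"
    by (rule sums_of_real[OF sums_eval_fps[OF assms]])
  then show ?thesis unfolding eval_fps_def[of "cfps a"] by (simp add: sums_iff)
qed

lemma eval_cnj:
  assumes "ereal (norm x) < fps_conv_radius a"
  shows "eval_fps (coeff_hom cnj a) (of_real x) = cnj (eval_fps a (of_real x))"
proof -
  have "(\<lambda>n. fps_nth a n * of_real x ^ n) sums eval_fps a (of_real x)"
    by (rule sums_eval_fps) (use assms in simp)
  then have "(\<lambda>n. cnj (fps_nth a n * of_real x ^ n)) sums cnj (eval_fps a (of_real x))"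
    by (simp only: sums_cnj)
  then show ?thesis unfolding eval_fps_def[of "coeff_hom cnj a"] by (simp add: sums_iff)
qed

lemma ev_cfps:
  assumes "bidisc_bounded X Y F" "\<bar>x\<bar> < X" "\<bar>y\<bar> < Y"
  shows "ev (map_coeff cfps F) (of_real x) (of_real y) = of_real (ev F x y)"
proof -
  have "section_at (map_coeff cfps F) (of_real x) = cfps (section_at F x)"
    using conv_coeff[OF assms(1), of x] assms(2) by (intro fps_ext) (simp add: eval_cfps)
  then show ?thesis unfolding ev_def using conv_section[OF assms(1), of x y] assms by (simp add: eval_cfps)
qed

lemma ereal_less_le_trans: "ereal Z \<le> c \<Longrightarrow> t < Z \<Longrightarrow> ereal t < c"
  by (rule less_le_trans[of _ "ereal Z"]) auto

lemma ev_ramify: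
  assumes "N > 0" "bidisc_bounded X Y F" "\<bar>t\<bar> ^ N < X" "\<bar>y\<bar> < Y"
  shows "ev (ramify N F) (of_real t) (of_real y) = of_real (ev F (t ^ N) y)"
  using ev_cfps[OF assms(2), of "t ^ N" y] assms
  by (simp add: ramify_eq_ram ev_map_ram power_abs)

lemma bidisc_bounded_ramify:
  assumes "N > 0" "bidisc_bounded (Z ^ N) Y F" "Z > 0"
  shows "bidisc_bounded Z Y (ramify N F)"
proof -
  obtain C where C: "\<And>i j. norm (fps_nth (fps_nth F j) i) * (Z ^ N) ^ i * Y ^ j \<le> C" and Y: "Y > 0"
    using assms(2) by (auto simp: bidisc_bounded_def)
  have C0: "C \<ge> 0" using order_trans[OF _ C[of 0 0]] by simp
  have "norm (fps_nth (fps_nth (ramify N F) j) i) * Z ^ i * Y ^ j \<le> C" for i j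
  proof (cases "N dvd i")
    case True
    then obtain k where "i = N * k" by auto
    then show ?thesis using C[of j k] assms(1) by (simp add: ramify_nth power_mult)
  qed (use assms C0 in \<open>simp add: ramify_nth\<close>)
  then show ?thesis using assms Y by (auto simp: bidisc_bounded_def)
qed

lemma eval_tendsto:
  fixes s :: "'a::{banach,real_normed_field} fps"
  assumes "geom_bounded s"
  shows "((\<lambda>t. eval_fps s (of_real t)) \<longlongrightarrow> fps_nth s 0) (at_right 0)"
proof -
  have r: "fps_conv_radius s > 0" using assms by (simp add: geom_bounded_iff_radius)
  then have "isCont (eval_fps s) 0"
  proof -
    have "0 \<in> eball 0 (fps_conv_radius s)" using r by (simp add: zero_ereal_def)
    then show ?thesis
      using continuous_on_eval_fps[of s] continuous_on_eq_continuous_at[OF open_eball, of 0 "fps_conv_radius s" "eval_fps s"] by blast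
  qed
  then have "(eval_fps s \<longlongrightarrow> fps_nth s 0) (nhds 0)" by (simp add: isCont_def tendsto_nhds_iff eval_fps_at_0)
  moreover have "filterlim (\<lambda>t::real. of_real t :: 'a) (nhds 0) (at_right 0)"
    by (rule tendsto_eq_intros | simp)+
  ultimately show ?thesis by (rule filterlim_compose)
qed

lemma geom_bounded_shift:
  fixes s :: "'a::{banach,real_normed_field} fps"
  shows "geom_bounded s \<Longrightarrow> geom_bounded (fps_shift m s)"
  by (simp add: geom_bounded_iff_radius)

lemma eventually_conv:
  fixes s :: "'a::{banach,real_normed_field} fps"
  assumes "geom_bounded s"
  shows "\<forall>\<^sub>F t in at_right 0. ereal \<bar>t\<bar> < fps_conv_radius s"
proof -
  have "0 < fps_conv_radius s" using assms by (simp add: geom_bounded_iff_radius)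
  then obtain c where c: "0 < ereal c" "ereal c < fps_conv_radius s" using ereal_dense2 by blast
  have "\<forall>\<^sub>F t in at_right 0. t \<in> {0<..<c}" using c by (intro eventually_at_right_real) auto
  then show ?thesis
  proof (rule eventually_mono)
    fix t assume "t \<in> {0<..<c}"
    then have "ereal \<bar>t\<bar> \<le> ereal c" by auto
    then show "ereal \<bar>t\<bar> < fps_conv_radius s" using c(2) by (rule le_less_trans)
  qed
qed

lemma eval_factor:
  fixes s :: "'a::{banach,real_normed_field} fps"
  assumes "m \<le> subdegree s \<or> s = 0" "ereal (norm t) < fps_conv_radius s"
  shows "eval_fps s t = t ^ m * eval_fps (fps_shift m s) t"
proof -
  have "s = fps_X ^ m * fps_shift m s"
  proof (cases "s = 0")
    case False
    then have "m \<le> subdegree s" using assms(1) by simp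
    from subdegree_decompose'[OF this] show ?thesis by (simp only: mult.commute)
  qed simp
  then have "eval_fps s t = eval_fps (fps_X ^ m * fps_shift m s) t" by simp
  also have "\<dots> = t ^ m * eval_fps (fps_shift m s) t"
    using assms(2) by (subst eval_fps_mult) auto
  finally show ?thesis .
qed

lemma eval_lead:
  fixes s :: "'a::{banach,real_normed_field} fps"
  assumes "geom_bounded s"
  shows "((\<lambda>t. eval_fps s (of_real t) / of_real t ^ subdegree s) \<longlongrightarrow> fps_nth s (subdegree s)) (at_right 0)"
proof -
  have "((\<lambda>t. eval_fps (fps_shift (subdegree s) s) (of_real t)) \<longlongrightarrow> fps_nth s (subdegree s)) (at_right 0)"
    using eval_tendsto[OF geom_bounded_shift[OF assms, of "subdegree s"]] by simp
  then show ?thesis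
  proof (rule Lim_transform_eventually)
    have "\<forall>\<^sub>F t in at_right 0. ereal \<bar>t\<bar> < fps_conv_radius s \<and> t > 0"
      by (intro eventually_conj eventually_conv assms eventually_at_right_less)
    then show "\<forall>\<^sub>F t in at_right 0. eval_fps (fps_shift (subdegree s) s) (of_real t) = eval_fps s (of_real t) / of_real t ^ subdegree s"
      by (rule eventually_mono) (subst eval_factor[of "subdegree s" s], auto)
  qed
qed

lemma eval_eventually_nonzero:
  fixes s :: "'a::{banach,real_normed_field} fps"
  assumes "geom_bounded s" "s \<noteq> 0"
  shows "\<forall>\<^sub>F t in at_right 0. eval_fps s (of_real t) \<noteq> 0"
proof -
  have "\<forall>\<^sub>F t in at_right 0. eval_fps s (of_real t) / of_real t ^ subdegree s \<noteq> 0"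
    using assms by (intro tendsto_imp_eventually_ne[OF eval_lead]) auto
  then show ?thesis by (rule eventually_mono) auto
qed

lemma eval_eventually_pos:
  fixes s :: "real fps"
  assumes "geom_bounded s" "fps_nth s (subdegree s) > 0"
  shows "\<forall>\<^sub>F t in at_right 0. eval_fps s t > 0"
proof -
  have "\<forall>\<^sub>F t in at_right 0. eval_fps s t / t ^ subdegree s > 0"
    using order_tendstoD(1)[OF eval_lead[OF assms(1)] assms(2)] by simp
  then show ?thesis
    using eventually_at_right_less[of 0]
    by eventually_elim (auto simp: zero_less_divide_iff)
qed

lemma lead_eqI:
  fixes s :: "real fps"
  assumes "geom_bounded s" "((\<lambda>t. eval_fps s t / t ^ E) \<longlongrightarrow> L) (at_right 0)" "L \<noteq> 0"
  shows "fps_nth s (subdegree s) = L"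
proof -
  let ?m = "subdegree s"
  have lead: "((\<lambda>t. eval_fps s t / t ^ ?m) \<longlongrightarrow> fps_nth s ?m) (at_right 0)"
    using eval_lead[OF assms(1)] by simp
  have pw: "((\<lambda>t::real. t ^ k) \<longlongrightarrow> 0) (at_right 0)" if "k > 0" for k
  proof -
    have "((\<lambda>t::real. t ^ k) \<longlongrightarrow> 0 ^ k) (at_right 0)" by (intro tendsto_intros)
    then show ?thesis using that by (simp add: power_0_left)
  qed
  have s0: "s \<noteq> 0"
  proof
    assume "s = 0"
    then have "((\<lambda>t::real. 0) \<longlongrightarrow> L) (at_right 0)" using assms(2) by simp
    then show False using assms(3) tendsto_unique[OF trivial_limit_at_right_real _ tendsto_const] by blast
  qed
  show ?thesis
  proof (cases ?m E rule: linorder_cases)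
    case equal
    then show ?thesis using tendsto_unique[OF trivial_limit_at_right_real lead] assms(2) by simp
  next
    case less
    have "((\<lambda>t. eval_fps s t / t ^ E * t ^ (E - ?m)) \<longlongrightarrow> L * 0) (at_right 0)"
      by (intro tendsto_mult assms pw) (use less in simp)
    moreover have "\<forall>\<^sub>F t in at_right 0. eval_fps s t / t ^ E * t ^ (E - ?m) = eval_fps s t / t ^ ?m"
      using eventually_at_right_less[of 0]
    proof eventually_elim
      case (elim t)
      have "t ^ E = t ^ (E - ?m) * t ^ ?m" using less by (simp flip: power_add)
      then show ?case using elim by simp
    qed
    ultimately have "((\<lambda>t. eval_fps s t / t ^ ?m) \<longlongrightarrow> L * 0) (at_right 0)" by (rule Lim_transform_eventually)
    then have "fps_nth s ?m = 0" using tendsto_unique[OF trivial_limit_at_right_real lead] by simp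
    then show ?thesis using s0 by simp
  next
    case greater
    have "((\<lambda>t. eval_fps s t / t ^ ?m * t ^ (?m - E)) \<longlongrightarrow> fps_nth s ?m * 0) (at_right 0)"
      by (intro tendsto_mult lead pw) (use greater in simp)
    moreover have "\<forall>\<^sub>F t in at_right 0. eval_fps s t / t ^ ?m * t ^ (?m - E) = eval_fps s t / t ^ E"
      using eventually_at_right_less[of 0]
    proof eventually_elim
      case (elim t)
      have "t ^ ?m = t ^ (?m - E) * t ^ E" using greater by (simp flip: power_add)
      then show ?case using elim by simp
    qed
    ultimately have "((\<lambda>t. eval_fps s t / t ^ E) \<longlongrightarrow> fps_nth s ?m * 0) (at_right 0)" by (rule Lim_transform_eventually)
    then show ?thesis using tendsto_unique[OF trivial_limit_at_right_real assms(2)] assms(3) by simp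
  qed
qed

lemma ev_add:
  fixes A B :: "'a::{banach,real_normed_field} fps fps"
  assumes "\<And>j. ereal (norm t) < fps_conv_radius (fps_nth A j)" "\<And>j. ereal (norm t) < fps_conv_radius (fps_nth B j)"
    and "ereal (norm y) < fps_conv_radius (section_at A t)" "ereal (norm y) < fps_conv_radius (section_at B t)"
  shows "ev (A + B) t y = ev A t y + ev B t y"
proof -
  have "section_at (A + B) t = section_at A t + section_at B t"
    by (rule fps_ext) (simp add: eval_fps_add assms)
  then show ?thesis using assms by (simp add: ev_def eval_fps_add)
qed

text \<open>Formal and analytic substitution agree: in F = F(r) + (y - r) q the second term vanishes
  when evaluated at y = r(t).\<close>

lemma eval_fsubst:
  fixes F :: "real fps fps"
  assumes "N > 0" "geom_bounded2 F" "geom_bounded r" "fps_nth r 0 = 0"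
  shows "\<forall>\<^sub>F t in at_right 0. ev F (t ^ N) (eval_fps r t) = eval_fps (fsubst (map_coeff (ram N) F) r) t"
proof -
  define FN where "FN = map_coeff (ram N) F"
  define s where "s = fsubst FN r"
  define q where "q = fquot FN r"
  have FNb: "geom_bounded2 FN" unfolding FN_def by (rule geom_bounded2_map_ram[OF assms(2,1)])
  have sb: "geom_bounded s" unfolding s_def by (rule geom_bounded_fsubst[OF FNb assms(3,4)])
  obtain X where X: "X > 0" "bidisc_bounded X X q"
    using geom_bounded2_imp_bidisc_bounded[OF geom_bounded2_fquot[OF FNb assms(3,4)]] unfolding q_def by blast
  have eq: "FN = fps_const s + q * (\<Prod>g\<in>#{#r#}. fps_X - fps_const g)"
    using fsubst_division[OF assms(4), of FN] by (simp add: s_def q_def mult.commute)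
  have rt: "((\<lambda>t. eval_fps r t) \<longlongrightarrow> 0) (at_right 0)" using eval_tendsto[OF assms(3)] assms(4) by simp
  have "\<forall>\<^sub>F t in at_right 0. dist (eval_fps r t) 0 < X" by (rule tendstoD[OF rt X(1)])
  moreover have "\<forall>\<^sub>F t in at_right 0. t \<in> {0<..<X}" using X by (intro eventually_at_right_real) auto
  ultimately show ?thesis
    using eventually_conv[OF assms(3)] eventually_conv[OF sb]
  proof eventually_elim
    case (elim t)
    define y where "y = eval_fps r t"
    have t: "norm t < X" "norm y < X" using elim by (auto simp: y_def)
    let ?P = "q * (\<Prod>g\<in>#{#r#}. fps_X - fps_const g)"
    have r: "ereal (norm t) < fps_conv_radius r" "ereal (norm t) < fps_conv_radius s" using elim by simp_all
    have sec: "section_at (fps_const s) t = fps_const (eval_fps s t)"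
      by (rule fps_ext) (simp add: fps_nth_fps_const)
    have secP: "section_at ?P t = section_at q t * (fps_X - fps_const (eval_fps r t))"
      using section_at_mult(1)[of t q "fps_X - fps_const r"] conv_coeff[OF X(2) t(1)]
        section_at_linear[OF r(1)] by simp
    have "ev FN t y = ev (fps_const s) t y + ev ?P t y"
      unfolding eq
    proof (rule ev_add)
      show "ereal (norm t) < fps_conv_radius (fps_nth (fps_const s) j)" for j
        using r by (simp add: fps_nth_fps_const)
      show "ereal (norm t) < fps_conv_radius (fps_nth ?P j)" for j
        using section_at_mult(2)[of t q "fps_X - fps_const r"] conv_coeff[OF X(2) t(1)]
          section_at_linear[OF r(1)] by simp
      show "ereal (norm y) < fps_conv_radius (section_at (fps_const s) t)" by (simp add: sec)
      show "ereal (norm y) < fps_conv_radius (section_at ?P t)"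
        unfolding secP
      proof (rule conv_mult[OF conv_section[OF X(2) t]])
        show "ereal (norm y) < fps_conv_radius (fps_X - fps_const (eval_fps r t))"
          using less_le_trans[OF _ fps_conv_radius_diff[of fps_X "fps_const (eval_fps r t)"]] by simp
      qed
    qed
    also have "ev (fps_const s) t y = eval_fps s t" by (rule ev_const)
    also have "ev ?P t y = ev q t y * (\<Prod>g\<in>#{#r#}. y - eval_fps g t)"
      by (rule ev_linear_prod) (use conv_coeff[OF X(2) t(1)] conv_section[OF X(2) t] r in auto)
    finally show ?case using assms(1) by (simp add: FN_def ev_map_ram s_def y_def)
  qed
qed

text \<open>A factorization in t = x^(1/N) together with one domain on which all series involved
  converge: |t| < Z, i.e. |x| < Z^N, and |y| < Y. The inverse \<open>v\<close> serves to keep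
  \<open>u\<close> free of zeros there.\<close>

locale np_data =
  fixes f F u v :: "real fps fps" and N :: nat and G :: "complex fps multiset" and Z Y :: real
  assumes N: "N > 0" and Z: "Z > 0"
    and factorization: "ramify N f = ramify N u * (\<Prod>g\<in>#G. fps_X - fps_const g)"
    and uv: "u * v = 1"
    and bounded: "bidisc_bounded (Z ^ N) Y f" "bidisc_bounded (Z ^ N) Y u" "bidisc_bounded (Z ^ N) Y v" "bidisc_bounded (Z ^ N) Y F"
    and deriv: "fps_deriv F = f"
    and G: "\<And>g. g \<in># G \<Longrightarrow> geom_bounded g" "\<And>g. g \<in># G \<Longrightarrow> fps_nth g 0 = 0" "\<And>g. g \<in># G \<Longrightarrow> ereal Z \<le> fps_conv_radius g"
    and simple: "\<And>r. count G (cfps r) \<le> 1"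
begin

text \<open>The real roots, as series in t.\<close>

definition "R = {r. cfps r \<in># G}"

lemma Y: "Y > 0" using bounded(1) by (simp add: bidisc_bounded_def)

lemma cfps_inj: "cfps a = cfps b \<Longrightarrow> a = b"
  by (metis coeff_hom_nth fps_ext of_real_eq_iff)

lemma R_fin: "finite R"
proof -
  have "cfps ` R \<subseteq> set_mset G" by (auto simp: R_def)
  then have "finite (cfps ` R)" by (rule finite_subset) simp
  then show ?thesis by (rule finite_imageD) (use cfps_inj in \<open>auto intro: inj_onI\<close>)
qed

lemma R_geom: "r \<in> R \<Longrightarrow> geom_bounded r"
  using G(1)[of "cfps r"] by (simp add: R_def geom_bounded_def)

lemma R_0: "r \<in> R \<Longrightarrow> fps_nth r 0 = 0"
  using G(2)[of "cfps r"] by (simp add: R_def)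

lemma pow_less: "\<bar>t\<bar> < Z \<Longrightarrow> \<bar>t\<bar> ^ N < Z ^ N"
  using N by (intro power_strict_mono) auto

lemma factor_formula:
  assumes "\<bar>t\<bar> < Z" "\<bar>y\<bar> < Y"
  shows "complex_of_real (ev f (t ^ N) y) =
    of_real (ev u (t ^ N) y) * (\<Prod>g\<in>#G. of_real y - eval_fps g (of_real t))"
proof -
  have b: "bidisc_bounded Z Y (ramify N u)" by (rule bidisc_bounded_ramify[OF N bounded(2) Z])
  have "complex_of_real (ev f (t ^ N) y) = ev (ramify N f) (of_real t) (of_real y)"
    using ev_ramify[OF N bounded(1) pow_less[OF assms(1)] assms(2)] by simp
  also have "\<dots> = ev (ramify N u) (of_real t) (of_real y) * (\<Prod>g\<in>#G. of_real y - eval_fps g (of_real t))"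
    unfolding factorization
  proof (rule ev_linear_prod)
    show "ereal (norm (complex_of_real t)) < fps_conv_radius (fps_nth (ramify N u) j)" for j
      by (rule conv_coeff[OF b]) (use assms in simp)
    show "ereal (norm (complex_of_real y)) < fps_conv_radius (section_at (ramify N u) (complex_of_real t))"
      by (rule conv_section[OF b]) (use assms in simp_all)
    show "ereal (norm (complex_of_real t)) < fps_conv_radius g" if "g \<in># G" for g
      by (rule ereal_less_le_trans[OF G(3)[OF that]]) (use assms in simp)
  qed
  also have "ev (ramify N u) (of_real t) (of_real y) = of_real (ev u (t ^ N) y)"
    using ev_ramify[OF N bounded(2) pow_less[OF assms(1)] assms(2)] by simp
  finally show ?thesis .
qed

lemma u_nonzero:
  assumes "\<bar>x\<bar> < Z ^ N" "\<bar>y\<bar> < Y"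
  shows "ev u x y \<noteq> 0"
proof -
  have "section_at (1 :: real fps fps) x = 1"
    by (rule fps_ext) (simp add: fps_one_nth)
  then have "ev u x y * ev v x y = 1"
    using ev_mult_bounded[OF bounded(2,3), of x y] assms by (simp add: uv ev_def)
  then show ?thesis by auto
qed

lemma R_eval: "r \<in> R \<Longrightarrow> \<bar>t\<bar> < Z \<Longrightarrow> eval_fps (cfps r) (of_real t) = of_real (eval_fps r t)"
proof -
  assume r: "r \<in> R" "\<bar>t\<bar> < Z"
  have "fps_conv_radius (cfps r) = fps_conv_radius r"
    by (simp add: fps_conv_radius_def conv_radius_def)
  then show ?thesis using r G(3)[of "cfps r"] by (intro eval_cfps) (auto simp: R_def intro: ereal_less_le_trans)
qed

lemma eventually_small: "c > 0 \<Longrightarrow> \<forall>\<^sub>F t in at_right 0. 0 < t \<and> t < (c::real)"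
  using eventually_at_right_real[of 0 c] by (auto elim: eventually_mono)

text \<open>The difference of \<open>g\<close> and its conjugate is a nonzero convergent series, so
  it has no zero for small t > 0; for real t its value is 2i times the imaginary part of
  g(t).\<close>

lemma eventually_nonreal:
  assumes "g \<in># G" "\<And>r. g \<noteq> cfps r"
  shows "\<forall>\<^sub>F t in at_right 0. eval_fps g (of_real t) \<notin> \<real>"
proof -
  let ?c = "coeff_hom cnj g"
  have cb: "geom_bounded ?c" using G(1)[OF assms(1)] by (simp add: geom_bounded_def)
  have "g - ?c \<noteq> 0"
  proof
    assume "g - ?c = 0"
    then have "cnj (fps_nth g i) = fps_nth g i" for i by (metis coeff_hom_nth right_minus_eq)
    then have "of_real (Re (fps_nth g i)) = fps_nth g i" for i by (metis Reals_cnj_iff of_real_Re)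
    then have "g = cfps (Abs_fps (\<lambda>i. Re (fps_nth g i)))" by (intro fps_ext) simp
    then show False using assms(2) by blast
  qed
  moreover have "geom_bounded (g - ?c)"
    using geom_bounded_add[OF G(1)[OF assms(1)], of "- ?c"] cb by (simp add: geom_bounded_def)
  ultimately have "\<forall>\<^sub>F t in at_right 0. eval_fps (g - ?c) (of_real t) \<noteq> 0"
    by (intro eval_eventually_nonzero) auto
  then show ?thesis
    using eventually_conv[OF G(1)[OF assms(1)]] eventually_conv[OF cb]
  proof eventually_elim
    case (elim t)
    then have "eval_fps g (of_real t) - cnj (eval_fps g (of_real t)) \<noteq> 0"
      by (simp add: eval_fps_diff eval_cnj)
    then show ?case by (auto simp: Reals_cnj_iff)
  qed
qed

text \<open>\<open>u\<close> has no zeros, and the factors with a non-real coefficient take no real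
  values, so only the real roots are left. The strip |y| < Y does not shrink with t.\<close>

lemma eventually_zeros:
  "\<forall>\<^sub>F t in at_right 0. \<forall>y. \<bar>y\<bar> < Y \<longrightarrow> (ev f (t ^ N) y = 0 \<longleftrightarrow> (\<exists>r\<in>R. y = eval_fps r t))"
proof -
  have "\<forall>\<^sub>F t in at_right 0. \<forall>g\<in>set_mset G. (\<forall>r. g \<noteq> cfps r) \<longrightarrow> eval_fps g (of_real t) \<notin> \<real>"
    using eventually_nonreal by (intro eventually_ball_finite) (auto intro: eventually_mono)
  then show ?thesis
    using eventually_small[OF Z]
  proof eventually_elim
    case (elim t)
    show ?case
    proof (intro allI impI)
      fix y assume y: "\<bar>y\<bar> < Y"
      have t: "\<bar>t\<bar> < Z" using elim by auto
      have "ev f (t ^ N) y = 0 \<longleftrightarrow> (\<Prod>g\<in>#G. of_real y - eval_fps g (of_real t)) = 0"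
      proof -
        have "\<bar>t ^ N\<bar> < Z ^ N" using pow_less[OF t] by (simp add: power_abs)
        then have "complex_of_real (ev u (t ^ N) y) \<noteq> 0" using u_nonzero[of "t ^ N" y] y by simp
        moreover have "ev f (t ^ N) y = 0 \<longleftrightarrow> complex_of_real (ev f (t ^ N) y) = 0" by (simp only: of_real_eq_0_iff)
        ultimately show ?thesis unfolding factor_formula[OF t y] by (simp only: mult_eq_0_iff simp_thms)
      qed
      also have "\<dots> \<longleftrightarrow> (\<exists>g\<in>#G. of_real y = eval_fps g (of_real t))"
        by (auto simp: prod_mset_zero_iff)
      also have "\<dots> \<longleftrightarrow> (\<exists>r\<in>R. y = eval_fps r t)"
      proof
        assume "\<exists>g\<in>#G. of_real y = eval_fps g (of_real t)"
        then obtain g where g: "g \<in># G" "of_real y = eval_fps g (of_real t)" by blast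
        then have "eval_fps g (of_real t) \<in> \<real>" by (metis Reals_of_real)
        then obtain r where "g = cfps r" using elim g by blast
        then have "r \<in> R" "of_real y = complex_of_real (eval_fps r t)"
          using g R_eval[of r t] t by (auto simp: R_def)
        then show "\<exists>r\<in>R. y = eval_fps r t" by auto
      next
        assume "\<exists>r\<in>R. y = eval_fps r t"
        then obtain r where "r \<in> R" "y = eval_fps r t" by auto
        then show "\<exists>g\<in>#G. of_real y = eval_fps g (of_real t)"
          using R_eval[of r t] t by (intro bexI[of _ "cfps r"]) (simp_all add: R_def)
      qed
      finally show "ev f (t ^ N) y = 0 \<longleftrightarrow> (\<exists>r\<in>R. y = eval_fps r t)" .
    qed
  qed
qed

lemma eventually_root_small:
  assumes "r \<in> R" "c > 0"
  shows "\<forall>\<^sub>F t in at_right 0. \<bar>eval_fps r t\<bar> < c"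
proof -
  have "((\<lambda>t. eval_fps r t) \<longlongrightarrow> 0) (at_right 0)" using eval_tendsto[OF R_geom[OF assms(1)]] R_0[OF assms(1)] by simp
  from tendstoD[OF this assms(2)] show ?thesis by simp
qed

lemma geom_bounded_diff: "geom_bounded a \<Longrightarrow> geom_bounded b \<Longrightarrow> geom_bounded (a - b)" for a b :: "'a::{banach,real_normed_field} fps"
  using geom_bounded_add[of a "- b"] by (simp add: geom_bounded_def)

lemma eventually_ne_roots:
  assumes "r \<in> R" "g \<in># G" "g \<noteq> cfps r"
  shows "\<forall>\<^sub>F t in at_right 0. eval_fps g (of_real t) \<noteq> of_real (eval_fps r t)"
proof -
  have cr: "cfps r \<in># G" using assms by (simp add: R_def)
  have "\<forall>\<^sub>F t in at_right 0. eval_fps (g - cfps r) (of_real t) \<noteq> 0"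
    using assms cr by (intro eval_eventually_nonzero geom_bounded_diff G) auto
  then show ?thesis
    using eventually_small[OF Z]
  proof eventually_elim
    case (elim t)
    have "ereal t < fps_conv_radius g" "ereal t < fps_conv_radius (cfps r)"
      using G(3)[OF assms(2)] G(3)[OF cr] elim by (auto intro: ereal_less_le_trans)
    then show ?case using elim R_eval[OF assms(1), of t] by (auto simp: eval_fps_diff)
  qed
qed

text \<open>Near y_0 = r(t) the function f is y - y_0 times the cofactor \<open>H\<close>, so its
  derivative at y_0 is H(y_0). This is nonzero because the root is simple and the other factors have
  different values for small t.\<close>

lemma eventually_simple:
  assumes "r \<in> R"
  shows "\<forall>\<^sub>F t in at_right 0. ev (fps_deriv f) (t ^ N) (eval_fps r t) \<noteq> 0"
proof -
  define G' where "G' = G - {#cfps r#}"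
  have "cfps r \<in># G" using assms by (simp add: R_def)
  then have Geq: "G = add_mset (cfps r) G'" by (simp add: G'_def)
  then have "count G' (cfps r) = 0" using simple[of r] by simp
  then have ne: "g \<noteq> cfps r" if "g \<in># G'" for g using that by (metis not_in_iff)
  have "\<forall>\<^sub>F t in at_right 0. \<forall>g\<in>set_mset G'. eval_fps g (of_real t) \<noteq> of_real (eval_fps r t)"
    using eventually_ne_roots[OF assms] ne Geq by (intro eventually_ball_finite) auto
  then show ?thesis
    using eventually_small[OF Z] eventually_root_small[OF assms Y]
  proof eventually_elim
    case (elim t)
    define y0 where "y0 = eval_fps r t"
    have t: "\<bar>t\<bar> < Z" "\<bar>t ^ N\<bar> < Z ^ N" using elim pow_less[of t] by (auto simp: power_abs)
    define H where "H y = complex_of_real (ev u (t ^ N) y) * (\<Prod>g\<in>#G'. of_real y - eval_fps g (of_real t))" for y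
    have Hf: "complex_of_real (ev f (t ^ N) y) = (of_real y - of_real y0) * H y" if "\<bar>y\<bar> < Y" for y
      using factor_formula[OF t(1) that] R_eval[OF assms t(1)] by (simp add: Geq H_def y0_def mult_ac)
    have H0: "H y0 \<noteq> 0"
      using u_nonzero[OF t(2), of y0] elim by (auto simp: H_def y0_def prod_mset_zero_iff)
    have dP: "\<exists>D. ((\<lambda>y. \<Prod>g\<in>#M. complex_of_real y - eval_fps g (of_real t)) has_vector_derivative D) (at y0)" for M
    proof (induction M)
      case (add g M)
      then obtain D where D: "((\<lambda>y. \<Prod>g\<in>#M. complex_of_real y - eval_fps g (of_real t)) has_vector_derivative D) (at y0)" by blast
      have "((\<lambda>y. complex_of_real y - eval_fps g (of_real t)) has_vector_derivative 1 - 0) (at y0)"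
        by (intro has_vector_derivative_diff has_vector_derivative_const)
           (use has_vector_derivative_of_real[OF DERIV_ident] in simp)
      from has_vector_derivative_mult[OF this D] show ?case by auto
    qed (auto intro: has_vector_derivative_const)
    have y0Y: "\<bar>y0\<bar> < Y" using elim by (simp add: y0_def)
    have "(\<lambda>y. complex_of_real (ev u (t ^ N) y)) differentiable at y0"
      using has_vector_derivative_of_real[OF ev_has_derivative[OF bounded(2), of "t ^ N" y0 UNIV]] t y0Y
      by (auto simp: differentiable_def has_vector_derivative_def)
    moreover have "(\<lambda>y. \<Prod>g\<in>#G'. complex_of_real y - eval_fps g (of_real t)) differentiable at y0"
      using dP[of G'] by (auto simp: differentiable_def has_vector_derivative_def)
    ultimately have "isCont H y0"
      unfolding H_def by (intro differentiable_imp_continuous_within differentiable_mult)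
    then have lim1: "(H \<longlongrightarrow> H y0) (at y0)" by (simp add: isCont_def)
    have D: "((\<lambda>y. ev f (t ^ N) y) has_field_derivative ev (fps_deriv f) (t ^ N) y0) (at y0)"
      using ev_has_derivative[OF bounded(1), of "t ^ N" y0 UNIV] t y0Y by simp
    have f0: "ev f (t ^ N) y0 = 0" using Hf[OF y0Y] by simp
    have "((\<lambda>y. (ev f (t ^ N) y - ev f (t ^ N) y0) / (y - y0)) \<longlongrightarrow> ev (fps_deriv f) (t ^ N) y0) (at y0)"
      using D by (simp add: has_field_derivative_iff)
    then have lim2: "((\<lambda>y. complex_of_real ((ev f (t ^ N) y - ev f (t ^ N) y0) / (y - y0))) \<longlongrightarrow> of_real (ev (fps_deriv f) (t ^ N) y0)) (at y0)"
      by (rule tendsto_of_real)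
    have "\<forall>\<^sub>F y in at y0. \<bar>y\<bar> < Y \<and> y \<noteq> y0"
    proof -
      have "\<forall>\<^sub>F y in at y0. y \<in> {-Y<..<Y}" using y0Y by (intro eventually_at_in_open') auto
      then show ?thesis by (auto simp: eventually_at_filter elim!: eventually_mono)
    qed
    then have "\<forall>\<^sub>F y in at y0. complex_of_real ((ev f (t ^ N) y - ev f (t ^ N) y0) / (y - y0)) = H y"
    proof eventually_elim
      case (elim y)
      then show ?case using Hf[of y] f0 by simp
    qed
    then have "(H \<longlongrightarrow> of_real (ev (fps_deriv f) (t ^ N) y0)) (at y0)"
      by (rule Lim_transform_eventually[OF lim2])
    then have "of_real (ev (fps_deriv f) (t ^ N) y0) = H y0"
      using tendsto_unique[OF _ _ lim1] by auto
    then show ?case using H0 by (auto simp: y0_def)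
  qed
qed

lemma eventually_less_roots:
  assumes "r \<in> R" "s \<in> R" "fps_nth (s - r) (subdegree (s - r)) > 0"
  shows "\<forall>\<^sub>F t in at_right 0. eval_fps r t < eval_fps s t"
proof -
  have "\<forall>\<^sub>F t in at_right 0. eval_fps (s - r) t > 0"
    by (rule eval_eventually_pos[OF geom_bounded_diff assms(3)]) (use R_geom assms in auto)
  then show ?thesis
    using eventually_conv[OF R_geom[OF assms(1)]] eventually_conv[OF R_geom[OF assms(2)]]
    by eventually_elim (simp add: eval_fps_diff)
qed

end

section \<open>The rescaled limit at a vertex\<close>

lemma continuous_on_prod_mset:
  fixes h :: "'b \<Rightarrow> 'c::topological_space \<Rightarrow> complex"
  assumes "\<And>g. g \<in># M \<Longrightarrow> continuous_on S (h g)"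
  shows "continuous_on S (\<lambda>x. \<Prod>g\<in>#M. h g x)"
  using assms by (induction M) (auto intro!: continuous_intros)

lemma prod_mset_power_distrib:
  fixes x :: complex
  shows "(\<Prod>g\<in>#M. x ^ e g * h g) = x ^ (\<Sum>g\<in>#M. e g) * (\<Prod>g\<in>#M. h g)"
  by (induction M) (auto simp: power_add mult_ac)

context np_data
begin

text \<open>The power of t split off from the factor y - g after y = \<beta> + t^m w: the minimum of
  m and the order of \<beta> - g. The case g = \<beta> is separate because
  \<open>subdegree 0\<close> is 0, not infinite.\<close>

definition edge_order :: "real fps \<Rightarrow> nat \<Rightarrow> complex fps \<Rightarrow> nat" where
  "edge_order \<beta> m g = (if cfps \<beta> = g then m else min m (subdegree (cfps \<beta> - g)))"

definition reduced :: "real fps \<Rightarrow> nat \<Rightarrow> complex fps \<Rightarrow> complex fps" where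
  "reduced \<beta> m g = fps_shift (edge_order \<beta> m g) (cfps \<beta> - g)"

text \<open>
  \<open>f(t ^ N, \<beta> + t ^ m w) t ^ m\<close> divided by the power \<open>edge_exponent\<close> of \<open>t\<close>, so that \<open>t = 0\<close> is allowed.
\<close>

definition edge_fun :: "real fps \<Rightarrow> nat \<Rightarrow> real \<Rightarrow> real \<Rightarrow> complex" where
  "edge_fun \<beta> m t w = complex_of_real (ev u (t ^ N) (eval_fps \<beta> t + t ^ m * w)) *
     (\<Prod>g\<in>#G. eval_fps (reduced \<beta> m g) (of_real t) + of_real (t ^ (m - edge_order \<beta> m g) * w))"

text \<open>The summand m is the factor in dy = t^m dw, which appears when f is integrated in
  w.\<close>

definition edge_exponent :: "real fps \<Rightarrow> nat \<Rightarrow> nat" where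
  "edge_exponent \<beta> m = m + (\<Sum>g\<in>#G. edge_order \<beta> m g)"

text \<open>For a root through the vertex, the limit of its coordinate w = (r - \<beta>) / t^m as t
  tends to 0. Two such roots leave along the same edge iff these values agree.\<close>

definition position :: "real fps \<Rightarrow> nat \<Rightarrow> real fps \<Rightarrow> real" where
  "position \<beta> m r = fps_nth (r - \<beta>) m"

lemma edge_order_le: "edge_order \<beta> m g \<le> m"
  by (auto simp: edge_order_def)

lemma radius_diff:
  assumes "\<beta> \<in> R" "g \<in># G"
  shows "ereal Z \<le> fps_conv_radius (cfps \<beta> - g)"
  using fps_conv_radius_diff[of "cfps \<beta>" g] G(3)[of g] G(3)[of "cfps \<beta>"] assms
  by (auto simp: R_def intro: order_trans[OF min.boundedI])

lemma radius_R: "r \<in> R \<Longrightarrow> ereal Z \<le> fps_conv_radius r"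
  using G(3)[of "cfps r"] by (simp add: R_def fps_conv_radius_def conv_radius_def)

lemma edge_fun_eq:
  assumes \<beta>: "\<beta> \<in> R" and t: "\<bar>t\<bar> < Z" and y: "\<bar>eval_fps \<beta> t + t ^ m * w\<bar> < Y"
  shows "complex_of_real (ev f (t ^ N) (eval_fps \<beta> t + t ^ m * w) * t ^ m) = of_real (t ^ edge_exponent \<beta> m) * edge_fun \<beta> m t w"
proof -
  have "of_real (eval_fps \<beta> t + t ^ m * w) - eval_fps g (of_real t) =
      of_real t ^ edge_order \<beta> m g * (eval_fps (reduced \<beta> m g) (of_real t) + of_real (t ^ (m - edge_order \<beta> m g) * w))"
    if g: "g \<in># G" for g
  proof -
    let ?e = "edge_order \<beta> m g" and ?s = "cfps \<beta> - g"
    have cr: "cfps \<beta> \<in># G" using \<beta> by (simp add: R_def)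
    have c: "ereal (norm (complex_of_real t)) < fps_conv_radius h" if "h \<in># G" for h
      by (rule ereal_less_le_trans[OF G(3)[OF that]]) (use t in simp)
    have cs: "ereal (norm (complex_of_real t)) < fps_conv_radius ?s"
      by (rule ereal_less_le_trans[OF radius_diff[OF \<beta> g]]) (use t in simp)
    have "of_real (eval_fps \<beta> t) - eval_fps g (of_real t) = eval_fps ?s (of_real t)"
      using R_eval[OF \<beta> t] c[OF cr] c[OF g] by (simp add: eval_fps_diff)
    also have "\<dots> = of_real t ^ ?e * eval_fps (reduced \<beta> m g) (of_real t)"
      unfolding reduced_def by (rule eval_factor[OF _ cs]) (auto simp: edge_order_def)
    finally have 1: "of_real (eval_fps \<beta> t) - eval_fps g (of_real t) = of_real t ^ ?e * eval_fps (reduced \<beta> m g) (of_real t)" .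
    have 2: "t ^ m = t ^ ?e * t ^ (m - ?e)" using edge_order_le[of \<beta> m g] by (simp flip: power_add)
    have "of_real (eval_fps \<beta> t + t ^ m * w) - eval_fps g (of_real t) =
        (of_real (eval_fps \<beta> t) - eval_fps g (of_real t)) + of_real (t ^ m * w)" by simp
    also have "\<dots> = of_real t ^ ?e * eval_fps (reduced \<beta> m g) (of_real t) + of_real (t ^ ?e * t ^ (m - ?e) * w)"
      unfolding 1 by (subst 2) simp
    also have "\<dots> = of_real t ^ ?e * (eval_fps (reduced \<beta> m g) (of_real t) + of_real (t ^ (m - ?e) * w))"
      by (simp add: distrib_left)
    finally show ?thesis .
  qed
  then have "(\<Prod>g\<in>#G. of_real (eval_fps \<beta> t + t ^ m * w) - eval_fps g (of_real t)) =
      (\<Prod>g\<in>#G. of_real t ^ edge_order \<beta> m g * (eval_fps (reduced \<beta> m g) (of_real t) + of_real (t ^ (m - edge_order \<beta> m g) * w)))"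
    by (intro arg_cong[of _ _ prod_mset] image_mset_cong) auto
  also have "\<dots> = of_real t ^ (\<Sum>g\<in>#G. edge_order \<beta> m g) *
      (\<Prod>g\<in>#G. eval_fps (reduced \<beta> m g) (of_real t) + of_real (t ^ (m - edge_order \<beta> m g) * w))"
    by (rule prod_mset_power_distrib)
  finally show ?thesis
    using factor_formula[OF t y] by (simp add: edge_fun_def edge_exponent_def power_add)
qed

text \<open>The single factors are complex, but for t > 0 the whole expression is a quotient of real
  quantities.\<close>

lemma edge_real:
  assumes "\<beta> \<in> R" "0 < t" "t < Z" "\<bar>eval_fps \<beta> t + t ^ m * w\<bar> < Y"
  shows "edge_fun \<beta> m t w = of_real (Re (edge_fun \<beta> m t w))"
    "ev f (t ^ N) (eval_fps \<beta> t + t ^ m * w) * t ^ m = t ^ edge_exponent \<beta> m * Re (edge_fun \<beta> m t w)"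
proof -
  have eq: "complex_of_real (ev f (t ^ N) (eval_fps \<beta> t + t ^ m * w) * t ^ m) = of_real (t ^ edge_exponent \<beta> m) * edge_fun \<beta> m t w"
    using edge_fun_eq[of \<beta> t m w] assms by simp
  have "Im (of_real (t ^ edge_exponent \<beta> m) * edge_fun \<beta> m t w) = 0" unfolding eq[symmetric] by simp
  then have "Im (edge_fun \<beta> m t w) = 0" using assms by simp
  then show "edge_fun \<beta> m t w = of_real (Re (edge_fun \<beta> m t w))" by (simp add: complex_eq_iff)
  show "ev f (t ^ N) (eval_fps \<beta> t + t ^ m * w) * t ^ m = t ^ edge_exponent \<beta> m * Re (edge_fun \<beta> m t w)"
    using arg_cong[OF eq, of Re] by simp
qed

text \<open>The point is continuity up to t = 0, where the powers of t have already been divided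
  out.\<close>

lemma edge_continuous:
  assumes \<beta>: "\<beta> \<in> R" and \<tau>: "\<tau> < Z" and small: "\<And>t w. t \<in> {0..\<tau>} \<Longrightarrow> w \<in> {-W..W} \<Longrightarrow> \<bar>eval_fps \<beta> t + t ^ m * w\<bar> < Y"
  shows "continuous_on ({0..\<tau>} \<times> {-W..W}) (\<lambda>(t, w). edge_fun \<beta> m t w)"
proof -
  let ?S = "{0..\<tau>} \<times> {-W..W} :: (real \<times> real) set"
  have c\<beta>: "continuous_on ?S (\<lambda>p. eval_fps \<beta> (fst p))"
    by (intro continuous_intros) (use radius_R[OF \<beta>] \<tau> in \<open>auto intro!: ereal_less_le_trans\<close>)
  have "continuous_on ?S (\<lambda>p. (\<lambda>(t, y). ev u t y) (fst p ^ N, eval_fps \<beta> (fst p) + fst p ^ m * snd p))"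
  proof (rule continuous_on_compose2[OF ev_continuous[OF bounded(2)]])
    show "continuous_on ?S (\<lambda>p. (fst p ^ N, eval_fps \<beta> (fst p) + fst p ^ m * snd p))"
      by (intro continuous_intros c\<beta>)
    show "(\<lambda>p. (fst p ^ N, eval_fps \<beta> (fst p) + fst p ^ m * snd p)) ` ?S \<subseteq> ball 0 (Z ^ N) \<times> ball 0 Y"
    proof (rule image_subsetI)
      fix p assume "p \<in> ?S"
      then obtain t w where p: "p = (t, w)" "t \<in> {0..\<tau>}" "w \<in> {-W..W}" by auto
      then have "\<bar>t\<bar> < Z" using \<tau> by auto
      from pow_less[OF this] have "\<bar>t ^ N\<bar> < Z ^ N" by (simp add: power_abs)
      then show "(fst p ^ N, eval_fps \<beta> (fst p) + fst p ^ m * snd p) \<in> ball 0 (Z ^ N) \<times> ball 0 Y"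
        using small[OF p(2,3)] p(1) by simp
    qed
  qed
  then have cu: "continuous_on ?S (\<lambda>p. complex_of_real (ev u (fst p ^ N) (eval_fps \<beta> (fst p) + fst p ^ m * snd p)))"
    by (intro continuous_intros) simp
  have cg: "continuous_on ?S (\<lambda>p. eval_fps (reduced \<beta> m g) (of_real (fst p)))" if "g \<in># G" for g
  proof (intro continuous_intros)
    show "(\<lambda>p. complex_of_real (fst p)) ` ?S \<subseteq> eball 0 (fps_conv_radius (reduced \<beta> m g))"
      using radius_diff[OF \<beta> that] \<tau> by (auto simp: reduced_def intro!: ereal_less_le_trans)
  qed
  have "continuous_on ?S (\<lambda>p. eval_fps (reduced \<beta> m g) (of_real (fst p)) + of_real (fst p ^ (m - edge_order \<beta> m g) * snd p))"
    if "g \<in># G" for g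
    by (rule continuous_on_add[OF cg[OF that]]) (intro continuous_intros)
  then have "continuous_on ?S (\<lambda>p. edge_fun \<beta> m (fst p) (snd p))"
    unfolding edge_fun_def by (rule continuous_on_mult[OF cu continuous_on_prod_mset])
  then show ?thesis by (simp add: case_prod_unfold)
qed

lemma small_strip:
  assumes \<beta>: "\<beta> \<in> R" and "m > 0" "W > 0"
  shows "\<exists>\<tau>>0. \<tau> < Z \<and> (\<forall>t\<in>{0..\<tau>}. \<forall>w\<in>{-W..W}. \<bar>eval_fps \<beta> t + t ^ m * w\<bar> < Y)"
proof -
  have "\<forall>\<^sub>F t in at_right 0. \<bar>eval_fps \<beta> t\<bar> < Y / 2" using eventually_root_small[OF \<beta>, of "Y / 2"] Y by simp
  moreover have "\<forall>\<^sub>F t in at_right 0. \<bar>t ^ m * W\<bar> < Y / 2"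
  proof -
    have "((\<lambda>t::real. t ^ m * W) \<longlongrightarrow> 0 ^ m * W) (at_right 0)" by (intro tendsto_intros)
    then have "((\<lambda>t::real. t ^ m * W) \<longlongrightarrow> 0) (at_right 0)" using assms(2) by (simp add: power_0_left)
    from tendstoD[OF this, of "Y / 2"] show ?thesis using Y by simp
  qed
  ultimately have "\<forall>\<^sub>F t in at_right 0. \<bar>eval_fps \<beta> t\<bar> < Y / 2 \<and> \<bar>t ^ m * W\<bar> < Y / 2" by (rule eventually_conj)
  then obtain b where b: "b > 0" "\<And>t. 0 < t \<Longrightarrow> t < b \<Longrightarrow> \<bar>eval_fps \<beta> t\<bar> < Y / 2 \<and> \<bar>t ^ m * W\<bar> < Y / 2"
    unfolding eventually_at_right_field by auto
  define \<tau> where "\<tau> = min b Z / 2"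
  have \<tau>: "0 < \<tau>" "\<tau> < b" "\<tau> < Z" using b(1) Z by (auto simp: \<tau>_def min_def)
  have "\<bar>eval_fps \<beta> t + t ^ m * w\<bar> < Y" if "t \<in> {0..\<tau>}" "w \<in> {-W..W}" for t w
  proof (cases "t = 0")
    case True
    then show ?thesis using assms(2) Y R_0[OF \<beta>] by (simp add: eval_fps_at_0 zero_power)
  next
    case False
    then have t: "\<bar>eval_fps \<beta> t\<bar> < Y / 2" "\<bar>t ^ m * W\<bar> < Y / 2" using b(2)[of t] that \<tau> by auto
    have "\<bar>t ^ m * w\<bar> \<le> \<bar>t ^ m * W\<bar>"
      using that assms(3) by (auto simp: abs_mult intro!: mult_left_mono)
    then show ?thesis using t by linarith
  qed
  then show ?thesis using \<tau> by blast
qed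

text \<open>In the coordinate w, the function F / t^E has a derivative that converges uniformly on
  the strip. The mean value inequality turns this into convergence of differences, even with end
  points that move with t.\<close>

lemma edge_limit:
  assumes \<beta>: "\<beta> \<in> R" and m: "m > 0" and W: "W > 0"
    and w: "(w1 \<longlongrightarrow> c1) (at_right 0)" "(w2 \<longlongrightarrow> c2) (at_right 0)" "c1 \<in> {-W<..<W}" "c2 \<in> {-W<..<W}"
  defines "Q \<equiv> \<lambda>w. integral {-W..w} (\<lambda>w. Re (edge_fun \<beta> m 0 w))"
  shows "((\<lambda>t. (ev F (t ^ N) (eval_fps \<beta> t + t ^ m * w2 t) - ev F (t ^ N) (eval_fps \<beta> t + t ^ m * w1 t)) / t ^ edge_exponent \<beta> m)
    \<longlongrightarrow> Q c2 - Q c1) (at_right 0)"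
proof -
  obtain \<tau> where \<tau>: "0 < \<tau>" "\<tau> < Z" "\<And>t w. t \<in> {0..\<tau>} \<Longrightarrow> w \<in> {-W..W} \<Longrightarrow> \<bar>eval_fps \<beta> t + t ^ m * w\<bar> < Y"
    using small_strip[OF \<beta> m W] by blast
  define k where "k t w = Re (edge_fun \<beta> m t w)" for t w
  have kc: "continuous_on ({0..\<tau>} \<times> {-W..W}) (\<lambda>(t, w). k t w)"
    using continuous_on_Re[OF edge_continuous[OF \<beta> \<tau>(2,3)]] by (simp add: k_def case_prod_unfold)
  have k0: "continuous_on {-W..W} (k 0)"
  proof -
    have "continuous_on {-W..W} (\<lambda>w. (\<lambda>(t, w). k t w) (0, w))"
      by (rule continuous_on_compose2[OF kc]) (use \<tau> in \<open>auto intro!: continuous_intros\<close>)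
    then show ?thesis by simp
  qed
  have Qd: "(Q has_real_derivative k 0 w) (at w within {-W..W})" if "w \<in> {-W..W}" for w
  proof -
    have kk: "k 0 = (\<lambda>w. Re (edge_fun \<beta> m 0 w))" by (rule ext) (simp add: k_def)
    show ?thesis using integral_has_real_derivative[OF k0 that] unfolding Q_def kk .
  qed
  have uc: "uniformly_continuous_on ({0..\<tau>} \<times> {-W..W}) (\<lambda>(t, w). k t w)"
    by (rule compact_uniformly_continuous[OF kc]) (auto intro: compact_Times)
  define \<Phi> where "\<Phi> t w = ev F (t ^ N) (eval_fps \<beta> t + t ^ m * w)" for t w
  have \<Phi>d: "(\<Phi> t has_real_derivative t ^ edge_exponent \<beta> m * k t w) (at w within {-W..W})"
    if "0 < t" "t \<le> \<tau>" "w \<in> {-W..W}" for t w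
  proof -
    let ?y = "eval_fps \<beta> t + t ^ m * w"
    have y: "\<bar>?y\<bar> < Y" using \<tau>(3) that by auto
    have x: "\<bar>t ^ N\<bar> < Z ^ N" using pow_less[of t] that \<tau> by (simp add: power_abs)
    have "((\<lambda>w. eval_fps \<beta> t + t ^ m * w) has_real_derivative t ^ m) (at w within {-W..W})"
      by (auto intro!: derivative_eq_intros)
    moreover have "((\<lambda>y. ev F (t ^ N) y) has_real_derivative ev f (t ^ N) ?y) (at ?y)"
      using ev_has_derivative[OF bounded(4), of "t ^ N" ?y UNIV] x y by (simp add: deriv)
    ultimately have "(\<Phi> t has_real_derivative ev f (t ^ N) ?y * t ^ m) (at w within {-W..W})"
      unfolding \<Phi>_def by (rule DERIV_chain2[rotated])
    then show ?thesis using edge_real(2)[OF \<beta>, of t m w] that \<tau> y by (simp add: k_def)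
  qed
  have wW: "\<forall>\<^sub>F t in at_right 0. w1 t \<in> {-W..W} \<and> w2 t \<in> {-W..W}"
  proof (rule eventually_conj)
    show "\<forall>\<^sub>F t in at_right 0. w1 t \<in> {-W..W}"
      using topological_tendstoD[OF w(1), of "{-W<..<W}"] w(3) by (auto elim: eventually_mono)
    show "\<forall>\<^sub>F t in at_right 0. w2 t \<in> {-W..W}"
      using topological_tendstoD[OF w(2), of "{-W<..<W}"] w(4) by (auto elim: eventually_mono)
  qed
  let ?E = "edge_exponent \<beta> m"
  have lim: "((\<lambda>t. (\<Phi> t (w2 t) - \<Phi> t (w1 t)) / t ^ ?E - (Q (w2 t) - Q (w1 t))) \<longlongrightarrow> 0) (at_right 0)"
  proof (rule tendstoI)
    fix e :: real assume e: "e > 0"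
    \<comment> \<open>The end points lie at most 2W apart, so the error is at most 2 W e' = e /
      2.\<close>
    define e' where "e' = e / (4 * W)"
    have e': "e' > 0" using e W by (simp add: e'_def)
    obtain \<delta> where \<delta>: "\<delta> > 0" "\<And>p q. p \<in> {0..\<tau>} \<times> {-W..W} \<Longrightarrow> q \<in> {0..\<tau>} \<times> {-W..W} \<Longrightarrow> dist q p < \<delta> \<Longrightarrow>
        dist ((\<lambda>(t, w). k t w) q) ((\<lambda>(t, w). k t w) p) < e'"
      using uc e' unfolding uniformly_continuous_on_def by blast
    have "\<forall>\<^sub>F t in at_right 0. 0 < t \<and> t < min \<delta> \<tau>" using eventually_small[of "min \<delta> \<tau>"] \<delta> \<tau> by auto
    then show "\<forall>\<^sub>F t in at_right 0. dist ((\<Phi> t (w2 t) - \<Phi> t (w1 t)) / t ^ ?E - (Q (w2 t) - Q (w1 t))) 0 < e"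
      using wW
    proof eventually_elim
      case (elim t)
      define D where "D w = \<Phi> t w / t ^ ?E - Q w" for w
      have "norm (D (w2 t) - D (w1 t)) \<le> e' * norm (w2 t - w1 t)"
      proof (rule field_differentiable_bound[of "{-W..W}"])
        fix w assume ww: "w \<in> {-W..W}"
        have "(D has_real_derivative (t ^ ?E * k t w) / t ^ ?E - k 0 w) (at w within {-W..W})"
          unfolding D_def using elim ww by (intro DERIV_diff DERIV_cdivide \<Phi>d Qd) auto
        then show "(D has_real_derivative k t w - k 0 w) (at w within {-W..W})" using elim by simp
        have "dist (t, w) (0, w) < \<delta>" using elim by (simp add: dist_Pair_Pair)
        then have "dist (k t w) (k 0 w) < e'" using \<delta>(2)[of "(0, w)" "(t, w)"] elim ww \<tau> by simp
        then show "norm (k t w - k 0 w) \<le> e'" by (simp add: dist_norm)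
      qed (use elim in auto)
      also have "\<dots> \<le> e' * (2 * W)" using elim e' by (intro mult_left_mono) (auto simp: abs_le_iff)
      also have "\<dots> < e" using e W by (simp add: e'_def)
      finally show ?case by (simp add: D_def diff_divide_distrib algebra_simps)
    qed
  qed
  have Qc: "((\<lambda>t. Q (w t)) \<longlongrightarrow> Q c) (at_right 0)" if "(w \<longlongrightarrow> c) (at_right 0)" "c \<in> {-W<..<W}" for w c
  proof -
    have "(Q has_real_derivative k 0 c) (at c)"
      using Qd[of c] that(2) at_within_interior[of c "{-W..W}"] by (simp add: interior_atLeastAtMost_real)
    then show ?thesis by (rule isCont_tendsto_compose[OF DERIV_isCont that(1)])
  qed
  have "((\<lambda>t. ((\<Phi> t (w2 t) - \<Phi> t (w1 t)) / t ^ ?E - (Q (w2 t) - Q (w1 t))) + (Q (w2 t) - Q (w1 t))) \<longlongrightarrow> 0 + (Q c2 - Q c1)) (at_right 0)"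
    by (intro tendsto_add lim tendsto_diff Qc w)
  then show ?thesis by (simp add: \<Phi>_def)
qed

lemma root_position:
  assumes \<beta>: "\<beta> \<in> R" "r \<in> R" "m \<le> subdegree (r - \<beta>) \<or> r - \<beta> = 0"
  shows "((\<lambda>t. eval_fps (fps_shift m (r - \<beta>)) t) \<longlongrightarrow> position \<beta> m r) (at_right 0)"
    "\<forall>\<^sub>F t in at_right 0. eval_fps r t = eval_fps \<beta> t + t ^ m * eval_fps (fps_shift m (r - \<beta>)) t"
proof -
  have b: "geom_bounded (r - \<beta>)" using geom_bounded_diff R_geom \<beta> by blast
  show "((\<lambda>t. eval_fps (fps_shift m (r - \<beta>)) t) \<longlongrightarrow> position \<beta> m r) (at_right 0)"
    using eval_tendsto[OF geom_bounded_shift[OF b, of m]] by (simp add: position_def)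
  show "\<forall>\<^sub>F t in at_right 0. eval_fps r t = eval_fps \<beta> t + t ^ m * eval_fps (fps_shift m (r - \<beta>)) t"
    using eventually_conv[OF b] eventually_conv[OF R_geom[OF \<beta>(1)]] eventually_conv[OF R_geom[OF \<beta>(2)]]
  proof eventually_elim
    case (elim t)
    have "t ^ m * eval_fps (fps_shift m (r - \<beta>)) t = eval_fps (r - \<beta>) t"
      using eval_factor[OF assms(3), of t] elim by simp
    then show ?case using elim by (simp add: eval_fps_diff)
  qed
qed

text \<open>The lower limit -W is arbitrary, since only differences of this primitive enter.\<close>

definition primitive_at :: "real fps \<Rightarrow> nat \<Rightarrow> real \<Rightarrow> real \<Rightarrow> real" where
  "primitive_at \<beta> m W w = integral {-W..w} (\<lambda>w. Re (edge_fun \<beta> m 0 w))"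

definition ball_of :: "real fps \<Rightarrow> nat \<Rightarrow> real fps set" where
  "ball_of \<beta> m = {r \<in> R. m \<le> subdegree (r - \<beta>) \<or> r - \<beta> = 0}"

lemma root_limit:
  assumes \<beta>: "\<beta> \<in> R" and m: "m > 0" and W: "\<And>r. r \<in> R \<Longrightarrow> position \<beta> m r \<in> {-W<..<W}" "W > 0"
    and rs: "r \<in> ball_of \<beta> m" "s \<in> ball_of \<beta> m"
  shows "((\<lambda>t. (ev F (t ^ N) (eval_fps s t) - ev F (t ^ N) (eval_fps r t)) / t ^ edge_exponent \<beta> m)
    \<longlongrightarrow> primitive_at \<beta> m W (position \<beta> m s) - primitive_at \<beta> m W (position \<beta> m r)) (at_right 0)"
proof -
  have r: "r \<in> R" "m \<le> subdegree (r - \<beta>) \<or> r - \<beta> = 0" and s: "s \<in> R" "m \<le> subdegree (s - \<beta>) \<or> s - \<beta> = 0"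
    using rs by (auto simp: ball_of_def)
  note pr = root_position[OF \<beta> r] and ps = root_position[OF \<beta> s]
  have "((\<lambda>t. (ev F (t ^ N) (eval_fps \<beta> t + t ^ m * eval_fps (fps_shift m (s - \<beta>)) t) -
       ev F (t ^ N) (eval_fps \<beta> t + t ^ m * eval_fps (fps_shift m (r - \<beta>)) t)) / t ^ edge_exponent \<beta> m)
    \<longlongrightarrow> primitive_at \<beta> m W (position \<beta> m s) - primitive_at \<beta> m W (position \<beta> m r)) (at_right 0)"
    unfolding primitive_at_def by (rule edge_limit[OF \<beta> m W(2) pr(1) ps(1) W(1)[OF r(1)] W(1)[OF s(1)]])
  then show ?thesis
  proof (rule Lim_transform_eventually)
    show "\<forall>\<^sub>F t in at_right 0. (ev F (t ^ N) (eval_fps \<beta> t + t ^ m * eval_fps (fps_shift m (s - \<beta>)) t) -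
       ev F (t ^ N) (eval_fps \<beta> t + t ^ m * eval_fps (fps_shift m (r - \<beta>)) t)) / t ^ edge_exponent \<beta> m =
       (ev F (t ^ N) (eval_fps s t) - ev F (t ^ N) (eval_fps r t)) / t ^ edge_exponent \<beta> m"
      using pr(2) ps(2) by eventually_elim simp
  qed
qed

lemma edge_fun_0:
  "m > 0 \<Longrightarrow> \<beta> \<in> R \<Longrightarrow> edge_fun \<beta> m 0 w = of_real (ev u 0 0) *
     (\<Prod>g\<in>#G. fps_nth (reduced \<beta> m g) 0 + (if edge_order \<beta> m g = m then of_real w else 0))"
proof -
  assume m: "m > 0" and \<beta>: "\<beta> \<in> R"
  have "eval_fps (reduced \<beta> m g) (of_real 0) + complex_of_real (0 ^ (m - edge_order \<beta> m g) * w) =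
      fps_nth (reduced \<beta> m g) 0 + (if edge_order \<beta> m g = m then of_real w else 0)" for g
    using edge_order_le[of \<beta> m g] by (auto simp: eval_fps_at_0 power_0_left)
  then show ?thesis unfolding edge_fun_def using m N R_0[OF \<beta>] by (simp add: eval_fps_at_0 power_0_left)
qed

text \<open>At t = 0 a factor of order below m becomes a nonzero constant, and every other factor
  becomes w plus a constant.\<close>

lemma edge_fun_0_zeros:
  assumes m: "m > 0" and \<beta>: "\<beta> \<in> R"
  shows "finite {w. edge_fun \<beta> m 0 w = 0}"
proof -
  have "{w. edge_fun \<beta> m 0 w = 0} \<subseteq> (\<lambda>g. - Re (fps_nth (reduced \<beta> m g) 0)) ` set_mset G"
  proof
    fix w assume "w \<in> {w. edge_fun \<beta> m 0 w = 0}"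
    moreover have "ev u 0 0 \<noteq> 0" using u_nonzero[of 0 0] Z Y by simp
    ultimately obtain g where g: "g \<in># G" "fps_nth (reduced \<beta> m g) 0 + (if edge_order \<beta> m g = m then of_real w else 0) = 0"
      unfolding mem_Collect_eq edge_fun_0[OF m \<beta>] by (auto simp: prod_mset_zero_iff)
    have "edge_order \<beta> m g = m"
    proof (rule ccontr)
      assume ne: "edge_order \<beta> m g \<noteq> m"
      then have e: "cfps \<beta> - g \<noteq> 0" "edge_order \<beta> m g = subdegree (cfps \<beta> - g)" by (auto simp: edge_order_def min_def split: if_splits)
      have "fps_nth (reduced \<beta> m g) 0 = fps_nth (cfps \<beta> - g) (subdegree (cfps \<beta> - g))"
        by (simp only: reduced_def fps_shift_nth e(2) add_0)
      then have "fps_nth (reduced \<beta> m g) 0 \<noteq> 0" using nth_subdegree_nonzero[OF e(1)] by simp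
      then show False using g ne by simp
    qed
    then have "complex_of_real w = - fps_nth (reduced \<beta> m g) 0" using g by (simp add: eq_neg_iff_add_eq_0 add.commute)
    then have "w = - Re (fps_nth (reduced \<beta> m g) 0)" by (metis Re_complex_of_real uminus_complex.sel(1))
    then show "w \<in> (\<lambda>g. - Re (fps_nth (reduced \<beta> m g) 0)) ` set_mset G" using g by blast
  qed
  then show ?thesis by (rule finite_subset) simp
qed

text \<open>For t > 0 the rescaled f has no zero between the two roots, hence a constant sign there.
  The limit inherits the sign only weakly: it can vanish in between, where conjugate non-real roots
  have the same real leading term. Its zeros are finite in number, though, so its integral between
  the two positions is not 0.\<close>

lemma consecutive_nonzero:
  assumes \<beta>: "\<beta> \<in> R" and m: "m > 0" and W: "\<And>r. r \<in> R \<Longrightarrow> position \<beta> m r \<in> {-W<..<W}" "W > 0"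
    and r: "r \<in> ball_of \<beta> m" and s: "s \<in> ball_of \<beta> m" and less: "position \<beta> m r < position \<beta> m s"
    and cons: "\<forall>\<^sub>F t in at_right 0. \<forall>q\<in>R. \<not> (eval_fps r t < eval_fps q t \<and> eval_fps q t < eval_fps s t)"
  shows "primitive_at \<beta> m W (position \<beta> m r) \<noteq> primitive_at \<beta> m W (position \<beta> m s)"
proof -
  define k where "k t w = Re (edge_fun \<beta> m t w)" for t w
  obtain \<tau> where \<tau>: "0 < \<tau>" "\<tau> < Z" "\<And>t w. t \<in> {0..\<tau>} \<Longrightarrow> w \<in> {-W..W} \<Longrightarrow> \<bar>eval_fps \<beta> t + t ^ m * w\<bar> < Y"
    using small_strip[OF \<beta> m W(2)] by blast
  have Kc: "continuous_on ({0..\<tau>} \<times> {-W..W}) (\<lambda>(t, w). edge_fun \<beta> m t w)"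
    by (rule edge_continuous[OF \<beta> \<tau>(2,3)])
  have kc: "continuous_on ({0..\<tau>} \<times> {-W..W}) (\<lambda>(t, w). k t w)"
    using continuous_on_Re[OF Kc] by (simp add: k_def case_prod_unfold)
  have kw: "continuous_on {-W..W} (k t)" if "t \<in> {0..\<tau>}" for t
  proof -
    have "continuous_on {-W..W} (\<lambda>w. (\<lambda>(t, w). k t w) (t, w))"
      by (rule continuous_on_compose2[OF kc]) (use that in \<open>auto intro!: continuous_intros\<close>)
    then show ?thesis by simp
  qed
  have Klim: "((\<lambda>t. edge_fun \<beta> m t w) \<longlongrightarrow> edge_fun \<beta> m 0 w) (at_right 0)" if "w \<in> {-W..W}" for w
  proof -
    have "continuous_on {0..\<tau>} (\<lambda>t. (\<lambda>(t, w). edge_fun \<beta> m t w) (t, w))"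
      by (rule continuous_on_compose2[OF Kc]) (use that in \<open>auto intro!: continuous_intros\<close>)
    then have "((\<lambda>t. edge_fun \<beta> m t w) \<longlongrightarrow> edge_fun \<beta> m 0 w) (at 0 within {0..\<tau>})"
      using \<tau> by (simp add: continuous_on_def)
    then show ?thesis using at_within_Icc_at_right[OF \<tau>(1)] by simp
  qed
  have klim: "((\<lambda>t. k t w) \<longlongrightarrow> k 0 w) (at_right 0)" if "w \<in> {-W..W}" for w
    unfolding k_def by (rule tendsto_Re[OF Klim[OF that]])
  have real0: "edge_fun \<beta> m 0 w = of_real (k 0 w)" if "w \<in> {-W..W}" for w
  proof -
    have "\<forall>\<^sub>F t in at_right 0. edge_fun \<beta> m t w = of_real (k t w)"
      using eventually_small[OF \<tau>(1)]
      by eventually_elim (use edge_real(1)[OF \<beta>] \<tau> that in \<open>auto simp: k_def\<close>)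
    then have "((\<lambda>t. complex_of_real (k t w)) \<longlongrightarrow> edge_fun \<beta> m 0 w) (at_right 0)"
      by (rule Lim_transform_eventually[OF Klim[OF that]])
    then show ?thesis
      using tendsto_unique[OF trivial_limit_at_right_real _ tendsto_of_real[OF klim[OF that]]] by blast
  qed
  define c c' where "c = position \<beta> m r" and "c' = position \<beta> m s"
  have rR: "r \<in> R" "m \<le> subdegree (r - \<beta>) \<or> r - \<beta> = 0" and sR: "s \<in> R" "m \<le> subdegree (s - \<beta>) \<or> s - \<beta> = 0"
    using r s by (auto simp: ball_of_def)
  note pr = root_position[OF \<beta> rR] and ps = root_position[OF \<beta> sR]
  have cc: "c \<in> {-W<..<W}" "c' \<in> {-W<..<W}" "c < c'" using W(1)[OF rR(1)] W(1)[OF sR(1)] less by (auto simp: c_def c'_def)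
  have sign: "k 0 w * k 0 w' \<ge> 0" if w: "c < w" "w < c'" "c < w'" "w' < c'" for w w'
  proof -
    have wW: "w \<in> {-W..W}" "w' \<in> {-W..W}" using w cc by auto
    have e1: "\<forall>\<^sub>F t in at_right 0. eval_fps (fps_shift m (r - \<beta>)) t < min w w'"
      using order_tendstoD(2)[OF pr(1), of "min w w'"] w by (simp add: c_def)
    have e2: "\<forall>\<^sub>F t in at_right 0. eval_fps (fps_shift m (s - \<beta>)) t > max w w'"
      using order_tendstoD(1)[OF ps(1), of "max w w'"] w by (simp add: c'_def)
    have "\<forall>\<^sub>F t in at_right 0. k t w * k t w' \<ge> 0"
      using e1 e2 pr(2) ps(2) cons eventually_zeros eventually_small[OF \<tau>(1)]
    proof eventually_elim
      case (elim t)
      have t: "t \<in> {0..\<tau>}" "t > 0" "t < Z" using elim \<tau> by auto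
      have nz: "k t v \<noteq> 0" if v: "v \<in> {min w w'..max w w'}" for v
      proof
        assume k0: "k t v = 0"
        have vW: "v \<in> {-W..W}" using v wW by auto
        let ?y = "eval_fps \<beta> t + t ^ m * v"
        have y: "\<bar>?y\<bar> < Y" using \<tau>(3)[OF t(1) vW] .
        have "ev f (t ^ N) ?y * t ^ m = 0" using edge_real(2)[OF \<beta> t(2,3) y] k0 by (simp add: k_def)
        then have "ev f (t ^ N) ?y = 0" using t by simp
        then obtain q where q: "q \<in> R" "?y = eval_fps q t" using elim(6) y by blast
        have "t ^ m * eval_fps (fps_shift m (r - \<beta>)) t < t ^ m * v" "t ^ m * v < t ^ m * eval_fps (fps_shift m (s - \<beta>)) t"
          using elim(1,2) v t by (auto intro!: mult_strict_left_mono)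
        then have "eval_fps r t < eval_fps q t" "eval_fps q t < eval_fps s t" unfolding q(2)[symmetric] elim(3,4) by linarith+
        then show False using elim(5) q(1) by blast
      qed
      have "connected (k t ` {min w w'..max w w'})"
      proof (rule connected_continuous_image)
        show "continuous_on {min w w'..max w w'} (k t)"
          by (rule continuous_on_subset[OF kw[OF t(1)]]) (use wW in auto)
      qed simp
      moreover have "k t w \<in> k t ` {min w w'..max w w'}" "k t w' \<in> k t ` {min w w'..max w w'}" by auto
      moreover have "0 \<notin> k t ` {min w w'..max w w'}" using nz by auto
      ultimately have "\<not> (k t w \<le> 0 \<and> 0 \<le> k t w')" "\<not> (k t w' \<le> 0 \<and> 0 \<le> k t w)"
        using connectedD_interval by blast+
      then show ?case by (auto simp: zero_le_mult_iff)
    qed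
    then show ?thesis
      using tendsto_lowerbound[OF tendsto_mult[OF klim[OF wW(1)] klim[OF wW(2)]] _ trivial_limit_at_right_real] by blast
  qed
  have "infinite {c<..<c'}" using cc by simp
  then have "\<not> {c<..<c'} \<subseteq> {w. edge_fun \<beta> m 0 w = 0}"
    using edge_fun_0_zeros[OF m \<beta>] finite_subset by blast
  then obtain w0 where w0: "c < w0" "w0 < c'" "k 0 w0 \<noteq> 0" using real0 cc by force
  define \<sigma> where "\<sigma> = sgn (k 0 w0)"
  have \<sigma>: "\<sigma> * k 0 w \<ge> 0" if "w \<in> {c<..<c'}" for w
    using sign[OF w0(1,2), of w] that w0(3) by (auto simp: \<sigma>_def sgn_if zero_le_mult_iff split: if_splits)
  have cont: "continuous_on {-W..W} (k 0)" using kw[of 0] \<tau> by simp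
  have csub: "{c..c'} \<subseteq> {-W..W}" using cc by auto
  have cont': "continuous_on {c..c'} (\<lambda>w. \<sigma> * k 0 w)"
    by (intro continuous_intros continuous_on_subset[OF cont csub])
  have comb: "primitive_at \<beta> m W c' = primitive_at \<beta> m W c + integral {c..c'} (k 0)"
  proof -
    have "k 0 integrable_on {-W..c'}"
      by (rule integrable_continuous_interval, rule continuous_on_subset[OF cont]) (use cc in auto)
    then have "integral {-W..c} (k 0) + integral {c..c'} (k 0) = integral {-W..c'} (k 0)"
      by (rule Henstock_Kurzweil_Integration.integral_combine[rotated 2]) (use cc in auto)
    moreover have "k 0 = (\<lambda>w. Re (edge_fun \<beta> m 0 w))" by (rule ext) (simp add: k_def)
    ultimately show ?thesis unfolding primitive_at_def by simp
  qed
  show ?thesis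
  proof
    assume "primitive_at \<beta> m W (position \<beta> m r) = primitive_at \<beta> m W (position \<beta> m s)"
    then have "integral {c..c'} (k 0) = 0" using comb by (simp add: c_def c'_def)
    then have i0: "integral (cbox c c') (\<lambda>w. \<sigma> * k 0 w) = 0" by simp
    have int: "(\<lambda>w. \<sigma> * k 0 w) integrable_on (cbox c c')" using integrable_continuous_interval[OF cont'] by simp
    have "((\<lambda>w. \<sigma> * k 0 w) has_integral 0) (cbox c c')" using integrable_integral[OF int] unfolding i0 .
    then have "\<sigma> * k 0 w0 = 0"
      by (rule has_integral_0_cbox_imp_0[rotated 2]) (use cont' \<sigma> cc w0 in \<open>auto simp: box_real\<close>)
    then show False using w0(3) by (auto simp: \<sigma>_def sgn_if split: if_splits)
  qed
qed

end

text \<open>Two primitives differ by a series in x alone, which cancels. This passes from the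
  primitive chosen in \<open>increment\<close> to the given one.\<close>

lemma fsubst_primitive_diff:
  fixes F f :: "real fps fps"
  assumes "fps_deriv F = f" "fps_nth r 0 = 0" "fps_nth s 0 = 0" "N > 0"
  shows "fsubst (map_coeff (ram N) (fps_integral0 f)) s - fsubst (map_coeff (ram N) (fps_integral0 f)) r =
    fsubst (map_coeff (ram N) F) s - fsubst (map_coeff (ram N) F) r"
proof -
  let ?F0 = "fps_integral0 f"
  have "F = ?F0 + fps_const (fps_nth F 0)"
  proof (rule fps_ext)
    fix n
    show "fps_nth F n = fps_nth (?F0 + fps_const (fps_nth F 0)) n"
    proof (cases n)
      case 0
      then show ?thesis by (simp add: fps_integral_def)
    next
      case (Suc m)
      have "fps_deriv ?F0 = fps_deriv F" using fps_deriv_fps_integral0_series assms(1) by simp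
      then have "of_nat (Suc m) * fps_nth ?F0 (Suc m) = of_nat (Suc m) * fps_nth F (Suc m)"
        by (metis Suc_eq_plus1 fps_deriv_nth)
      moreover have "(of_nat (Suc m) :: real fps) \<noteq> 0" by (simp only: of_nat_eq_0_iff nat.simps not_False_eq_True)
      ultimately have "fps_nth ?F0 (Suc m) = fps_nth F (Suc m)" by (simp only: mult_cancel_left simp_thms)
      then show ?thesis using Suc by (simp add: fps_nth_fps_const)
    qed
  qed
  then have "map_coeff (ram N) F = map_coeff (ram N) ?F0 + fps_const (ram N (fps_nth F 0))"
    using hom_simps(2)[OF fps_hom_map_coeff[OF fps_hom_ram[OF assms(4)]]] map_coeff_const[OF fps_hom_ram[OF assms(4)]]
    by metis
  then show ?thesis by (simp add: fsubst_add assms)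
qed

section \<open>Critical values along two real roots\<close>

context np_data
begin

text \<open>The vertex is the one where \<open>r\<close> and \<open>s\<close> separate, with
  \<open>r\<close> as base point \<beta>. The same limit, with the same exponent, serves all pairs
  of roots through it: for neighbours it yields the initial coefficients of the increments, for
  \<open>r\<close> and \<open>s\<close> the comparison of the critical values.\<close>

lemma eventually_iso_pair:
  assumes inj: "injectivity_condition f" and rt: "root_set f = puiseux N ` R"
    and r: "r \<in> R" and s: "s \<in> R" and rs: "r \<noteq> s"
  shows "\<forall>\<^sub>F t in at_right 0. ev F (t ^ N) (eval_fps r t) \<noteq> ev F (t ^ N) (eval_fps s t) \<and>
     (ev F (t ^ N) (eval_fps r t) < ev F (t ^ N) (eval_fps s t) \<longleftrightarrow> less_int f (puiseux N r) (puiseux N s))"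
proof -
  have Rne: "R \<noteq> {}" using r by auto
  interpret rt: root_tree "root_set f" "\<lambda>\<xi> \<eta>. valuation (\<eta> - \<xi>)" f
    by (rule root_tree_puiseux[OF N R_fin Rne R_0 rt])
  define m where "m = subdegree (s - r)"
  have d: "valuation (puiseux N q - puiseux N p) = (if q = p then \<infinity> else ereal (real (subdegree (q - p)) / real N))" for p q :: "real fps"
    by (simp add: puiseux_diff[OF N] valuation_puiseux[OF N])
  have l: "less_R (puiseux N p) (puiseux N q) \<longleftrightarrow> fps_nth (q - p) (subdegree (q - p)) > 0" for p q :: "real fps"
    by (simp only: less_R_def puiseux_diff[OF N] init_coeff_puiseux[OF N])
  have m: "m > 0"
  proof -
    have "fps_nth (s - r) 0 = 0" using R_0 r s by simp
    then show ?thesis using rs unfolding m_def by (metis eq_iff_diff_eq_0 gr0I nth_subdegree_zero_iff)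
  qed
  let ?a = "puiseux N r" and ?b = "puiseux N s"
  have ab: "?a \<in> root_set f" "?b \<in> root_set f" "?a \<noteq> ?b" using r s rs rt puiseux_inj[OF N] by auto
  have h: "rt.h ?a ?b = ereal (real m / real N)" unfolding rt.h_def[OF ab] d m_def using rs by simp
  have le_iff: "ereal (real m / real N) \<le> ereal (real k / real N) \<longleftrightarrow> m \<le> k"
    "ereal (real m / real N) < ereal (real k / real N) \<longleftrightarrow> m < k"
    "ereal (real k / real N) = ereal (real m / real N) \<longleftrightarrow> k = m" for k
    using N by (simp_all add: divide_le_cancel divide_less_cancel)
  have B: "puiseux N q \<in> rt.B ?a ?b \<longleftrightarrow> q \<in> ball_of r m" if "q \<in> R" for q
    unfolding rt.B_def[OF ab] h using that rt le_iff(1) by (auto simp: d ball_of_def)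
  \<comment> \<open>Any bound that exceeds all positions; the interval (-W, W) then contains all
    relevant limits of w.\<close>
  define W where "W = 1 + (\<Sum>q\<in>R. \<bar>position r m q\<bar>)"
  have W0: "W > 0" unfolding W_def by (rule add_pos_nonneg) (auto intro: sum_nonneg)
  have W: "position r m q \<in> {-W<..<W}" if "q \<in> R" for q
  proof -
    have "\<bar>position r m q\<bar> \<le> (\<Sum>q\<in>R. \<bar>position r m q\<bar>)"
      by (rule member_le_sum[OF that _ R_fin]) simp
    then show ?thesis by (auto simp: W_def)
  qed
  \<comment> \<open>The potential for \<open>less_int_iff\<close>: the primitive of the limit,
    evaluated at the position of the root.\<close>
  define \<Psi> where "\<Psi> \<xi> = primitive_at r m W (position r m (inv_into R (puiseux N) \<xi>))" for \<xi>
  have injR: "inj_on (puiseux N) R" by (rule inj_onI) (simp add: puiseux_inj[OF N])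
  have \<Psi>: "\<Psi> (puiseux N q) = primitive_at r m W (position r m q)" if "q \<in> R" for q
    unfolding \<Psi>_def inv_into_f_f[OF injR that] ..
  have limit: "((\<lambda>t. (ev F (t ^ N) (eval_fps q' t) - ev F (t ^ N) (eval_fps q t)) / t ^ edge_exponent r m)
      \<longlongrightarrow> \<Psi> (puiseux N q') - \<Psi> (puiseux N q)) (at_right 0)"
    if "q \<in> ball_of r m" "q' \<in> ball_of r m" for q q'
    using root_limit[OF r m W W0 that] that \<Psi> by (simp add: ball_of_def)
  have edge_const: "\<Psi> c = \<Psi> e"
    if ce: "c \<in> rt.B ?a ?b" "e \<in> rt.B ?a ?b" "rt.h ?a ?b < valuation (e - c)" for c e
  proof -
    obtain q q' where q: "c = puiseux N q" "q \<in> R" "e = puiseux N q'" "q' \<in> R"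
      using rt.ball_subset[OF ab ce(1)] rt.ball_subset[OF ab ce(2)] unfolding rt by blast
    have "fps_nth (q' - q) m = 0"
    proof (cases "q' = q")
      case False
      then have "m < subdegree (q' - q)" using ce(3) le_iff(2) unfolding q h d by simp
      then show ?thesis by (rule nth_less_subdegree_zero)
    qed simp
    then have "position r m q = position r m q'" by (simp add: position_def)
    then show ?thesis using q \<Psi> by simp
  qed
  have incr: "init_coeff (increment f j) = \<Psi> (root_list f ! Suc j) - \<Psi> (root_list f ! j)"
    if j: "Suc j < length (root_list f)" "root_list f ! j \<in> rt.B ?a ?b" "root_list f ! Suc j \<in> rt.B ?a ?b"
      "valuation (root_list f ! Suc j - root_list f ! j) = rt.h ?a ?b" for j
  proof -
    obtain q q' where q: "root_list f ! j = puiseux N q" "q \<in> R" "root_list f ! Suc j = puiseux N q'" "q' \<in> R"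
      using j rt rt.ball_subset[OF ab] by blast
    have qb: "q \<in> ball_of r m" "q' \<in> ball_of r m" using B q j by auto
    have sub: "subdegree (q' - q) = m" "q' \<noteq> q"
      using j(4) le_iff(3) unfolding q h d by (auto split: if_splits)
    have "less_R (puiseux N q) (puiseux N q')"
      using rt.rs_nth_less[of j "Suc j"] j(1) q by simp
    then have pos: "fps_nth (q' - q) m > 0" unfolding l sub .
    \<comment> \<open>Neighbours in \<open>root_list\<close> have no root between them as series,
      hence none between their values for small t.\<close>
    have cons: "\<forall>\<^sub>F t in at_right 0. \<forall>p\<in>R. \<not> (eval_fps q t < eval_fps p t \<and> eval_fps p t < eval_fps q' t)"
    proof (intro eventually_ball_finite R_fin ballI)
      fix p assume p: "p \<in> R"
      then have "puiseux N p \<in> set (root_list f)" using rt rt.rs by simp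
      then obtain i where i: "i < length (root_list f)" "root_list f ! i = puiseux N p" by (auto simp: in_set_conv_nth)
      show "\<forall>\<^sub>F t in at_right 0. \<not> (eval_fps q t < eval_fps p t \<and> eval_fps p t < eval_fps q' t)"
      proof (cases "i = j \<or> i = Suc j")
        case True
        then have "p = q \<or> p = q'" using i q puiseux_inj[OF N] by metis
        then show ?thesis by auto
      next
        case False
        then consider "i < j" | "Suc j < i" by linarith
        then show ?thesis
        proof cases
          case 1
          then have "less_R (puiseux N p) (puiseux N q)" using rt.rs_nth_less[of i j] i j q by simp
          from eventually_less_roots[OF p q(2) this[unfolded l]] show ?thesis
            by (rule eventually_mono) auto
        next
          case 2
          then have "less_R (puiseux N q') (puiseux N p)" using rt.rs_nth_less[of "Suc j" i] i j q by simp
          from eventually_less_roots[OF q(4) p this[unfolded l]] show ?thesis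
            by (rule eventually_mono) auto
        qed
      qed
    qed
    have "position r m q < position r m q'" using pos by (simp add: position_def)
    from consecutive_nonzero[OF r m W W0 qb this cons]
    have ne: "\<Psi> (puiseux N q') - \<Psi> (puiseux N q) \<noteq> 0" using \<Psi> q by simp
    define S where "S p = fsubst (map_coeff (ram N) F) p" for p
    have Fg: "geom_bounded2 F" by (rule bidisc_bounded_imp_geom_bounded2[OF bounded(4)])
    have Sg: "geom_bounded (S p)" if "p \<in> R" for p
      unfolding S_def using that R_geom R_0 N Fg by (intro geom_bounded_fsubst geom_bounded2_map_ram) auto
    have "((\<lambda>t. eval_fps (S q' - S q) t / t ^ edge_exponent r m) \<longlongrightarrow> \<Psi> (puiseux N q') - \<Psi> (puiseux N q)) (at_right 0)"
    proof (rule Lim_transform_eventually[OF limit[OF qb]])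
      show "\<forall>\<^sub>F t in at_right 0. (ev F (t ^ N) (eval_fps q' t) - ev F (t ^ N) (eval_fps q t)) / t ^ edge_exponent r m =
          eval_fps (S q' - S q) t / t ^ edge_exponent r m"
        using eval_fsubst[OF N Fg R_geom[OF q(2)] R_0[OF q(2)]] eval_fsubst[OF N Fg R_geom[OF q(4)] R_0[OF q(4)]]
          eventually_conv[OF Sg[OF q(2)]] eventually_conv[OF Sg[OF q(4)]]
        by eventually_elim (simp add: S_def eval_fps_diff)
    qed
    from lead_eqI[OF geom_bounded_diff[OF Sg[OF q(4)] Sg[OF q(2)]] this ne]
    have lead: "fps_nth (S q' - S q) (subdegree (S q' - S q)) = \<Psi> (puiseux N q') - \<Psi> (puiseux N q)" .
    have "increment f j = puiseux N (S q' - S q)"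
      unfolding increment_def q subst_y_eq[OF N R_0[OF q(2)]] subst_y_eq[OF N R_0[OF q(4)]] puiseux_diff[OF N]
        fsubst_primitive_diff[OF deriv R_0[OF q(2)] R_0[OF q(4)] N] S_def ..
    then have "init_coeff (increment f j) = fps_nth (S q' - S q) (subdegree (S q' - S q))"
      by (simp only: init_coeff_puiseux[OF N])
    then show ?thesis using lead q by simp
  qed
  have ne: "\<Psi> ?a \<noteq> \<Psi> ?b" and li: "less_int f ?a ?b \<longleftrightarrow> \<Psi> ?a < \<Psi> ?b"
    using rt.less_int_iff[OF inj ab edge_const incr] by blast+
  have rb: "r \<in> ball_of r m" "s \<in> ball_of r m" using r s by (auto simp: ball_of_def m_def)
  note lim = limit[OF rb]
  show ?thesis
  proof (cases "\<Psi> ?a < \<Psi> ?b")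
    case True
    then have "\<forall>\<^sub>F t in at_right 0. 0 < (ev F (t ^ N) (eval_fps s t) - ev F (t ^ N) (eval_fps r t)) / t ^ edge_exponent r m"
      by (intro order_tendstoD(1)[OF lim]) simp
    then show ?thesis using eventually_at_right_less[of 0]
    proof eventually_elim
      case (elim t)
      then have "ev F (t ^ N) (eval_fps r t) < ev F (t ^ N) (eval_fps s t)" by (simp add: zero_less_divide_iff)
      then show ?case using True li by auto
    qed
  next
    case False
    then have "\<forall>\<^sub>F t in at_right 0. (ev F (t ^ N) (eval_fps s t) - ev F (t ^ N) (eval_fps r t)) / t ^ edge_exponent r m < 0"
      using ne by (intro order_tendstoD(2)[OF lim]) simp
    then show ?thesis using eventually_at_right_less[of 0]
    proof eventually_elim
      case (elim t)
      then have "ev F (t ^ N) (eval_fps s t) < ev F (t ^ N) (eval_fps r t)" by (simp add: divide_less_0_iff)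
      then show ?case using False li by auto
    qed
  qed
qed

lemma eventually_order_pair:
  assumes "r \<in> R" "s \<in> R"
  shows "\<forall>\<^sub>F t in at_right 0. eval_fps r t < eval_fps s t \<longleftrightarrow> less_R (puiseux N r) (puiseux N s)"
proof -
  have l: "less_R (puiseux N p) (puiseux N q) \<longleftrightarrow> fps_nth (q - p) (subdegree (q - p)) > 0" for p q :: "real fps"
    by (simp only: less_R_def puiseux_diff[OF N] init_coeff_puiseux[OF N])
  have sd: "subdegree (r - s) = subdegree (s - r)"
    by (metis minus_diff_eq subdegree_uminus)
  consider "r = s" | "fps_nth (s - r) (subdegree (s - r)) > 0" | "fps_nth (s - r) (subdegree (s - r)) < 0"
    using nth_subdegree_nonzero[of "s - r"] by (metis eq_iff_diff_eq_0 linorder_neqE_linordered_idom)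
  then show ?thesis
  proof cases
    case 1
    then show ?thesis by (simp add: l)
  next
    case 2
    then have "less_R (puiseux N r) (puiseux N s)" unfolding l .
    then show ?thesis using eventually_less_roots[OF assms 2] by (auto elim: eventually_mono)
  next
    case 3
    then have "\<not> less_R (puiseux N r) (puiseux N s)" unfolding l by simp
    moreover have "fps_nth (r - s) (subdegree (r - s)) > 0" using 3 unfolding sd by simp
    from eventually_less_roots[OF assms(2,1) this]
    have "\<forall>\<^sub>F t in at_right 0. eval_fps s t < eval_fps r t" .
    ultimately show ?thesis by (auto elim: eventually_mono)
  qed
qed

end

section \<open>Morse functions and persistence of critical points\<close>

text \<open>Unlike \<open>bidisc_bounded X Y\<close>, this is preserved by \<open>fps_deriv\<close>.\<close>

definition strip :: "real \<Rightarrow> real \<Rightarrow> real fps fps \<Rightarrow> bool" where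
  "strip X Y F \<longleftrightarrow> Y > 0 \<and> (\<forall>Y'. 0 < Y' \<and> Y' < Y \<longrightarrow> bidisc_bounded X Y' F)"

lemma bidisc_bounded_imp_strip:
  assumes "bidisc_bounded X Y F"
  shows "strip X Y F"
proof -
  have "X > 0" "Y > 0" using assms by (auto simp: bidisc_bounded_def)
  then show ?thesis using bidisc_bounded_mono[OF assms, of X] by (simp add: strip_def)
qed

lemma strip_deriv: "strip X Y F \<Longrightarrow> strip X Y (fps_deriv F)"
  unfolding strip_def
proof (elim conjE, intro conjI allI impI)
  fix Y' assume *: "\<forall>Y'. 0 < Y' \<and> Y' < Y \<longrightarrow> bidisc_bounded X Y' F" "0 < Y' \<and> Y' < Y"
  then have "bidisc_bounded X ((Y' + Y) / 2) F" by simp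
  then show "bidisc_bounded X Y' (fps_deriv F)" by (rule bidisc_bounded_deriv) (use * in auto)
qed

lemma stripE:
  assumes "strip X Y F" "\<bar>y\<bar> < Y"
  obtains Y' where "bidisc_bounded X Y' F" "\<bar>y\<bar> < Y'"
proof -
  have "bidisc_bounded X ((\<bar>y\<bar> + Y) / 2) F" using assms by (auto simp: strip_def)
  then show thesis by (rule that) (use assms in simp)
qed

lemma strip_has_derivative:
  assumes "strip X Y F" "\<bar>x\<bar> < X" "\<bar>y\<bar> < Y"
  shows "((\<lambda>y. ev F x y) has_real_derivative ev (fps_deriv F) x y) (at y within A)"
proof -
  obtain Y' where "bidisc_bounded X Y' F" "\<bar>y\<bar> < Y'" using assms(1,3) by (rule stripE)
  then show ?thesis using assms(2) by (intro ev_has_derivative) auto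
qed

lemma strip_eval2:
  assumes "strip X Y F" "\<bar>x\<bar> < X" "\<bar>y\<bar> < Y"
  shows "eval2 F x y = ev F x y"
proof -
  obtain Y' where "bidisc_bounded X Y' F" "\<bar>y\<bar> < Y'" using assms(1,3) by (rule stripE)
  then show ?thesis using assms(2) by (intro eval2_eq_ev) auto
qed

lemma strip_continuous:
  assumes "strip X Y F" "S \<subseteq> {-X<..<X} \<times> {-Y<..<Y}"
  shows "continuous_on S (\<lambda>(x, y). ev F x y)"
proof (rule continuous_at_imp_continuous_on, rule ballI)
  fix p assume "p \<in> S"
  then obtain x y where p: "p = (x, y)" "\<bar>x\<bar> < X" "\<bar>y\<bar> < Y" using assms(2) by (cases p) (auto simp: abs_less_iff)
  obtain Y' where Y': "bidisc_bounded X Y' F" "\<bar>y\<bar> < Y'" using assms(1) p(3) by (rule stripE)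
  have "open (ball (0::real) X \<times> ball (0::real) Y')" by (intro open_Times) auto
  moreover have "p \<in> ball 0 X \<times> ball 0 Y'" using p Y' by simp
  ultimately show "isCont (\<lambda>(x, y). ev F x y) p"
    using ev_continuous[OF Y'(1)] by (simp only: continuous_on_eq_continuous_at)
qed

lemma at_Icc_not_bot: "a < b \<Longrightarrow> c \<in> {a..b} \<Longrightarrow> at c within {a..b} \<noteq> (bot :: real filter)"
  by (simp add: trivial_limit_within)

lemma derivative_within_unique:
  assumes "a < b" "c \<in> {a..b}" "(\<phi> has_real_derivative p) (at c within {a..b})" "(\<phi> has_real_derivative q) (at c within {a..b})"
  shows "p = q"
  using has_field_derivative_unique[OF assms(3,4)] at_Icc_not_bot[OF assms(1,2)] by simp

locale strip_interval =
  fixes X Y a b :: real and F :: "real fps fps"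
  assumes strip: "strip X Y F" and ab: "a < b" "-Y < a" "b < Y"
begin

lemma in_strip: "y \<in> {a..b} \<Longrightarrow> \<bar>y\<bar> < Y" using ab by auto

lemma eval2_has_derivative:
  assumes "strip X Y H" "\<bar>x\<bar> < X" "y \<in> {a..b}"
  shows "(eval2 H x has_real_derivative eval2 (fps_deriv H) x y) (at y within {a..b})"
proof -
  have "((\<lambda>y. ev H x y) has_real_derivative eval2 (fps_deriv H) x y) (at y within {a..b})"
    using strip_has_derivative[OF assms(1,2) in_strip[OF assms(3)]] strip_eval2[OF strip_deriv[OF assms(1)] assms(2) in_strip[OF assms(3)]]
    by simp
  then show ?thesis
    by (rule has_field_derivative_transform_within[OF _ zero_less_one assms(3)])
       (use strip_eval2[OF assms(1,2)] in_strip in simp)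
qed

lemma crit_points_eq:
  assumes "\<bar>x\<bar> < X"
  shows "crit_points a b (eval2 F x) = {c \<in> {a..b}. ev (fps_deriv F) x c = 0}"
proof -
  have "(eval2 F x has_real_derivative 0) (at c within {a..b}) \<longleftrightarrow> ev (fps_deriv F) x c = 0" if "c \<in> {a..b}" for c
  proof -
    have e: "eval2 (fps_deriv F) x c = ev (fps_deriv F) x c"
      by (rule strip_eval2[OF strip_deriv[OF strip] assms in_strip[OF that]])
    have d: "(eval2 F x has_real_derivative ev (fps_deriv F) x c) (at c within {a..b})"
      using eval2_has_derivative[OF strip assms that] unfolding e .
    show ?thesis using d derivative_within_unique[OF ab(1) that _ d] by metis
  qed
  then show ?thesis by (auto simp: crit_points_def)
qed

text \<open>The sequence \<open>D\<close> in \<open>morse_on\<close> is determined by its first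
  member, since derivatives within an interval of positive length are unique; so \<open>D 2\<close>
  is the second y-derivative of the series.\<close>

lemma morse_on_iff:
  assumes x: "\<bar>x\<bar> < X"
  defines "C \<equiv> {c \<in> {a..b}. ev (fps_deriv F) x c = 0}"
  shows "morse_on a b (eval2 F x) \<longleftrightarrow>
    (\<forall>c\<in>C. ev (fps_deriv (fps_deriv F)) x c \<noteq> 0) \<and> C \<subseteq> {a<..<b} \<and> inj_on (ev F x) C"
proof -
  have inj: "inj_on (eval2 F x) C \<longleftrightarrow> inj_on (ev F x) C"
    by (rule inj_on_cong) (use strip_eval2[OF strip x] in_strip in \<open>auto simp: C_def\<close>)
  have cr: "crit_points a b (eval2 F x) = C" unfolding C_def by (rule crit_points_eq[OF x])
  have e: "eval2 H x c = ev H x c" if "strip X Y H" "c \<in> C" for H c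
    using strip_eval2[OF that(1) x] that(2) in_strip by (simp add: C_def)
  have s: "strip X Y ((fps_deriv ^^ n) F)" for n by (induction n) (simp_all add: strip strip_deriv)
  have e2: "eval2 (fps_deriv (fps_deriv F)) x c = ev (fps_deriv (fps_deriv F)) x c" if "c \<in> C" for c
    using e[OF s[of 2] that] by (simp add: eval_nat_numeral)
  show ?thesis
  proof
    assume m: "morse_on a b (eval2 F x)"
    then obtain D where D: "D 0 = eval2 F x" "\<And>n y. y \<in> {a..b} \<Longrightarrow> (D n has_real_derivative D (Suc n) y) (at y within {a..b})"
      "\<And>c. c \<in> C \<Longrightarrow> D 2 c \<noteq> 0"
      unfolding morse_on_def cr by blast
    have D1: "D 1 y = eval2 (fps_deriv F) x y" if y: "y \<in> {a..b}" for y
      using D(2)[OF y, of 0] eval2_has_derivative[OF strip x y] derivative_within_unique[OF ab(1) y] by (simp add: D(1))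
    have "ev (fps_deriv (fps_deriv F)) x c \<noteq> 0" if c: "c \<in> C" for c
    proof -
      have c': "c \<in> {a..b}" using c by (simp add: C_def)
      have "(eval2 (fps_deriv F) x has_real_derivative D 2 c) (at c within {a..b})"
      proof (rule has_field_derivative_transform_within[OF _ zero_less_one c'])
        show "(D 1 has_real_derivative D 2 c) (at c within {a..b})" using D(2)[OF c', of 1] by (simp add: numeral_2_eq_2)
      qed (use D1 in simp)
      from derivative_within_unique[OF ab(1) c' this eval2_has_derivative[OF strip_deriv[OF strip] x c']]
      show ?thesis using D(3)[OF c] e2[OF c] by simp
    qed
    then show "(\<forall>c\<in>C. ev (fps_deriv (fps_deriv F)) x c \<noteq> 0) \<and> C \<subseteq> {a<..<b} \<and> inj_on (ev F x) C"
      using m by (simp add: morse_on_def cr inj)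
  next
    assume *: "(\<forall>c\<in>C. ev (fps_deriv (fps_deriv F)) x c \<noteq> 0) \<and> C \<subseteq> {a<..<b} \<and> inj_on (ev F x) C"
    show "morse_on a b (eval2 F x)"
      unfolding morse_on_def cr inj
    proof (intro conjI exI[of _ "\<lambda>n. eval2 ((fps_deriv ^^ n) F) x"] allI ballI)
      fix n y assume "y \<in> {a..b}"
      from eval2_has_derivative[OF s x this, of n]
      show "(eval2 ((fps_deriv ^^ n) F) x has_real_derivative eval2 ((fps_deriv ^^ Suc n) F) x y) (at y within {a..b})" by simp
    next
      fix c assume "c \<in> C"
      with * e2 show "eval2 ((fps_deriv ^^ 2) F) x c \<noteq> 0" by (simp add: eval_nat_numeral)
    qed (use * in auto)
  qed
qed

end

section \<open>Persistence of critical points\<close>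

lemma uniformly_close:
  fixes G :: "real \<Rightarrow> real \<Rightarrow> real"
  assumes "continuous_on (S \<times> K) (\<lambda>(x, y). G x y)" "compact K" "x0 \<in> S" "e > 0"
  shows "\<forall>\<^sub>F x in at x0 within S. \<forall>y\<in>K. \<bar>G x y - G x0 y\<bar> < e"
proof -
  obtain X0 where X0: "x0 \<in> X0" "open X0" "\<forall>x\<in>X0 \<inter> S. \<forall>y\<in>K. dist (G x y) (G x0 y) \<le> e / 2"
    using continuous_on_prod_compactE[OF assms(1-3), of "e / 2"] assms(4) by auto
  have "\<bar>G x y - G x0 y\<bar> < e" if "x \<in> X0" "x \<in> S" "y \<in> K" for x y
  proof -
    have "dist (G x y) (G x0 y) \<le> e / 2" using X0(3) that by blast
    then show ?thesis using assms(4) by (simp add: dist_real_def)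
  qed
  then show ?thesis unfolding eventually_at_topological using X0 by blast
qed

lemma section_continuous:
  fixes G :: "real \<Rightarrow> real \<Rightarrow> real"
  assumes "continuous_on (S \<times> K) (\<lambda>(x, y). G x y)" "x \<in> S"
  shows "continuous_on K (G x)"
  by (rule continuous_on_compose2[OF assms(1), of K "\<lambda>y. (x, y)", simplified])
     (use assms(2) in \<open>auto intro!: continuous_intros\<close>)

lemma eventually_nonzero_on_compact:
  fixes G :: "real \<Rightarrow> real \<Rightarrow> real"
  assumes cont: "continuous_on (S \<times> K) (\<lambda>(x, y). G x y)" and K: "compact K" and x0: "x0 \<in> S"
    and nz: "\<And>y. y \<in> K \<Longrightarrow> G x0 y \<noteq> 0"
  shows "\<forall>\<^sub>F x in at x0 within S. \<forall>y\<in>K. G x y \<noteq> 0"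
proof (cases "K = {}")
  case False
  have "continuous_on K (\<lambda>y. \<bar>G x0 y\<bar>)" by (intro continuous_on_rabs section_continuous[OF cont x0])
  from continuous_attains_inf[OF K False this]
  obtain y0 where y0: "y0 \<in> K" "\<forall>y\<in>K. \<bar>G x0 y0\<bar> \<le> \<bar>G x0 y\<bar>" by auto
  have "\<forall>\<^sub>F x in at x0 within S. \<forall>y\<in>K. \<bar>G x y - G x0 y\<bar> < \<bar>G x0 y0\<bar>"
    using nz[OF y0(1)] by (intro uniformly_close[OF cont K x0]) simp
  then show ?thesis by (rule eventually_mono) (use y0 in fastforce)
qed simp

text \<open>In the application \<phi>, g and h are F_x and its first two y-derivatives, and the last
  three conditions are those of a Morse function at every parameter in \<open>S\<close>.\<close>

locale critical_family =
  fixes S :: "real set" and a b :: real and \<phi> g h :: "real \<Rightarrow> real \<Rightarrow> real"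
  assumes continuous: "continuous_on (S \<times> {a..b}) (\<lambda>(x, y). \<phi> x y)" "continuous_on (S \<times> {a..b}) (\<lambda>(x, y). g x y)"
      "continuous_on (S \<times> {a..b}) (\<lambda>(x, y). h x y)"
    and deriv: "\<And>x y. x \<in> S \<Longrightarrow> y \<in> {a..b} \<Longrightarrow> (g x has_real_derivative h x y) (at y within {a..b})"
    and nondegenerate: "\<And>x c. x \<in> S \<Longrightarrow> c \<in> {a..b} \<Longrightarrow> g x c = 0 \<Longrightarrow> h x c \<noteq> 0"
    and interior: "\<And>x c. x \<in> S \<Longrightarrow> c \<in> {a..b} \<Longrightarrow> g x c = 0 \<Longrightarrow> c \<in> {a<..<b}"
    and distinct: "\<And>x. x \<in> S \<Longrightarrow> inj_on (\<phi> x) {c \<in> {a..b}. g x c = 0}"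
begin

definition "zeros x = {c \<in> {a..b}. g x c = 0}"

text \<open>An accumulation point of zeros would be a zero with nonzero derivative, but such a zero
  is isolated.\<close>

lemma finite_zeros:
  assumes x: "x \<in> S"
  shows "finite (zeros x)"
proof (rule ccontr)
  assume "infinite (zeros x)"
  moreover have "zeros x \<subseteq> {a..b}" by (auto simp: zeros_def)
  ultimately obtain l where l: "l \<in> {a..b}" "l islimpt zeros x"
    using compact_Icc[of a b] unfolding compact_eq_Bolzano_Weierstrass by blast
  have "closed {y \<in> {a..b}. g x y = 0}"
    by (intro continuous_closed_preimage_constant section_continuous[OF continuous(2) x]) simp
  then have "l \<in> zeros x" using l(2) unfolding closed_limpt zeros_def by blast
  then have gl: "g x l = 0" and hl: "h x l \<noteq> 0" using nondegenerate[OF x l(1)] by (auto simp: zeros_def)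
  have "((\<lambda>y. (g x y - g x l) / (y - l)) \<longlongrightarrow> h x l) (at l within {a..b})"
    using deriv[OF x l(1)] by (simp add: has_field_derivative_iff)
  from tendsto_imp_eventually_ne[OF this hl]
  have "\<forall>\<^sub>F y in at l within {a..b}. y \<notin> zeros x" by (rule eventually_mono) (auto simp: zeros_def gl)
  then obtain T where "open T" "l \<in> T" "\<And>y. y \<in> T \<Longrightarrow> y \<noteq> l \<Longrightarrow> y \<in> {a..b} \<Longrightarrow> y \<notin> zeros x"
    by (auto simp: eventually_at_topological)
  then show False using l(2) unfolding islimpt_def zeros_def by blast
qed

text \<open>An isomorphism of the bi-ordered sets of critical points, written on the first
  coordinates alone.\<close>

definition similar :: "real \<Rightarrow> real \<Rightarrow> bool" where
  "similar x x' \<longleftrightarrow> (\<exists>H. bij_betw H (zeros x) (zeros x') \<and>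
     (\<forall>c\<in>zeros x. \<forall>d\<in>zeros x. (c < d \<longleftrightarrow> H c < H d) \<and> (\<phi> x c < \<phi> x d \<longleftrightarrow> \<phi> x' (H c) < \<phi> x' (H d))))"

lemma similar_sym: "similar x x' \<Longrightarrow> similar x' x"
  unfolding similar_def
proof (elim exE conjE)
  fix H assume H: "bij_betw H (zeros x) (zeros x')" and o: "\<forall>c\<in>zeros x. \<forall>d\<in>zeros x. (c < d \<longleftrightarrow> H c < H d) \<and> (\<phi> x c < \<phi> x d \<longleftrightarrow> \<phi> x' (H c) < \<phi> x' (H d))"
  let ?I = "inv_into (zeros x) H"
  have "?I c \<in> zeros x" "H (?I c) = c" if "c \<in> zeros x'" for c
    using that H by (auto simp: bij_betw_def inv_into_into f_inv_into_f)
  then show "\<exists>H. bij_betw H (zeros x') (zeros x) \<and> (\<forall>c\<in>zeros x'. \<forall>d\<in>zeros x'. (c < d \<longleftrightarrow> H c < H d) \<and> (\<phi> x' c < \<phi> x' d \<longleftrightarrow> \<phi> x (H c) < \<phi> x (H d)))"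
    using bij_betw_inv_into[OF H] o by (intro exI[of _ ?I]) simp
qed

lemma similar_trans: "similar x x' \<Longrightarrow> similar x' x'' \<Longrightarrow> similar x x''"
  unfolding similar_def
proof (elim exE conjE)
  fix H H' assume *: "bij_betw H (zeros x) (zeros x')" "\<forall>c\<in>zeros x. \<forall>d\<in>zeros x. (c < d \<longleftrightarrow> H c < H d) \<and> (\<phi> x c < \<phi> x d \<longleftrightarrow> \<phi> x' (H c) < \<phi> x' (H d))"
    "bij_betw H' (zeros x') (zeros x'')" "\<forall>c\<in>zeros x'. \<forall>d\<in>zeros x'. (c < d \<longleftrightarrow> H' c < H' d) \<and> (\<phi> x' c < \<phi> x' d \<longleftrightarrow> \<phi> x'' (H' c) < \<phi> x'' (H' d))"
  have "H c \<in> zeros x'" if "c \<in> zeros x" for c using that *(1) by (auto simp: bij_betw_def)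
  then show "\<exists>H. bij_betw H (zeros x) (zeros x'') \<and> (\<forall>c\<in>zeros x. \<forall>d\<in>zeros x. (c < d \<longleftrightarrow> H c < H d) \<and> (\<phi> x c < \<phi> x d \<longleftrightarrow> \<phi> x'' (H c) < \<phi> x'' (H d)))"
    using bij_betw_trans[OF *(1,3)] *(2,4) by (intro exI[of _ "H' \<circ> H"]) simp
qed

lemma MVT_section:
  assumes x: "x \<in> S" and cd: "a \<le> c" "c < d" "d \<le> b"
  obtains z where "c < z" "z < d" "g x d - g x c = (d - c) * h x z"
proof -
  have cont: "continuous_on {c..d} (g x)"
    by (rule continuous_on_subset[OF section_continuous[OF continuous(2) x]]) (use cd in auto)
  have D: "(g x has_derivative (*) (h x z)) (at z)" if z: "c < z" "z < d" for z
  proof -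
    have "at z within {a..b} = at z" by (rule at_within_Icc_at) (use z cd in auto)
    then show ?thesis using deriv[OF x, of z] z cd by (simp add: has_field_derivative_def)
  qed
  obtain z where "c < z" "z < d" "g x d - g x c = h x z * (d - c)" by (rule mvt[OF cd(2) cont D])
  then show thesis using that by (simp add: mult.commute)
qed

text \<open>Around each critical point c for x0 there is an interval on which h keeps the sign of
  h(x0, c). For x near x0 the intermediate value theorem gives a zero of g(x, .) in it, the mean
  value theorem shows that it is the only one, and outside these intervals g stays nonzero by
  compactness.\<close>

lemma eventually_similar:
  assumes x0: "x0 \<in> S"
  shows "\<forall>\<^sub>F x in at x0 within S. similar x0 x"
proof -
  define C where "C = zeros x0"
  have C_fin: "finite C" unfolding C_def by (rule finite_zeros[OF x0])
  have C: "c \<in> {a<..<b}" "c \<in> {a..b}" "g x0 c = 0" "h x0 c \<noteq> 0" if "c \<in> C" for c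
    using that interior[OF x0] nondegenerate[OF x0] by (auto simp: C_def zeros_def)
  \<comment> \<open>Each critical value will move by less than 2 \<eta>, so gaps above 4 \<eta>
    preserve the order of the values.\<close>
  obtain \<eta> where \<eta>: "\<eta> > 0" "\<And>c d. c \<in> C \<Longrightarrow> d \<in> C \<Longrightarrow> \<phi> x0 c < \<phi> x0 d \<Longrightarrow> 4 * \<eta> < \<phi> x0 d - \<phi> x0 c"
  proof -
    have "\<forall>\<^sub>F \<eta> in at_right 0. \<forall>c\<in>C. \<forall>d\<in>C. \<phi> x0 c < \<phi> x0 d \<longrightarrow> 4 * \<eta> < \<phi> x0 d - \<phi> x0 c"
    proof (intro eventually_ball_finite C_fin ballI)
      fix c d :: real
      show "\<forall>\<^sub>F \<eta> in at_right 0. \<phi> x0 c < \<phi> x0 d \<longrightarrow> 4 * \<eta> < \<phi> x0 d - \<phi> x0 c"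
      proof (cases "\<phi> x0 c < \<phi> x0 d")
        case True
        then have "\<forall>\<^sub>F \<eta> in at_right 0. \<eta> \<in> {0<..<(\<phi> x0 d - \<phi> x0 c) / 4}" by (intro eventually_at_right_real) simp
        then show ?thesis by (rule eventually_mono) auto
      qed simp
    qed
    with eventually_at_right_less[of "0::real"]
    have "\<forall>\<^sub>F \<eta> in at_right 0. 0 < \<eta> \<and> (\<forall>c\<in>C. \<forall>d\<in>C. \<phi> x0 c < \<phi> x0 d \<longrightarrow> 4 * \<eta> < \<phi> x0 d - \<phi> x0 c)"
      by (rule eventually_conj)
    from eventually_happens[OF this] show thesis using that by auto
  qed
  have near: "\<forall>\<^sub>F r in at_right 0. \<forall>y\<in>{a..b}. \<bar>y - c\<bar> \<le> r \<longrightarrow> \<bar>G x0 y - G x0 c\<bar> < e"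
    if G: "continuous_on (S \<times> {a..b}) (\<lambda>(x, y). G x y)" and c: "c \<in> C" and e: "e > 0" for G :: "real \<Rightarrow> real \<Rightarrow> real" and c e
  proof -
    obtain d where d: "d > 0" "\<And>y. y \<in> {a..b} \<Longrightarrow> dist y c < d \<Longrightarrow> dist (G x0 y) (G x0 c) < e"
      using section_continuous[OF G x0] C(2)[OF c] e unfolding continuous_on_iff by blast
    have "\<forall>\<^sub>F r in at_right 0. r \<in> {0<..<d}" using d(1) by (rule eventually_at_right_real)
    then show ?thesis by (rule eventually_mono) (use d(2) in \<open>auto simp: dist_real_def\<close>)
  qed
  \<comment> \<open>One radius for all critical points: the intervals stay inside [a, b], are
    disjoint, and neither h nor \<phi> varies much on them.\<close>
  obtain r where r: "r > 0"
    and r_in: "\<And>c. c \<in> C \<Longrightarrow> a \<le> c - r \<and> c + r \<le> b"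
    and r_sep: "\<And>c d. c \<in> C \<Longrightarrow> d \<in> C \<Longrightarrow> c < d \<Longrightarrow> c + r < d - r"
    and r_h: "\<And>c y. c \<in> C \<Longrightarrow> y \<in> {a..b} \<Longrightarrow> \<bar>y - c\<bar> \<le> r \<Longrightarrow> \<bar>h x0 y - h x0 c\<bar> < \<bar>h x0 c\<bar> / 2"
    and r_\<phi>: "\<And>c y. c \<in> C \<Longrightarrow> y \<in> {a..b} \<Longrightarrow> \<bar>y - c\<bar> \<le> r \<Longrightarrow> \<bar>\<phi> x0 y - \<phi> x0 c\<bar> < \<eta>"
  proof -
    have 1: "\<forall>\<^sub>F r in at_right 0. \<forall>c\<in>C. a \<le> c - r \<and> c + r \<le> b"
    proof (intro eventually_ball_finite C_fin ballI)
      fix c assume "c \<in> C"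
      then have "\<forall>\<^sub>F r in at_right 0. r \<in> {0<..<min (c - a) (b - c)}" using C(1) by (intro eventually_at_right_real) auto
      then show "\<forall>\<^sub>F r in at_right 0. a \<le> c - r \<and> c + r \<le> b" by (rule eventually_mono) auto
    qed
    have 2: "\<forall>\<^sub>F r in at_right 0. \<forall>c\<in>C. \<forall>d\<in>C. c < d \<longrightarrow> c + r < d - r"
    proof (intro eventually_ball_finite C_fin ballI)
      fix c d :: real
      show "\<forall>\<^sub>F r in at_right 0. c < d \<longrightarrow> c + r < d - r"
      proof (cases "c < d")
        case True
        then have "\<forall>\<^sub>F r in at_right 0. r \<in> {0<..<(d - c) / 2}" by (intro eventually_at_right_real) simp
        then show ?thesis by (rule eventually_mono) auto
      qed simp
    qed
    have 3: "\<forall>\<^sub>F r in at_right 0. \<forall>c\<in>C. \<forall>y\<in>{a..b}. \<bar>y - c\<bar> \<le> r \<longrightarrow> \<bar>h x0 y - h x0 c\<bar> < \<bar>h x0 c\<bar> / 2"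
      using C(4) by (intro eventually_ball_finite C_fin ballI near continuous) auto
    have 4: "\<forall>\<^sub>F r in at_right 0. \<forall>c\<in>C. \<forall>y\<in>{a..b}. \<bar>y - c\<bar> \<le> r \<longrightarrow> \<bar>\<phi> x0 y - \<phi> x0 c\<bar> < \<eta>"
      using \<eta>(1) by (intro eventually_ball_finite C_fin ballI near continuous) auto
    from eventually_happens[OF eventually_conj[OF eventually_at_right_less[of "0::real"] eventually_conj[OF eventually_conj[OF 1 2] eventually_conj[OF 3 4]]]]
    show thesis using that by auto
  qed
  define K where "K = {a..b} - (\<Union>c\<in>C. {c - r<..<c + r})"
  have K: "compact K" unfolding K_def by (intro compact_diff compact_Icc open_UN ballI) auto
  have K_nz: "g x0 y \<noteq> 0" if "y \<in> K" for y
  proof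
    assume "g x0 y = 0"
    then have "y \<in> C" using that by (auto simp: C_def zeros_def K_def)
    then show False using that r by (auto simp: K_def)
  qed
  have ends: "g x0 (c + r) * h x0 c > 0" "g x0 (c - r) * h x0 c < 0" if c: "c \<in> C" for c
  proof -
    have hh: "h x0 z * h x0 c > 0" if "z \<in> {a..b}" "\<bar>z - c\<bar> \<le> r" for z
      using r_h[OF c that] C(4)[OF c] by (auto simp: abs_if zero_less_mult_iff split: if_splits)
    obtain z where z: "c < z" "z < c + r" "g x0 (c + r) - g x0 c = (c + r - c) * h x0 z"
      by (rule MVT_section[OF x0, of c "c + r"]) (use r r_in[OF c] in auto)
    have "h x0 z * h x0 c > 0" using hh[of z] z r_in[OF c] r by auto
    then show "g x0 (c + r) * h x0 c > 0" using z r C(3)[OF c] by (simp add: mult.assoc)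
    obtain z where z: "c - r < z" "z < c" "g x0 c - g x0 (c - r) = (c - (c - r)) * h x0 z"
      by (rule MVT_section[OF x0, of "c - r" c]) (use r r_in[OF c] in auto)
    have "r * (h x0 z * h x0 c) > 0" using hh[of z] z r_in[OF c] r by auto
    moreover have "g x0 (c - r) = - (r * h x0 z)" using z(3) C(3)[OF c] by simp
    then have "g x0 (c - r) * h x0 c = - (r * (h x0 z * h x0 c))" by (simp add: mult.assoc)
    ultimately show "g x0 (c - r) * h x0 c < 0" by simp
  qed
  have "\<forall>\<^sub>F x in at x0 within S. \<forall>c\<in>C. \<forall>y\<in>{a..b}. \<bar>h x y - h x0 y\<bar> < \<bar>h x0 c\<bar> / 2"
    using C(4) by (intro eventually_ball_finite C_fin ballI uniformly_close continuous compact_Icc x0) auto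
  moreover have "\<forall>\<^sub>F x in at x0 within S. \<forall>y\<in>{a..b}. \<bar>\<phi> x y - \<phi> x0 y\<bar> < \<eta>"
    by (intro uniformly_close continuous compact_Icc x0 \<eta>(1))
  moreover have "\<forall>\<^sub>F x in at x0 within S. \<forall>y\<in>K. g x y \<noteq> 0"
    by (rule eventually_nonzero_on_compact[OF continuous_on_subset[OF continuous(2)] K x0 K_nz]) (auto simp: K_def)
  moreover have "\<forall>\<^sub>F x in at x0 within S. \<forall>c\<in>C. \<forall>y\<in>{a..b}. \<bar>g x y - g x0 y\<bar> < \<bar>g x0 (c + r)\<bar>"
    using ends by (intro eventually_ball_finite C_fin ballI uniformly_close continuous compact_Icc x0) fastforce
  moreover have "\<forall>\<^sub>F x in at x0 within S. \<forall>c\<in>C. \<forall>y\<in>{a..b}. \<bar>g x y - g x0 y\<bar> < \<bar>g x0 (c - r)\<bar>"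
    using ends by (intro eventually_ball_finite C_fin ballI uniformly_close continuous compact_Icc x0) fastforce
  moreover have "\<forall>\<^sub>F x in at x0 within S. x \<in> S" by (simp add: eventually_at_filter)
  ultimately show ?thesis
  proof eventually_elim
    case (elim x)
    have x: "x \<in> S" by fact
    \<comment> \<open>Two errors, each less than half of |h(x0, c)|, cannot change the sign.\<close>
    have hx: "h x y * h x0 c > 0" if c: "c \<in> C" and y: "c - r \<le> y" "y \<le> c + r" for c y
    proof -
      have yab: "y \<in> {a..b}" using r_in[OF c] y by auto
      have "\<bar>h x0 y - h x0 c\<bar> < \<bar>h x0 c\<bar> / 2" by (rule r_h[OF c yab]) (use y in auto)
      moreover have "\<bar>h x y - h x0 y\<bar> < \<bar>h x0 c\<bar> / 2" using elim(1) c yab by blast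
      ultimately show ?thesis by (auto simp: abs_if zero_less_mult_iff split: if_splits)
    qed
    have "\<exists>z. c - r < z \<and> z < c + r \<and> g x z = 0" if c: "c \<in> C" for c
    proof -
      have m1: "c + r \<in> {a..b}" "c - r \<in> {a..b}" using r_in[OF c] r by auto
      have "\<bar>g x (c + r) - g x0 (c + r)\<bar> < \<bar>g x0 (c + r)\<bar>" "\<bar>g x (c - r) - g x0 (c - r)\<bar> < \<bar>g x0 (c - r)\<bar>"
        using elim(4,5) c m1 by blast+
      then have s: "g x (c + r) * h x0 c > 0" "g x (c - r) * h x0 c < 0"
        using ends[OF c] by (auto simp: abs_if zero_less_mult_iff mult_less_0_iff split: if_splits)
      have cont: "continuous_on {c - r..c + r} (\<lambda>y. g x y * h x0 c)"
        by (intro continuous_intros continuous_on_subset[OF section_continuous[OF continuous(2) x]]) (use m1 in auto)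
      obtain z where z: "c - r \<le> z" "z \<le> c + r" "g x z * h x0 c = 0"
        using IVT'[of "\<lambda>y. g x y * h x0 c" "c - r" 0 "c + r", OF _ _ _ cont] s r by auto
      then have "g x z = 0" using C(4)[OF c] by simp
      moreover have "z \<noteq> c - r" "z \<noteq> c + r" using s z by auto
      ultimately show ?thesis using z by (intro exI[of _ z]) auto
    qed
    then obtain H where H: "\<And>c. c \<in> C \<Longrightarrow> c - r < H c \<and> H c < c + r \<and> g x (H c) = 0" by metis
    have H_in: "H c \<in> {a..b}" if "c \<in> C" for c using H[OF that] r_in[OF that] by auto
    have uniq: "z = H c" if c: "c \<in> C" and z: "c - r < z" "z < c + r" "g x z = 0" for c z
    proof (rule ccontr)
      assume "z \<noteq> H c"
      have no: False if pq: "p < q" "c - r < p" "q < c + r" "g x p = 0" "g x q = 0" for p q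
      proof -
        obtain w where w: "p < w" "w < q" "g x q - g x p = (q - p) * h x w"
          by (rule MVT_section[OF x, of p q]) (use pq r_in[OF c] in auto)
        then have "h x w = 0" using pq by simp
        then show False using hx[OF c, of w] w pq by simp
      qed
      show False using no[of z "H c"] no[of "H c" z] H[OF c] z \<open>z \<noteq> H c\<close> by linarith
    qed
    have less: "H c < H d" if "c \<in> C" "d \<in> C" "c < d" for c d
      using H[OF that(1)] H[OF that(2)] r_sep[OF that] by linarith
    have less_iff: "c < d \<longleftrightarrow> H c < H d" if "c \<in> C" "d \<in> C" for c d
      using less[OF that] less[OF that(2,1)] by (metis less_asym less_irrefl linorder_less_linear)
    have \<phi>_close: "\<bar>\<phi> x (H c) - \<phi> x0 c\<bar> < 2 * \<eta>" if c: "c \<in> C" for c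
    proof -
      have "\<bar>\<phi> x0 (H c) - \<phi> x0 c\<bar> < \<eta>" by (rule r_\<phi>[OF c H_in[OF c]]) (use H[OF c] in auto)
      moreover have "\<bar>\<phi> x (H c) - \<phi> x0 (H c)\<bar> < \<eta>" using elim(2) H_in[OF c] by blast
      ultimately show ?thesis by linarith
    qed
    have \<phi>_less: "\<phi> x (H c) < \<phi> x (H d)" if "c \<in> C" "d \<in> C" "\<phi> x0 c < \<phi> x0 d" for c d
      using \<phi>_close[OF that(1)] \<phi>_close[OF that(2)] \<eta>(2)[OF that] by linarith
    have \<phi>_iff: "\<phi> x0 c < \<phi> x0 d \<longleftrightarrow> \<phi> x (H c) < \<phi> x (H d)" if cd: "c \<in> C" "d \<in> C" for c d
    proof -
      have "\<phi> x0 c = \<phi> x0 d \<Longrightarrow> c = d" using distinct[OF x0] cd by (auto simp: C_def zeros_def inj_on_def)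
      then show ?thesis using \<phi>_less[OF cd] \<phi>_less[OF cd(2,1)] by (metis less_asym less_irrefl linorder_less_linear)
    qed
    have "bij_betw H C (zeros x)"
      unfolding bij_betw_def
    proof
      show "inj_on H C" using less by (metis inj_onI less_irrefl linorder_less_linear)
      show "H ` C = zeros x"
      proof
        show "H ` C \<subseteq> zeros x" using H H_in by (auto simp: zeros_def)
        show "zeros x \<subseteq> H ` C"
        proof
          fix z assume z: "z \<in> zeros x"
          then have "z \<notin> K" using elim(3) by (auto simp: zeros_def)
          then obtain c where "c \<in> C" "c - r < z" "z < c + r" using z by (auto simp: K_def zeros_def)
          then show "z \<in> H ` C" using uniq z by (auto simp: zeros_def)
        qed
      qed
    qed
    then show "similar x0 x" unfolding similar_def C_def[symmetric] using less_iff \<phi>_iff by blast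
  qed
qed

text \<open>The classes of \<open>similar\<close> are open in \<open>S\<close>, so a connected
  \<open>S\<close> lies in one class.\<close>

lemma similar_if_connected:
  assumes "connected S" "x \<in> S" "x' \<in> S"
  shows "similar x x'"
proof (rule connected_equivalence_relation[OF assms])
  fix x assume x: "x \<in> S"
  obtain T where T: "open T" "x \<in> T" "\<And>y. y \<in> T \<Longrightarrow> y \<noteq> x \<Longrightarrow> y \<in> S \<Longrightarrow> similar x y"
    using eventually_similar[OF x] by (auto simp: eventually_at_topological)
  have "similar x x" unfolding similar_def by (rule exI[of _ id]) auto
  then show "\<exists>U. openin (top_of_set S) U \<and> x \<in> U \<and> (\<forall>y\<in>U. similar x y)"
    using T x by (intro exI[of _ "S \<inter> T"]) (auto intro: openin_open_Int)
qed (blast intro: similar_sym similar_trans)+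

end

section \<open>Morse rectangles\<close>

lemma strict_linear_order_on_key:
  fixes key :: "'a \<Rightarrow> 'b::linorder"
  assumes "inj_on key A" "\<And>x y. x \<in> A \<Longrightarrow> y \<in> A \<Longrightarrow> P x y \<longleftrightarrow> key x < key y"
  shows "strict_linear_order_on A (Restr {(x, y). P x y} A)"
  unfolding strict_linear_order_on_def
proof (intro conjI)
  show "trans (Restr {(x, y). P x y} A)"
  proof (rule transI)
    fix x y z assume "(x, y) \<in> Restr {(x, y). P x y} A" "(y, z) \<in> Restr {(x, y). P x y} A"
    then show "(x, z) \<in> Restr {(x, y). P x y} A" using assms(2)[of x y] assms(2)[of y z] assms(2)[of x z] by auto
  qed
  show "irrefl (Restr {(x, y). P x y} A)"
    unfolding irrefl_def using assms(2) by auto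
  show "total_on A (Restr {(x, y). P x y} A)"
    unfolding total_on_def
  proof (intro ballI impI)
    fix x y assume *: "x \<in> A" "y \<in> A" "x \<noteq> y"
    then have "key x \<noteq> key y" using assms(1) by (auto simp: inj_on_def)
    then show "(x, y) \<in> Restr {(x, y). P x y} A \<or> (y, x) \<in> Restr {(x, y). P x y} A"
      using * assms(2)[of x y] assms(2)[of y x] by auto
  qed
qed

text \<open>The order axioms hold on both sides because all four relations are comparisons of real
  numbers: coordinates for \<open>Crit\<close>, coordinates of the preimages for \<open>A\<close>.
  In the application this yields that \<open>less_int f\<close> is a strict linear order on the
  roots.\<close>

lemma biordered_isoI:
  fixes \<phi> :: "real \<Rightarrow> real" and a b :: real
  defines "C \<equiv> crit_points a b \<phi>"
  assumes fin: "finite C" and inj: "inj_on \<phi> C" and H: "bij_betw H C A"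
    and iff: "\<And>c d. c \<in> C \<Longrightarrow> d \<in> C \<Longrightarrow> (c < d \<longleftrightarrow> P (H c) (H d)) \<and> (\<phi> c < \<phi> d \<longleftrightarrow> Q (H c) (H d))"
  shows "biordered_iso (Crit a b \<phi>) less_s less_t A P Q"
proof -
  let ?I = "inv_into C H"
  have I: "bij_betw ?I A C" by (rule bij_betw_inv_into[OF H])
  then have IC: "x \<in> A \<Longrightarrow> ?I x \<in> C" for x by (auto simp: bij_betw_def)
  have HI: "H (?I x) = x" if "x \<in> A" for x using that H by (auto simp: bij_betw_def f_inv_into_f)
  have Crit: "Crit a b \<phi> = (\<lambda>c. (c, \<phi> c)) ` C" by (simp add: Crit_def C_def)
  have fst: "bij_betw fst (Crit a b \<phi>) C" unfolding Crit bij_betw_def by (force intro: inj_onI)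
  have snd: "inj_on snd (Crit a b \<phi>)" unfolding Crit using inj by (auto simp: inj_on_def)
  have "biordered_set (Crit a b \<phi>) less_s less_t"
    unfolding biordered_set_def
  proof (intro conjI)
    show "strict_linear_order_on (Crit a b \<phi>) (Restr {(x, y). less_s x y} (Crit a b \<phi>))"
      by (rule strict_linear_order_on_key[OF bij_betw_imp_inj_on[OF fst]]) (rule less_s_def)
    show "strict_linear_order_on (Crit a b \<phi>) (Restr {(x, y). less_t x y} (Crit a b \<phi>))"
      by (rule strict_linear_order_on_key[OF snd]) (rule less_t_def)
  qed (use fin Crit in simp)
  moreover have "biordered_set A P Q"
    unfolding biordered_set_def
  proof (intro conjI)
    show "finite A" using fin H bij_betw_finite by blast
    have injI: "inj_on ?I A" using I by (simp add: bij_betw_def)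
    show "strict_linear_order_on A (Restr {(x, y). P x y} A)"
      by (rule strict_linear_order_on_key[OF injI]) (use iff[OF IC IC] HI in auto)
    have "inj_on (\<phi> \<circ> ?I) A" using injI inj I by (intro comp_inj_on) (simp_all add: bij_betw_def)
    then show "strict_linear_order_on A (Restr {(x, y). Q x y} A)"
      by (rule strict_linear_order_on_key) (use iff[OF IC IC] HI in auto)
  qed
  moreover have "bij_betw (H \<circ> fst) (Crit a b \<phi>) A" by (rule bij_betw_trans[OF fst H])
  moreover have "\<forall>x\<in>Crit a b \<phi>. \<forall>y\<in>Crit a b \<phi>.
    (less_s x y \<longleftrightarrow> P ((H \<circ> fst) x) ((H \<circ> fst) y)) \<and> (less_t x y \<longleftrightarrow> Q ((H \<circ> fst) x) ((H \<circ> fst) y))"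
    unfolding Crit using iff by (auto simp: less_s_def less_t_def)
  ultimately show ?thesis unfolding biordered_iso_def by blast
qed

text \<open>Two domains occur together: the bidisc of the factorization, with |y| < Y, and the strip
  X2, Y2 around a given rectangle, whose interval [a, b] may reach beyond Y or not.\<close>

locale np_interval = np_data + strip_interval X2 Y2 a b F for X2 Y2 a b +
  assumes a: "a < 0" and b: "0 < b" and X2: "X2 > 0"
    and single: "{c \<in> {a..b}. ev f 0 c = 0} = {0}"
    and injective: "injectivity_condition f" and roots: "root_set f = puiseux N ` R"
begin

lemma strip_f: "strip X2 Y2 f" using strip_deriv[OF strip] by (simp add: deriv)

lemma power_filterlim: "filterlim (\<lambda>t. t ^ N) (at 0 within {-X2<..<X2}) (at_right (0::real))"
proof -
  have lim: "((\<lambda>t::real. t ^ N) \<longlongrightarrow> 0) (at_right 0)"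
    using N by (auto intro!: tendsto_eq_intros)
  moreover have "\<forall>\<^sub>F t in at_right 0. t ^ N \<in> {-X2<..<X2} \<and> t ^ N \<noteq> (0::real)"
    using tendstoD[OF lim X2] eventually_at_right_less[of "0::real"]
  proof eventually_elim
    case (elim t)
    then have "t ^ N > 0" by simp
    then have "- X2 < t ^ N" using X2 by linarith
    then show ?case using elim by auto
  qed
  ultimately show ?thesis by (simp add: filterlim_at)
qed

text \<open>The factorization describes the zeros only for |y| < Y. On the rest of [a, b] the
  function f(0, .) has no zero by \<open>single\<close>, so by compactness f(x, .) has none for
  small x.\<close>

lemma eventually_crit:
  "\<forall>\<^sub>F t in at_right 0. {c \<in> {a..b}. ev f (t ^ N) c = 0} = (\<lambda>r. eval_fps r t) ` R"
proof -
  \<comment> \<open>Small enough for the interval (-\<sigma>, \<sigma>) to lie both in the domain of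
    the factorization and in [a, b].\<close>
  define \<sigma> where "\<sigma> = min Y (min (- a) b) / 2"
  have \<sigma>: "0 < \<sigma>" "\<sigma> < Y" "a < - \<sigma>" "\<sigma> < b" using Y a b by (auto simp: \<sigma>_def)
  define K where "K = {a..b} - {-\<sigma><..<\<sigma>}"
  have "\<forall>\<^sub>F x in at 0 within {-X2<..<X2}. \<forall>y\<in>K. ev f x y \<noteq> 0"
  proof (rule eventually_nonzero_on_compact)
    show "continuous_on ({-X2<..<X2} \<times> K) (\<lambda>(x, y). ev f x y)"
      by (rule strip_continuous[OF strip_f]) (use ab in \<open>auto simp: K_def\<close>)
    show "compact K" unfolding K_def by (intro compact_diff) auto
    show "ev f 0 y \<noteq> 0" if "y \<in> K" for y
    proof
      assume "ev f 0 y = 0"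
      then have "y = 0" using that single by (auto simp: K_def)
      then show False using that \<sigma> by (simp add: K_def)
    qed
  qed (use X2 in simp)
  then have "\<forall>\<^sub>F t in at_right 0. \<forall>y\<in>K. ev f (t ^ N) y \<noteq> 0"
    by (rule eventually_compose_filterlim[OF _ power_filterlim])
  moreover have "\<forall>\<^sub>F t in at_right 0. \<forall>r\<in>R. \<bar>eval_fps r t\<bar> < \<sigma>"
    using eventually_root_small \<sigma>(1) R_fin by (intro eventually_ball_finite) auto
  ultimately show ?thesis using eventually_zeros
  proof eventually_elim
    case (elim t)
    show ?case
    proof
      show "{c \<in> {a..b}. ev f (t ^ N) c = 0} \<subseteq> (\<lambda>r. eval_fps r t) ` R"
      proof
        fix c assume c: "c \<in> {c \<in> {a..b}. ev f (t ^ N) c = 0}"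
        then have "c \<notin> K" using elim(1) by blast
        then have "\<bar>c\<bar> < Y" using c \<sigma> by (auto simp: K_def)
        then show "c \<in> (\<lambda>r. eval_fps r t) ` R" using elim(3) c by blast
      qed
      show "(\<lambda>r. eval_fps r t) ` R \<subseteq> {c \<in> {a..b}. ev f (t ^ N) c = 0}"
      proof
        fix c assume c: "c \<in> (\<lambda>r. eval_fps r t) ` R"
        then have "\<bar>c\<bar> < \<sigma>" using elim(2) by auto
        moreover from this have "ev f (t ^ N) c = 0" using elim(3) c \<sigma> by auto
        ultimately show "c \<in> {c \<in> {a..b}. ev f (t ^ N) c = 0}" using \<sigma> by auto
      qed
    qed
  qed
qed

lemma eventually_order:
  "\<forall>\<^sub>F t in at_right 0. \<forall>r\<in>R. \<forall>s\<in>R. (r \<noteq> s \<longrightarrow> ev F (t ^ N) (eval_fps r t) \<noteq> ev F (t ^ N) (eval_fps s t)) \<and>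
     (eval_fps r t < eval_fps s t \<longleftrightarrow> less_R (puiseux N r) (puiseux N s)) \<and>
     (ev F (t ^ N) (eval_fps r t) < ev F (t ^ N) (eval_fps s t) \<longleftrightarrow> less_int f (puiseux N r) (puiseux N s))"
proof (intro eventually_ball_finite R_fin ballI)
  fix r s assume rs: "r \<in> R" "s \<in> R"
  show "\<forall>\<^sub>F t in at_right 0. (r \<noteq> s \<longrightarrow> ev F (t ^ N) (eval_fps r t) \<noteq> ev F (t ^ N) (eval_fps s t)) \<and>
     (eval_fps r t < eval_fps s t \<longleftrightarrow> less_R (puiseux N r) (puiseux N s)) \<and>
     (ev F (t ^ N) (eval_fps r t) < ev F (t ^ N) (eval_fps s t) \<longleftrightarrow> less_int f (puiseux N r) (puiseux N s))"
  proof (cases "r = s")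
    case True
    have "R \<noteq> {}" and mem: "s \<in> R" using rs by auto
    interpret root_tree "root_set f" "\<lambda>\<xi> \<eta>. valuation (\<eta> - \<xi>)" f
      by (rule root_tree_puiseux[OF N R_fin \<open>R \<noteq> {}\<close> R_0 roots])
    have "\<not> less_int f (puiseux N s) (puiseux N s)" by (rule less_int_irrefl) (use mem roots in auto)
    then show ?thesis using eventually_order_pair[OF mem mem] True by simp
  next
    case False
    show ?thesis using eventually_order_pair[OF rs] eventually_iso_pair[OF injective roots rs False]
      by eventually_elim simp
  qed
qed

lemma morse_near_0:
  "\<exists>\<epsilon>>0. \<forall>x\<in>{0<..\<epsilon>}. morse_on a b (eval2 F x) \<and>
    (\<exists>H. bij_betw H {c \<in> {a..b}. ev f x c = 0} (root_set f) \<and>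
      (\<forall>c\<in>{c \<in> {a..b}. ev f x c = 0}. \<forall>d\<in>{c \<in> {a..b}. ev f x c = 0}.
        (c < d \<longleftrightarrow> less_R (H c) (H d)) \<and> (ev F x c < ev F x d \<longleftrightarrow> less_int f (H c) (H d))))"
    (is "\<exists>\<epsilon>>0. \<forall>x\<in>{0<..\<epsilon>}. ?P x")
proof -
  have "\<forall>\<^sub>F t in at_right 0. \<forall>r\<in>R. ev (fps_deriv f) (t ^ N) (eval_fps r t) \<noteq> 0"
    using eventually_simple R_fin by (intro eventually_ball_finite) auto
  moreover have "\<forall>\<^sub>F t in at_right 0. \<forall>r\<in>R. \<bar>eval_fps r t\<bar> < min (- a) b"
    using a b R_fin by (intro eventually_ball_finite ballI eventually_root_small) auto
  moreover have "\<forall>\<^sub>F t in at_right 0. \<bar>t ^ N\<bar> < X2"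
  proof -
    have "\<forall>\<^sub>F x in at 0 within {-X2<..<X2}. \<bar>x\<bar> < X2" 
      unfolding eventually_at_filter by (rule always_eventually) auto
    then show ?thesis by (rule eventually_compose_filterlim[OF _ power_filterlim])
  qed
  ultimately have "\<forall>\<^sub>F t in at_right 0. ?P (t ^ N)"
    using eventually_crit eventually_order
  proof eventually_elim
    case (elim t)
    define C where "C = {c \<in> {a..b}. ev f (t ^ N) c = 0}"
    let ?e = "\<lambda>r. eval_fps r t"
    have C: "C = ?e ` R" unfolding C_def by fact
    have inj: "inj_on ?e R" by (rule inj_onI) (metis elim(5))
    have "morse_on a b (eval2 F (t ^ N))"
      unfolding morse_on_iff[OF elim(3)] deriv C_def[symmetric] C
      using elim(1,2,5) by (fastforce simp: inj_on_def)
    moreover have "bij_betw (puiseux N) R (root_set f)"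
      unfolding bij_betw_def using roots by (auto intro!: inj_onI simp: puiseux_inj[OF N])
    then have "bij_betw (puiseux N \<circ> inv_into R ?e) C (root_set f)"
      unfolding C by (rule bij_betw_trans[OF bij_betw_inv_into[OF inj_on_imp_bij_betw[OF inj]]])
    moreover have "\<forall>c\<in>C. \<forall>d\<in>C.
        (c < d \<longleftrightarrow> less_R ((puiseux N \<circ> inv_into R ?e) c) ((puiseux N \<circ> inv_into R ?e) d)) \<and>
        (ev F (t ^ N) c < ev F (t ^ N) d \<longleftrightarrow> less_int f ((puiseux N \<circ> inv_into R ?e) c) ((puiseux N \<circ> inv_into R ?e) d))"
      unfolding C using elim(5) by (simp add: inv_into_f_f[OF inj])
    ultimately show ?case unfolding C_def[symmetric] by blast
  qed
  then obtain d where d: "d > 0" "\<And>t. 0 < t \<Longrightarrow> t < d \<Longrightarrow> ?P (t ^ N)"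
    unfolding eventually_at_right_field by blast
  \<comment> \<open>Return from t to x: every x in (0, (d/2)^N] is t^N with t = x^(1/N) \<le> d/2 <
    d.\<close>
  have "?P x" if x: "x \<in> {0<..(d / 2) ^ N}" for x
  proof -
    have "root N x \<le> root N ((d / 2) ^ N)" using N x by (subst real_root_le_iff) auto
    also have "\<dots> = d / 2" using N d(1) by (intro real_root_power_cancel) auto
    finally have "?P (root N x ^ N)" using d(1) N x by (intro d(2)) auto
    moreover have "root N x ^ N = x" using N x by simp
    ultimately show ?thesis by (simp only:)
  qed
  moreover have "(d / 2) ^ N > 0" using d(1) by simp
  ultimately show ?thesis by blast
qed

end

section \<open>Common domain of convergence and the theorem\<close>

lemma np_data_exists:
  assumes rr: "right_reduced f" and prim: "is_primitive F f"
  obtains u v N G Z Y where "np_data f F u v N G Z Y" "root_set f = puiseux N ` {r. cfps r \<in># G}"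
proof -
  have f: "geom_bounded2 f" "fps_nth (fps_nth f 0) 0 = 0" "\<exists>j. fps_nth (fps_nth f j) 0 \<noteq> 0"
    using rr by (auto simp: right_reduced_def convergent_series_iff)
  have F: "geom_bounded2 F" "fps_deriv F = f" using prim by (auto simp: is_primitive_def convergent_series_iff)
  obtain k where k: "fps_nth (fps_nth f k) 0 \<noteq> 0" "\<And>j. j < k \<Longrightarrow> fps_nth (fps_nth f j) 0 = 0"
    using exists_least_iff[of "\<lambda>j. fps_nth (fps_nth f j) 0 \<noteq> 0"] f(3) by auto
  obtain N G u where NP: "N > 0" "geom_bounded2 u" "fps_nth (fps_nth u 0) 0 \<noteq> 0"
    "\<forall>g\<in>#G. geom_bounded g \<and> fps_nth g 0 = 0" "ramify N f = ramify N u * (\<Prod>g\<in>#G. fps_X - fps_const g)"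
    using np_factorization_real[OF f(1) k(2,1)] by blast
  obtain v where v: "u * v = 1" "geom_bounded2 v" using geom_bounded2_inverse[OF NP(2,3)] by blast
  obtain X where X: "X > 0" "bidisc_bounded X X f" "bidisc_bounded X X u" "bidisc_bounded X X v" "bidisc_bounded X X F"
  proof -
    obtain X1 X2 X3 X4 where *: "X1 > 0" "bidisc_bounded X1 X1 f" "X2 > 0" "bidisc_bounded X2 X2 u"
      "X3 > 0" "bidisc_bounded X3 X3 v" "X4 > 0" "bidisc_bounded X4 X4 F"
      using geom_bounded2_imp_bidisc_bounded[OF f(1)] geom_bounded2_imp_bidisc_bounded[OF NP(2)]
        geom_bounded2_imp_bidisc_bounded[OF v(2)] geom_bounded2_imp_bidisc_bounded[OF F(1)] by blast
    let ?X = "min (min X1 X2) (min X3 X4)"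
    show thesis
      by (rule that[of ?X]) (use * in \<open>auto intro: bidisc_bounded_mono[OF *(2)] bidisc_bounded_mono[OF *(4)] bidisc_bounded_mono[OF *(6)] bidisc_bounded_mono[OF *(8)]\<close>)
  qed
  have "\<forall>\<^sub>F t in at_right 0. \<forall>g\<in>set_mset G. ereal \<bar>t\<bar> < fps_conv_radius g"
    using NP(4) by (intro eventually_ball_finite ballI eventually_conv) auto
  moreover have "\<forall>\<^sub>F t in at_right 0. t \<in> {0<..<min X 1}" using X by (intro eventually_at_right_real) simp
  ultimately have "\<forall>\<^sub>F t in at_right 0. (\<forall>g\<in>set_mset G. ereal \<bar>t\<bar> < fps_conv_radius g) \<and> t \<in> {0<..<min X 1}"
    by (rule eventually_conj)
  from eventually_happens[OF this] obtain Z where Z: "0 < Z" "Z < X" "Z < 1" "\<forall>g\<in>#G. ereal Z < fps_conv_radius g"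
    by (auto simp: trivial_limit_at_right_real)
  \<comment> \<open>Z < 1 ensures Z^N \<le> Z < X, so the x-radius in \<open>np_data\<close> does
    not exceed the common radius.\<close>
  have "Z ^ N \<le> Z ^ 1" using Z NP(1) by (intro power_decreasing) auto
  then have ZN: "Z ^ N \<le> X" "0 < Z ^ N" using Z by auto
  have "np_data f F u v N G Z X"
  proof
    show "bidisc_bounded (Z ^ N) X f" "bidisc_bounded (Z ^ N) X u" "bidisc_bounded (Z ^ N) X v" "bidisc_bounded (Z ^ N) X F"
      using X ZN by (auto intro: bidisc_bounded_mono)
    show "count G (cfps r) \<le> 1" for r by (rule real_roots_data(2)[OF NP rr])
  qed (use NP v F Z in \<open>auto intro: less_imp_le\<close>)
  moreover have "root_set f = puiseux N ` {r. cfps r \<in># G}" by (rule real_roots_data(1)[OF NP])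
  ultimately show thesis by (rule that)
qed

text \<open>At t = 0 all factors y - g become y, so f(0, y) is a nonvanishing factor times a power
  of y.\<close>

lemma (in np_data) zeros_at_0:
  assumes "fps_nth (fps_nth f 0) 0 = 0" "\<bar>y\<bar> < Y"
  shows "ev f 0 y = 0 \<longleftrightarrow> y = 0"
proof
  assume "y = 0"
  then show "ev f 0 y = 0" using assms(1) by (simp add: ev_def eval_fps_at_0)
next
  assume "ev f 0 y = 0"
  then have "ev f (0 ^ N) y = 0" using N by (simp add: zero_power)
  then have "of_real (ev u (0 ^ N) y) * (\<Prod>g\<in>#G. of_real y - eval_fps g 0) = (0 :: complex)"
    using factor_formula[of 0 y] Z assms(2) by simp
  moreover have "ev u (0 ^ N) y \<noteq> 0" using u_nonzero[of "0 ^ N" y] N Z assms(2) by (simp add: zero_power)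
  ultimately show "y = 0" using G(2) by (auto simp: eval_fps_at_0)
qed

text \<open>The open set \<open>U\<close> contains points slightly beyond the two right corners of
  the rectangle. Summability at the one with the larger |y| gives a bidisc centred at 0 that
  contains the whole rectangle.\<close>

lemma converges_on_Icc_imp_bidisc_bounded:
  assumes "converges_on ({0..\<epsilon>} \<times> {a..b}) F" "0 < \<epsilon>" "a < 0" "0 < b"
  obtains X Y where "bidisc_bounded X Y F" "\<epsilon> < X" "- Y < a" "b < Y"
proof -
  obtain U where U: "open U" "{0..\<epsilon>} \<times> {a..b} \<subseteq> U"
    "\<And>x y. (x, y) \<in> U \<Longrightarrow> (\<lambda>(i, j). fps_nth (fps_nth F j) i * x ^ i * y ^ j) summable_on UNIV"
    using assms(1) unfolding converges_on_def by blast
  have in_U: "\<forall>\<^sub>F \<delta> in at_right 0. (\<epsilon> + \<delta>, y + s * \<delta>) \<in> U" if "y \<in> {a..b}" for y s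
  proof -
    have "((\<lambda>\<delta>. (\<epsilon> + \<delta>, y + s * \<delta>)) \<longlongrightarrow> (\<epsilon>, y)) (at_right 0)"
      by (auto intro!: tendsto_eq_intros)
    then show ?thesis by (rule topological_tendstoD[OF _ U(1)]) (use U(2) that assms in auto)
  qed
  have "\<forall>\<^sub>F \<delta> in at_right 0. (\<epsilon> + \<delta>, a + (- 1) * \<delta>) \<in> U \<and> (\<epsilon> + \<delta>, b + 1 * \<delta>) \<in> U \<and> 0 < \<delta>"
    using assms by (intro eventually_conj in_U eventually_at_right_less) auto
  from eventually_happens[OF this]
  obtain \<delta> where \<delta>: "\<delta> > 0" "(\<epsilon> + \<delta>, a - \<delta>) \<in> U" "(\<epsilon> + \<delta>, b + \<delta>) \<in> U"
    by (auto simp: trivial_limit_at_right_real)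
  have 1: "bidisc_bounded (\<epsilon> + \<delta>) \<bar>a - \<delta>\<bar> F" "bidisc_bounded (\<epsilon> + \<delta>) \<bar>b + \<delta>\<bar> F"
    by (rule summable_imp_bidisc_bounded; use U(3)[OF \<delta>(2)] U(3)[OF \<delta>(3)] assms \<delta>(1) in simp)+
  show thesis
  proof (cases "\<bar>a - \<delta>\<bar> \<le> \<bar>b + \<delta>\<bar>")
    case True
    then show thesis using that[OF 1(2)] \<delta>(1) assms by auto
  next
    case False
    then show thesis using that[OF 1(1)] \<delta>(1) assms by auto
  qed
qed

theorem theoremA:
  fixes f F :: "real fps fps"
  assumes "right_reduced f" and "injectivity_condition f" and "is_primitive F f"
  shows "morsification F \<and>
    (\<forall>\<epsilon> a b x. morse_rectangle F \<epsilon> a b \<longrightarrow> x \<in> {0<..\<epsilon>} \<longrightarrow>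
      biordered_iso (Crit a b (eval2 F x)) less_s less_t (root_set f) less_R (less_int f))"
proof -
  obtain u v N G Z Y where np: "np_data f F u v N G Z Y" and roots: "root_set f = puiseux N ` {r. cfps r \<in># G}"
    using np_data_exists[OF assms(1,3)] .
  interpret np_data f F u v N G Z Y by (rule np)
  have roots': "root_set f = puiseux N ` R" unfolding R_def by (rule roots)
  have f0: "fps_nth (fps_nth f 0) 0 = 0" using assms(1) by (simp add: right_reduced_def)
  have "morsification F"
  proof -
    have ZN: "Z ^ N > 0" using Z by simp
    interpret strip_interval "Z ^ N" Y "- (Y / 2)" "Y / 2" F
      using Y by unfold_locales (auto intro: bidisc_bounded_imp_strip bounded)
    interpret np_interval f F u v N G Z Y "Z ^ N" Y "- (Y / 2)" "Y / 2"
    proof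
      show "{c \<in> {- (Y / 2)..Y / 2}. ev f 0 c = 0} = {0}"
        using Y zeros_at_0[OF f0] by auto
    qed (use Y ZN assms(2) roots' in auto)
    obtain \<epsilon> where \<epsilon>: "\<epsilon> > 0" "\<And>x. x \<in> {0<..\<epsilon>} \<Longrightarrow> morse_on (- (Y / 2)) (Y / 2) (eval2 F x)"
      using morse_near_0 by blast
    \<comment> \<open>The x-range is also cut to Z^N / 2, which keeps the rectangle inside the open
      bidisc of convergence.\<close>
    have "morse_rectangle F (min \<epsilon> (Z ^ N / 2)) (- (Y / 2)) (Y / 2)"
      unfolding morse_rectangle_def
    proof (intro conjI ballI)
      show "crit_points (- (Y / 2)) (Y / 2) (eval2 F 0) = {0}"
        using crit_points_eq[of 0] single ZN by (simp add: deriv)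
      have "open (ball (0::real) (Z ^ N) \<times> ball (0::real) Y)" by (intro open_Times) auto
      moreover have "{0..min \<epsilon> (Z ^ N / 2)} \<times> {- (Y / 2)..Y / 2} \<subseteq> ball 0 (Z ^ N) \<times> ball 0 Y"
        using ZN Y by auto
      moreover have "\<forall>(x, y)\<in>ball 0 (Z ^ N) \<times> ball 0 Y. (\<lambda>(i, j). fps_nth (fps_nth F j) i * x ^ i * y ^ j) summable_on UNIV"
        using summable_bidisc[OF bounded(4)] by auto
      ultimately show "converges_on ({0..min \<epsilon> (Z ^ N / 2)} \<times> {- (Y / 2)..Y / 2}) F"
        unfolding converges_on_def by blast
    qed (use \<epsilon> ZN Y in auto)
    then show ?thesis unfolding morsification_def by blast
  qed
  moreover have "biordered_iso (Crit a b (eval2 F x)) less_s less_t (root_set f) less_R (less_int f)"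
    if mr: "morse_rectangle F \<epsilon> a b" and x: "x \<in> {0<..\<epsilon>}" for \<epsilon> a b x
  proof -
    have m: "\<epsilon> > 0" "a < 0" "0 < b" "converges_on ({0..\<epsilon>} \<times> {a..b}) F" "crit_points a b (eval2 F 0) = {0}"
      "\<And>x. x \<in> {0<..\<epsilon>} \<Longrightarrow> morse_on a b (eval2 F x)"
      using mr by (auto simp: morse_rectangle_def)
    obtain X2 Y2 where XY: "bidisc_bounded X2 Y2 F" "\<epsilon> < X2" "- Y2 < a" "b < Y2"
      using converges_on_Icc_imp_bidisc_bounded[OF m(4,1-3)] .
    interpret si: strip_interval X2 Y2 a b F
      using XY m by unfold_locales (auto intro: bidisc_bounded_imp_strip)
    interpret np_interval f F u v N G Z Y X2 Y2 a b
    proof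
      show "{c \<in> {a..b}. ev f 0 c = 0} = {0}"
        using si.crit_points_eq[of 0] m XY by (simp add: deriv)
    qed (use m XY assms(2) roots' in auto)
    have small: "\<bar>y\<bar> < X2" if "y \<in> {0<..\<epsilon>}" for y using that XY by auto
    have morse: "(\<forall>c\<in>{c \<in> {a..b}. ev f y c = 0}. ev (fps_deriv f) y c \<noteq> 0) \<and>
        {c \<in> {a..b}. ev f y c = 0} \<subseteq> {a<..<b} \<and> inj_on (ev F y) {c \<in> {a..b}. ev f y c = 0}"
      if "y \<in> {0<..\<epsilon>}" for y
      using m(6)[OF that] si.morse_on_iff[OF small[OF that]] by (simp add: deriv)
    \<comment> \<open>The parameter 0 is left out: there the critical point is degenerate unless
      f(0, y) has order 1. The remaining range is still connected.\<close>
    interpret critical_family "{0<..\<epsilon>}" a b "ev F" "ev f" "ev (fps_deriv f)"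
    proof
      have sub: "{0<..\<epsilon>} \<times> {a..b} \<subseteq> {-X2<..<X2} \<times> {-Y2<..<Y2}" using XY m by auto
      show "continuous_on ({0<..\<epsilon>} \<times> {a..b}) (\<lambda>(x, y). ev F x y)" "continuous_on ({0<..\<epsilon>} \<times> {a..b}) (\<lambda>(x, y). ev f x y)"
        "continuous_on ({0<..\<epsilon>} \<times> {a..b}) (\<lambda>(x, y). ev (fps_deriv f) x y)"
        by (intro strip_continuous[OF _ sub] si.strip strip_f strip_deriv)+
      show "(ev f x has_real_derivative ev (fps_deriv f) x y) (at y within {a..b})" if "x \<in> {0<..\<epsilon>}" "y \<in> {a..b}" for x y
        using strip_has_derivative[OF strip_f small[OF that(1)] si.in_strip[OF that(2)]] .
    qed (use morse in blast)+
    obtain \<epsilon>0 where \<epsilon>0: "\<epsilon>0 > 0" "\<And>x. x \<in> {0<..\<epsilon>0} \<Longrightarrow>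
      \<exists>H. bij_betw H (zeros x) (root_set f) \<and> (\<forall>c\<in>zeros x. \<forall>d\<in>zeros x.
        (c < d \<longleftrightarrow> less_R (H c) (H d)) \<and> (ev F x c < ev F x d \<longleftrightarrow> less_int f (H c) (H d)))"
      using morse_near_0 unfolding zeros_def by blast
    \<comment> \<open>A parameter in both ranges, where the isomorphism with the roots is known;
      connectedness of the x-range carries it over to the given \<open>x\<close>.\<close>
    define x1 where "x1 = min \<epsilon>0 \<epsilon>"
    have x1: "x1 \<in> {0<..\<epsilon>0}" "x1 \<in> {0<..\<epsilon>}" using \<epsilon>0(1) m(1) by (auto simp: x1_def)
    obtain H where H: "bij_betw H (zeros x1) (root_set f)" "\<forall>c\<in>zeros x1. \<forall>d\<in>zeros x1.
        (c < d \<longleftrightarrow> less_R (H c) (H d)) \<and> (ev F x1 c < ev F x1 d \<longleftrightarrow> less_int f (H c) (H d))"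
      using \<epsilon>0(2)[OF x1(1)] by blast
    have "connected {0<..\<epsilon>}" by simp
    from similar_if_connected[OF this x x1(2)]
    obtain h where h: "bij_betw h (zeros x) (zeros x1)"
      "\<forall>c\<in>zeros x. \<forall>d\<in>zeros x. (c < d \<longleftrightarrow> h c < h d) \<and> (ev F x c < ev F x d \<longleftrightarrow> ev F x1 (h c) < ev F x1 (h d))"
      unfolding similar_def by blast
    have hz: "h c \<in> zeros x1" if "c \<in> zeros x" for c using that h(1) by (auto simp: bij_betw_def)
    have cr: "crit_points a b (eval2 F x) = zeros x"
      unfolding zeros_def si.crit_points_eq[OF small[OF x]] np_data.deriv[OF np] ..
    have e: "eval2 F x c = ev F x c" if "c \<in> zeros x" for c
      using that si.in_strip strip_eval2[OF si.strip small[OF x]] by (simp add: zeros_def)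
    show ?thesis
    proof (rule biordered_isoI)
      show "finite (crit_points a b (eval2 F x))" unfolding cr by (rule finite_zeros[OF x])
      show "inj_on (eval2 F x) (crit_points a b (eval2 F x))" using m(6)[OF x] by (simp add: morse_on_def)
      show "bij_betw (H \<circ> h) (crit_points a b (eval2 F x)) (root_set f)"
        unfolding cr by (rule bij_betw_trans[OF h(1) H(1)])
      show "(c < d \<longleftrightarrow> less_R ((H \<circ> h) c) ((H \<circ> h) d)) \<and> (eval2 F x c < eval2 F x d \<longleftrightarrow> less_int f ((H \<circ> h) c) ((H \<circ> h) d))"
        if "c \<in> crit_points a b (eval2 F x)" "d \<in> crit_points a b (eval2 F x)" for c d
        using that hz e H(2) h(2) unfolding cr by simp
    qed
  qed
  ultimately show ?thesis by blast
qed

end
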